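(* Let $(X,\omega)$ be a compact complex Hermitian manifold of complex dimension $n$, equipped with a Hermitian form $\omega$. Fix an integer $1\le m\le n$. Then for every $p$ with $0<p<\frac{n}{n-m}$ (where $\frac{n}{n-m}$ is read as $+\infty$ if $m=n$), one has $\mathcal{SH}_m(X,\omega)\subset L^p(X,\omega^n)$; that is, every $(\omega,m)$-subharmonic function $\varphi$ on $X$ satisfies $\int_X|\varphi|^p\,\omega^n<+\infty$.
   Context: Conventions: $d=\partial+\bar\partial$, $d^c=i(\bar\partial-\partial)$, so $dd^c=2i\partial\bar\partial$. The form $\omega$ is a smooth positive $(1,1)$-form, not assumed closed. Definition of $\mathcal{SH}_m(X,\omega)$. Let $\Omega$ be an open set in $\mathbb{C}^n$ (a local chart) and $\alpha$ a Hermitian metric on $\Omega$. (1) A $\mathcal{C}^2$ function $h$ is harmonic with respect to $\alpha$ if $dd^c h\wedge\alpha^{n-1}=0$ at all points. (2) A function $u:\Omega\to\{-\infty\}\cup\mathbb{R}$ is subharmonic with respect to $\alpha$ if it is upper semicontinuous, $u\in L^1_{loc}(\Omega)$, and for every relatively compact open $D\Subset\Omega$ and every $h\in\mathcal{C}^0(\overline D)$ that is harmonic with respect to $\alpha$ on $D$, $u\le h$ on $\partial D$ implies $u\le h$ in $D$. (3) A function $\varphi:\Omega\to\{-\infty\}\cup\mathbb{R}$ is quasi-subharmonic with respect to $\alpha$ if locally $\varphi=u+\rho$ with $u$ subharmonic with respect to $\alpha$ and $\rho$ smooth. It is $\omega$-subharmonic with respect to $\alpha$ if moreover $(\omega+dd^c\varphi)\wedge\alpha^{n-1}\ge0$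 in the sense of distributions. (4) $\Gamma_m(\omega)$ denotes the set of (smooth) real $(1,1)$-forms $\gamma$ with $\gamma^k\wedge\omega^{n-k}>0$ for $k=1,\dots,m$. For $\gamma_1,\dots,\gamma_{m-1}\in\Gamma_m(\omega)$, the form $\gamma_1\wedge\cdots\wedge\gamma_{m-1}\wedge\omega^{n-m}$ is a strictly positive $(n-1,n-1)$-form, hence equals $\widetilde\alpha^{\,n-1}$ for a unique Hermitian metric $\widetilde\alpha$. (5) A function $\varphi:\Omega\to[-\infty,+\infty)$ is $(\omega,m)$-subharmonic (with respect to $\omega$) if it is $\omega$-subharmonic with respect to $\widetilde\alpha$ for every Hermitian metric $\widetilde\alpha$ of the form $\widetilde\alpha^{\,n-1}=\gamma_1\wedge\cdots\wedge\gamma_{m-1}\wedge\omega^{n-m}$ with $\gamma_1,\dots,\gamma_{m-1}\in\Gamma_m(\omega)$. A function $u:X\to\mathbb{R}\cup\{-\infty\}$ is $(\omega,m)$-subharmonic on $X$ if it is so on each local chart of $X$. $\mathcal{SH}_m(X,\omega)$ is the set of all locally integrable $(\omega,m)$-subharmonic functions on $X$. For $u\in\mathcal{C}^2(X)$, this is equivalent to $(\omega+dd^cu)^k\wedge\omega^{n-k}\ge0$ on $X$ for $k=1,\dots,m$. *)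

theory Defs
  imports "HOL-Analysis.Analysis"
begin

section \<open>Exterior algebra of \<open>\<complex>\<^sup>n\<close>\<close>

text \<open>
  A complex-valued exterior form on \<open>\<complex>\<^sup>n\<close>, viewed as a real vector space, is a function of
  the list of its arguments; a form of degree \<open>k\<close> vanishes on all lists of length other than \<open>k\<close>.
  A differential form is a function from points to such forms.
\<close>

type_synonym 'n form = "(complex^'n) list \<Rightarrow> complex"
type_synonym 'n form_field = "complex^'n \<Rightarrow> 'n form"

text \<open>
  The wedge product is the sum over shuffles, without a factorial factor, so that
  \<open>(a \<and> b)(v, w) = a(v) b(w) - a(w) b(v)\<close> for 1-forms.
\<close>

definition wedge :: "'n form \<Rightarrow> 'n form \<Rightarrow> 'n form" where
  "wedge a b = (\<lambda>vs. \<Sum>I\<in>Pow {..<length vs}.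
     (-1) ^ card {(i, j). i \<in> I \<and> j \<in> {..<length vs} - I \<and> j < i}
       * a (nths vs I) * b (nths vs (- I)))"

definition const_form :: "complex \<Rightarrow> 'n form" where
  "const_form c = (\<lambda>vs. if vs = [] then c else 0)"

definition wedge_list :: "'n form list \<Rightarrow> 'n form" where
  "wedge_list as = foldr wedge as (const_form 1)"

definition form_power :: "'n form \<Rightarrow> nat \<Rightarrow> 'n form" where
  "form_power a k = wedge_list (replicate k a)"

definition dz :: "'n::finite \<Rightarrow> 'n form" where
  "dz j = (\<lambda>vs. if length vs = 1 then hd vs $ j else 0)"

definition dzbar :: "'n::finite \<Rightarrow> 'n form" where
  "dzbar j = (\<lambda>vs. if length vs = 1 then cnj (hd vs $ j) else 0)"

definition real_11_form :: "('n::finite) form \<Rightarrow> bool" where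
  "real_11_form a \<longleftrightarrow>
     (\<exists>C. a = (\<lambda>vs. \<Sum>j\<in>UNIV. \<Sum>k\<in>UNIV. C j k * wedge (dz j) (dzbar k) vs)) \<and>
     (\<forall>vs. a vs \<in> \<real>)"

text \<open>
  With \<open>a = i \<Sum> h\<^sub>j\<^sub>k dz\<^sub>j \<and> dzbar\<^sub>k\<close> one has \<open>a(v, iv) = 2 \<Sum> h\<^sub>j\<^sub>k v\<^sub>j cnj v\<^sub>k\<close>.
\<close>

definition positive_11_form :: "('n::finite) form \<Rightarrow> bool" where
  "positive_11_form a \<longleftrightarrow> real_11_form a \<and> (\<forall>v. v \<noteq> 0 \<longrightarrow> Re (a [v, \<i> *s v]) > 0)"

definition std_kaehler :: "('n::finite) form" where
  "std_kaehler = (\<lambda>vs. \<i> / 2 * (\<Sum>j\<in>UNIV. wedge (dz j) (dzbar j) vs))"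

text \<open>
  This is \<open>(i/2 dz\<^sub>1 \<and> dzbar\<^sub>1) \<and> \<dots> \<and> (i/2 dz\<^sub>n \<and> dzbar\<^sub>n)\<close>, the form of Lebesgue measure;
  writing it as a power avoids choosing an order on the index type.
\<close>

definition std_vol :: "('n::finite) form" where
  "std_vol = (\<lambda>vs. form_power std_kaehler CARD('n) vs / fact CARD('n))"

definition top_coeff :: "('n::finite) form \<Rightarrow> real" where
  "top_coeff a = (THE c. a = (\<lambda>vs. of_real c * std_vol vs))"

definition positive_top_form :: "('n::finite) form \<Rightarrow> bool" where
  "positive_top_form a \<longleftrightarrow> (\<exists>c>0. a = (\<lambda>vs. of_real c * std_vol vs))"


section \<open>Differential forms on open subsets of \<open>\<complex>\<^sup>n\<close>\<close>

primrec C_k_on :: "nat \<Rightarrow> 'a::real_normed_vector set \<Rightarrow> ('a \<Rightarrow> 'b::real_normed_vector) \<Rightarrow> bool" where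
  "C_k_on 0 S f \<longleftrightarrow> continuous_on S f"
| "C_k_on (Suc k) S f \<longleftrightarrow> (\<forall>x\<in>S. f differentiable (at x)) \<and>
     (\<forall>v. C_k_on k S (\<lambda>x. frechet_derivative f (at x) v))"

definition smooth_on :: "'a::real_normed_vector set \<Rightarrow> ('a \<Rightarrow> 'b::real_normed_vector) \<Rightarrow> bool" where
  "smooth_on S f \<longleftrightarrow> (\<forall>k. C_k_on k S f)"

definition smooth_form_on :: "(complex^'n) set \<Rightarrow> ('n::finite) form_field \<Rightarrow> bool" where
  "smooth_form_on S F \<longleftrightarrow> (\<forall>vs. smooth_on S (\<lambda>z. F z vs))"

text \<open>
  For a function \<open>f\<close>, the 1-forms \<open>\<partial>f\<close> and \<open>\<partial>bar f\<close> are the complex linear and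
  antilinear parts of the differential: \<open>\<partial>f(v) = (Df(v) - i Df(iv)) / 2\<close> and
  \<open>\<partial>bar f(v) = (Df(v) + i Df(iv)) / 2\<close>.  On forms, \<open>\<partial>(\<Sum> f\<^sub>I dx\<^sub>I) = \<Sum> \<partial>f\<^sub>I \<and> dx\<^sub>I\<close>,
  and likewise for \<open>\<partial>bar\<close>.
\<close>

definition drop_nth :: "nat \<Rightarrow> 'a list \<Rightarrow> 'a list" where
  "drop_nth j xs = take j xs @ drop (Suc j) xs"

definition del :: "('n::finite) form_field \<Rightarrow> 'n form_field" where
  "del F = (\<lambda>z vs. \<Sum>j<length vs. (-1) ^ j *
     (let D = frechet_derivative (\<lambda>y. F y (drop_nth j vs)) (at z)
      in (D (vs ! j) - \<i> * D (\<i> *s (vs ! j))) / 2))"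

definition delbar :: "('n::finite) form_field \<Rightarrow> 'n form_field" where
  "delbar F = (\<lambda>z vs. \<Sum>j<length vs. (-1) ^ j *
     (let D = frechet_derivative (\<lambda>y. F y (drop_nth j vs)) (at z)
      in (D (vs ! j) + \<i> * D (\<i> *s (vs ! j))) / 2))"

definition ext_d :: "('n::finite) form_field \<Rightarrow> 'n form_field" where
  "ext_d F = (\<lambda>z vs. del F z vs + delbar F z vs)"

definition ext_dc :: "('n::finite) form_field \<Rightarrow> 'n form_field" where
  "ext_dc F = (\<lambda>z vs. \<i> * (delbar F z vs - del F z vs))"

definition ddc :: "('n::finite) form_field \<Rightarrow> 'n form_field" where
  "ddc F = ext_d (ext_dc F)"

definition fun_form :: "(complex^'n \<Rightarrow> real) \<Rightarrow> ('n::finite) form_field" where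
  "fun_form h = (\<lambda>z. const_form (of_real (h z)))"

definition hermitian_metric_on :: "(complex^'n) set \<Rightarrow> ('n::finite) form_field \<Rightarrow> bool" where
  "hermitian_metric_on S \<alpha> \<longleftrightarrow> smooth_form_on S \<alpha> \<and> (\<forall>z\<in>S. positive_11_form (\<alpha> z))"

definition Gamma_m :: "nat \<Rightarrow> (complex^'n) set \<Rightarrow> ('n::finite) form_field \<Rightarrow> 'n form_field set" where
  "Gamma_m m \<Omega> \<omega> = {\<gamma>. smooth_form_on \<Omega> \<gamma> \<and> (\<forall>z\<in>\<Omega>. real_11_form (\<gamma> z) \<and>
     (\<forall>k\<in>{1..m}. positive_top_form
        (wedge (form_power (\<gamma> z) k) (form_power (\<omega> z) (CARD('n) - k)))))}"


section \<open>Subharmonicity with respect to a Hermitian metric\<close>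

definition upper_semicontinuous_on :: "'a::topological_space set \<Rightarrow> ('a \<Rightarrow> ereal) \<Rightarrow> bool" where
  "upper_semicontinuous_on S u \<longleftrightarrow>
     (\<forall>z\<in>S. \<forall>a. u z < a \<longrightarrow> (\<forall>\<^sub>F y in at z within S. u y < a))"

definition loc_integrable_on :: "'a::euclidean_space set \<Rightarrow> ('a \<Rightarrow> ereal) \<Rightarrow> bool" where
  "loc_integrable_on S u \<longleftrightarrow> u \<in> borel_measurable (restrict_space lebesgue S) \<and>
     (\<forall>K. compact K \<and> K \<subseteq> S \<longrightarrow> (\<integral>\<^sup>+z\<in>K. e2ennreal \<bar>u z\<bar> \<partial>lebesgue) < \<infinity>)"

definition harmonic_wrt :: "('n::finite) form_field \<Rightarrow> (complex^'n) set \<Rightarrow> (complex^'n \<Rightarrow> real) \<Rightarrow> bool" where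
  "harmonic_wrt \<alpha> D h \<longleftrightarrow> C_k_on 2 D h \<and>
     (\<forall>z\<in>D. wedge (ddc (fun_form h) z) (form_power (\<alpha> z) (CARD('n) - 1)) = (\<lambda>_. 0))"

definition subharmonic_wrt :: "('n::finite) form_field \<Rightarrow> (complex^'n) set \<Rightarrow> (complex^'n \<Rightarrow> ereal) \<Rightarrow> bool" where
  "subharmonic_wrt \<alpha> \<Omega> u \<longleftrightarrow>
     (\<forall>z\<in>\<Omega>. u z \<noteq> \<infinity>) \<and> upper_semicontinuous_on \<Omega> u \<and> loc_integrable_on \<Omega> u \<and>
     (\<forall>D h. open D \<and> compact (closure D) \<and> closure D \<subseteq> \<Omega> \<and>
        continuous_on (closure D) h \<and> harmonic_wrt \<alpha> D h \<and>
        (\<forall>z\<in>frontier D. u z \<le> ereal (h z)) \<longrightarrow> (\<forall>z\<in>D. u z \<le> ereal (h z)))"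

definition quasi_subharmonic_wrt :: "('n::finite) form_field \<Rightarrow> (complex^'n) set \<Rightarrow> (complex^'n \<Rightarrow> ereal) \<Rightarrow> bool" where
  "quasi_subharmonic_wrt \<alpha> \<Omega> \<phi> \<longleftrightarrow>
     (\<forall>z\<in>\<Omega>. \<exists>V u \<rho>. open V \<and> z \<in> V \<and> V \<subseteq> \<Omega> \<and> subharmonic_wrt \<alpha> V u \<and>
        smooth_on V (\<rho> :: complex^'n \<Rightarrow> real) \<and> (\<forall>y\<in>V. \<phi> y = u y + ereal (\<rho> y)))"

definition test_function_on :: "'a::euclidean_space set \<Rightarrow> ('a \<Rightarrow> real) \<Rightarrow> bool" where
  "test_function_on \<Omega> \<theta> \<longleftrightarrow> smooth_on UNIV \<theta> \<and>
     compact (closure {z. \<theta> z \<noteq> 0}) \<and> closure {z. \<theta> z \<noteq> 0} \<subseteq> \<Omega>"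

text \<open>
  Since \<open>\<alpha>\<close> need not be closed, \<open>dd\<^sup>c \<phi> \<and> \<alpha>\<^sup>n\<^sup>-\<^sup>1\<close> acts on a test function \<open>\<theta>\<close> by
  \<open>\<integral> \<phi> dd\<^sup>c (\<theta> \<alpha>\<^sup>n\<^sup>-\<^sup>1)\<close>.  The value of \<open>real_of_ereal\<close> at \<open>-\<infinity>\<close> is irrelevant: \<open>\<phi>\<close> is locally
  integrable, hence finite almost everywhere.
\<close>

definition ddc_distrib_nonneg ::
  "('n::finite) form_field \<Rightarrow> 'n form_field \<Rightarrow> (complex^'n) set \<Rightarrow> (complex^'n \<Rightarrow> ereal) \<Rightarrow> bool" where
  "ddc_distrib_nonneg \<omega> \<alpha> \<Omega> \<phi> \<longleftrightarrow>
     (\<forall>\<theta>. test_function_on \<Omega> \<theta> \<and> (\<forall>z. \<theta> z \<ge> 0) \<longrightarrow>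
        (LINT z:\<Omega>|lebesgue. \<theta> z * top_coeff (wedge (\<omega> z) (form_power (\<alpha> z) (CARD('n) - 1)))) +
        (LINT z:\<Omega>|lebesgue. real_of_ereal (\<phi> z) *
           top_coeff (ddc (\<lambda>y vs. of_real (\<theta> y) * form_power (\<alpha> y) (CARD('n) - 1) vs) z)) \<ge> 0)"

definition omega_subharmonic_wrt ::
  "('n::finite) form_field \<Rightarrow> 'n form_field \<Rightarrow> (complex^'n) set \<Rightarrow> (complex^'n \<Rightarrow> ereal) \<Rightarrow> bool" where
  "omega_subharmonic_wrt \<omega> \<alpha> \<Omega> \<phi> \<longleftrightarrow>
     quasi_subharmonic_wrt \<alpha> \<Omega> \<phi> \<and> ddc_distrib_nonneg \<omega> \<alpha> \<Omega> \<phi>"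

definition omega_m_subharmonic_on ::
  "nat \<Rightarrow> ('n::finite) form_field \<Rightarrow> (complex^'n) set \<Rightarrow> (complex^'n \<Rightarrow> ereal) \<Rightarrow> bool" where
  "omega_m_subharmonic_on m \<omega> \<Omega> \<phi> \<longleftrightarrow>
     (\<forall>z\<in>\<Omega>. \<phi> z \<noteq> \<infinity>) \<and>
     (\<forall>\<gamma>s \<alpha>. length \<gamma>s = m - 1 \<and> set \<gamma>s \<subseteq> Gamma_m m \<Omega> \<omega> \<and> hermitian_metric_on \<Omega> \<alpha> \<and>
        (\<forall>z\<in>\<Omega>. form_power (\<alpha> z) (CARD('n) - 1) =
           wedge (wedge_list (map (\<lambda>\<gamma>. \<gamma> z) \<gamma>s)) (form_power (\<omega> z) (CARD('n) - m)))
        \<longrightarrow> omega_subharmonic_wrt \<omega> \<alpha> \<Omega> \<phi>)"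


section \<open>Compact Hermitian manifolds\<close>

text \<open>
  The points of the manifold are the elements of a Hausdorff type \<open>'a\<close>.  A chart \<open>(U, f)\<close> consists
  of its domain and its coordinate map; the values of \<open>f\<close> outside \<open>U\<close> are irrelevant.
\<close>

type_synonym ('a, 'n) chart = "'a set \<times> ('a \<Rightarrow> complex^'n)"

definition chart_image :: "('a, 'n) chart \<Rightarrow> (complex^'n) set" where
  "chart_image c = snd c ` fst c"

definition chart_inv :: "('a, 'n) chart \<Rightarrow> complex^'n \<Rightarrow> 'a" where
  "chart_inv c = inv_into (fst c) (snd c)"

definition is_chart :: "('a::topological_space, 'n::finite) chart \<Rightarrow> bool" where
  "is_chart c \<longleftrightarrow> open (fst c) \<and> open (chart_image c) \<and>
     homeomorphism (fst c) (chart_image c) (snd c) (chart_inv c)"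

definition overlap :: "('a, 'n) chart \<Rightarrow> ('a, 'n) chart \<Rightarrow> (complex^'n) set" where
  "overlap c c' = snd c ` (fst c \<inter> fst c')"

definition transition :: "('a, 'n) chart \<Rightarrow> ('a, 'n) chart \<Rightarrow> complex^'n \<Rightarrow> complex^'n" where
  "transition c c' = snd c' \<circ> chart_inv c"

definition holomorphic_map_on :: "(complex^'n) set \<Rightarrow> (complex^'n \<Rightarrow> complex^('n::finite)) \<Rightarrow> bool" where
  "holomorphic_map_on S T \<longleftrightarrow>
     (\<forall>z\<in>S. \<exists>D. (T has_derivative D) (at z) \<and> (\<forall>c v. D (c *s v) = c *s D v))"

definition compatible_charts :: "('a, 'n::finite) chart \<Rightarrow> ('a, 'n) chart \<Rightarrow> bool" where
  "compatible_charts c c' \<longleftrightarrow>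
     holomorphic_map_on (overlap c c') (transition c c') \<and>
     holomorphic_map_on (overlap c' c) (transition c' c)"

definition complex_atlas :: "('a::topological_space, 'n::finite) chart set \<Rightarrow> bool" where
  "complex_atlas A \<longleftrightarrow> (\<forall>c\<in>A. is_chart c) \<and> (\<Union>c\<in>A. fst c) = UNIV \<and>
     (\<forall>c\<in>A. \<forall>c'\<in>A. compatible_charts c c')"

text \<open>The maximal atlas determined by \<open>A\<close>.\<close>

definition local_charts :: "('a::topological_space, 'n::finite) chart set \<Rightarrow> ('a, 'n) chart set" where
  "local_charts A = {c. is_chart c \<and> (\<forall>c'\<in>A. compatible_charts c c')}"

definition compact_complex_manifold :: "('a::t2_space, 'n::finite) chart set \<Rightarrow> bool" where
  "compact_complex_manifold A \<longleftrightarrow> compact (UNIV :: 'a set) \<and> complex_atlas A"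

definition pullback :: "(complex^'n \<Rightarrow> complex^'n) \<Rightarrow> ('n::finite) form_field \<Rightarrow> 'n form_field" where
  "pullback T F = (\<lambda>z vs. F (T z) (map (frechet_derivative T (at z)) vs))"

text \<open>A Hermitian form on the manifold is given by its expressions in all local charts.\<close>

definition hermitian_form ::
  "('a::topological_space, 'n::finite) chart set \<Rightarrow> (('a, 'n) chart \<Rightarrow> 'n form_field) \<Rightarrow> bool" where
  "hermitian_form A \<omega> \<longleftrightarrow>
     (\<forall>c\<in>local_charts A. hermitian_metric_on (chart_image c) (\<omega> c)) \<and>
     (\<forall>c\<in>local_charts A. \<forall>c'\<in>local_charts A. \<forall>z\<in>overlap c c'.
        \<omega> c z = pullback (transition c c') (\<omega> c') z)"

definition SH_m ::
  "nat \<Rightarrow> ('a::topological_space, 'n::finite) chart set \<Rightarrow> (('a, 'n) chart \<Rightarrow> 'n form_field) \<Rightarrow>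
     ('a \<Rightarrow> ereal) set" where
  "SH_m m A \<omega> = {\<phi>. \<forall>c\<in>local_charts A.
     loc_integrable_on (chart_image c) (\<phi> \<circ> chart_inv c) \<and>
     omega_m_subharmonic_on m (\<omega> c) (chart_image c) (\<phi> \<circ> chart_inv c)}"

text \<open>The Borel measure on the manifold defined by the top degree form \<open>\<omega>\<^sup>n\<close>.\<close>

definition is_volume_measure ::
  "('a::topological_space, 'n::finite) chart set \<Rightarrow> (('a, 'n) chart \<Rightarrow> 'n form_field) \<Rightarrow>
     'a measure \<Rightarrow> bool" where
  "is_volume_measure A \<omega> \<nu> \<longleftrightarrow> sets \<nu> = sets borel \<and>
     (\<forall>c\<in>local_charts A. \<forall>B\<in>sets borel. B \<subseteq> fst c \<longrightarrow>
        emeasure \<nu> B =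
          (\<integral>\<^sup>+z\<in>snd c ` B. ennreal (top_coeff (form_power (\<omega> c z) CARD('n))) \<partial>lebesgue))"

definition volume_measure ::
  "('a::topological_space, 'n::finite) chart set \<Rightarrow> (('a, 'n) chart \<Rightarrow> 'n form_field) \<Rightarrow> 'a measure" where
  "volume_measure A \<omega> = (THE \<nu>. is_volume_measure A \<omega> \<nu>)"

definition ext_abs_powr :: "ereal \<Rightarrow> real \<Rightarrow> ennreal" where
  "ext_abs_powr x p = (if \<bar>x\<bar> = \<infinity> then \<infinity> else ennreal (\<bar>real_of_ereal x\<bar> powr p))"

definition L_p :: "real \<Rightarrow> 'a measure \<Rightarrow> ('a \<Rightarrow> ereal) set" where
  "L_p p \<nu> = {\<phi>. \<phi> \<in> borel_measurable \<nu> \<and> (\<integral>\<^sup>+x. ext_abs_powr (\<phi> x) p \<partial>\<nu>) < \<infinity>}"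

end

theory Submission
 imports Defs "HOL-Real_Asymp.Real_Asymp"
begin

text \<open>Let \<open>w\<close> be a point of a chart and \<open>q\<close> a quadratic weight adapted to \<open>\<omega>\<close> at \<open>w\<close>. The forms
\<open>\<gamma> = \<omega> - s/(m-1) \<kappa>(q) \<eta>\<close> with \<open>\<eta>\<close> of rank one (so \<open>\<eta> \<and> \<eta> = 0\<close>) lie in \<open>\<Gamma>\<^sub>m(\<omega>)\<close> as soon as \<open>s < n - n/m\<close> (take \<open>s = 0\<close> if \<open>m = 1\<close>).
Testing subharmonicity for the resulting metric against a function of \<open>q\<close> makes the principal part of the
operator nonnegative up to an absorbable error and gives the decay \<open>\<integral>\<^bsub>B(w,R)\<^esub> \<bar>\<phi>\<bar> \<le> C R\<^bsup>2a+2\<^esup>\<close> for every \<open>a < n - n/m\<close>. Testing next with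
\<open>\<omega>\<close> alone against a superposition of radial kernels over a separated net of a compact set \<open>E\<close> gives
\<open>\<integral>\<^sub>E \<bar>\<phi>\<bar> \<le> C (R\<^sup>2 + R\<^bsup>2a+2-2n\<^esup> |E|)\<close>. Optimising \<open>R\<close> for \<open>E = {\<bar>\<phi>\<bar> > t}\<close> yields a weak type bound of
exponent \<open>1 + 1/(n-a-1)\<close>, which tends to \<open>n/(n-m)\<close>, hence local integrability of every smaller power.\<close>

text \<open>Since omega is not closed, dd^c(theta alpha^(n-1)) also contains derivatives of omega.
  The weight is therefore frozen at w, and every remainder is half a power of u = q + c better than
  the principal part. The shift c > 0 keeps the test functions smooth, so phi is never regularised,
  but all constants must be uniform in c and w. The threshold: eta wedge omega^(n-1) = (q/n) omega^n
  at frozen coefficients, so gamma^m wedge omega^(n-m) loses about the fraction m/(m-1) * s/n, which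
  is below 1 iff s < n - n/m. Powers are affine in eta, so the root alpha = omega - s/(n-1) kappa
  eta is explicit. With kappa = 1/u and theta = u^(-a) the principal part is a positive multiple of
  (s - a) u^(-a-1), whence any a < s. Decay by itself gives no higher integrability. In the second
  test the poles of the kernels are spread over E at a scale delta that is sent to 0, and the decay
  only pays for cutting the kernels off at radius R. phi enters as A - phi >= 1; A may be inserted
  because dd^c of a compactly supported form has integral zero.\<close>

abbreviation (input) "rl == real_of_ereal"
abbreviation (input) "weighted1 F' F'' u == sqrt u * (abs (F' u) + u * abs (F'' u))"
abbreviation (input) "weighted2 F F' F'' u == sqrt u * (abs (F u) + u * abs (F' u) + u^2 * abs (F'' u))"
abbreviation (input) FD where "FD f z == frechet_derivative f (at z)"

section \<open>The exterior algebra as a ring\<close>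

text \<open>Contraction in the first argument. A form is determined by its value on the empty list
  and by its contractions, so identities of the algebra go by induction on the argument list, for
  arbitrary functions of lists.\<close>

definition iota :: "complex^'n => 'n form => 'n form" where
 "iota v a = (%vs. a (v # vs))"

text \<open>The grading involution; it carries the sign of the Leibniz rule for
  contractions.\<close>

definition grade_sign :: "('n::finite) form => 'n form" where
 "grade_sign a = (%vs. (-1) ^ length vs * a vs)"

lemma wedge_Nil: "wedge a b [] = a [] * b []" by (simp add: wedge_def)

lemma Pow_lessThan_Suc:
 "Pow {..<Suc n} = (%J. insert 0 (Suc ` J)) ` Pow {..<n} \<union> (`) Suc ` Pow {..<n}"
proof (intro equalityI subsetI)
 fix I assume "I : Pow {..<Suc n}"
 hence sub: "I \<subseteq> {..<Suc n}" by simp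
 define J where "J = {j. Suc j : I}"
 have J: "J : Pow {..<n}" using sub by (auto simp: J_def)
 have "I = (if 0 : I then insert 0 (Suc ` J) else Suc ` J)" unfolding J_def by (auto simp: image_iff gr0_conv_Suc) (metis not0_implies_Suc)+
 thus "I : (%J. insert 0 (Suc ` J)) ` Pow {..<n} \<union> (`) Suc ` Pow {..<n}" using J by (metis UnCI image_eqI)
qed auto

text \<open>Shuffles are split by whether \<open>v\<close> goes to the left or to the right factor.
  If it goes right, it precedes every argument of the left factor and so adds one inversion for each
  of them; this produces \<open>grade_sign a\<close>.\<close>

lemma wedge_Cons:
 "wedge a b (v # vs) = wedge (iota v a) b vs + wedge (grade_sign a) (iota v b) vs" proof -
 let ?n = "length vs"
 let ?inv = "%I N. {(i, j). i : I & j : {..<N} - I & j < i}"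
 let ?t = "%I. (-1) ^ card (?inv I (Suc ?n)) * a (nths (v # vs) I) * b (nths (v # vs) (- I))"
 have inj0: "inj_on (%J. insert 0 (Suc ` J)) (Pow {..<?n})"
 proof (rule inj_onI)
  fix J J' :: "nat set"
  assume "insert 0 (Suc ` J) = insert 0 (Suc ` J')"
  hence "Suc ` J = Suc ` J'" by (metis Diff_insert_absorb imageE nat.distinct(1))
  thus "J = J'" by (metis inj_image_eq_iff inj_Suc)
 qed
 have inj1: "inj_on ((`) Suc) (Pow {..<?n})" by (rule inj_onI) (metis inj_image_eq_iff inj_Suc)
 have c0: "card (?inv (insert 0 (Suc ` J)) (Suc ?n)) = card (?inv J ?n)" for J proof -
  have "?inv (insert 0 (Suc ` J)) (Suc ?n) = (%(i, j). (Suc i, Suc j)) ` ?inv J ?n"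
  proof (intro equalityI subsetI)
  fix p assume "p : ?inv (insert 0 (Suc ` J)) (Suc ?n)"
  then obtain i j where p: "p = (i, j)" "i : insert 0 (Suc ` J)" "j < Suc ?n" "j ~= 0" "j ~: Suc ` J" "j < i" by auto
  then obtain i' j' where "i = Suc i'" "j = Suc j'" by (metis less_nat_zero_code not0_implies_Suc)
  with p show "p : (%(i, j). (Suc i, Suc j)) ` ?inv J ?n" by (intro image_eqI[of _ _ "(i', j')"]) auto
  qed auto
  moreover have "inj_on (%(i, j). (Suc i, Suc j)) (?inv J ?n)" by (auto simp: inj_on_def)
  ultimately show ?thesis by (simp only: card_image)
 qed
 have c1: "card (?inv (Suc ` J) (Suc ?n)) = card (?inv J ?n) + card J" if "J \<subseteq> {..<?n}" for J proof -
  have fin: "finite J" using that finite_subset by blast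
  have eq: "?inv (Suc ` J) (Suc ?n) = (%(i, j). (Suc i, Suc j)) ` ?inv J ?n \<union> (%i. (Suc i, 0)) ` J"
  proof (intro equalityI subsetI)
  fix p assume "p : ?inv (Suc ` J) (Suc ?n)"
  then obtain i j where p: "p = (i, j)" "i : Suc ` J" "j < Suc ?n" "j ~: Suc ` J" "j < i" by auto
  then obtain i' where i: "i = Suc i'" "i' : J" by auto
  show "p : (%(i, j). (Suc i, Suc j)) ` ?inv J ?n \<union> (%i. (Suc i, 0)) ` J" proof (cases j)
  case 0
  thus ?thesis using p i by auto
  next
  case (Suc j')
  thus ?thesis using p i by (intro UnI1 image_eqI[of _ _ "(i', j')"]) auto
  qed
  qed (use that in auto)
  have fin2: "finite (?inv J ?n)" by (rule finite_subset[of _ "J \<times> {..<?n}"]) (use fin in auto)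
  have "card (?inv (Suc ` J) (Suc ?n)) =
  card ((%(i, j). (Suc i, Suc j)) ` ?inv J ?n) + card ((%i. (Suc i, 0::nat)) ` J)" unfolding eq by (rule card_Un_disjoint) (use fin fin2 in auto)
  also have "card ((%(i, j). (Suc i, Suc j)) ` ?inv J ?n) = card (?inv J ?n)" by (rule card_image) (auto simp: inj_on_def)
  also have "card ((%i. (Suc i, 0::nat)) ` J) = card J" by (rule card_image) (auto simp: inj_on_def)
  finally show ?thesis .
 qed
 have n0: "nths (v # vs) (insert 0 (Suc ` J)) = v # nths vs J"
  "nths (v # vs) (- insert 0 (Suc ` J)) = nths vs (- J)"
  "nths (v # vs) (Suc ` J) = nths vs J"
  "nths (v # vs) (- (Suc ` J)) = v # nths vs (- J)" for J proof -
  have "{j. Suc j : insert 0 (Suc ` J)} = J" "{j. Suc j : - insert 0 (Suc ` J)} = - J"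
  "{j. Suc j : Suc ` J} = J" "{j. Suc j : - (Suc ` J)} = - J" by auto
  thus "nths (v # vs) (insert 0 (Suc ` J)) = v # nths vs J"
  "nths (v # vs) (- insert 0 (Suc ` J)) = nths vs (- J)"
  "nths (v # vs) (Suc ` J) = nths vs J"
  "nths (v # vs) (- (Suc ` J)) = v # nths vs (- J)" by (simp_all only: nths_Cons) auto
 qed
 have len: "length (nths vs J) = card J" if "J \<subseteq> {..<?n}" for J proof -
  have "{i. i < ?n & i : J} = J" using that by auto
  thus ?thesis by (simp add: length_nths)
 qed
 have "wedge a b (v # vs) = (SUM I:Pow {..<Suc ?n}. ?t I)" by (simp add: wedge_def)
 also have "... = (SUM I:(%J. insert 0 (Suc ` J)) ` Pow {..<?n}. ?t I) + (SUM I:(`) Suc ` Pow {..<?n}. ?t I)"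
  unfolding Pow_lessThan_Suc by (rule sum.union_disjoint) auto
 also have "(SUM I:(%J. insert 0 (Suc ` J)) ` Pow {..<?n}. ?t I) = wedge (iota v a) b vs"
  unfolding sum.reindex[OF inj0] wedge_def by (rule sum.cong) (simp_all only: o_def c0 n0 iota_def)
 also have "(SUM I:(`) Suc ` Pow {..<?n}. ?t I) = wedge (grade_sign a) (iota v b) vs" unfolding sum.reindex[OF inj1] wedge_def
 proof (rule sum.cong)
  fix J assume "J : Pow {..<?n}"
  hence "J \<subseteq> {..<?n}" by simp
  thus "(?t o (`) Suc) J = (-1) ^ card (?inv J ?n) * grade_sign a (nths vs J) * iota v b (nths vs (- J))"
  by (simp only: o_def c1 len n0 iota_def grade_sign_def power_add mult_ac)
 qed simp
 finally show ?thesis .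
qed

lemma iota_wedge: "iota v (wedge a b) = (%vs. wedge (iota v a) b vs + wedge (grade_sign a) (iota v b) vs)"
 unfolding iota_def[of v "wedge a b"] by (simp add: wedge_Cons)

lemma wedge_add_left: "wedge (%vs. a vs + b vs) c vs = wedge a c vs + wedge b c vs" by (simp add: wedge_def sum.distrib[symmetric] algebra_simps)

lemma wedge_add_right: "wedge c (%vs. a vs + b vs) vs = wedge c a vs + wedge c b vs" by (simp add: wedge_def sum.distrib[symmetric] algebra_simps)

lemma wedge_scale_left: "wedge (%vs. k * a vs) c vs = k * wedge a c vs" by (simp add: wedge_def sum_distrib_left mult_ac)

lemma wedge_scale_right: "wedge c (%vs. k * a vs) vs = k * wedge c a vs" by (simp add: wedge_def sum_distrib_left mult_ac)

lemma grade_sign_iota: "iota v (grade_sign a) = (%vs. - grade_sign (iota v a) vs)" by (simp add: iota_def grade_sign_def)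

lemma wedge_minus_left: "wedge (%vs. - a vs) c vs = - wedge a c vs" using wedge_scale_left[of "-1"] by simp

lemma wedge_minus_right: "wedge c (%vs. - a vs) vs = - wedge c a vs" using wedge_scale_right[of c "-1"] by simp

lemma grade_sign_wedge_aux:
 fixes a b :: "('n::finite) form"
 shows "grade_sign (wedge a b) vs = wedge (grade_sign a) (grade_sign b) vs"
proof (induction vs arbitrary: a b)
 case Nil
 thus ?case by (simp add: grade_sign_def wedge_Nil)
next
 case (Cons v vs)
 have "grade_sign (wedge a b) (v # vs) =
  - (grade_sign (wedge (iota v a) b) vs + grade_sign (wedge (grade_sign a) (iota v b)) vs)" by (simp add: grade_sign_def wedge_Cons algebra_simps)
 also have "... = wedge (grade_sign a) (grade_sign b) (v # vs)" by (simp add: Cons wedge_Cons grade_sign_iota wedge_minus_left wedge_minus_right)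
 finally show ?case .
qed

lemma grade_sign_wedge:
 fixes a b :: "('n::finite) form"
 shows "grade_sign (wedge a b) = wedge (grade_sign a) (grade_sign b)" using grade_sign_wedge_aux by blast

lemma wedge_assoc:
 fixes a b c :: "('n::finite) form"
 shows "wedge (wedge a b) c vs = wedge a (wedge b c) vs"
proof (induction vs arbitrary: a b c)
 case Nil
 thus ?case by (simp add: wedge_Nil)
next
 case (Cons v vs)
 show ?case by (simp add: wedge_Cons iota_wedge wedge_add_left wedge_add_right grade_sign_wedge Cons)
qed

lemma grade_sign_grade_sign: "grade_sign (grade_sign a) = a" by (simp add: grade_sign_def flip: power_add mult.assoc)

text \<open>Contraction exchanges even and odd forms, so both parities have to run through one
  induction.\<close>

lemma wedge_commute_aux:
 fixes a b :: "('n::finite) form"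
 shows
 "(grade_sign a = a --> wedge a b vs = wedge b a vs) &
 (grade_sign a = (%vs. - a vs) --> wedge a b vs = wedge (grade_sign b) a vs)"
proof (induction vs arbitrary: a b)
 case Nil
 thus ?case by (simp add: wedge_Nil grade_sign_def)
next
 case (Cons v vs)
 have "wedge a b (v # vs) = wedge b a (v # vs)" if a: "grade_sign a = a" proof -
  have "grade_sign (iota v a) = (%vs. - iota v a vs)" using grade_sign_iota[of v a] a by (metis add.inverse_inverse)
  hence "wedge (iota v a) b vs = wedge (grade_sign b) (iota v a) vs" using Cons by blast
  moreover have "wedge a (iota v b) vs = wedge (iota v b) a vs" using Cons a by blast
  ultimately show ?thesis by (simp add: wedge_Cons a)
 qed
 moreover have "wedge a b (v # vs) = wedge (grade_sign b) a (v # vs)" if a: "grade_sign a = (%vs. - a vs)" proof -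
  have "(%vs. - iota v a vs) = iota v (grade_sign a)" by (simp add: a iota_def)
  also have "... = (%vs. - grade_sign (iota v a) vs)" by (rule grade_sign_iota)
  finally have "- iota v a us = - grade_sign (iota v a) us" for us by (rule fun_cong)
  hence "grade_sign (iota v a) = iota v a" by (intro HOL.ext) (metis add.inverse_inverse)
  hence "wedge (iota v a) b vs = wedge b (iota v a) vs" using Cons by blast
  moreover have "wedge a (iota v b) vs = wedge (grade_sign (iota v b)) a vs" using Cons a by blast
  ultimately show ?thesis by (simp add: wedge_Cons a wedge_minus_left grade_sign_iota grade_sign_grade_sign)
 qed
 ultimately show ?case by blast
qed

lemma wedge_const_left:
 fixes a :: "('n::finite) form"
 shows "wedge (const_form c) a vs = c * a vs"
proof (induction vs arbitrary: a)
 case Nil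
 thus ?case by (simp add: wedge_Nil const_form_def)
next
 case (Cons v vs)
 have *: "iota v (const_form c) = (%vs. 0 * const_form c vs)" "grade_sign (const_form c) = const_form c" by (auto simp: iota_def const_form_def grade_sign_def)
 show ?case unfolding wedge_Cons * wedge_scale_left Cons by (simp add: iota_def)
qed

lemma wedge_const_right:
 fixes a :: "('n::finite) form"
 shows "wedge a (const_form c) vs = c * a vs"
proof (induction vs arbitrary: a)
 case Nil
 thus ?case by (simp add: wedge_Nil const_form_def)
next
 case (Cons v vs)
 have *: "iota v (const_form c) = (%vs. 0 * const_form c vs)" by (auto simp: iota_def const_form_def)
 show ?case unfolding wedge_Cons * wedge_scale_right Cons by (simp add: iota_def)
qed

text \<open>A copy of the forms as a type of its own, so that wedge products and powers become those
  of an associative ring with unit.\<close>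

typedef ('n::finite) ext = "UNIV :: 'n form set" morphisms form_of Ext by simp

setup_lifting type_definition_ext

instantiation ext :: (finite) ring_1
begin

lift_definition zero_ext :: "'a ext" is "%_. 0" .
lift_definition one_ext :: "'a ext" is "const_form 1" .
lift_definition plus_ext :: "'a ext => 'a ext => 'a ext" is "%a b vs. a vs + b vs" .
lift_definition minus_ext :: "'a ext => 'a ext => 'a ext" is "%a b vs. a vs - b vs" .
lift_definition uminus_ext :: "'a ext => 'a ext" is "%a vs. - a vs" .
lift_definition times_ext :: "'a ext => 'a ext => 'a ext" is wedge .

instance
proof
 fix a b c :: "'a ext"
 show "a * b * c = a * (b * c)" by transfer (rule HOL.ext, rule wedge_assoc)
 show "1 * a = a" by transfer (rule HOL.ext, simp add: wedge_const_left)
 show "a * 1 = a" by transfer (rule HOL.ext, simp add: wedge_const_right)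
 show "a + b + c = a + (b + c)" by transfer (simp add: add_ac)
 show "a + b = b + a" by transfer (simp add: add_ac)
 show "0 + a = a" by transfer simp
 show "- a + a = 0" by transfer simp
 show "a - b = a + - b" by transfer simp
 show "(a + b) * c = a * c + b * c" by transfer (rule HOL.ext, simp add: wedge_add_left)
 show "a * (b + c) = a * b + a * c" by transfer (rule HOL.ext, simp add: wedge_add_right)
 show "(0::'a ext) ~= 1" by transfer (simp add: const_form_def fun_eq_iff exI[of _ "[]"])
qed

end

lift_definition scal :: "complex => ('n::finite) ext" is const_form .
lift_definition contr :: "complex^'n => ('n::finite) ext => 'n ext" is iota .
lift_definition gsign :: "('n::finite) ext => 'n ext" is grade_sign .
lift_definition covec :: "(complex^'n => complex) => ('n::finite) ext" is
 "%l vs. if length vs = 1 then l (hd vs) else 0" .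

lemma form_of_eqI: "(!!vs. form_of a vs = form_of b vs) ==> a = b" by (metis form_of_inject ext)

lemma form_of_simps [simp]:
 "form_of 0 vs = 0"
 "form_of (a + b) vs = form_of a vs + form_of b vs"
 "form_of (a - b) vs = form_of a vs - form_of b vs"
 "form_of (- a) vs = - form_of a vs"
 "form_of (scal c * a) vs = c * form_of a vs" by (transfer, simp add: wedge_const_left)+

lemma form_of_sum [simp]: "form_of (sum f A) vs = (SUM i:A. form_of (f i) vs)" by (induction A rule: infinite_finite_induct) auto

lemma form_of_mult: "form_of (a * b) = wedge (form_of a) (form_of b)" by transfer simp

lemma form_of_Ext [simp]: "form_of (Ext a) = a" by (simp add: Ext_inverse)

lemma Ext_wedge: "Ext (wedge a b) = Ext a * Ext b" by (simp add: times_ext.abs_eq)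

lemma Ext_wedge_list: "Ext (wedge_list as) = prod_list (map Ext as)" by (induction as) (simp_all add: wedge_list_def Ext_wedge one_ext_def)

lemma Ext_form_power: "Ext (form_power a k) = Ext a ^ k" by (induction k) (simp_all add: form_power_def wedge_list_def Ext_wedge one_ext_def)

lemma Ext_scale: "Ext (%vs. c * a vs) = scal c * Ext a" by (rule form_of_eqI) simp

lemma Ext_sum: "Ext (%vs. SUM i:A. f i vs) = (SUM i:A. Ext (f i))" by (rule form_of_eqI) simp

lemma scal_commute: "a * scal c = scal c * a" by (rule form_of_eqI) (simp add: form_of_mult scal.rep_eq wedge_const_left wedge_const_right)

lemma scal_left_commute: "a * (scal c * b) = scal c * (a * b)" by (metis mult.assoc scal_commute)

lemma scal_add: "scal (c + d) = scal c + scal d" by (rule form_of_eqI) (simp add: scal.rep_eq const_form_def)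

lemma scal_minus: "scal (- c) = - scal c" by (rule form_of_eqI) (simp add: scal.rep_eq const_form_def)

lemma scal_diff: "scal (c - d) = scal c - scal d" by (rule form_of_eqI) (simp add: scal.rep_eq const_form_def)

lemma scal_mult: "scal (c * d) = scal c * scal d" by (rule form_of_eqI) (simp only: form_of_simps scal.rep_eq const_form_def, simp)

lemma scal_0 [simp]: "scal 0 = 0" by (rule form_of_eqI) (simp add: scal.rep_eq const_form_def)

lemma scal_1 [simp]: "scal 1 = 1" by (rule form_of_eqI) (simp add: scal.rep_eq one_ext.rep_eq)

lemma scal_of_nat: "scal (of_nat k) = of_nat k" by (induction k) (auto simp: scal_add)

lemma scal_mult_assoc: "scal c * (scal d * a) = scal (c * d) * a" by (simp add: scal_mult mult.assoc)

lemma scal_mult_power: "(scal c * a) ^ k = scal (c ^ k) * a ^ k"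
proof (induction k)
 case (Suc k)
 have "(scal c * a) ^ Suc k = scal c * (a * scal (c ^ k)) * a ^ k" by (simp add: Suc mult.assoc)
 also have "... = scal (c ^ Suc k) * a ^ Suc k" by (simp add: scal_commute[of a] scal_mult mult.assoc)
 finally show ?case .
qed simp

lemma contr_mult: "contr v (a * b) = contr v a * b + gsign a * contr v b" by transfer (rule iota_wedge)

lemma contr_add [simp]: "contr v (a + b) = contr v a + contr v b" by transfer (simp add: iota_def)

lemma contr_scal [simp]: "contr v (scal c) = 0" by transfer (simp add: iota_def const_form_def)

lemma contr_0 [simp]: "contr v 0 = 0" by transfer (simp add: iota_def)

lemma contr_1 [simp]: "contr v 1 = 0" by (metis contr_scal scal_1)

lemma contr_covec [simp]: "contr v (covec l) = scal (l v)" by transfer (auto simp: iota_def const_form_def)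

lemma gsign_mult: "gsign (a * b) = gsign a * gsign b" by transfer (rule grade_sign_wedge)

lemma gsign_add [simp]: "gsign (a + b) = gsign a + gsign b" by transfer (simp add: grade_sign_def algebra_simps)

lemma gsign_scal [simp]: "gsign (scal c) = scal c" by transfer (auto simp: grade_sign_def const_form_def)

lemma gsign_1 [simp]: "gsign 1 = 1" by (metis gsign_scal scal_1)

lemma gsign_0 [simp]: "gsign 0 = 0" by transfer (auto simp: grade_sign_def)

lemma gsign_covec [simp]: "gsign (covec l) = - covec l" by transfer (auto simp: grade_sign_def)

lemma contr_scal_mult [simp]: "contr v (scal c * a) = scal c * contr v a" by (simp add: contr_mult)

lemma contr_sum: "contr v (sum f A) = (SUM i:A. contr v (f i))" by (induction A rule: infinite_finite_induct) auto

lemma even_commute: "gsign a = a ==> a * b = b * a" by transfer (rule HOL.ext, use wedge_commute_aux in blast)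

lemma odd_commute: "gsign a = - a ==> a * b = gsign b * a"
proof transfer
 fix a b :: "'a form" assume "grade_sign a = (%vs. - a vs)"
 thus "wedge a b = wedge (grade_sign b) a" using wedge_commute_aux by blast
qed

lemma covec_anticommute: "covec l * covec k = - (covec k * covec l)" by (simp add: odd_commute[of "covec l"])

lemma covec_square: "covec l * covec l = 0" proof -
 have "form_of (covec l * covec l) vs = - form_of (covec l * covec l) vs" for vs by (metis covec_anticommute form_of_simps(4))
 moreover have "x = 0" if "x = - x" for x :: complex using that by simp
 ultimately have "form_of (covec l * covec l) vs = form_of 0 vs" for vs by simp
 thus ?thesis by (rule form_of_eqI)
qed

lemma covec_add: "covec (%v. l v + k v) = covec l + covec k" by (rule form_of_eqI) (simp add: covec.rep_eq)

lemma covec_scale: "covec (%v. c * l v) = scal c * covec l" by (rule form_of_eqI) (simp add: covec.rep_eq)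

lemma covec_sum: "covec (%v. SUM i:A. l i v) = (SUM i:A. covec (l i))" by (rule form_of_eqI) (simp add: covec.rep_eq)

lemma form_of_covec_mult:
 "form_of (covec l * covec k) vs = (if length vs = 2 then l (vs!0) * k (vs!1) - l (vs!1) * k (vs!0) else 0)" proof -
 have *: "form_of (scal a * covec k - covec l * scal b) us = (if length us = 1 then a * k (hd us) - b * l (hd us) else 0)" for a b us
  by (simp add: scal_commute covec.rep_eq)
 show ?thesis proof (cases vs)
  case Nil
  thus ?thesis by (simp add: form_of_mult wedge_Nil covec.rep_eq)
 next
  case (Cons v us)
  have "form_of (covec l * covec k) (v # us) = form_of (contr v (covec l * covec k)) us" by (simp add: contr.rep_eq iota_def)
  also have "... = form_of (scal (l v) * covec k - covec l * scal (k v)) us" by (simp only: contr_mult contr_covec gsign_covec) simp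
  also have "... = (if length us = 1 then l v * k (hd us) - k v * l (hd us) else 0)" by (rule *)
  finally show ?thesis using Cons by (cases us) auto
 qed
qed

definition gen :: "'n + 'n => ('n::finite) ext" where
 "gen x = (case x of Inl j => covec (%v. v $ j) | Inr j => covec (%v. cnj (v $ j)))"

definition monom_ext :: "('n + 'n) list => ('n::finite) ext" where
 "monom_ext xs = prod_list (map gen xs)"

lemma monom_ext_Nil [simp]: "monom_ext [] = 1"
 and monom_ext_Cons [simp]: "monom_ext (x # xs) = gen x * monom_ext xs"
 and monom_ext_append: "monom_ext (xs @ ys) = monom_ext xs * monom_ext ys" by (simp_all add: monom_ext_def)

lemma gen_anticommute: "gen x * gen y = - (gen y * gen x)" unfolding gen_def by (auto split: sum.split intro: covec_anticommute)

lemma gen_square: "gen x * gen x = 0" unfolding gen_def by (auto split: sum.split intro: covec_square)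

lemma gsign_gen [simp]: "gsign (gen x) = - gen x" unfolding gen_def by (auto split: sum.split)

lemma monom_ext_move:
 "x : set xs ==> EX s:{1,-1}. monom_ext xs = scal s * (gen x * monom_ext (remove1 x xs))"
proof (induction xs)
 case (Cons y xs)
 show ?case proof (cases "x = y")
  case True
  thus ?thesis by (intro bexI[of _ 1]) auto
 next
  case False
  hence "x : set xs" using Cons.prems by simp
  from Cons.IH[OF this] obtain s where s: "s : {1,-1}" and eq: "monom_ext xs = scal s * (gen x * monom_ext (remove1 x xs))" by blast
  have "monom_ext (y # xs) = scal s * (gen y * gen x * monom_ext (remove1 x xs))" by (simp add: eq scal_left_commute mult.assoc)
  also have "... = scal (- s) * (gen x * monom_ext (remove1 x (y # xs)))" using False by (simp add: gen_anticommute[of y x] scal_minus mult.assoc)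
  finally show ?thesis using s by (intro bexI[of _ "- s"]) auto
 qed
qed simp

lemma monom_ext_mset:
 "mset xs = mset ys ==> EX s:{1,-1}. monom_ext xs = scal s * monom_ext ys"
proof (induction xs arbitrary: ys)
 case Nil
 thus ?case by (intro bexI[of _ 1]) auto
next
 case (Cons x xs)
 hence "x : set ys" by (metis list.set_intros(1) set_mset_mset)
 then obtain s where s: "s : {1,-1}" "monom_ext ys = scal s * (gen x * monom_ext (remove1 x ys))" using monom_ext_move by blast
 have "mset xs = mset (remove1 x ys)" using Cons.prems by (metis add_mset_remove_trivial mset.simps(2) mset_remove1)
 then obtain t where t: "t : {1,-1}" "monom_ext xs = scal t * monom_ext (remove1 x ys)" using Cons.IH by blast
 have "s * s = 1" using s by auto
 hence "scal (t * s) * monom_ext ys = scal t * (gen x * monom_ext (remove1 x ys))" by (simp add: s(2) scal_mult_assoc mult.assoc)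
 also have "... = monom_ext (x # xs)" by (simp add: t(2) scal_left_commute)
 finally show ?case using s t by (intro bexI[of _ "t * s"]) auto
qed

lemma monom_ext_not_distinct: "~ distinct xs ==> monom_ext xs = 0"
proof (induction xs)
 case (Cons x xs)
 show ?case proof (cases "x : set xs")
  case True
  then obtain s where "monom_ext xs = scal s * (gen x * monom_ext (remove1 x xs))" using monom_ext_move by blast
  hence "monom_ext (x # xs) = scal s * (gen x * gen x * monom_ext (remove1 x xs))" by (simp add: scal_left_commute mult.assoc)
  thus ?thesis by (simp add: gen_square)
 next
  case False
  thus ?thesis using Cons by simp
 qed
qed simp

text \<open>An element of the ring may be any function of lists, alternating or not. The degree is
  therefore defined through the span of the monomials in the dz and their conjugates; alternation
  comes with it.\<close>

inductive homog :: "nat => ('n::finite) ext => bool" where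
 homog_monom: "length xs = k ==> homog k (scal c * monom_ext xs)"
| homog_add: "homog k a ==> homog k b ==> homog k (a + b)"

lemma homog_0 [simp]: "homog k 0" using homog_monom[of "replicate k undefined" k 0] by simp

lemma homog_scal: "homog k a ==> homog k (scal c * a)" by (induction rule: homog.induct)
  (simp_all add: scal_mult_assoc distrib_left homog.intros)

lemma homog_uminus: "homog k a ==> homog k (- a)" using homog_scal[of k a "-1"] by (simp add: scal_minus)

lemma homog_diff: "homog k a ==> homog k b ==> homog k (a - b)" using homog_add[of k a "- b"] homog_uminus[of k b] by simp

lemma homog_sum: "(!!i. i : A ==> homog k (f i)) ==> homog k (sum f A)" by (induction A rule: infinite_finite_induct) (auto intro: homog_add)

lemma homog_scal_0: "homog 0 (scal c)" using homog_monom[of "[]" 0 c] by simp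

lemma homog_1: "homog 0 1" using homog_scal_0[of 1] by simp

lemma homog_mult: "homog k a ==> homog l b ==> homog (k + l) (a * b)"
proof (induction rule: homog.induct)
 case (homog_monom xs k c)
 from homog_monom(2) show ?case
 proof (induction rule: homog.induct)
  case (homog_monom ys l d)
  have "scal c * monom_ext xs * (scal d * monom_ext ys) = scal (c * d) * monom_ext (xs @ ys)"
  by (simp add: mult.assoc scal_left_commute[of _ d] scal_mult monom_ext_append)
  thus ?case using homog.homog_monom[of "xs @ ys" "k + l" "c * d"] homog_monom \<open>length xs = k\<close> by simp
 next
  case (homog_add l a b)
  thus ?case by (simp add: distrib_left homog.homog_add)
 qed
next
 case (homog_add k a b)
 thus ?case by (simp add: distrib_right homog.homog_add)
qed

lemma homog_mult': "homog k a ==> homog l b ==> k + l = r ==> homog r (a * b)" using homog_mult by blast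

lemma homog_power: "homog k a ==> homog (k * l) (a ^ l)" by (induction l) (auto simp: homog_1 intro: homog_mult')

lemma homog_prod_list: "(!!a. a : set as ==> homog k a) ==> homog (k * length as) (prod_list as)" by (induction as) (auto simp: homog_1 intro: homog_mult')

lemma homog_gen: "homog 1 (gen x)" using homog_monom[of "[x]" 1 1] by simp

lemma gsign_homog: "homog k a ==> gsign a = scal ((-1) ^ k) * a"
proof (induction rule: homog.induct)
 case (homog_monom xs k c)
 have "gsign (monom_ext xs) = scal ((-1) ^ length xs) * monom_ext xs"
 proof (induction xs)
  case (Cons x xs)
  thus ?case by (simp add: gsign_mult scal_left_commute[of "gen x"] scal_minus)
 qed simp
 thus ?case using homog_monom by (simp add: gsign_mult scal_mult_assoc mult.commute)
next
 case (homog_add k a b)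
 thus ?case by (simp add: distrib_left)
qed

lemma homog2_commute: "homog 2 a ==> a * b = b * a" using gsign_homog[of 2 a] by (intro even_commute) simp

lemma homog2_gsign: "homog 2 a ==> gsign a = a" using gsign_homog[of 2 a] by simp

text \<open>There are 2n generators and each squares to zero; a longer monomial repeats one of
  them.\<close>

lemma homog_eq_0:
 assumes "homog k (a :: ('n::finite) ext)" "k > 2 * CARD('n)"
 shows "a = 0" using assms
proof (induction rule: homog.induct)
 case (homog_monom xs k c)
 have "card (set xs) <= CARD('n + 'n)" by (rule card_mono) auto
 also have "... = 2 * CARD('n)" by simp
 finally have "~ distinct xs" using homog_monom distinct_card by fastforce
 thus ?case by (simp add: monom_ext_not_distinct)
qed simp

lemma complex_vec_expand: "(v :: complex^'n) = (SUM j:UNIV. Re (v $ j) *\<^sub>R axis j 1 + Im (v $ j) *\<^sub>R axis j \<i>)"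
proof (rule vec_eq_iff[THEN iffD2, rule_format])
 fix k
 have "(SUM j:UNIV. Re (v $ j) *\<^sub>R axis j 1 + Im (v $ j) *\<^sub>R axis j \<i>) $ k =
  (SUM j:UNIV. if j = k then v $ k else 0)" unfolding sum_component by (rule sum.cong) (auto simp: axis_def complex_eq_iff)
 thus "v $ k = (SUM j:UNIV. Re (v $ j) *\<^sub>R axis j 1 + Im (v $ j) *\<^sub>R axis j \<i>) $ k" by simp
qed

lemma real_linear_expand:
 fixes l :: "complex^'n => complex"
 assumes "linear l"
 shows "l v = (SUM j:UNIV. (l (axis j 1) - \<i> * l (axis j \<i>)) / 2 * v $ j
  + (l (axis j 1) + \<i> * l (axis j \<i>)) / 2 * cnj (v $ j))" proof -
 have "l v = l (SUM j:UNIV. Re (v $ j) *\<^sub>R axis j 1 + Im (v $ j) *\<^sub>R axis j \<i>)" using complex_vec_expand[of v] by simp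
 also have "... = (SUM j:UNIV. Re (v $ j) *\<^sub>R l (axis j 1) + Im (v $ j) *\<^sub>R l (axis j \<i>))"
  using assms by (simp add: linear_sum linear_add linear_scale)
 also have "... = (SUM j:UNIV. (l (axis j 1) - \<i> * l (axis j \<i>)) / 2 * v $ j
  + (l (axis j 1) + \<i> * l (axis j \<i>)) / 2 * cnj (v $ j))"
 proof (rule sum.cong)
  fix j
  have v: "v $ j = of_real (Re (v $ j)) + \<i> * of_real (Im (v $ j))" by (simp add: complex_eq_iff)
  have "cnj (v $ j) = of_real (Re (v $ j)) - \<i> * of_real (Im (v $ j))" by (simp add: complex_eq_iff)
  moreover have "Re (v $ j) *\<^sub>R l (axis j 1) + Im (v $ j) *\<^sub>R l (axis j \<i>) =
  (l (axis j 1) - \<i> * l (axis j \<i>)) / 2 * (of_real (Re (v $ j)) + \<i> * of_real (Im (v $ j)))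
  + (l (axis j 1) + \<i> * l (axis j \<i>)) / 2 * (of_real (Re (v $ j)) - \<i> * of_real (Im (v $ j)))" by (simp add: scaleR_conv_of_real field_simps)
  ultimately show "Re (v $ j) *\<^sub>R l (axis j 1) + Im (v $ j) *\<^sub>R l (axis j \<i>) =
  (l (axis j 1) - \<i> * l (axis j \<i>)) / 2 * v $ j + (l (axis j 1) + \<i> * l (axis j \<i>)) / 2 * cnj (v $ j)" using v by simp
 qed simp
 finally show ?thesis .
qed

text \<open>A real linear covector is the sum of its complex linear and its antilinear part, which
  puts every real covector into degree one.\<close>

lemma covec_real_linear:
 fixes l :: "complex^'n => complex"
 assumes "linear l"
 shows "covec l = (SUM j:UNIV. scal ((l (axis j 1) - \<i> * l (axis j \<i>)) / 2) * gen (Inl j)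
  + scal ((l (axis j 1) + \<i> * l (axis j \<i>)) / 2) * gen (Inr j))" proof -
 have "covec l = covec (%v. SUM j:UNIV. (l (axis j 1) - \<i> * l (axis j \<i>)) / 2 * v $ j
  + (l (axis j 1) + \<i> * l (axis j \<i>)) / 2 * cnj (v $ j))" by (rule arg_cong[of _ _ covec], rule HOL.ext, rule real_linear_expand[OF assms])
 thus ?thesis by (simp only: covec_sum covec_add covec_scale gen_def sum.case)
qed

lemma homog_covec: "linear l ==> homog 1 (covec l)" unfolding covec_real_linear by (intro homog_sum homog_add homog_scal homog_gen)

section \<open>Powers of sums with square-zero terms\<close>

lemma of_nat_left_commute: "a * (of_nat k * b) = of_nat k * (a * (b :: 'a::ring_1))" by (metis mult.assoc mult_of_nat_commute)

text \<open>The binomial formula stops after the linear term in \<open>e\<close>. This is what makes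
  the powers of a rank-one perturbation of a metric affine in the perturbation.\<close>

lemma sum_power_square_zero:
 fixes e s :: "'a::ring_1"
 assumes "e * s = s * e" "e * e = 0"
 shows "(e + s) ^ Suc k = s ^ Suc k + of_nat (Suc k) * (e * s ^ k)"
proof (induction k)
 case (Suc k)
 have c: "s * (e * s ^ k) = e * s ^ Suc k" by (metis assms(1) mult.assoc power_Suc)
 have "(e + s) ^ Suc (Suc k) = (e + s) * (s ^ Suc k + of_nat (Suc k) * (e * s ^ k))" unfolding power_Suc[of _ "Suc k"] Suc ..
 also have "... = e * s ^ Suc k + s * s ^ Suc k + e * (of_nat (Suc k) * (e * s ^ k)) + s * (of_nat (Suc k) * (e * s ^ k))"
  by (simp only: distrib_right distrib_left add_ac)
 also have "... = e * s ^ Suc k + s * s ^ Suc k + of_nat (Suc k) * (e * e * s ^ k) + of_nat (Suc k) * (s * (e * s ^ k))"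
  by (simp only: of_nat_left_commute mult.assoc)
 also have "... = s ^ Suc (Suc k) + of_nat (Suc (Suc k)) * (e * s ^ Suc k)"
  unfolding c assms(2) of_nat_Suc[of "Suc k"] distrib_right power_Suc[of s "Suc k"] by (simp only: mult_zero_left mult_zero_right mult_1 add_0_right add_0_left add_ac)
 finally show ?case .
qed simp

text \<open>In the multinomial expansion only the terms that use every element once survive; there
  are \<open>fact (length es)\<close> of them, all equal.\<close>

lemma sum_list_power_square_zero:
 fixes es :: "'a::ring_1 list"
 assumes "!!a b. a : set es ==> b : set es ==> a * b = b * a" "!!a. a : set es ==> a * a = 0"
 shows "sum_list es ^ length es = of_nat (fact (length es)) * prod_list es & sum_list es ^ Suc (length es) = 0" using assms
proof (induction es)
 case (Cons e es)
 let ?s = "sum_list es" and ?k = "length es"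
 have IH: "?s ^ ?k = of_nat (fact ?k) * prod_list es" "?s ^ Suc ?k = 0" using Cons by auto
 have "e * sum_list xs = sum_list xs * e" if "set xs \<subseteq> set es" for xs using that Cons.prems(1)[of e] by (induction xs) (auto simp: algebra_simps)
 hence c: "e * ?s = ?s * e" by blast
 have sq: "e * e = 0" using Cons by simp
 have 0: "?s ^ Suc (Suc ?k) = 0" using IH(2) by (metis mult_zero_right power_Suc)
 have "(e + ?s) ^ Suc ?k = of_nat (Suc ?k) * (e * (of_nat (fact ?k) * prod_list es))" unfolding sum_power_square_zero[OF c sq] IH by simp
 also have "... = of_nat (Suc ?k) * of_nat (fact ?k) * (e * prod_list es)" by (metis mult.assoc mult_of_nat_commute)
 finally have "(e + ?s) ^ Suc ?k = of_nat (fact (Suc ?k)) * (e * prod_list es)" by (simp only: fact_Suc of_nat_mult of_nat_id)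
 moreover have "(e + ?s) ^ Suc (Suc ?k) = 0" unfolding sum_power_square_zero[OF c sq] IH 0 by simp
 ultimately show ?case by simp
qed simp

section \<open>The volume form and coefficients of top degree\<close>

definition dzz :: "'n => 'n => ('n::finite) ext" where
 "dzz j k = gen (Inl j) * gen (Inr k)"

lemma homog_dzz: "homog 2 (dzz j k)" unfolding dzz_def by (rule homog_mult'[OF homog_gen homog_gen]) simp

lemma Ext_dz: "Ext (dz j) = gen (Inl j)" and Ext_dzbar: "Ext (dzbar j) = gen (Inr j)" by (rule form_of_eqI, simp add: dz_def dzbar_def gen_def covec.rep_eq)+

lemma Ext_wedge_dz: "Ext (wedge (dz j) (dzbar k)) = dzz j k" by (simp add: Ext_wedge Ext_dz Ext_dzbar dzz_def)

lemma dzz_square: "dzz j k * dzz j l = 0" "dzz k j * dzz l j = 0" proof -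
 have "dzz j k * dzz j l = gen (Inl j) * (gen (Inr k) * gen (Inl j)) * gen (Inr l)" by (simp add: dzz_def mult.assoc)
 also have "... = - (gen (Inl j) * gen (Inl j) * gen (Inr k) * gen (Inr l))" by (simp add: gen_anticommute[of "Inr k" "Inl j"] mult.assoc)
 finally show "dzz j k * dzz j l = 0" by (simp add: gen_square)
 have "dzz k j * dzz l j = gen (Inl k) * (gen (Inr j) * gen (Inl l)) * gen (Inr j)" by (simp add: dzz_def mult.assoc)
 also have "... = - (gen (Inl k) * gen (Inl l) * (gen (Inr j) * gen (Inr j)))" by (simp add: gen_anticommute[of "Inr j" "Inl l"] mult.assoc)
 finally show "dzz k j * dzz l j = 0" by (simp add: gen_square)
qed

definition vol_ext :: "('n::finite) ext" where "vol_ext = Ext std_vol"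

text \<open>Some enumeration of the indices. The two-forms \<open>dzz j j\<close> commute, so every
  order gives the same product.\<close>

definition ind_list :: "('n::finite) list" where
 "ind_list = (SOME l. set l = UNIV & distinct l)"

lemma ind_list: "set (ind_list :: ('n::finite) list) = UNIV" "distinct (ind_list :: ('n::finite) list)"
 "length (ind_list :: ('n::finite) list) = CARD('n)" proof -
 have "EX l. set l = (UNIV :: 'n set) & distinct l" using finite_distinct_list[of "UNIV :: 'n set"] by simp
 thus *: "set (ind_list :: 'n list) = UNIV" "distinct (ind_list :: 'n list)" unfolding ind_list_def by (metis (mono_tags, lifting) someI_ex)+
 show "length (ind_list :: 'n list) = CARD('n)" using distinct_card[OF *(2)] *(1) by simp
qed

lemma sum_list_ind_list: "sum_list (map f (ind_list :: ('n::finite) list)) = (SUM j:UNIV. f j :: 'a::comm_monoid_add)"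
 using sum_list_distinct_conv_sum_set[OF ind_list(2), of f] ind_list(1) by metis

lemma Ext_std_kaehler: "Ext std_kaehler = scal (\<i> / 2) * (SUM j:UNIV. dzz j j)" unfolding std_kaehler_def by (simp only: Ext_scale Ext_sum Ext_wedge_dz)

text \<open>The summands \<open>dzz j j\<close> commute and square to zero, so the power is
  \<open>fact CARD('n)\<close> times their product, and the factorial cancels against the one in
  \<open>std_vol\<close>.\<close>

lemma vol_ext_eq:
 "vol_ext = scal ((\<i> / 2) ^ CARD('n)) * prod_list (map (%j::'n::finite. dzz j j) ind_list)" proof -
 let ?es = "map (%j::'n. dzz j j) ind_list"
 have "sum_list ?es ^ length ?es = of_nat (fact (length ?es)) * prod_list ?es"
  by (rule sum_list_power_square_zero[THEN conjunct1]) (auto simp: dzz_square intro: homog2_commute[OF homog_dzz])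
 hence *: "(SUM j:UNIV. dzz j j) ^ CARD('n) = scal (fact CARD('n)) * prod_list ?es"
  using scal_of_nat[of "fact CARD('n)", where 'a='n] by (simp add: ind_list(3) sum_list_ind_list)
 have "vol_ext = Ext (%vs. (1 / fact CARD('n)) * form_power (std_kaehler :: 'n form) CARD('n) vs)" by (simp add: vol_ext_def std_vol_def)
 also have "... = scal (1 / fact CARD('n)) * (scal ((\<i> / 2) ^ CARD('n)) * (scal (fact CARD('n)) * prod_list ?es))"
  by (simp only: Ext_scale Ext_form_power Ext_std_kaehler scal_mult_power *)
 also have "... = scal ((\<i> / 2) ^ CARD('n)) * prod_list ?es" by (simp add: scal_mult_assoc)
 finally show ?thesis .
qed

lemma monom_ext_top:
 assumes "length xs = 2 * CARD('n)"
 shows "EX c. monom_ext xs = scal c * (vol_ext :: ('n::finite) ext)" proof (cases "distinct xs")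
 case False
 thus ?thesis using monom_ext_not_distinct[of xs] by (intro exI[of _ 0]) simp
next
 case True
 let ?ys = "concat (map (%j::'n. [Inl j, Inr j]) ind_list)"
 have m: "monom_ext (concat (map (%j::'n. [Inl j, Inr j]) l)) = prod_list (map (%j. dzz j j) l)" for l by (induction l) (simp_all add: dzz_def mult.assoc)
 have set: "set ?ys = UNIV" proof -
  have "x : set ?ys" for x :: "'n + 'n" by (cases x) (auto simp: ind_list)
  thus ?thesis by auto
 qed
 have len: "length (concat (map (%j::'n. [Inl j, Inr j]) l)) = 2 * length l" for l by (induction l) auto
 have "card (set ?ys) = length ?ys" by (simp only: set len ind_list(3)) simp
 hence dist: "distinct ?ys" by (rule card_distinct)
 have "card (set xs) = CARD('n + 'n)" using True assms distinct_card by fastforce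
 hence "set xs = UNIV" by (simp add: card_eq_UNIV_imp_eq_UNIV)
 hence "mset xs = mset ?ys" using set dist True set_eq_iff_mset_eq_distinct by blast
 then obtain s where "monom_ext xs = scal s * monom_ext ?ys" using monom_ext_mset by blast
 hence 1: "monom_ext xs = scal s * prod_list (map (%j. dzz j j) ind_list)" by (simp only: m)
 have "prod_list (map (%j::'n. dzz j j) ind_list) = scal (1 / (\<i> / 2) ^ CARD('n)) * vol_ext" unfolding vol_ext_eq scal_mult_assoc by simp
 thus ?thesis using 1 scal_mult_assoc by metis
qed

lemma homog_top: "homog k (a :: ('n::finite) ext) ==> k = 2 * CARD('n) ==> EX c. a = scal c * vol_ext"
proof (induction rule: homog.induct)
 case (homog_monom xs k c)
 thus ?case using monom_ext_top[of xs] scal_mult_assoc by metis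
next
 case (homog_add k a b)
 thus ?case by (metis distrib_right scal_add)
qed

lemma contr_prod_list_0: "(!!l. l : set ls ==> l b = 0) ==> contr b (prod_list (map covec ls)) = 0"
proof (induction ls)
 case (Cons l ls)
 hence "l b = 0" "contr b (prod_list (map covec ls)) = 0" by auto
 thus ?case by (simp add: contr_mult)
qed simp

text \<open>Contracting with the dual vector \<open>b\<close> strips the factor
  \<open>covec (d b)\<close> and kills the rest of the product, so nonvanishing passes from the
  shorter product to the longer one.\<close>

lemma prod_list_covec_nonzero:
 assumes "distinct bs" "!!b. b : set bs ==> d b b = 1" "!!b c. b : set bs ==> c : set bs ==> b ~= c ==> d b c = 0"
 shows "prod_list (map covec (map d bs)) ~= (0 :: ('n::finite) ext)" using assms
proof (induction bs)
 case (Cons b bs)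
 let ?P = "prod_list (map covec (map d bs))"
 have "contr b ?P = 0" by (rule contr_prod_list_0) (use Cons.prems in auto)
 hence "contr b (covec (d b) * ?P) = ?P" using Cons.prems by (simp add: contr_mult)
 moreover have "?P ~= 0" using Cons by auto
 ultimately show ?case using contr_0 by auto
qed simp

definition basis_list :: "(complex^('n::finite)) list" where
 "basis_list = (SOME l. set l = Basis & distinct l)"

lemma basis_list: "set (basis_list :: (complex^('n::finite)) list) = Basis"
 "distinct (basis_list :: (complex^('n::finite)) list)"
 "length (basis_list :: (complex^('n::finite)) list) = 2 * CARD('n)" proof -
 have "EX l. set l = (Basis :: (complex^'n) set) & distinct l" using finite_distinct_list[of "Basis :: (complex^'n) set"] by simp
 thus *: "set (basis_list :: (complex^'n) list) = Basis" "distinct (basis_list :: (complex^'n) list)"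
  unfolding basis_list_def by (metis (mono_tags, lifting) someI_ex)+
 show "length (basis_list :: (complex^'n) list) = 2 * CARD('n)" using distinct_card[OF *(2)] *(1) by simp
qed

definition coord :: "complex^('n::finite) => complex^'n => complex" where
 "coord b v = of_real (v \<bullet> b)"

lemma linear_coord: "linear (coord b)" by (rule linearI) (simp_all add: coord_def inner_add_left scaleR_conv_of_real[of _ "of_real _"])

text \<open>Volume form in real coordinates. As top degree is spanned by \<open>vol_ext\<close>, its
  nonvanishing gives that of \<open>vol_ext\<close> with no constant to compute; it also serves to
  read off the real determinant of a pullback.\<close>

definition real_vol :: "('n::finite) ext" where
 "real_vol = prod_list (map (%b. covec (coord b)) basis_list)"

lemma real_vol_nonzero: "real_vol ~= (0 :: ('n::finite) ext)" proof -
 have "prod_list (map covec (map coord basis_list)) ~= (0 :: 'n ext)" by (rule prod_list_covec_nonzero) (auto simp: basis_list coord_def inner_Basis)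
 thus ?thesis by (simp add: real_vol_def o_def)
qed

lemma homog_real_vol: "homog (2 * CARD('n)) (real_vol :: ('n::finite) ext)" proof -
 have "homog (1 * length (map (%b::complex^'n. covec (coord b)) basis_list)) (real_vol :: 'n ext)"
  unfolding real_vol_def by (rule homog_prod_list) (auto intro!: homog_covec[unfolded One_nat_def] linear_coord)
 thus ?thesis by (simp add: basis_list)
qed

lemma vol_ext_nonzero: "vol_ext ~= (0 :: ('n::finite) ext)" using homog_top[OF homog_real_vol refl, where 'n='n] real_vol_nonzero[where 'n='n] by force

definition vol_args :: "(complex^('n::finite)) list" where
 "vol_args = (SOME vs. form_of vol_ext vs ~= 0)"

lemma vol_args: "form_of vol_ext vol_args ~= 0" proof -
 have "EX vs. form_of vol_ext vs ~= 0" using vol_ext_nonzero form_of_eqI[of vol_ext 0] by auto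
 thus ?thesis unfolding vol_args_def by (rule someI_ex)
qed

text \<open>Coefficient against the volume form, read off on one fixed argument list where the
  volume form does not vanish. This gives a linear functional on the whole ring, which
  \<open>top_coeff\<close>, a definite description, is not.\<close>

definition topc :: "('n::finite) ext => complex" where
 "topc a = form_of a vol_args / form_of (vol_ext :: 'n ext) vol_args"

lemma topc_simps [simp]:
 "topc (a + b) = topc a + topc b" "topc (a - b) = topc a - topc b" "topc (scal c * a) = c * topc a"
 "topc 0 = 0" "topc (- a) = - topc a" by (simp_all add: topc_def add_divide_distrib diff_divide_distrib)

lemma topc_sum: "topc (sum f A) = (SUM i:A. topc (f i))" by (simp add: topc_def sum_divide_distrib)

lemma topc_vol [simp]: "topc vol_ext = 1" using vol_args by (simp add: topc_def)

lemma topc_eq: "homog (2 * CARD('n)) (a :: ('n::finite) ext) ==> a = scal (topc a) * vol_ext" using homog_top[of "2 * CARD('n)" a] by auto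

definition real_ext :: "('n::finite) ext => bool" where
 "real_ext a \<longleftrightarrow> (ALL vs. form_of a vs : \<real>)"

lemma real_ext_mult: "real_ext a ==> real_ext b ==> real_ext (a * b)"
 unfolding real_ext_def form_of_mult wedge_def by (intro allI sum_in_Reals Reals_mult Reals_power) auto

lemma real_ext_1: "real_ext 1" by (simp add: real_ext_def one_ext.rep_eq const_form_def)

lemma real_ext_power: "real_ext a ==> real_ext (a ^ k)" by (induction k) (auto simp: real_ext_mult real_ext_1)

lemma real_ext_scal: "real_ext a ==> c : \<real> ==> real_ext (scal c * a)" by (simp add: real_ext_def)

lemma real_ext_sum: "(!!i. i : A ==> real_ext (f i)) ==> real_ext (sum f A)" by (simp add: real_ext_def sum_in_Reals)

lemma form_of_dzz: "form_of (dzz j k) vs =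
 (if length vs = 2 then vs!0 $ j * cnj (vs!1 $ k) - vs!1 $ j * cnj (vs!0 $ k) else 0)" by (simp add: dzz_def gen_def form_of_covec_mult)

lemma real_ext_vol: "real_ext (vol_ext :: ('n::finite) ext)" proof -
 have "real_ext (scal (\<i> / 2) * dzz j j)" for j :: 'n unfolding real_ext_def by (auto simp: form_of_dzz complex_is_Real_iff mult.commute)
 hence "real_ext (Ext (std_kaehler :: 'n form))" unfolding Ext_std_kaehler sum_distrib_left by (intro real_ext_sum)
 hence "real_ext (scal (1 / fact CARD('n)) * Ext (std_kaehler :: 'n form) ^ CARD('n))"
 proof (intro real_ext_scal real_ext_power)
  have "1 / fact CARD('n) = complex_of_real (1 / fact CARD('n))" by simp
  thus "1 / fact CARD('n) : (\<real> :: complex set)" by (metis Reals_of_real)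
 qed
 moreover have "vol_ext = Ext (%vs. (1 / fact CARD('n)) * form_power (std_kaehler :: 'n form) CARD('n) vs)" by (simp add: vol_ext_def std_vol_def)
 ultimately show ?thesis by (simp only: Ext_scale Ext_form_power)
qed

lemma topc_real: "real_ext a ==> topc a : \<real>" using real_ext_vol by (auto simp: topc_def real_ext_def intro!: Reals_divide)

lemma top_coeff_eqI:
 assumes "Ext a = scal (of_real c) * vol_ext"
 shows "top_coeff a = c" proof -
 have *: "a = (%vs. of_real d * std_vol vs) \<longleftrightarrow> Ext a = scal (of_real d) * vol_ext" for d
  unfolding vol_ext_def Ext_scale[symmetric] by (metis form_of_Ext)
 show ?thesis unfolding top_coeff_def *
 proof (rule the_equality)
  fix d assume "Ext a = scal (of_real d) * vol_ext"
  hence "topc (scal (of_real d) * (vol_ext :: 'a ext)) = topc (scal (of_real c) * (vol_ext :: 'a ext))" using assms by simp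
  thus "d = c" by simp
 qed (rule assms)
qed

lemma top_coeff_eq:
 assumes "homog (2 * CARD('n)) (Ext a :: ('n::finite) ext)" "real_ext (Ext a)"
 shows "top_coeff a = Re (topc (Ext a))"
proof (rule top_coeff_eqI)
 have "of_real (Re (topc (Ext a))) = topc (Ext a)" using topc_real[OF assms(2)] by (metis of_real_Re)
 thus "Ext a = scal (of_real (Re (topc (Ext a)))) * vol_ext" using topc_eq[OF assms(1)] by simp
qed

lemma positive_top_formI:
 assumes "homog (2 * CARD('n)) (Ext a :: ('n::finite) ext)" "real_ext (Ext a)" "Re (topc (Ext a)) > 0"
 shows "positive_top_form a" proof -
 have "of_real (Re (topc (Ext a))) = topc (Ext a)" using topc_real[OF assms(2)] by (metis of_real_Re)
 hence "Ext a = Ext (%vs. of_real (Re (topc (Ext a))) * std_vol vs)" using topc_eq[OF assms(1)] unfolding Ext_scale vol_ext_def by simp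
 hence "a = (%vs. of_real (Re (topc (Ext a))) * std_vol vs)" by (metis form_of_Ext)
 thus ?thesis unfolding positive_top_form_def using assms(3) by blast
qed

section \<open>Contraction identities, Hermitian matrices and (1,1)-forms\<close>

lemma contr_power:
 assumes "homog 2 w"
 shows "contr v (w ^ Suc k) = of_nat (Suc k) * (contr v w * w ^ k)"
proof (induction k)
 case 0
 thus ?case by simp
next
 case (Suc k)
 have "contr v (w * w ^ Suc k) = contr v w * w ^ Suc k + w * (of_nat (Suc k) * (contr v w * w ^ k))" unfolding contr_mult homog2_gsign[OF assms] Suc ..
 also have "w * (of_nat (Suc k) * (contr v w * w ^ k)) = of_nat (Suc k) * (w * (contr v w * w ^ k))" by (rule of_nat_left_commute)
 also have "w * (contr v w * w ^ k) = contr v w * w ^ Suc k" by (simp add: homog2_commute[OF assms, of "contr v w"] flip: mult.assoc)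
 finally show ?case by (simp only: power_Suc[of w "Suc k"] of_nat_Suc[of "Suc k"] distrib_right mult_1_left add.commute)
qed

text \<open>\<open>covec l * w ^ CARD('n)\<close> has degree 2n + 1 and vanishes; contracting this
  zero with \<open>v\<close> and applying the Leibniz rule gives the identity. It computes traces
  with respect to \<open>w\<close>.\<close>

lemma covec_contr_top:
 fixes w :: "('n::finite) ext"
 assumes "homog 2 w" "linear l"
 shows "of_nat CARD('n) * (covec l * contr v w * w ^ (CARD('n) - 1)) = scal (l v) * w ^ CARD('n)" proof -
 have n: "CARD('n) = Suc (CARD('n) - 1)" using zero_less_card_finite[where 'a='n] by simp
 have "homog (1 + 2 * CARD('n)) (covec l * w ^ CARD('n))" by (intro homog_mult homog_covec homog_power assms)
 hence "covec l * w ^ CARD('n) = 0" by (rule homog_eq_0) simp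
 hence "0 = contr v (covec l * w ^ CARD('n))" by simp
 also have "... = scal (l v) * w ^ CARD('n) - covec l * contr v (w ^ CARD('n))" by (simp add: contr_mult)
 also have "contr v (w ^ CARD('n)) = of_nat CARD('n) * (contr v w * w ^ (CARD('n) - 1))" using contr_power[OF assms(1), of v "CARD('n) - 1"] n by metis
 also have "covec l * (of_nat CARD('n) * (contr v w * w ^ (CARD('n) - 1))) =
  of_nat CARD('n) * (covec l * contr v w * w ^ (CARD('n) - 1))" by (simp only: of_nat_left_commute mult.assoc)
 finally show ?thesis by simp
qed

definition herm_ext :: "('n => 'n => complex) => ('n::finite) ext" where
 "herm_ext h = (SUM j:UNIV. SUM k:UNIV. scal (\<i> * h j k) * dzz j k)"

definition hermitian :: "('n => 'n => complex) => bool" where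
 "hermitian h \<longleftrightarrow> (ALL j k. h k j = cnj (h j k))"

lemma sum_sum_delta:
 assumes "finite A" "j : A" "k : A"
 shows "(SUM j':A. SUM k':A. if j' = j then if k' = k then f j' k' else 0 else 0) = (f j k :: 'a::comm_monoid_add)" proof -
 have "(SUM j':A. SUM k':A. if j' = j then if k' = k then f j' k' else 0 else 0)
  = (SUM j':A. if j' = j then f j k else 0)" using assms by (intro sum.cong) auto
 thus ?thesis using assms by simp
qed

lemma dzz_prod_list_0:
 assumes "k : set js"
 shows "dzz k l * prod_list (map (%j. scal \<i> * dzz j j) js) = 0"
  and "dzz l k * prod_list (map (%j. scal \<i> * dzz j j) js) = 0" proof -
 have "z * prod_list (map (%j. scal \<i> * dzz j j) js) = 0" if "homog 2 z" "z * dzz k k = 0" for z using assms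
 proof (induction js)
  case (Cons j js)
  let ?P = "prod_list (map (%j. scal \<i> * dzz j j) js)"
  have "z * (scal \<i> * dzz j j * ?P) = scal \<i> * (z * dzz j j * ?P)" by (simp add: mult.assoc scal_left_commute[of z])
  also have "... = 0" proof (cases "k = j")
  case True
  thus ?thesis using that by simp
  next
  case False
  hence "z * ?P = 0" using Cons by simp
  moreover have "z * dzz j j * ?P = dzz j j * (z * ?P)" by (simp add: homog2_commute[OF that(1)] mult.assoc)
  ultimately show ?thesis by simp
  qed
  finally show ?case by simp
 qed simp
 from this[OF homog_dzz dzz_square(1)] this[OF homog_dzz dzz_square(2)]
 show "dzz k l * prod_list (map (%j. scal \<i> * dzz j j) js) = 0"
  and "dzz l k * prod_list (map (%j. scal \<i> * dzz j j) js) = 0" by auto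
qed

text \<open>Completing squares (Schur complements) reduces the number of variables by one.\<close>

lemma hermitian_power:
 fixes h :: "'n::finite => 'n => complex"
 assumes "distinct js" "hermitian h"
  and "!!v. EX j:set js. v j ~= 0 ==> Re (SUM j:set js. SUM k:set js. h j k * v j * cnj (v k)) > 0"
 shows "EX c>0. (SUM j:set js. SUM k:set js. scal (\<i> * h j k) * dzz j k) ^ length js
  = scal (of_real c) * prod_list (map (%j. scal \<i> * dzz j j) js)
  & (SUM j:set js. SUM k:set js. scal (\<i> * h j k) * dzz j k) ^ Suc (length js) = 0" using assms
proof (induction js arbitrary: h)
 case Nil
 thus ?case by (auto intro!: exI[of _ 1])
next
 case (Cons j js)
 let ?J = "set (j # js)" and ?r = "length js"
 let ?P = "prod_list (map (%j. scal \<i> * dzz j j) js)"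
 have jn: "j ~: set js" and dist: "distinct js" using Cons.prems by auto
 have herm: "h l k = cnj (h k l)" for k l using Cons.prems(2) unfolding hermitian_def by blast
 define d where "d = Re (h j j)"
 have hjj: "h j j = of_real d" using herm[of j j] by (simp add: d_def complex_eq_iff)
 have "Re (SUM k:?J. SUM l:?J. h k l * of_bool (k = j) * cnj (of_bool (l = j))) > 0" by (rule Cons.prems(3)) auto
 also have "(SUM k:?J. SUM l:?J. h k l * of_bool (k = j) * cnj (of_bool (l = j))) =
  (SUM k:?J. SUM l:?J. if k = j then if l = j then h k l else 0 else 0)" by (intro sum.cong) auto
 also have "... = h j j" by (rule sum_sum_delta) auto
 finally have d: "d > 0" by (simp add: d_def)
 define h' where "h' k l = h k l - h k j * h j l / of_real d" for k l
 have h'j: "h' j l = 0" "h' k j = 0" for k l using d by (auto simp: h'_def hjj)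
 have herm': "hermitian h'" unfolding hermitian_def h'_def by (simp add: herm[symmetric])
 have pos': "Re (SUM k:set js. SUM l:set js. h' k l * v k * cnj (v l)) > 0" if v: "EX k:set js. v k ~= 0" for v proof -
  define b where "b = (SUM k:set js. h k j * v k)"
  have cb: "cnj b = (SUM l:set js. h j l * cnj (v l))" by (simp add: b_def herm[of j, symmetric])
  \<comment> \<open>The extension of \<open>v\<close> by the \<open>j\<close>-th coordinate that
    minimises the Hermitian form of \<open>h\<close>; the minimum is the form of
    \<open>h'\<close>.\<close>
  define u where "u = v(j := - b / of_real d)"
  have uk: "u k = v k" if "k : set js" for k using that jn by (auto simp: u_def)
  have uj: "u j = - b / of_real d" by (simp add: u_def)
  have "(SUM k:?J. SUM l:?J. h k l * u k * cnj (u l)) =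
  h j j * u j * cnj (u j) + (SUM l:set js. h j l * u j * cnj (u l))
  + (SUM k:set js. h k j * u k * cnj (u j) + (SUM l:set js. h k l * u k * cnj (u l)))" using jn by simp
  also have "... = h j j * u j * cnj (u j) + u j * cnj b + b * cnj (u j)
  + (SUM k:set js. SUM l:set js. h k l * v k * cnj (v l))" proof -
  have "(SUM l:set js. h j l * u j * cnj (u l)) = u j * cnj b" unfolding cb sum_distrib_left by (rule sum.cong) (auto simp: uk)
  moreover have "(SUM k:set js. h k j * u k * cnj (u j)) = b * cnj (u j)" unfolding b_def sum_distrib_right by (rule sum.cong) (auto simp: uk)
  moreover have "(SUM k:set js. SUM l:set js. h k l * u k * cnj (u l))
  = (SUM k:set js. SUM l:set js. h k l * v k * cnj (v l))" by (intro sum.cong) (auto simp: uk)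
  ultimately show ?thesis by (simp add: sum.distrib)
  qed
  also have "... = (SUM k:set js. SUM l:set js. h k l * v k * cnj (v l)) - b * cnj b / of_real d" using d by (simp add: uj hjj field_simps)
  also have "b * cnj b / of_real d = (SUM k:set js. SUM l:set js. h k j * h j l / of_real d * v k * cnj (v l))"
  unfolding cb unfolding b_def sum_product sum_divide_distrib by (intro sum.cong) (auto simp: field_simps)
  also have "(SUM k:set js. SUM l:set js. h k l * v k * cnj (v l))
  - (SUM k:set js. SUM l:set js. h k j * h j l / of_real d * v k * cnj (v l))
  = (SUM k:set js. SUM l:set js. h' k l * v k * cnj (v l))" by (simp add: h'_def sum_subtractf[symmetric] left_diff_distrib)
  finally have "(SUM k:set js. SUM l:set js. h' k l * v k * cnj (v l)) = (SUM k:?J. SUM l:?J. h k l * u k * cnj (u l))" by simp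
  moreover have "Re (SUM k:?J. SUM l:?J. h k l * u k * cnj (u l)) > 0" by (rule Cons.prems(3)) (use v uk in auto)
  ultimately show ?thesis by simp
 qed
 define W where "W = (SUM k:?J. SUM l:?J. scal (\<i> * h k l) * dzz k l)"
 define W' where "W' = (SUM k:set js. SUM l:set js. scal (\<i> * h' k l) * dzz k l)"
 obtain c where c: "c > 0" "W' ^ ?r = scal (of_real c) * ?P" "W' ^ Suc ?r = 0" using Cons.IH[OF dist herm' pos'] unfolding W'_def by auto
 \<comment> \<open>The completed square: its matrix is column \<open>j\<close> times row
   \<open>j\<close> over \<open>d\<close>, of rank one. Hence \<open>A\<close> is a multiple of a
   product of two covectors and squares to zero.\<close>
 define A where "A = (SUM k:?J. SUM l:?J. scal (\<i> * (h k j * h j l / of_real d)) * dzz k l)"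
 have "A + W' = W" proof -
  have "W' = (SUM k:?J. SUM l:?J. scal (\<i> * h' k l) * dzz k l)" unfolding W'_def using jn by (simp add: h'j)
  hence "A + W' = (SUM k:?J. SUM l:?J. scal (\<i> * (h k j * h j l / of_real d)) * dzz k l + scal (\<i> * h' k l) * dzz k l)"
  unfolding A_def by (simp only: sum.distrib)
  also have "... = W" unfolding W_def distrib_right[symmetric] scal_add[symmetric]
  by (intro sum.cong refl arg_cong2[of _ _ _ _ "(*)"] arg_cong[of _ _ scal]) (simp add: h'_def algebra_simps)
  finally show ?thesis .
 qed
 have hA: "homog 2 A" unfolding A_def by (intro homog_sum homog_scal homog_dzz)
 define mm where "mm = (SUM k:?J. scal (h k j) * gen (Inl k))"
 define nu where "nu = (SUM l:?J. scal (h j l) * gen (Inr l))"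
 have mm: "mm = covec (%v. SUM k:?J. h k j * v $ k)" unfolding mm_def gen_def by (simp only: covec_sum covec_scale sum.case)
 have nu: "nu = covec (%v. SUM k:?J. h j k * cnj (v $ k))" unfolding nu_def gen_def by (simp only: covec_sum covec_scale sum.case)
 have Amm: "A = scal (\<i> / of_real d) * (mm * nu)" proof -
  have "scal (\<i> * (h k j * h j l / of_real d)) * dzz k l
  = scal (\<i> / of_real d) * (scal (h k j) * gen (Inl k) * (scal (h j l) * gen (Inr l)))" for k l
  unfolding dzz_def mult.assoc scal_left_commute[of "gen (Inl k)"] scal_mult_assoc by simp
  thus ?thesis unfolding A_def mm_def nu_def sum_product unfolding sum_distrib_left by presburger
 qed
 have AA: "A * A = 0" proof -
  have nm: "nu * mm = - (mm * nu)" unfolding mm nu by (rule covec_anticommute)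
  have "mm * nu * (mm * nu) = mm * (nu * mm) * nu" by (simp only: mult.assoc)
  also have "... = - (mm * mm * (nu * nu))" by (simp only: nm mult_minus_left mult_minus_right mult.assoc)
  finally have "mm * nu * (mm * nu) = - (mm * mm * (nu * nu))" .
  hence "mm * nu * (mm * nu) = 0" unfolding mm covec_square by simp
  thus ?thesis unfolding Amm by (simp add: mult.assoc scal_left_commute[of _ "\<i> / of_real d"])
 qed
 \<comment> \<open>Only the entry with both indices equal to \<open>j\<close> survives, since any
   other index lies in \<open>js\<close> and meets the same generator in \<open>?P\<close>.\<close>
 have AP: "A * ?P = scal (of_real d) * (scal \<i> * dzz j j * ?P)" proof -
  have z: "scal (\<i> * (h k j * h j l / of_real d)) * dzz k l * ?P =
  (if k = j then if l = j then scal (of_real d) * (scal \<i> * dzz j j * ?P) else 0 else 0)"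
  if "k : ?J" "l : ?J" for k l proof (cases "k = j & l = j")
  case True
  have "\<i> * (of_real d * of_real d / of_real d) = complex_of_real d * \<i>" using d by simp
  with True show ?thesis by (simp only: hjj scal_mult mult.assoc if_True simp_thms)
  next
  case False
  hence "k : set js | l : set js" using that by auto
  hence "dzz k l * ?P = 0" using dzz_prod_list_0 by blast
  thus ?thesis using False by (simp add: mult.assoc)
  qed
  have "A * ?P = (SUM k:?J. SUM l:?J. if k = j then if l = j then scal (of_real d) * (scal \<i> * dzz j j * ?P) else 0 else 0)"
  unfolding A_def sum_distrib_right by (intro sum.cong refl z)
  also have "... = scal (of_real d) * (scal \<i> * dzz j j * ?P)" using jn by (simp add: sum.neutral)
  finally show ?thesis .
 qed
 have W0: "W' ^ Suc (Suc ?r) = 0" using c(3) by (metis mult_zero_right power_Suc)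
 note ex = sum_power_square_zero[OF homog2_commute[OF hA] AA, of W', unfolded \<open>A + W' = W\<close>]
 have "W ^ Suc ?r = of_nat (Suc ?r) * (A * (scal (of_real c) * ?P))" unfolding ex c by simp
 also have "... = scal (of_nat (Suc ?r)) * (scal (of_real c) * (scal (of_real d) * (scal \<i> * dzz j j * ?P)))"
  by (simp only: scal_left_commute[of A] AP scal_of_nat)
 also have "... = scal (of_real (real (Suc ?r) * c * d)) * prod_list (map (%j. scal \<i> * dzz j j) (j # js))" by (simp add: scal_mult_assoc mult.assoc)
 finally have "W ^ length (j # js) = scal (of_real (real (Suc ?r) * c * d)) * prod_list (map (%j. scal \<i> * dzz j j) (j # js))" by simp
 moreover have "real (Suc ?r) * c * d > 0" using c d by simp
 moreover have "W ^ Suc (length (j # js)) = 0"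
  unfolding list.size ex[of "Suc ?r", simplified] add_0_right One_nat_def add_Suc_right using ex[of "Suc ?r"] c(3) W0 by simp
 ultimately show ?case unfolding W_def by blast
qed

lemma herm_ext_top_pos:
 fixes h :: "'n::finite => 'n => complex"
 assumes "hermitian h" "!!v :: complex^'n. v ~= 0 ==> Re (SUM j:UNIV. SUM k:UNIV. h j k * v $ j * cnj (v $ k)) > 0"
 shows "Re (topc (herm_ext h ^ CARD('n))) > 0" proof -
 have "Re (SUM j:set ind_list. SUM k:set ind_list. h j k * v j * cnj (v k)) > 0" if "EX j:set ind_list. v j ~= 0" for v
  using assms(2)[of "\<chi> j. v j"] that by (auto simp: ind_list vec_eq_iff)
 from hermitian_power[OF ind_list(2) assms(1) this] obtain c where c: "c > 0"
  "herm_ext h ^ CARD('n) = scal (of_real c) * prod_list (map (%j. scal \<i> * dzz j j) (ind_list :: 'n list))" by (auto simp: ind_list herm_ext_def)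
 have *: "prod_list (map (%j. scal \<i> * dzz j j) l) = scal (\<i> ^ length l) * prod_list (map (%j. dzz j j) l)" for l :: "'n list"
 proof (induction l)
  case (Cons j l)
  have "scal \<i> * dzz j j * (scal (\<i> ^ length l) * prod_list (map (%j. dzz j j) l)) =
  scal (\<i> * \<i> ^ length l) * (dzz j j * prod_list (map (%j. dzz j j) l))" by (simp only: mult.assoc scal_left_commute[of "dzz j j"] scal_mult)
  thus ?case using Cons by simp
 qed simp
 \<comment> \<open>One factor 2 per variable: the ratio of \<i> to the \<i>/2 of the standard volume
   form.\<close>
 have "prod_list (map (%j. scal \<i> * dzz j j) (ind_list :: 'n list)) = scal (2 ^ CARD('n)) * vol_ext"
  unfolding * vol_ext_eq scal_mult_assoc by (simp add: ind_list power_divide)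
 hence "topc (herm_ext h ^ CARD('n)) = of_real c * 2 ^ CARD('n)" using c by simp
 thus ?thesis using c(1) by (metis Re_complex_of_real of_real_mult of_real_numeral of_real_power zero_less_mult_iff zero_less_numeral zero_less_power)
qed

text \<open>Polarisation: for the form of \<open>h\<close> the two values are
  \<open>h j k + h k j\<close> and \<i> times \<open>h j k - h k j\<close>, so the combination
  returns \<open>h j k\<close>.\<close>

definition hcoef :: "('n::finite) form => 'n => 'n => complex" where
 "hcoef a j k = (a [axis j 1, axis k \<i>] - \<i> * a [axis j 1, axis k 1]) / 2"

lemma form_of_herm_ext:
 "form_of (herm_ext h) [v, w] = (SUM j:UNIV. SUM k:UNIV. \<i> * h j k * (v $ j * cnj (w $ k) - w $ j * cnj (v $ k)))" by (simp add: herm_ext_def form_of_dzz)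

lemma form_of_herm_ext_J:
 "form_of (herm_ext h) [v, \<i> *s v] = 2 * (SUM j:UNIV. SUM k:UNIV. h j k * v $ j * cnj (v $ k))"
 unfolding form_of_herm_ext sum_distrib_left by (intro sum.cong) (auto simp: algebra_simps)

lemma hcoef_herm_ext: "hcoef (form_of (herm_ext h)) j k = h j k" proof -
 have ax: "(axis j x :: complex^'a) $ l = (if l = j then x else 0)" for j x l by (simp add: axis_def)
 have s: "(SUM j':UNIV. SUM k':UNIV. if j' = j then if k' = k then f j' k' else 0 else 0) = f j k" for f :: "'a => 'a => complex" and j k
  by (rule sum_sum_delta) auto
 have e: "form_of (herm_ext h) [axis j x, axis k y] = \<i> * h j k * x * cnj y - \<i> * h k j * y * cnj x" for x y proof -
  have "form_of (herm_ext h) [axis j x, axis k y] =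
  (SUM j':UNIV. SUM k':UNIV. (if j' = j then if k' = k then \<i> * h j' k' * x * cnj y else 0 else 0) -
  (if j' = k then if k' = j then \<i> * h j' k' * y * cnj x else 0 else 0))" unfolding form_of_herm_ext ax by (intro sum.cong) (auto simp: algebra_simps)
  thus ?thesis by (simp only: sum_subtractf s)
 qed
 show ?thesis unfolding hcoef_def e by (simp add: algebra_simps)
qed

text \<open>Hermitian symmetry comes from the vanishing imaginary parts of the values on the pairs
  of axis vectors used in \<open>hcoef\<close>.\<close>

lemma real_11_form_herm:
 assumes "real_11_form (a :: ('n::finite) form)"
 shows "Ext a = herm_ext (hcoef a)" "hermitian (hcoef a)" "real_ext (Ext a)" proof -
 obtain C where C: "a = (%vs. SUM j:UNIV. SUM k:UNIV. C j k * wedge (dz j) (dzbar k) vs)" and r: "!!vs. a vs : \<real>"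
  using assms by (auto simp: real_11_form_def)
 have "Ext a = (SUM j:UNIV. SUM k:UNIV. scal (C j k) * dzz j k)" unfolding C by (simp only: Ext_sum Ext_scale Ext_wedge_dz)
 also have "... = herm_ext (%j k. - \<i> * C j k)" by (simp add: herm_ext_def)
 finally have E: "Ext a = herm_ext (%j k. - \<i> * C j k)" .
 hence "a = form_of (herm_ext (%j k. - \<i> * C j k))" by (metis form_of_Ext)
 hence "hcoef a = (%j k. - \<i> * C j k)" using hcoef_herm_ext by blast
 with E show 1: "Ext a = herm_ext (hcoef a)" by simp
 show "real_ext (Ext a)" using r by (simp add: real_ext_def)
 have "hcoef a k j = cnj (hcoef a j k)" for j k proof -
  have ev: "a [axis j x, axis k y] = \<i> * hcoef a j k * x * cnj y - \<i> * hcoef a k j * y * cnj x" for x y proof -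
  have ax: "(axis j x :: complex^'n) $ l = (if l = j then x else 0)" for j x l by (simp add: axis_def)
  have s: "(SUM j':UNIV. SUM k':UNIV. if j' = j then if k' = k then f j' k' else 0 else 0) = f j k" for f :: "'n => 'n => complex" and j k
  by (rule sum_sum_delta) auto
  have "a [axis j x, axis k y] = form_of (herm_ext (hcoef a)) [axis j x, axis k y]" by (metis 1 form_of_Ext)
  also have "... = (SUM j':UNIV. SUM k':UNIV. (if j' = j then if k' = k then \<i> * hcoef a j' k' * x * cnj y else 0 else 0) -
  (if j' = k then if k' = j then \<i> * hcoef a j' k' * y * cnj x else 0 else 0))" unfolding form_of_herm_ext ax by (intro sum.cong) (auto simp: algebra_simps)
  finally show ?thesis by (simp only: sum_subtractf s)
  qed
  have "Im (a [axis j 1, axis k 1]) = 0" "Im (a [axis j 1, axis k \<i>]) = 0" using r by (auto simp: complex_is_Real_iff)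
  thus ?thesis unfolding ev by (auto simp: complex_eq_iff)
 qed
 thus "hermitian (hcoef a)" unfolding hermitian_def by blast
qed

lemma real_ext_herm: "hermitian h ==> real_ext (herm_ext h)" proof -
 assume h: "hermitian h"
 have "cnj (form_of (herm_ext h) vs) = form_of (herm_ext h) vs" for vs proof -
  have "cnj (form_of (herm_ext h) vs) = (SUM j:UNIV. SUM k:UNIV. \<i> * h k j * form_of (dzz k j) vs)" proof -
  have "cnj (h j k) = h k j" for j k using h unfolding hermitian_def by metis
  thus ?thesis unfolding herm_ext_def form_of_sum form_of_simps cnj_sum form_of_dzz by (intro sum.cong refl) (auto simp: algebra_simps)
  qed
  also have "... = (SUM k:UNIV. SUM j:UNIV. \<i> * h k j * form_of (dzz k j) vs)" by (rule sum.swap)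
  also have "... = form_of (herm_ext h) vs" unfolding herm_ext_def by simp
  finally show ?thesis .
 qed
 thus ?thesis by (simp add: real_ext_def Reals_cnj_iff)
qed

lemma real_11_form_herm_ext: "hermitian h ==> real_11_form (form_of (herm_ext h))" unfolding real_11_form_def
proof (intro conjI exI)
 show "form_of (herm_ext h) = (%vs. SUM j:UNIV. SUM k:UNIV. (\<i> * h j k) * wedge (dz j) (dzbar k) vs)"
  unfolding herm_ext_def by (rule HOL.ext) (simp add: Ext_wedge_dz[symmetric])
 assume "hermitian h"
 thus "ALL vs. form_of (herm_ext h) vs : \<real>" using real_ext_herm by (auto simp: real_ext_def)
qed

lemma homog_herm_ext: "homog 2 (herm_ext h)" unfolding herm_ext_def by (intro homog_sum homog_scal homog_dzz)

lemma positive_11_form_top: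
 fixes a :: "('n::finite) form"
 assumes "positive_11_form a"
 shows "Re (topc (Ext a ^ CARD('n))) > 0" proof -
 have r: "real_11_form a" and p: "!!v. v ~= 0 ==> Re (a [v, \<i> *s v]) > 0" using assms by (auto simp: positive_11_form_def)
 have "Re (SUM j:UNIV. SUM k:UNIV. hcoef a j k * v $ j * cnj (v $ k)) > 0" if "v ~= 0" for v proof -
  have "a [v, \<i> *s v] = 2 * (SUM j:UNIV. SUM k:UNIV. hcoef a j k * v $ j * cnj (v $ k))"
  unfolding form_of_herm_ext_J[symmetric] real_11_form_herm(1)[OF r, symmetric] by simp
  thus ?thesis using p[OF that] by simp
 qed
 from herm_ext_top_pos[OF real_11_form_herm(2)[OF r] this] show ?thesis unfolding real_11_form_herm(1)[OF r, symmetric] .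
qed

section \<open>Functions of class \<open>C\<^sup>k\<close>\<close>

lemma frechet_derivative_cong_open:
 assumes "open S" "x : S" "!!y. y : S ==> f y = g y"
 shows "FD f x = FD g x" proof -
 have "(f has_derivative D) (at x) \<longleftrightarrow> (g has_derivative D) (at x)" for D using has_derivative_transform_within_open[of f D x UNIV S g]
  has_derivative_transform_within_open[of g D x UNIV S f] assms by auto
 thus ?thesis by (simp add: frechet_derivative_def)
qed

lemma differentiable_cong_open:
 assumes "open S" "x : S" "!!y. y : S ==> f y = g y" "f differentiable (at x)"
 shows "g differentiable (at x)" using assms(4) has_derivative_transform_within_open[of f _ x UNIV S g] assms(1-3) unfolding differentiable_def by blast

lemma C_k_on_cong:
 assumes "open S" "!!x. x : S ==> f x = g x" "C_k_on k S f"
 shows "C_k_on k S g" using assms(2,3)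
proof (induction k arbitrary: f g)
 case 0
 thus ?case by (simp cong: continuous_on_cong)
next
 case (Suc k)
 have "C_k_on k S (%x. FD g x v)" for v
 proof (rule Suc.IH)
  show "FD f x v = FD g x v" if "x : S" for x using frechet_derivative_cong_open[OF assms(1) that] Suc.prems(1) by metis
  show "C_k_on k S (%x. FD f x v)" using Suc.prems by simp
 qed
 thus ?case using Suc.prems differentiable_cong_open[OF assms(1), of _ f g] by simp
qed

lemma C_k_on_subset: "C_k_on k S f ==> T \<subseteq> S ==> C_k_on k T f" by (induction k arbitrary: f) (auto intro: continuous_on_subset)

lemma C_k_on_SucD: "C_k_on (Suc k) S f ==> C_k_on k S f"
proof (induction k arbitrary: f)
 case 0
 thus ?case by (auto intro!: continuous_at_imp_continuous_on differentiable_imp_continuous_within)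
next
 case (Suc k)
 have "C_k_on (Suc k) S (%x. FD f x v)" for v using Suc.prems by (subst (asm) C_k_on.simps(2)) blast
 hence "C_k_on k S (%x. FD f x v)" for v by (rule Suc.IH)
 thus ?case using Suc.prems by simp
qed

lemma C_k_on_le: "C_k_on k S f ==> l <= k ==> C_k_on l S f" by (induction k) (auto simp: le_Suc_eq dest: C_k_on_SucD simp del: C_k_on.simps)

lemma C_k_on_continuous: "C_k_on k S f ==> continuous_on S f" using C_k_on_le[of k S f 0] by simp

lemma C_k_on_SucI:
 assumes "open S" "!!x. x : S ==> (f has_derivative D x) (at x)" "!!v. C_k_on k S (%x. D x v)"
 shows "C_k_on (Suc k) S f" proof -
 have eq: "FD f x = D x" if "x : S" for x using frechet_derivative_at[OF assms(2)[OF that]] by simp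
 have "C_k_on k S (%x. FD f x v)" for v by (rule C_k_on_cong[OF assms(1) _ assms(3)[of v]]) (simp add: eq)
 thus ?thesis using assms(2) by (auto simp: differentiable_def)
qed

lemma C_k_on_has_derivative:
 "C_k_on (Suc k) S f ==> x : S ==> (f has_derivative FD f x) (at x)" by (simp add: frechet_derivative_works)

lemma C_k_on_const [simp]: "C_k_on k S (%x. c)"
proof (induction k arbitrary: c)
 case (Suc k)
 have "FD (%x. c) x = (%_. 0)" for x :: 'a by (rule frechet_derivative_at[symmetric]) simp
 thus ?case using Suc by simp
qed simp

lemma C_k_on_bounded_linear:
 assumes "bounded_linear h" "open S" "C_k_on k S f"
 shows "C_k_on k S (%x. h (f x))" using assms(3)
proof (induction k arbitrary: f)
 case 0
 thus ?case using bounded_linear.continuous_on[OF assms(1)] by simp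
next
 case (Suc k)
 show ?case
 proof (rule C_k_on_SucI[OF assms(2)])
  show "((%x. h (f x)) has_derivative (%v. h (FD f x v))) (at x)" if "x : S" for x
  by (rule bounded_linear.has_derivative[OF assms(1) C_k_on_has_derivative[OF Suc.prems that]])
  show "C_k_on k S (%x. h (FD f x v))" for v using Suc by simp
 qed
qed

lemma C_k_on_linear:
 assumes "bounded_linear h" "open S"
 shows "C_k_on k S h" proof (cases k)
 case 0
 thus ?thesis using linear_continuous_on[OF assms(1)] by simp
next
 case (Suc l)
 thus ?thesis using C_k_on_SucI[OF assms(2), of h "%_. h"] bounded_linear_imp_has_derivative[OF assms(1)] by auto
qed

lemma C_k_on_add:
 assumes "open S" "C_k_on k S f" "C_k_on k S g"
 shows "C_k_on k S (%x. f x + g x)" using assms(2,3)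
proof (induction k arbitrary: f g)
 case 0
 thus ?case by (auto intro: continuous_on_add)
next
 case (Suc k)
 show ?case
 proof (rule C_k_on_SucI[OF assms(1)])
  show "((%x. f x + g x) has_derivative (%v. FD f x v + FD g x v)) (at x)"
  if "x : S" for x by (intro has_derivative_add C_k_on_has_derivative[OF Suc.prems(1) that] C_k_on_has_derivative[OF Suc.prems(2) that])
  show "C_k_on k S (%x. FD f x v + FD g x v)" for v using Suc by simp
 qed
qed

text \<open>The derivative of a bilinear product is a sum of two products of the same kind with one
  derivative less to spare, so the induction on the order closes.\<close>

lemma C_k_on_bilinear:
 assumes "bounded_bilinear pr" "open S" "C_k_on k S f" "C_k_on k S g"
 shows "C_k_on k S (%x. pr (f x) (g x))" using assms(3,4)
proof (induction k arbitrary: f g)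
 case 0
 thus ?case using bounded_bilinear.continuous_on[OF assms(1)] by simp
next
 case (Suc k)
 show ?case
 proof (rule C_k_on_SucI[OF assms(2)])
  show "((%x. pr (f x) (g x)) has_derivative
  (%v. pr (f x) (FD g x v) + pr (FD f x v) (g x))) (at x)"
  if "x : S" for x by (rule bounded_bilinear.FDERIV[OF assms(1) C_k_on_has_derivative[OF Suc.prems(1) that] C_k_on_has_derivative[OF Suc.prems(2) that]])
  show "C_k_on k S (%x. pr (f x) (FD g x v) + pr (FD f x v) (g x))" for v
  by (intro C_k_on_add[OF assms(2)] Suc.IH C_k_on_SucD[OF Suc.prems(1)] C_k_on_SucD[OF Suc.prems(2)])
  (use Suc.prems in simp_all)
 qed
qed

lemmas C_k_on_mult = C_k_on_bilinear[OF bounded_bilinear_mult]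
lemma C_k_on_sum: "open S ==> (!!i. i : A ==> C_k_on k S (f i)) ==> C_k_on k S (%x. SUM i:A. f i x)"
 by (induction A rule: infinite_finite_induct) (auto intro: C_k_on_add)

lemma C_k_on_of_real:
 "open S ==> C_k_on k S f ==> C_k_on k S (%x. of_real (f x) :: 'b::{real_normed_algebra_1})" by (rule C_k_on_bounded_linear[OF bounded_linear_of_real])

lemma C_k_on_minus: "open S ==> C_k_on k S f ==> C_k_on k S (%x. - f x)" by (rule C_k_on_bounded_linear[OF bounded_linear_minus[OF bounded_linear_ident]])

lemma C_k_on_diff: "open S ==> C_k_on k S f ==> C_k_on k S g ==> C_k_on k S (%x. f x - g x)"
 using C_k_on_add[of S k f "%x. - g x"] C_k_on_minus[of S k g] by simp

lemma C_k_on_cmult: "open S ==> C_k_on k S f ==> C_k_on k S (%x. c * f x :: 'b::real_normed_algebra)" by (rule C_k_on_mult) auto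

lemma C_k_on_compose_real:
 fixes g :: "real => real"
 assumes "open S" "open T" "f ` S \<subseteq> T" "C_k_on k T g" "C_k_on k S f"
 shows "C_k_on k S (%x. g (f x))" using assms(4,5)
proof (induction k arbitrary: g)
 case 0
 thus ?case using assms(3) by (auto intro: continuous_on_compose2)
next
 case (Suc k)
 let ?g' = "%y. FD g y 1"
 show ?case
 proof (rule C_k_on_SucI[OF assms(1)])
  show "((%x. g (f x)) has_derivative (%v. FD f x v * ?g' (f x))) (at x)"
  if "x : S" for x proof -
  have fx: "f x : T" using that assms(3) by auto
  have g: "(g has_derivative FD g (f x)) (at (f x))" by (rule C_k_on_has_derivative[OF Suc.prems(1) fx])
  have star: "FD g (f x) u = u * ?g' (f x)" for u using linear_scale[OF has_derivative_linear[OF g], of u 1] by simp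
  have "((%x. g (f x)) has_derivative (%v. FD g (f x) (FD f x v))) (at x)" by (rule has_derivative_compose[OF C_k_on_has_derivative[OF Suc.prems(2) that] g])
  moreover have "(%v. FD g (f x) (FD f x v))
  = (%v. FD f x v * ?g' (f x))" by (rule HOL.ext, rule star)
  ultimately show ?thesis by (simp only:)
  qed
  show "C_k_on k S (%x. FD f x v * ?g' (f x))" for v
  proof (rule C_k_on_mult[OF assms(1)])
  show "C_k_on k S (%x. FD f x v)" using Suc.prems(2) by simp
  have "C_k_on k T ?g'" using Suc.prems(1) by simp
  thus "C_k_on k S (%x. ?g' (f x))" by (rule Suc.IH[OF _ C_k_on_SucD[OF Suc.prems(2)]])
  qed
 qed
qed

lemma C_k_on_real_SucI:
 fixes g :: "real => real"
 assumes "open T" "!!x. x : T ==> (g has_real_derivative g' x) (at x)" "C_k_on k T g'"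
 shows "C_k_on (Suc k) T g"
proof (rule C_k_on_SucI[OF assms(1)])
 show "(g has_derivative (%v. v * g' x)) (at x)" if "x : T" for x using assms(2)[OF that] by (simp add: has_field_derivative_def mult_commute_abs)
 show "C_k_on k T (%x. v * g' x)" for v by (rule C_k_on_cmult) (use assms in auto)
qed

lemma C_k_on_Un:
 assumes "open S" "open T" "C_k_on k S f" "C_k_on k T f"
 shows "C_k_on k (S \<union> T) f" using assms(3,4)
proof (induction k arbitrary: f)
 case 0
 thus ?case using assms by (auto intro: continuous_on_open_Un)
qed auto

lemma smooth_on_cong: "open S ==> (!!x. x : S ==> f x = g x) ==> smooth_on S f ==> smooth_on S g" unfolding smooth_on_def using C_k_on_cong by blast

lemma smooth_on_subset: "smooth_on S f ==> T \<subseteq> S ==> smooth_on T f" unfolding smooth_on_def using C_k_on_subset by blast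

lemma smooth_on_const [simp]: "smooth_on S (%x. c)" by (simp add: smooth_on_def)

lemma smooth_on_mult:
 fixes f g :: "'a::real_normed_vector => 'b::real_normed_algebra"
 shows "open S ==> smooth_on S f ==> smooth_on S g ==> smooth_on S (%x. f x * g x)" unfolding smooth_on_def by (blast intro: C_k_on_mult)

lemma smooth_on_cmult:
 fixes f :: "'a::real_normed_vector => 'b::real_normed_algebra"
 shows "open S ==> smooth_on S f ==> smooth_on S (%x. c * f x)" by (rule smooth_on_mult) auto

lemma smooth_on_add: "open S ==> smooth_on S f ==> smooth_on S g ==> smooth_on S (%x. f x + g x)" unfolding smooth_on_def by (blast intro: C_k_on_add)

lemma smooth_on_diff: "open S ==> smooth_on S f ==> smooth_on S g ==> smooth_on S (%x. f x - g x)" unfolding smooth_on_def by (blast intro: C_k_on_diff)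

lemma smooth_on_sum: "open S ==> (!!i. i : A ==> smooth_on S (f i)) ==> smooth_on S (%x. SUM i:A. f i x)" unfolding smooth_on_def by (blast intro: C_k_on_sum)

lemma smooth_on_of_real:
 "open S ==> smooth_on S f ==> smooth_on S (%x. of_real (f x) :: 'b::{real_normed_algebra_1})" unfolding smooth_on_def by (blast intro: C_k_on_of_real)

lemma smooth_on_linear: "bounded_linear h ==> open S ==> smooth_on S h" unfolding smooth_on_def by (blast intro: C_k_on_linear)

lemma smooth_on_compose_real:
 fixes g :: "real => real"
 shows "open S ==> open T ==> f ` S \<subseteq> T ==> smooth_on T g ==> smooth_on S f ==> smooth_on S (%x. g (f x))"
 unfolding smooth_on_def by (blast intro: C_k_on_compose_real)

lemma smooth_on_Un: "open S ==> open T ==> smooth_on S f ==> smooth_on T f ==> smooth_on (S \<union> T) f" unfolding smooth_on_def by (blast intro: C_k_on_Un)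

text \<open>\<open>S\<close> and the complement of \<open>K\<close> are open and cover the space,
  and the function is smooth on both.\<close>

lemma smooth_on_extend_zero:
 assumes "open S" "closed K" "K \<subseteq> S" "smooth_on S f" "!!x. x ~: K ==> f x = 0"
 shows "smooth_on UNIV f" proof -
 have "smooth_on (- K) f" by (rule smooth_on_cong[of _ "%_. 0"]) (use assms in auto)
 hence "smooth_on (S \<union> - K) f" by (intro smooth_on_Un assms) (use assms in auto)
 moreover have "S \<union> - K = UNIV" using assms(3) by auto
 ultimately show ?thesis by simp
qed

lemma smooth_on_frechet: "smooth_on S f ==> smooth_on S (%x. FD f x v)" unfolding smooth_on_def by (metis C_k_on.simps(2))

lemma smooth_on_has_derivative:
 "smooth_on S f ==> x : S ==> (f has_derivative FD f x) (at x)" unfolding smooth_on_def using C_k_on_has_derivative by blast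

lemma smooth_on_continuous: "smooth_on S f ==> continuous_on S f" unfolding smooth_on_def using C_k_on_continuous by blast

lemma smooth_on_realI:
 fixes g :: "real => real"
 assumes "open T" "!!x. x : T ==> (g has_real_derivative g' x) (at x)" "smooth_on T g'"
 shows "smooth_on T g" unfolding smooth_on_def
proof
 fix k
 have "C_k_on (Suc k) T g" using C_k_on_real_SucI[OF assms(1,2)] assms(3) by (auto simp: smooth_on_def)
 thus "C_k_on k T g" by (rule C_k_on_SucD)
qed

lemma smooth_on_powr: "smooth_on {0<..} (%x::real. x powr b)" unfolding smooth_on_def
proof
 fix k show "C_k_on k {0<..} (%x::real. x powr b)"
 proof (induction k arbitrary: b)
  case 0
  thus ?case by (auto intro!: continuous_intros)
 next
  case (Suc k)
  show ?case
  proof (rule C_k_on_real_SucI)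
  show "((%x. x powr b) has_real_derivative b * x powr (b - 1)) (at x)" if "x : {0<..}" for x using that by (auto intro!: derivative_eq_intros)
  show "C_k_on k {0<..} (%x. b * x powr (b - 1))" by (rule C_k_on_cmult) (use Suc in auto)
  qed auto
 qed
qed

section \<open>Flat functions and smooth cutoffs\<close>

definition flat_fun :: "nat => real => real" where
 "flat_fun j x = (if x <= 0 then 0 else exp (- (1 / x)) / x ^ j)"

lemma flat_fun_tendsto: "((%x. exp (- (1 / x)) / x ^ j) \<longlongrightarrow> (0::real)) (at_right 0)" by real_asymp

lemma flat_fun_deriv: "(flat_fun j has_real_derivative flat_fun (j + 2) x - real j * flat_fun (Suc j) x) (at x)" proof (cases "x = 0")
 case True
 have l: "((%y. flat_fun j y / y) \<longlongrightarrow> 0) (at_left 0)"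
  by (rule tendsto_eventually) (auto simp: eventually_at_left_field flat_fun_def intro: exI[of _ "-1"])
 have r: "((%y. flat_fun j y / y) \<longlongrightarrow> 0) (at_right 0)"
 proof (rule Lim_transform_eventually[OF flat_fun_tendsto[of "Suc j"]])
  show "\<forall>\<^sub>F x in at_right 0. exp (- (1 / x)) / x ^ Suc j = flat_fun j x / x"
  by (auto simp: eventually_at_right_field flat_fun_def intro!: exI[of _ 1])
 qed
 have "((%y. flat_fun j y / y) \<longlongrightarrow> 0) (at 0)" using l r by (rule filterlim_split_at)
 thus ?thesis using True by (simp add: has_field_derivative_iff flat_fun_def)
next
 case False
 show ?thesis proof (cases "x < 0")
  case True
  have "((%_. 0) has_real_derivative 0) (at x)" by simp
  hence "(flat_fun j has_real_derivative 0) (at x)"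
  by (rule has_field_derivative_transform_within_open[of _ _ _ "{..<0}"]) (use True in \<open>auto simp: flat_fun_def\<close>)
  thus ?thesis using True by (simp add: flat_fun_def)
 next
  case False
  with \<open>x ~= 0\<close> have x: "x > 0" by simp
  have "((%x. exp (- (1 / x)) / x ^ j) has_real_derivative
  exp (- (1 / x)) / x ^ (j + 2) - real j * (exp (- (1 / x)) / x ^ Suc j)) (at x)" proof (cases j)
  case 0
  thus ?thesis using x by (auto intro!: derivative_eq_intros simp: field_simps power2_eq_square)
  next
  case (Suc i)
  show ?thesis unfolding Suc using x by (auto intro!: derivative_eq_intros simp: divide_simps power2_eq_square) (simp add: algebra_simps, cases i, auto)
  qed
  hence "(flat_fun j has_real_derivative
  exp (- (1 / x)) / x ^ (j + 2) - real j * (exp (- (1 / x)) / x ^ Suc j)) (at x)"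
  by (rule has_field_derivative_transform_within_open[of _ _ _ "{0<..}"]) (use x in \<open>auto simp: flat_fun_def\<close>)
  thus ?thesis using x by (simp add: flat_fun_def)
 qed
qed

text \<open>The family is closed under differentiation up to linear combinations, so the induction
  on the order treats all \<open>j\<close> at once.\<close>

lemma smooth_flat_fun: "smooth_on UNIV (flat_fun j)" unfolding smooth_on_def
proof
 fix k show "C_k_on k UNIV (flat_fun j)"
 proof (induction k arbitrary: j)
  case 0
  thus ?case using flat_fun_deriv DERIV_isCont by (force intro: continuous_at_imp_continuous_on)
 next
  case (Suc k)
  show ?case by (rule C_k_on_real_SucI[OF _ flat_fun_deriv]) (auto intro!: C_k_on_diff C_k_on_cmult Suc)
 qed
qed

lemma smooth_cutoff:
 "EX py::real => real. smooth_on UNIV py & (ALL x<=1. py x = 1) & (ALL x>=2. py x = 0) & (ALL x. 0 <= py x & py x <= 1)" proof -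
 let ?f = "flat_fun 0"
 have f: "?f x >= 0" "?f x > 0 \<longleftrightarrow> x > 0" for x by (auto simp: flat_fun_def)
 \<comment> \<open>One of \<open>2 - x\<close> and \<open>x - 1\<close> is positive, so the
   denominator never vanishes. It is written as a real power to use the smoothness of powers on the
   positive half line.\<close>
 define py where "py x = ?f (2 - x) * (?f (2 - x) + ?f (x - 1)) powr (-1)" for x
 have pos: "?f (2 - x) + ?f (x - 1) > 0" for x using f(1)[of "2 - x"] f(1)[of "x - 1"] f(2)[of "2 - x"] f(2)[of "x - 1"] by (cases "x < 2") auto
 have lin: "smooth_on UNIV (%x::real. a + b * x)" for a b by (intro smooth_on_add smooth_on_cmult smooth_on_linear[OF bounded_linear_ident]) auto
 have s1: "smooth_on UNIV (%x. ?f (2 - x))" using smooth_on_compose_real[OF _ _ _ smooth_flat_fun[of 0] lin[of 2 "-1"]] by simp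
 have s2: "smooth_on UNIV (%x. ?f (x - 1))" using smooth_on_compose_real[OF _ _ _ smooth_flat_fun[of 0] lin[of "-1" 1]] by simp
 have "smooth_on UNIV py" unfolding py_def by (intro smooth_on_mult s1 smooth_on_compose_real[OF _ _ _ smooth_on_powr[of "-1"]] smooth_on_add s2)
  (use pos in auto)
 moreover have "py x = 1" if "x <= 1" for x using that pos[of x] by (simp add: py_def flat_fun_def powr_minus)
 moreover have "py x = 0" if "x >= 2" for x using that by (simp add: py_def flat_fun_def)
 moreover have "0 <= py x & py x <= 1" for x using pos[of x] f(1)[of "2 - x"] f(1)[of "x - 1"] by (auto simp: py_def powr_minus field_simps)
 ultimately show ?thesis by blast
qed

section \<open>The operator \<open>dd\<^sup>c\<close>\<close>

lemma covec_expand: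
 assumes "linear l"
 shows "covec l = (SUM b:Basis. scal (l b) * covec (coord b))" proof -
 have "l v = (SUM b:Basis. l b * coord b v)" for v proof -
  have "l v = l (SUM b:Basis. (v \<bullet> b) *\<^sub>R b)" by (simp add: euclidean_representation)
  also have "... = (SUM b:Basis. (v \<bullet> b) *\<^sub>R l b)" using assms by (simp add: linear_sum linear_scale)
  finally show ?thesis by (simp add: coord_def scaleR_conv_of_real mult.commute)
 qed
 hence "covec l = covec (%v. SUM b:Basis. l b * coord b v)" by (intro arg_cong[of _ _ covec] HOL.ext)
 thus ?thesis by (simp only: covec_sum covec_scale)
qed

text \<open>Expansion along the first factor. It has the shape of the alternating sums in
  \<open>del\<close> and \<open>delbar\<close>, and so identifies d(f E) with df wedge E for a
  constant form E.\<close>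

lemma form_of_covec_times:
 "form_of (covec l * E) vs = (SUM j<length vs. (-1) ^ j * l (vs ! j) * form_of E (drop_nth j vs))"
proof (induction vs arbitrary: E)
 case Nil
 thus ?case by (simp add: form_of_mult wedge_Nil covec.rep_eq)
next
 case (Cons v vs)
 have d: "drop_nth 0 (v # vs) = vs" "drop_nth (Suc j) (v # vs) = v # drop_nth j vs" for j by (simp_all add: drop_nth_def)
 have c: "form_of X (v # us) = form_of (contr v X) us" for X us by (simp add: contr.rep_eq iota_def)
 have "form_of (covec l * E) (v # vs) = form_of (scal (l v) * E - covec l * contr v E) vs" unfolding c contr_mult by simp
 also have "... = l v * form_of E vs - (SUM j<length vs. (-1) ^ j * l (vs ! j) * form_of E (v # drop_nth j vs))" by (simp add: Cons c)
 also have "... = (SUM j<length (v # vs). (-1) ^ j * l ((v # vs) ! j) * form_of E (drop_nth j (v # vs)))"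
  by (simp add: sum.lessThan_Suc_shift d sum_negf del: sum.lessThan_Suc)
 finally show ?case .
qed

text \<open>The terms with \<i> cancel between \<open>del\<close> and \<open>delbar\<close>, leaving
  the real differential.\<close>

lemma ext_d_eq:
 "ext_d F z vs = (SUM j<length vs. (-1) ^ j * FD (%y. F y (drop_nth j vs)) z (vs ! j))"
 unfolding ext_d_def del_def delbar_def Let_def sum.distrib[symmetric] by (rule sum.cong) (auto simp: field_simps)

lemma ext_dc_eq:
 "ext_dc F z vs = (SUM j<length vs. (-1) ^ j * - FD (%y. F y (drop_nth j vs)) z (\<i> *s (vs ! j)))"
 unfolding ext_dc_def del_def delbar_def Let_def sum_subtractf[symmetric] sum_distrib_left by (rule sum.cong) (auto simp: field_simps)

lemma linear_vec_i: "linear (%v::complex^'n. \<i> *s v)" by (rule linearI) (simp_all add: vec_eq_iff algebra_simps)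

text \<open>Fields are written with scalar coefficients and constant forms, so that all derivatives
  fall on the coefficients.\<close>

lemma ext_d_combination:
 assumes "open S" "z : S" "!!y vs. y : S ==> F y vs = (SUM i:I. f i y * form_of (E i) vs)"
  "!!i. i : I ==> f i differentiable (at z)"
 shows "ext_d F z vs = (SUM i:I. form_of (covec (FD (f i) z) * E i) vs)"
  and "ext_dc F z vs = (SUM i:I. form_of (covec (%v. - FD (f i) z (\<i> *s v)) * E i) vs)" proof -
 have D: "FD (%y. F y us) z v = (SUM i:I. FD (f i) z v * form_of (E i) us)" for us v proof -
  have "((%y. SUM i:I. f i y * form_of (E i) us) has_derivative
  (%v. SUM i:I. FD (f i) z v * form_of (E i) us)) (at z)"
  using assms(4) by (intro has_derivative_sum has_derivative_mult_left) (simp add: frechet_derivative_works)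
  hence "((%y. F y us) has_derivative
  (%v. SUM i:I. FD (f i) z v * form_of (E i) us)) (at z)" by (rule has_derivative_transform_within_open[OF _ assms(1,2)]) (simp add: assms(3))
  from frechet_derivative_at[OF this, symmetric] show ?thesis by simp
 qed
 show "ext_d F z vs = (SUM i:I. form_of (covec (FD (f i) z) * E i) vs)"
  unfolding ext_d_eq D form_of_covec_times sum_distrib_left by (subst sum.swap) (simp add: mult.assoc)
 show "ext_dc F z vs = (SUM i:I. form_of (covec (%v. - FD (f i) z (\<i> *s v)) * E i) vs)"
  unfolding ext_dc_eq D form_of_covec_times sum_distrib_left sum_negf[symmetric] by (subst sum.swap) (simp add: mult.assoc)
qed

definition D2 :: "('a::real_normed_vector => 'b::real_normed_vector) => 'a => 'a => 'a => 'b" where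
 "D2 f a b z = FD (%y. FD f y b) z a"

abbreviation xi :: "complex^('n::finite) => 'n ext" where "xi b == covec (coord b)"

text \<open>The two-form dd^c f in real coordinates. The twist by \<i> comes from d^c f(v) = -
  Df(\<i> v), which \<open>d\<close> then differentiates in the direction \<open>a\<close>.\<close>

definition ddc_fun :: "(complex^'n => complex) => complex^'n => ('n::finite) ext" where
 "ddc_fun f z = (SUM a:Basis. SUM b:Basis. scal (- D2 f a (\<i> *s b) z) * (xi a * xi b))"

lemma C2_D:
 assumes "C_k_on 2 S f" "y : S"
 shows "f differentiable (at y)" "(%y. FD f y v) differentiable (at y)"
  "linear (FD f y)" using assms linear_frechet_derivative by (auto simp: numeral_2_eq_2)

lemma ext_dc_combination:
 assumes "open S" "!!y vs. y : S ==> F y vs = (SUM i:I. f i y * form_of (E i) vs)"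
  "!!i. i : I ==> C_k_on 2 S (f i)" "finite I" "y : S"
 shows "ext_dc F y vs = (SUM (i, b):I \<times> Basis. - FD (f i) y (\<i> *s b) * form_of (xi b * E i) vs)" proof -
 have lin: "linear (%v. - FD (f i) y (\<i> *s v))" if "i : I" for i
  using linear_compose[OF linear_vec_i linear_compose[OF C2_D(3)[OF assms(3)[OF that] assms(5)] linear_uminus]] by (simp add: o_def)
 have "ext_dc F y vs = (SUM i:I. form_of (covec (%v. - FD (f i) y (\<i> *s v)) * E i) vs)"
  by (rule ext_d_combination(2)[OF assms(1) \<open>y : S\<close> assms(2)]) (use C2_D(1)[OF assms(3,5)] in auto)
 also have "... = (SUM i:I. SUM b:Basis. - FD (f i) y (\<i> *s b) * form_of (xi b * E i) vs)"
  by (rule sum.cong[OF refl]) (simp only: covec_expand[OF lin] sum_distrib_right form_of_sum mult.assoc form_of_simps)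
 finally show ?thesis by (simp only: sum.cartesian_product)
qed

lemma ddc_combination:
 assumes "open S" "z : S" "!!y vs. y : S ==> F y vs = (SUM i:I. f i y * form_of (E i) vs)"
  "!!i. i : I ==> C_k_on 2 S (f i)" "finite I"
 shows "Ext (ddc F z) = (SUM i:I. ddc_fun (f i) z * E i)" proof -
 let ?g = "%(i, b) y. - FD (f i) y (\<i> *s b)"
 have gd: "?g p differentiable (at z)" if "p : I \<times> Basis" for p
  using that C2_D(2)[OF assms(4) \<open>z : S\<close>] by (auto intro: differentiable_minus)
 have gD: "FD (?g p) z a = - D2 (f (fst p)) a (\<i> *s snd p) z" if "p : I \<times> Basis" for p a proof -
  have "((%y. FD (f (fst p)) y (\<i> *s snd p)) has_derivative
  (%a. D2 (f (fst p)) a (\<i> *s snd p) z)) (at z)" unfolding D2_def using C2_D(2)[OF assms(4) \<open>z : S\<close>, of "fst p" "\<i> *s snd p"] that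
  by (auto simp: frechet_derivative_works)
  from frechet_derivative_at[OF has_derivative_minus[OF this], symmetric] show ?thesis by (simp add: case_prod_beta)
 qed
 have "ddc F z vs = (SUM p:I \<times> Basis. form_of (covec (FD (?g p) z) * (xi (snd p) * E (fst p))) vs)" for vs
  unfolding ddc_def by (rule ext_d_combination(1)[OF assms(1,2)])
  (auto simp: ext_dc_combination[OF assms(1,3,4,5)] case_prod_beta intro!: sum.cong gd[unfolded case_prod_beta])
 hence "Ext (ddc F z) = (SUM p:I \<times> Basis. covec (FD (?g p) z) * (xi (snd p) * E (fst p)))" by (intro form_of_eqI) simp
 also have "... = (SUM p:I \<times> Basis. SUM a:Basis. scal (- D2 (f (fst p)) a (\<i> *s snd p) z) * (xi a * xi (snd p) * E (fst p)))"
 proof (rule sum.cong[OF refl])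
  fix p assume p: "p : I \<times> (Basis :: (complex^'a) set)"
  have "linear (FD (?g p) z)" using gd[OF p] by (rule linear_frechet_derivative)
  from covec_expand[OF this]
  show "covec (FD (?g p) z) * (xi (snd p) * E (fst p)) =
  (SUM a:Basis. scal (- D2 (f (fst p)) a (\<i> *s snd p) z) * (xi a * xi (snd p) * E (fst p)))" by (simp only: sum_distrib_right mult.assoc gD[OF p])
 qed
 also have "... = (SUM i:I. SUM b:Basis. SUM a:Basis. scal (- D2 (f i) a (\<i> *s b) z) * (xi a * xi b * E i))" unfolding sum.cartesian_product' by simp
 also have "... = (SUM i:I. SUM a:Basis. SUM b:Basis. scal (- D2 (f i) a (\<i> *s b) z) * (xi a * xi b * E i))" by (rule sum.cong[OF refl], rule sum.swap)
 also have "... = (SUM i:I. ddc_fun (f i) z * E i)" by (simp add: ddc_fun_def sum_distrib_right mult.assoc)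
 finally show ?thesis .
qed

lemma real_derivative_real:
 fixes f :: "'a::real_normed_vector => complex"
 assumes "open S" "z : S" "!!y. y : S ==> f y : \<real>" "f differentiable (at z)"
 shows "FD f z v : \<real>" proof -
 have "(f has_derivative FD f z) (at z)" using assms(4) by (simp add: frechet_derivative_works)
 hence "((%y. Im (f y)) has_derivative (%v. Im (FD f z v))) (at z)" by (rule has_derivative_Im)
 hence "((%y. 0::real) has_derivative (%v. Im (FD f z v))) (at z)"
  by (rule has_derivative_transform_within_open[OF _ assms(1,2)]) (use assms(3) in \<open>auto simp: complex_is_Real_iff\<close>)
 hence "(%v. Im (FD f z v)) = (%v. 0)" using has_derivative_unique[OF _ has_derivative_const] by blast
 thus ?thesis by (simp add: complex_is_Real_iff fun_eq_iff)
qed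

lemma combination_differentiable:
 assumes "open S" "z : S" "!!y vs. y : S ==> F y vs = (SUM i:I. f i y * form_of (E i) vs)"
  "!!i. i : I ==> f i differentiable (at z)" "finite I"
 shows "(%y. F y vs) differentiable (at z)" by (rule differentiable_cong_open[OF assms(1,2), of "%y. SUM i:I. f i y * form_of (E i) vs"])
  (auto simp: assms(3) intro!: differentiable_sum[OF assms(5)] differentiable_mult assms(4))

text \<open>\<open>d\<close> and \<open>d^c\<close> preserve real forms. Reality is required because
  \<open>top_coeff\<close> is described through real multiples of the volume form.\<close>

lemma ddc_real:
 assumes "open S" "z : S" "!!y vs. y : S ==> F y vs = (SUM i:I. f i y * form_of (E i) vs)"
  "!!i. i : I ==> C_k_on 2 S (f i)" "finite I" "!!y vs. y : S ==> F y vs : \<real>"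
 shows "real_ext (Ext (ddc F z))" proof -
 have d1: "(%y. F y us) differentiable (at y)" if "y : S" for y us
  by (rule combination_differentiable[OF assms(1) that assms(3) _ assms(5)]) (use C2_D(1)[OF assms(4) that] in auto)
 have r1: "ext_dc F y vs : \<real>" if "y : S" for y vs unfolding ext_dc_eq
  by (intro sum_in_Reals Reals_mult Reals_minus Reals_power real_derivative_real[OF assms(1) that _ d1[OF that]])
  (auto simp: assms(6))
 have d2: "(%y. ext_dc F y us) differentiable (at z)" for us
 proof (rule combination_differentiable[OF assms(1,2), where I = "I \<times> Basis" and
  f = "%(i, b) y. - FD (f i) y (\<i> *s b)" and E = "%(i, b). xi b * E i"])
  show "finite (I \<times> (Basis :: (complex^'a) set))" using assms(5) by simp
  show "ext_dc F y vs = (SUM i:I \<times> Basis. (case i of (i, b) => %y. - FD (f i) y (\<i> *s b)) y *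
  form_of (case i of (i, b) => xi b * E i) vs)" if "y : S" for y vs by (simp add: ext_dc_combination[OF assms(1,3,4,5) that] case_prod_beta)
  show "(case p of (i, b) => %y. - FD (f i) y (\<i> *s b)) differentiable at z"
  if "p : I \<times> Basis" for p using that C2_D(2)[OF assms(4) \<open>z : S\<close>] by (auto intro: differentiable_minus)
 qed
 have "ddc F z vs : \<real>" for vs unfolding ddc_def ext_d_eq
  by (intro sum_in_Reals Reals_mult Reals_power real_derivative_real[OF assms(1,2) _ d2]) (auto simp: r1)
 thus ?thesis by (simp add: real_ext_def)
qed

lemma homog_xi: "homog 1 (xi b)" by (rule homog_covec) (rule linear_coord)

lemma homog_ddc_fun: "homog 2 (ddc_fun f z)" unfolding ddc_fun_def by (intro homog_sum homog_scal homog_mult'[OF homog_xi homog_xi]) simp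

section \<open>Quadratic weights\<close>

text \<open>The Riemannian metric of a (1,1)-form; on the diagonal it is twice the Hermitian square
  of the coefficient matrix.\<close>

definition hprod :: "('n::finite) ext => complex^'n => complex^'n => real" where
 "hprod be u v = Re (form_of be [u, \<i> *s v])"

text \<open>The coefficients of the metric are held at their value in \<open>w\<close>. Then
  \<open>q\<close> is exactly quadratic with dd^c q = 2 \<open>be\<close>, and the exact formulas
  below have no lower order terms.\<close>

locale frozen =
 fixes h :: "'n::finite => 'n => complex" and w :: "complex^'n"
 assumes herm: "hermitian h"
begin

abbreviation be where "be == herm_ext h"
abbreviation H where "H == hprod be"

definition q where "q z = H (z - w) (z - w) / 2"
definition dq where "dq z = covec (%v. of_real (H (z - w) v))"
definition dcq where "dcq z = covec (%v. - of_real (H (z - w) (\<i> *s v)))"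
text \<open>This is \<i> times del q wedge delbar q, since \<open>dq\<close> and \<open>dcq\<close>
  are the differentials d q and d^c q. It is of rank one and semipositive.\<close>

definition et where "et z = scal (1 / 2) * (dq z * dcq z)"

lemma form_be: "form_of be [u, v] = of_real (- H u (\<i> *s v))" proof -
 have "real_ext be" using herm by (rule real_ext_herm)
 hence "form_of be [u, v] : \<real>" by (simp add: real_ext_def)
 moreover have "\<i> *s (\<i> *s v) = - v" by (simp add: vec_eq_iff)
 moreover have "form_of be [u, - v] = - form_of be [u, v]" by (simp add: form_of_herm_ext sum_negf algebra_simps sum_subtractf)
 ultimately show ?thesis by (simp add: hprod_def of_real_Re)
qed

lemma H_linear_right: "linear (H u)" and H_linear_left: "linear (%u. H u v)" proof -
 have "form_of be [u, a + b] = form_of be [u, a] + form_of be [u, b]"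
  "form_of be [a + b, u] = form_of be [a, u] + form_of be [b, u]"
  "form_of be [u, r *\<^sub>R a] = of_real r * form_of be [u, a]"
  "form_of be [r *\<^sub>R a, u] = of_real r * form_of be [a, u]" for u a b r unfolding form_of_herm_ext
  by (simp_all add: sum.distrib[symmetric] sum_distrib_left scaleR_conv_of_real[where 'a = complex])
  (intro sum.cong refl, simp add: algebra_simps)+
 moreover have "\<i> *s (a + b) = \<i> *s a + \<i> *s b" "\<i> *s (r *\<^sub>R a) = r *\<^sub>R (\<i> *s a)" for a b :: "complex^'n" and r
  by (simp_all add: vec_eq_iff algebra_simps)
 ultimately show "linear (H u)" "linear (%u. H u v)" by (auto intro!: linearI simp: hprod_def)
qed

lemma H_bilinear: "bilinear H" unfolding bilinear_def using H_linear_right H_linear_left by blast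

lemma H_bounded_bilinear: "bounded_bilinear H" using H_bilinear bilinear_conv_bounded_bilinear by blast

lemma H_i: "H (\<i> *s u) (\<i> *s v) = H u v" unfolding hprod_def form_of_herm_ext by (simp add: algebra_simps)

lemma H_sym: "H u v = H v u" proof -
 have "H u v = Re (form_of be [u, \<i> *s v])" by (simp add: hprod_def)
 also have "form_of be [u, \<i> *s v] = - form_of be [\<i> *s v, u]"
  unfolding form_of_herm_ext sum_negf[symmetric] by (intro sum.cong refl) (simp add: algebra_simps)
 also have "... = of_real (H (\<i> *s v) (\<i> *s u))" unfolding form_be by simp
 finally show ?thesis by (simp add: H_i)
qed

lemma H_i_self: "H u (\<i> *s u) = 0" proof -
 have "H u (\<i> *s u) = H (\<i> *s u) (\<i> *s (\<i> *s u))" by (rule H_i[symmetric])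
 also have "\<i> *s (\<i> *s u) = - u" by (simp add: vec_eq_iff)
 also have "H (\<i> *s u) (- u) = - H (\<i> *s u) u" using linear_neg[OF H_linear_right] by blast
 finally show ?thesis using H_sym[of u "\<i> *s u"] by simp
qed

lemma linear_of_real_H: "linear (%v. of_real (H u v) :: complex)"
 using linear_compose[OF H_linear_right, of "of_real"] by (simp add: o_def bounded_linear.linear bounded_linear_of_real)

lemma linear_of_real_HJ: "linear (%v. - of_real (H u (\<i> *s v)) :: complex)"
 using linear_compose[OF linear_vec_i linear_compose[OF linear_of_real_H[of u] linear_uminus]] by (simp add: o_def)

lemma contr_be: "contr u be = covec (%v. - of_real (H u (\<i> *s v)))"
proof (rule form_of_eqI)
 fix vs
 show "form_of (contr u be) vs = form_of (covec (%v. - of_real (H u (\<i> *s v)))) vs" proof (cases "length vs = 1")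
  case True
  then obtain v where "vs = [v]" by (auto simp: length_Suc_conv)
  thus ?thesis using form_be by (simp add: contr.rep_eq iota_def covec.rep_eq)
 next
  case False
  thus ?thesis by (simp add: contr.rep_eq iota_def covec.rep_eq herm_ext_def form_of_dzz)
 qed
qed

lemma dcq_contr: "dcq z = contr (z - w) be" by (simp add: dcq_def contr_be)

text \<open>Euler's identity: the sum over \<open>a\<close> of \<open>xi a\<close> times the
  contraction with \<open>a\<close> multiplies a form by its degree, here 2.\<close>

lemma euler_covec:
 assumes "linear l" "linear k"
 shows "(SUM a:Basis. xi a * contr a (covec l * covec k)) = scal 2 * (covec l * covec k)" proof -
 have "(SUM a:Basis. xi a * contr a (covec l * covec k)) =
  (SUM a:Basis. scal (l a) * xi a * covec k - scal (k a) * xi a * covec l)"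
 proof (rule sum.cong[OF refl])
  fix a
  have "xi a * contr a (covec l * covec k) = scal (l a) * xi a * covec k - xi a * (covec l * scal (k a))"
  by (simp add: contr_mult right_diff_distrib scal_left_commute[of "xi a"] mult.assoc)
  also have "xi a * (covec l * scal (k a)) = scal (k a) * xi a * covec l" by (simp add: scal_commute[of "covec l"] scal_left_commute[of "xi a"] mult.assoc)
  finally show "xi a * contr a (covec l * covec k) = scal (l a) * xi a * covec k - scal (k a) * xi a * covec l" .
 qed
 also have "... = covec l * covec k - covec k * covec l"
  unfolding sum_subtractf sum_distrib_right[symmetric] covec_expand[OF assms(1), symmetric] covec_expand[OF assms(2), symmetric] ..
 also have "... = scal 2 * (covec l * covec k)" unfolding covec_anticommute[of k l] one_add_one[symmetric] scal_add scal_1 distrib_right by simp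
 finally show ?thesis .
qed

lemma euler_dzz: "(SUM a:Basis. xi a * contr a (dzz j k)) = scal 2 * dzz j k" proof -
 have l: "linear (%v. v $ j)" "linear (%v. cnj (v $ k))" by (auto intro!: linearI)
 show ?thesis using euler_covec[OF l] by (simp add: dzz_def gen_def)
qed

lemma sum_HJ: "(SUM a:Basis. SUM b:Basis. scal (- of_real (H a (\<i> *s b))) * (xi a * xi b)) = scal 2 * be" proof -
 have "(SUM b:Basis. scal (- of_real (H a (\<i> *s b))) * (xi a * xi b)) = xi a * contr a be" for a
  unfolding contr_be covec_expand[OF linear_of_real_HJ] sum_distrib_left by (simp add: scal_left_commute[of "xi a"])
 hence "(SUM a:Basis. SUM b:Basis. scal (- of_real (H a (\<i> *s b))) * (xi a * xi b))
  = (SUM a:Basis. SUM j:UNIV. SUM k:UNIV. scal (\<i> * h j k) * (xi a * contr a (dzz j k)))"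
  by (simp add: herm_ext_def contr_sum sum_distrib_left scal_left_commute[of "xi _"])
 also have "... = (SUM j:UNIV. SUM k:UNIV. SUM a:Basis. scal (\<i> * h j k) * (xi a * contr a (dzz j k)))"
  by (subst sum.swap) (rule sum.cong[OF refl], rule sum.swap)
 also have "... = (SUM j:UNIV. SUM k:UNIV. scal (\<i> * h j k) * (scal 2 * dzz j k))" by (simp only: sum_distrib_left[symmetric] euler_dzz)
 also have "... = scal 2 * be" unfolding herm_ext_def sum_distrib_left scal_mult_assoc by (simp add: mult.commute)
 finally show ?thesis .
qed

lemma sum_dq: "(SUM a:Basis. scal (of_real (H (z - w) a)) * xi a) = dq z" unfolding dq_def covec_expand[OF linear_of_real_H] ..

lemma sum_dcq: "(SUM a:Basis. scal (- of_real (H (z - w) (\<i> *s a))) * xi a) = dcq z" unfolding dcq_def covec_expand[OF linear_of_real_HJ] ..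

text \<open>\<open>dcq\<close> is the contraction of \<open>be\<close> with the Euler field
  \<open>z - w\<close>, so \<open>covec_contr_top\<close> applies with the covector dq, whose value
  on that field is 2q. This is the origin of all the quotients q/n below.\<close>

lemma et_top: "scal (of_nat CARD('n)) * (et z * be ^ (CARD('n) - 1)) = scal (of_real (q z)) * be ^ CARD('n)" proof -
 have "scal (of_nat CARD('n)) * (dq z * dcq z * be ^ (CARD('n) - 1)) = scal (of_real (2 * q z)) * be ^ CARD('n)"
  unfolding scal_of_nat dcq_contr dq_def covec_contr_top[OF homog_herm_ext linear_of_real_H] by (simp add: q_def)
 hence "scal (1/2) * (scal (of_nat CARD('n)) * (dq z * dcq z * be ^ (CARD('n) - 1))) =
  scal (1/2) * (scal (of_real (2 * q z)) * be ^ CARD('n))" by simp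
 thus ?thesis unfolding et_def scal_mult_assoc mult.assoc scal_mult[symmetric] by (simp add: mult.commute)
qed

lemma topc_et: "topc (et z * be ^ (CARD('n) - 1)) = of_real (q z / CARD('n)) * topc (be ^ CARD('n))" proof -
 have "of_nat CARD('n) * topc (et z * be ^ (CARD('n) - 1)) = of_real (q z) * topc (be ^ CARD('n))" using arg_cong[OF et_top, of topc z] by simp
 thus ?thesis by (simp add: field_simps)
qed

lemma et_square: "et z * et z = 0" proof -
 have "dq z * dcq z * (dq z * dcq z) = dq z * (dcq z * dq z) * dcq z" by (simp only: mult.assoc)
 also have "dcq z * dq z = - (dq z * dcq z)" unfolding dq_def dcq_def by (rule covec_anticommute)
 also have "dq z * - (dq z * dcq z) * dcq z = - (dq z * dq z * (dcq z * dcq z))" by (simp only: mult_minus_left mult_minus_right mult.assoc)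
 also have "... = 0" unfolding dq_def covec_square by simp
 finally show ?thesis unfolding et_def by (simp add: mult.assoc scal_left_commute[of _ "1/2"])
qed

lemma homog_et: "homog 2 (et z)" unfolding et_def dq_def dcq_def
 by (intro homog_scal homog_mult'[OF homog_covec homog_covec] linear_of_real_H linear_of_real_HJ) simp

lemma q_derivative: "(q has_derivative (%v. H (z - w) v)) (at z)" proof -
 have "((%z. H (z - w) (z - w)) has_derivative (%v. H (z - w) v + H v (z - w))) (at z)"
  by (rule bounded_bilinear.FDERIV[OF H_bounded_bilinear]) (auto intro!: derivative_eq_intros)
 from has_derivative_mult_right[OF this, of "1/2"] show ?thesis unfolding q_def H_sym[of _ "z - w"] by simp
qed

lemma H_derivative: "((%z. H (z - w) c) has_derivative (%v. H v c)) (at z)"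
 using bounded_linear.has_derivative[OF bounded_bilinear.bounded_linear_left[OF H_bounded_bilinear, of c]
  has_derivative_diff[OF has_derivative_ident has_derivative_const[of w]]] by simp

lemma smooth_H: "smooth_on UNIV (%z. H (z - w) c)" proof -
 have "(%z. H (z - w) c) = (%z. H z c - H w c)" using linear_diff[OF H_linear_left] by blast
 moreover have "smooth_on UNIV (%z. H z c - H w c)"
  by (intro smooth_on_diff smooth_on_const smooth_on_linear bounded_bilinear.bounded_linear_left[OF H_bounded_bilinear]) auto
 ultimately show ?thesis by simp
qed

lemma smooth_q: "smooth_on UNIV q" proof -
 have "C_k_on (Suc k) UNIV q" for k by (rule C_k_on_SucI[OF _ q_derivative]) (use smooth_H in \<open>auto simp: smooth_on_def\<close>)
 thus ?thesis unfolding smooth_on_def using C_k_on_SucD by blast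
qed

lemma D2_comp_q:
 assumes "!!x. (g has_real_derivative g' x) (at x)" "!!x. (g' has_real_derivative g'' x) (at x)"
 shows "FD (%z. complex_of_real (g (q z))) z b = of_real (g' (q z) * H (z - w) b)"
  and "D2 (%z. complex_of_real (g (q z))) a b z = of_real (g'' (q z) * H (z - w) a * H (z - w) b + g' (q z) * H a b)" proof -
 have comp: "((%z. k (q z)) has_derivative (%v. k' (q z) * H (z - w) v)) (at z)"
  if "!!x. (k has_real_derivative k' x) (at x)" for k k' z using has_derivative_compose[OF q_derivative that[unfolded has_field_derivative_def]] by simp
 have 1: "FD (%z. complex_of_real (g (q z))) z = (%b. of_real (g' (q z) * H (z - w) b))" for z
  by (rule frechet_derivative_at[symmetric], rule has_derivative_of_real, rule comp[OF assms(1)])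
 thus "FD (%z. complex_of_real (g (q z))) z b = of_real (g' (q z) * H (z - w) b)" by simp
 have "((%z. complex_of_real (g' (q z) * H (z - w) b)) has_derivative
  (%a. of_real (g' (q z) * H a b + g'' (q z) * H (z - w) a * H (z - w) b))) (at z)"
  by (rule has_derivative_of_real, rule has_derivative_mult[OF comp[OF assms(2)] H_derivative])
 from frechet_derivative_at[OF this, symmetric]
 show "D2 (%z. complex_of_real (g (q z))) a b z = of_real (g'' (q z) * H (z - w) a * H (z - w) b + g' (q z) * H a b)" unfolding D2_def 1 by simp
qed

lemma ddc_fun_comp_q:
 assumes "!!x. (g has_real_derivative g' x) (at x)" "!!x. (g' has_real_derivative g'' x) (at x)"
 shows "ddc_fun (%z. of_real (g (q z))) z = scal (of_real (2 * g' (q z))) * be + scal (of_real (2 * g'' (q z))) * et z" proof -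
 have "scal (- D2 (%z. complex_of_real (g (q z))) a (\<i> *s b) z) * (xi a * xi b) =
  scal (of_real (g' (q z))) * (scal (- of_real (H a (\<i> *s b))) * (xi a * xi b)) +
  scal (of_real (g'' (q z))) * (scal (of_real (H (z - w) a)) * xi a * (scal (- of_real (H (z - w) (\<i> *s b))) * xi b))" for a b proof -
  have "- D2 (%z. complex_of_real (g (q z))) a (\<i> *s b) z = of_real (g' (q z)) * (- of_real (H a (\<i> *s b))) +
  of_real (g'' (q z)) * (of_real (H (z - w) a) * (- of_real (H (z - w) (\<i> *s b))))" unfolding D2_comp_q(2)[OF assms] by simp
  thus ?thesis by (simp only: scal_add scal_mult distrib_right mult.assoc scal_left_commute[of "xi a"])
 qed
 hence "ddc_fun (%z. of_real (g (q z))) z = scal (of_real (g' (q z))) * (scal 2 * be) +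
  scal (of_real (g'' (q z))) * (dq z * dcq z)" unfolding ddc_fun_def sum_HJ[symmetric] sum_dq[symmetric] sum_dcq[symmetric] sum_product
  by (simp only: sum.distrib sum_distrib_left)
 moreover have "dq z * dcq z = scal 2 * et z" by (simp add: et_def scal_mult_assoc)
 ultimately show ?thesis by (simp add: scal_mult_assoc mult.commute)
qed

end

section \<open>dd^c of the rank-one form\<close>

lemma covec_triple_swap: "covec a * covec b * (covec c * X) = - (covec c * covec b * (covec a * X))" proof -
 have "covec a * covec b * (covec c * X) = covec a * (covec b * covec c) * X" by (simp only: mult.assoc)
 also have "... = - (covec a * covec c * covec b * X)" by (simp only: covec_anticommute[of b c] mult.assoc mult_minus_left mult_minus_right)
 also have "... = covec c * (covec a * covec b) * X" by (simp only: covec_anticommute[of a c] mult.assoc mult_minus_left mult_minus_right minus_minus)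
 also have "... = - (covec c * covec b * (covec a * X))" by (simp only: covec_anticommute[of a b] mult.assoc mult_minus_left mult_minus_right)
 finally show ?thesis .
qed

text \<open>Degree-four forms with coefficients indexed by the two derivatives (\<open>a\<close>,
  \<open>b\<close>) and the two covectors of the rank-one form (\<open>c\<close>, \<open>d\<close>).
  Exchanging slots 1 and 3, or 2 and 4, changes the sign, so coefficients symmetric in such a pair
  drop out.\<close>

definition quad_sum :: "(complex^'n => complex^'n => complex^'n => complex^'n => complex) => ('n::finite) ext" where
 "quad_sum K = (SUM a:Basis. SUM b:Basis. SUM c:Basis. SUM d:Basis. scal (K a b c d) * (xi a * xi b * (xi c * xi d)))"

lemma quad_sum_add: "quad_sum (%a b c d. K a b c d + L a b c d) = quad_sum K + quad_sum L" by (simp add: quad_sum_def scal_add distrib_right sum.distrib)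

lemma quad_sum_scal: "quad_sum (%a b c d. r * K a b c d) = scal r * quad_sum K" by (simp add: quad_sum_def scal_mult_assoc sum_distrib_left)

lemma quad_sum_swap13: "quad_sum (%a b c d. K c b a d) = - quad_sum K" proof -
 have "quad_sum (%a b c d. K c b a d) = (SUM a:Basis. SUM c:Basis. SUM b:Basis. SUM d:Basis. scal (K c b a d) * (xi a * xi b * (xi c * xi d)))"
  unfolding quad_sum_def by (rule sum.cong[OF refl], rule sum.swap)
 also have "... = (SUM c:Basis. SUM a:Basis. SUM b:Basis. SUM d:Basis. scal (K c b a d) * (xi a * xi b * (xi c * xi d)))" by (rule sum.swap)
 also have "... = (SUM c:Basis. SUM b:Basis. SUM a:Basis. SUM d:Basis. scal (K c b a d) * (xi a * xi b * (xi c * xi d)))"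
  by (rule sum.cong[OF refl], rule sum.swap)
 also have "... = - quad_sum K" unfolding quad_sum_def sum_negf[symmetric] by (intro sum.cong refl) (subst covec_triple_swap, simp)
 finally show ?thesis .
qed

lemma quad_sum_swap24: "quad_sum (%a b c d. K a d c b) = - quad_sum K" proof -
 have s: "xi a * xi b * (xi c * xi d) = - (xi a * xi d * (xi c * xi b))" for a b c d :: "complex^'a"
  using covec_triple_swap[of "coord b" "coord c" "coord d" 1] by (simp add: mult.assoc)
 have "quad_sum (%a b c d. K a d c b) = (SUM a:Basis. SUM c:Basis. SUM b:Basis. SUM d:Basis. scal (K a d c b) * (xi a * xi b * (xi c * xi d)))"
  unfolding quad_sum_def by (rule sum.cong[OF refl], rule sum.swap)
 also have "... = (SUM a:Basis. SUM c:Basis. SUM d:Basis. SUM b:Basis. scal (K a d c b) * (xi a * xi b * (xi c * xi d)))"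
  by (rule sum.cong[OF refl], rule sum.cong[OF refl], rule sum.swap)
 also have "... = (SUM a:Basis. SUM d:Basis. SUM c:Basis. SUM b:Basis. scal (K a d c b) * (xi a * xi b * (xi c * xi d)))"
  by (rule sum.cong[OF refl], rule sum.swap)
 also have "... = - quad_sum K" unfolding quad_sum_def sum_negf[symmetric] by (intro sum.cong refl) (subst s, simp)
 finally show ?thesis .
qed

lemma ext_self_neg: "a = - a ==> a = (0 :: ('n::finite) ext)"
proof (rule form_of_eqI)
 fix vs assume "a = - a"
 hence "form_of a vs = - form_of a vs" by (metis form_of_simps(4))
 thus "form_of a vs = form_of 0 vs" by simp
qed

lemma quad_sum_sym13: "(!!a b c d. K c b a d = K a b c d) ==> quad_sum K = 0" using quad_sum_swap13[of K] by (intro ext_self_neg) presburger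

lemma quad_sum_sym24: "(!!a b c d. K a d c b = K a b c d) ==> quad_sum K = 0" using quad_sum_swap24[of K] by (intro ext_self_neg) presburger

lemma quad_sum_product:
 "quad_sum (%a b c d. K a b * L c d) =
  (SUM a:Basis. SUM b:Basis. scal (K a b) * (xi a * xi b)) * (SUM c:Basis. SUM d:Basis. scal (L c d) * (xi c * xi d))" proof -
 have "scal (K a b) * (xi a * xi b) * (scal (L c d) * (xi c * xi d)) = scal (K a b * L c d) * (xi a * xi b * (xi c * xi d))" for a b c d
  by (simp only: scal_mult mult.assoc scal_left_commute[of "xi a"] scal_left_commute[of "xi b"])
 thus ?thesis unfolding quad_sum_def sum_distrib_right unfolding sum_distrib_left by simp
qed

context frozen
begin

definition etcoef where "etcoef z c d = - (H (z - w) c * H (z - w) (\<i> *s d)) / 2"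

lemma et_expand: "et z = (SUM c:Basis. SUM d:Basis. scal (of_real (etcoef z c d)) * (xi c * xi d))" proof -
 have "scal (of_real (etcoef z c d)) * (xi c * xi d) =
  scal (1/2) * (scal (of_real (H (z - w) c)) * xi c * (scal (- of_real (H (z - w) (\<i> *s d))) * xi d))" for c d proof -
  have "complex_of_real (etcoef z c d) = 1/2 * (of_real (H (z - w) c) * (- of_real (H (z - w) (\<i> *s d))))" by (simp add: etcoef_def)
  thus ?thesis by (simp only: scal_mult mult.assoc scal_left_commute[of "xi c"])
 qed
 thus ?thesis unfolding et_def sum_dq[symmetric] sum_dcq[symmetric] sum_product by (simp only: sum_distrib_left)
qed

lemma smooth_etcoef: "smooth_on UNIV (%z. etcoef z c d)" proof -
 have "(%z. etcoef z c d) = (%z. - (1/2) * (H (z - w) c * H (z - w) (\<i> *s d)))" by (simp add: etcoef_def)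
 moreover have "smooth_on UNIV ..." by (intro smooth_on_cmult smooth_on_mult smooth_H) auto
 ultimately show ?thesis by simp
qed

lemma D_etcoef_comp:
 assumes "!!x. (B has_real_derivative B' x) (at x)"
 shows "FD (%z. complex_of_real (B (q z) * etcoef z c d)) z b =
  of_real (- 1 / 2 * (B' (q z) * H (z - w) b * H (z - w) c * H (z - w) (\<i> *s d)
  + B (q z) * H b c * H (z - w) (\<i> *s d) + B (q z) * H (z - w) c * H b (\<i> *s d)))" proof -
 let ?mu = "%z. H (z - w) (\<i> *s d)" and ?lam = "%z. H (z - w) c"
 have "((%z. B (q z)) has_derivative (%v. B' (q z) * H (z - w) v)) (at z)"
  using has_derivative_compose[OF q_derivative assms[unfolded has_field_derivative_def]] by simp
 from has_derivative_mult[OF this has_derivative_mult[OF H_derivative[of c] H_derivative[of "\<i> *s d"]]]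
 have "((%z. B (q z) * (?lam z * ?mu z)) has_derivative
  (%v. B (q z) * (?lam z * H v (\<i> *s d) + H v c * ?mu z) + B' (q z) * H (z - w) v * (?lam z * ?mu z))) (at z)" .
 from has_derivative_of_real[OF has_derivative_mult_right[OF this, of "- 1 / 2"], where 'a = complex]
 have "((%z. complex_of_real (B (q z) * etcoef z c d)) has_derivative (%v. of_real (- 1 / 2 * (B (q z) * (?lam z * H v (\<i> *s d) + H v c * ?mu z) + B' (q z) * H (z - w) v * (?lam z * ?mu z))))) (at z)"
  by (rule has_derivative_eq_rhs[OF has_derivative_transform[OF UNIV_I, rotated]]) (auto simp: etcoef_def)
 from frechet_derivative_at[OF this, symmetric] show ?thesis by (simp add: algebra_simps)
qed

lemma D2_etcoef_comp:
 assumes "!!x. (B has_real_derivative B' x) (at x)" "!!x. (B' has_real_derivative B'' x) (at x)"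
 shows "D2 (%z. complex_of_real (B (q z) * etcoef z c d)) a b z =
  of_real (- 1 / 2 * (B'' (q z) * H (z - w) a * H (z - w) b * H (z - w) c * H (z - w) (\<i> *s d)
  + B' (q z) * (H a b * (H (z - w) c * H (z - w) (\<i> *s d)))
  + B' (q z) * (H (z - w) b * H a c * H (z - w) (\<i> *s d))
  + B' (q z) * (H (z - w) b * H (z - w) c * H a (\<i> *s d))
  + B' (q z) * (H (z - w) a * H b c * H (z - w) (\<i> *s d))
  + B (q z) * (H b c * H a (\<i> *s d))
  + B' (q z) * (H (z - w) a * H (z - w) c * H b (\<i> *s d))
  + B (q z) * (H a c * H b (\<i> *s d))))" proof -
 let ?mu = "%z. H (z - w) (\<i> *s d)" and ?lam = "%z. H (z - w) c" and ?b = "%z. H (z - w) b"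
 have B: "((%z. B (q z)) has_derivative (%v. B' (q z) * H (z - w) v)) (at z)"
  using has_derivative_compose[OF q_derivative assms(1)[unfolded has_field_derivative_def]] by simp
 have B': "((%z. B' (q z)) has_derivative (%v. B'' (q z) * H (z - w) v)) (at z)"
  using has_derivative_compose[OF q_derivative assms(2)[unfolded has_field_derivative_def]] by simp
 note d1 = has_derivative_mult[OF has_derivative_mult[OF has_derivative_mult[OF B' H_derivative[of b]] H_derivative[of c]] H_derivative[of "\<i> *s d"]]
 note d2 = has_derivative_mult[OF has_derivative_mult[OF B has_derivative_const[of "H b c"]] H_derivative[of "\<i> *s d"]]
 note d3 = has_derivative_mult[OF has_derivative_mult[OF B H_derivative[of c]] has_derivative_const[of "H b (\<i> *s d)"]]
 from has_derivative_of_real[OF has_derivative_mult_right[OF has_derivative_add[OF has_derivative_add[OF d1 d2] d3], of "- 1 / 2"], where 'a = complex]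
 have "((%z. complex_of_real (- 1 / 2 * (B' (q z) * ?b z * ?lam z * ?mu z + B (q z) * H b c * ?mu z + B (q z) * ?lam z * H b (\<i> *s d)))) has_derivative
  (%a. of_real (- 1 / 2 * (B'' (q z) * H (z - w) a * H (z - w) b * H (z - w) c * H (z - w) (\<i> *s d)
  + B' (q z) * (H a b * (H (z - w) c * H (z - w) (\<i> *s d)))
  + B' (q z) * (H (z - w) b * H a c * H (z - w) (\<i> *s d))
  + B' (q z) * (H (z - w) b * H (z - w) c * H a (\<i> *s d))
  + B' (q z) * (H (z - w) a * H b c * H (z - w) (\<i> *s d))
  + B (q z) * (H b c * H a (\<i> *s d))
  + B' (q z) * (H (z - w) a * H (z - w) c * H b (\<i> *s d))
  + B (q z) * (H a c * H b (\<i> *s d)))))) (at z)"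
  by (rule has_derivative_eq_rhs, intro HOL.ext arg_cong[of _ _ complex_of_real] arg_cong[of _ _ "(*) (- 1 / 2)"])
  (simp add: algebra_simps)
 from frechet_derivative_at[OF this, symmetric] show ?thesis unfolding D2_def D_etcoef_comp[OF assms(1)] by simp
qed

text \<open>Of the eight terms of the second derivative four are symmetric in a pair of slots and
  vanish. \<open>K1\<close> occurs three times with signs +, -, - and \<open>K4\<close> once with
  sign -, which leaves minus one of each. The minus sign is the source of the gain: the rank-one
  form is subtracted from the metric, so its contribution to the operator is positive to leading
  order.\<close>

lemma ddc_fun_etcoef:
 assumes "!!x. (B has_real_derivative B' x) (at x)" "!!x. (B' has_real_derivative B'' x) (at x)"
 shows "(SUM c:Basis. SUM d:Basis. ddc_fun (%z. of_real (B (q z) * etcoef z c d)) z * (xi c * xi d)) =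
  - (scal (of_real (2 * B' (q z))) * (be * et z) + scal (of_real (2 * B (q z))) * (be * be))" proof -
 let ?l = "%a. complex_of_real (H (z - w) a)" and ?m = "%d. complex_of_real (H (z - w) (\<i> *s d))"
 let ?HJ = "%a d. complex_of_real (H a (\<i> *s d))"
 let ?b0 = "complex_of_real (B (q z))" and ?b1 = "complex_of_real (B' (q z))" and ?b2 = "complex_of_real (B'' (q z))"
 define K1 where "K1 = (%a b c d. ?HJ a b * (?l c * ?m d))"
 define K4 where "K4 = (%a b c d. ?HJ a b * ?HJ c d)"
 have coef: "- D2 (%z. complex_of_real (B (q z) * etcoef z c d)) a (\<i> *s b) z =
  1 / 2 * (?b2 * (?l a * ?m b * ?l c * ?m d) + (?b1 * K1 a b c d + (?b1 * (?m b * of_real (H a c) * ?m d)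
  + (?b1 * K1 a d c b + (?b1 * K1 c b a d + (?b0 * K4 c b a d + (?b1 * (?l a * ?l c * of_real (H (\<i> *s b) (\<i> *s d)))
  + ?b0 * (of_real (H a c) * of_real (H (\<i> *s b) (\<i> *s d))))))))))" (is "_ = 1 / 2 * ?S") for a b c d proof -
  have "- D2 (%z. complex_of_real (B (q z) * etcoef z c d)) a (\<i> *s b) z = 1 / 2 *
  of_real (B'' (q z) * H (z - w) a * H (z - w) (\<i> *s b) * H (z - w) c * H (z - w) (\<i> *s d)
  + B' (q z) * (H a (\<i> *s b) * (H (z - w) c * H (z - w) (\<i> *s d)))
  + B' (q z) * (H (z - w) (\<i> *s b) * H a c * H (z - w) (\<i> *s d))
  + B' (q z) * (H (z - w) (\<i> *s b) * H (z - w) c * H a (\<i> *s d))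
  + B' (q z) * (H (z - w) a * H (\<i> *s b) c * H (z - w) (\<i> *s d))
  + B (q z) * (H (\<i> *s b) c * H a (\<i> *s d))
  + B' (q z) * (H (z - w) a * H (z - w) c * H (\<i> *s b) (\<i> *s d))
  + B (q z) * (H a c * H (\<i> *s b) (\<i> *s d)))" (is "_ = 1 / 2 * ?R") unfolding D2_etcoef_comp[OF assms] of_real_mult[of "- 1 / 2"] by simp
  moreover have "?R = ?S" unfolding K1_def K4_def H_sym[of "\<i> *s b" c] by (simp add: algebra_simps)
  ultimately show ?thesis by simp
 qed
 have "(SUM c:Basis. SUM d:Basis. ddc_fun (%z. of_real (B (q z) * etcoef z c d)) z * (xi c * xi d))
  = quad_sum (%a b c d. - D2 (%z. complex_of_real (B (q z) * etcoef z c d)) a (\<i> *s b) z)" proof -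
  let ?T = "%a b c d. scal (- D2 (%z. complex_of_real (B (q z) * etcoef z c d)) a (\<i> *s b) z) * (xi a * xi b * (xi c * xi d))"
  have "(SUM c:Basis. SUM d:Basis. ddc_fun (%z. of_real (B (q z) * etcoef z c d)) z * (xi c * xi d))
  = (SUM c:Basis. SUM d:Basis. SUM a:Basis. SUM b:Basis. ?T a b c d)" by (simp add: ddc_fun_def sum_distrib_right mult.assoc)
  also have "... = (SUM p:Basis \<times> Basis. SUM r:Basis \<times> Basis. ?T (fst r) (snd r) (fst p) (snd p))" unfolding sum.cartesian_product' by simp
  also have "... = (SUM r:Basis \<times> Basis. SUM p:Basis \<times> Basis. ?T (fst r) (snd r) (fst p) (snd p))" by (rule sum.swap)
  also have "... = quad_sum (%a b c d. - D2 (%z. complex_of_real (B (q z) * etcoef z c d)) a (\<i> *s b) z)"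
  unfolding quad_sum_def sum.cartesian_product' by simp
  finally show ?thesis .
 qed
 also have "... = scal (1 / 2) * (scal ?b2 * quad_sum (%a b c d. ?l a * ?m b * ?l c * ?m d) + (scal ?b1 * quad_sum K1
  + (scal ?b1 * quad_sum (%a b c d. ?m b * of_real (H a c) * ?m d)
  + (scal ?b1 * quad_sum (%a b c d. K1 a d c b) + (scal ?b1 * quad_sum (%a b c d. K1 c b a d)
  + (scal ?b0 * quad_sum (%a b c d. K4 c b a d) + (scal ?b1 * quad_sum (%a b c d. ?l a * ?l c * of_real (H (\<i> *s b) (\<i> *s d)))
  + scal ?b0 * quad_sum (%a b c d. of_real (H a c) * of_real (H (\<i> *s b) (\<i> *s d))))))))))" unfolding coef quad_sum_add quad_sum_scal ..
 also have "quad_sum (%a b c d. ?l a * ?m b * ?l c * ?m d) = 0" by (rule quad_sum_sym13) simp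
 also have "quad_sum (%a b c d. ?m b * of_real (H a c) * ?m d) = 0" by (rule quad_sum_sym24) simp
 also have "quad_sum (%a b c d. ?l a * ?l c * of_real (H (\<i> *s b) (\<i> *s d))) = 0" by (rule quad_sum_sym13) simp
 also have "quad_sum (%a b c d. of_real (H a c) * of_real (H (\<i> *s b) (\<i> *s d))) = 0" by (rule quad_sum_sym13) (simp add: H_sym)
 also have "quad_sum (%a b c d. K1 a d c b) = - quad_sum K1" by (rule quad_sum_swap24)
 also have "quad_sum (%a b c d. K1 c b a d) = - quad_sum K1" by (rule quad_sum_swap13)
 also have "quad_sum (%a b c d. K4 c b a d) = - quad_sum K4" by (rule quad_sum_swap13)
 finally have eq: "(SUM c:Basis. SUM d:Basis. ddc_fun (%z. of_real (B (q z) * etcoef z c d)) z * (xi c * xi d))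
  = - (scal (1 / 2) * (scal ?b1 * quad_sum K1) + scal (1 / 2) * (scal ?b0 * quad_sum K4))" by (simp add: distrib_left right_diff_distrib)
 have HJ: "(SUM a:Basis. SUM b:Basis. scal (?HJ a b) * (xi a * xi b)) = - (scal 2 * be)" unfolding sum_HJ[symmetric] by (simp add: scal_minus sum_negf)
 have lm: "(SUM c:Basis. SUM d:Basis. scal (?l c * ?m d) * (xi c * xi d)) = - (scal 2 * et z)" proof -
  have "scal (?l c * ?m d) * (xi c * xi d) = - (scal 2 * (scal (of_real (etcoef z c d)) * (xi c * xi d)))" for c d
  by (simp add: scal_mult_assoc etcoef_def scal_minus)
  thus ?thesis unfolding et_expand sum_distrib_left by (simp add: sum_negf)
 qed
 have "quad_sum K1 = scal 2 * be * (scal 2 * et z)" unfolding K1_def quad_sum_product HJ lm by simp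
 also have "... = scal 4 * (be * et z)" by (simp only: mult.assoc scal_left_commute[of be] scal_mult_assoc) simp
 finally have "scal (1 / 2) * (scal ?b1 * quad_sum K1) = scal (of_real (2 * B' (q z))) * (be * et z)" by (simp add: scal_mult_assoc mult.commute)
 moreover have "quad_sum K4 = scal 2 * be * (scal 2 * be)" unfolding K4_def quad_sum_product HJ by simp
 moreover have "... = scal 4 * (be * be)" by (simp only: mult.assoc scal_left_commute[of be] scal_mult_assoc) simp
 ultimately show ?thesis unfolding eq by (simp add: scal_mult_assoc mult.commute)
qed

end

section \<open>Errors from freezing the coefficients\<close>

lemma D2_mult:
 fixes f g :: "complex^'n => complex"
 assumes "open S" "z : S" "C_k_on 2 S f" "C_k_on 2 S g"
 shows "FD (%z. f z * g z) z b = f z * FD g z b + FD f z b * g z"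
  and "D2 (%z. f z * g z) a b z = D2 f a b z * g z + FD f z b * FD g z a
  + FD f z a * FD g z b + f z * D2 g a b z" proof -
 have hd: "(f has_derivative FD f y) (at y)" "(g has_derivative FD g y) (at y)"
  if "y : S" for y using C2_D(1)[OF assms(3) that] C2_D(1)[OF assms(4) that] by (simp_all add: frechet_derivative_works)
 have 1: "FD (%z. f z * g z) y b = f y * FD g y b + FD f y b * g y"
  if "y : S" for y b using frechet_derivative_at[OF has_derivative_mult[OF hd[OF that]], symmetric] by simp
 from 1[OF assms(2)] show "FD (%z. f z * g z) z b = f z * FD g z b + FD f z b * g z" .
 have hd2: "((%y. FD f y b) has_derivative (%a. D2 f a b z)) (at z)"
  "((%y. FD g y b) has_derivative (%a. D2 g a b z)) (at z)"
  unfolding D2_def using C2_D(2)[OF assms(3,2)] C2_D(2)[OF assms(4,2)] by (simp_all add: frechet_derivative_works)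
 have "D2 (%z. f z * g z) a b z = FD (%y. f y * FD g y b + FD f y b * g y) z a"
  unfolding D2_def by (rule fun_cong[OF frechet_derivative_cong_open[OF assms(1,2)]]) (rule 1)
 also have "... = f z * D2 g a b z + FD f z a * FD g z b
  + (FD f z b * FD g z a + D2 f a b z * g z)" using frechet_derivative_at[OF has_derivative_add[OF has_derivative_mult[OF hd(1)[OF assms(2)] hd2(2)]
  has_derivative_mult[OF hd2(1) hd(2)[OF assms(2)]]], symmetric] by simp
 finally show "D2 (%z. f z * g z) a b z = D2 f a b z * g z + FD f z b * FD g z a
  + FD f z a * FD g z b + f z * D2 g a b z" by simp
qed

text \<open>The directions in which \<open>ddc_fun\<close> differentiates.\<close>

definition dirs :: "(complex^('n::finite)) set" where
 "dirs = Basis \<union> (%b. \<i> *s b) ` Basis"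

lemma finite_dirs: "finite dirs" by (simp add: dirs_def)

lemma norm_i_scale: "norm (\<i> *s v) = norm (v :: complex^'n)" by (simp add: norm_vec_def norm_mult L2_set_def)

lemma norm_dirs: "b : dirs ==> norm b = 1" by (auto simp: dirs_def norm_i_scale)

lemma topc_ddc_fun:
 "topc (ddc_fun f z * E) = (SUM a:Basis. SUM b:Basis. - D2 f a (\<i> *s b) z * topc (xi a * xi b * E))"
 unfolding ddc_fun_def sum_distrib_right topc_sum by (simp only: mult.assoc topc_simps)

definition basis_weight :: "('n::finite) ext => real" where
 "basis_weight E = (SUM a:Basis. SUM b:Basis. cmod (topc (xi a * xi b * E)))"

lemma basis_weight_nonneg: "basis_weight E >= 0" unfolding basis_weight_def by (intro sum_nonneg) auto

text \<open>Product rule, compared with the constant coefficient \<open>p\<close>. The second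
  derivatives of \<open>f\<close> meet \<open>P z - p\<close>, which is of size \<open>r\<close>;
  two cross terms contain first derivatives of \<open>f\<close>, and one term contains
  \<open>f\<close> undifferentiated.\<close>

lemma frozen_error:
 fixes f P :: "complex^'n => complex"
 assumes "open S" "z : S" "C_k_on 2 S f" "C_k_on 2 S P"
  and A2: "!!a b. a : dirs ==> b : dirs ==> cmod (D2 f a b z) <= A2"
  and A1: "!!b. b : dirs ==> cmod (FD f z b) <= A1"
  and A0: "cmod (f z) <= A0"
  and P: "cmod (P z - p) <= L * r" "!!b. b : dirs ==> cmod (FD P z b) <= L"
  "!!a b. a : dirs ==> b : dirs ==> cmod (D2 P a b z) <= L"
 shows "cmod (topc (ddc_fun (%z. f z * P z) z * E) - p * topc (ddc_fun f z * E))
  <= L * (A2 * r + 2 * A1 + A0) * basis_weight E" proof -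
 have b: "cmod (D2 (%z. f z * P z) a b z - p * D2 f a b z) <= L * (A2 * r + 2 * A1 + A0)" if "a : dirs" "b : dirs" for a b proof -
  have "D2 (%z. f z * P z) a b z - p * D2 f a b z = D2 f a b z * (P z - p) + FD f z b * FD P z a
  + FD f z a * FD P z b + f z * D2 P a b z" unfolding D2_mult(2)[OF assms(1-4)] by (simp add: algebra_simps)
  also have "cmod ... <= cmod (D2 f a b z) * cmod (P z - p) + cmod (FD f z b) * cmod (FD P z a)
  + cmod (FD f z a) * cmod (FD P z b) + cmod (f z) * cmod (D2 P a b z)" unfolding norm_mult[symmetric] by (intro norm_triangle_le add_mono order_refl)
  also have "... <= A2 * (L * r) + A1 * L + A1 * L + A0 * L"
  using A2[OF that] A1[OF that(1)] A1[OF that(2)] A0 P(1) P(2)[OF that(1)] P(2)[OF that(2)] P(3)[OF that]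
  by (intro add_mono mult_mono) (auto intro: order_trans[OF norm_ge_zero])
  finally show ?thesis by (simp add: algebra_simps)
 qed
 hence b: "cmod (p * D2 f a b z - D2 (%z. f z * P z) a b z) <= L * (A2 * r + 2 * A1 + A0)" if "a : dirs" "b : dirs" for a b
  using that by (simp add: norm_minus_commute)
 have "topc (ddc_fun (%z. f z * P z) z * E) - p * topc (ddc_fun f z * E) =
  (SUM a:Basis. SUM b:Basis. (p * D2 f a (\<i> *s b) z - D2 (%z. f z * P z) a (\<i> *s b) z) * topc (xi a * xi b * E))"
  unfolding topc_ddc_fun sum_distrib_left sum_subtractf[symmetric] by (simp add: algebra_simps)
 also have "cmod ... <= (SUM a:Basis. SUM b:Basis. L * (A2 * r + 2 * A1 + A0) * cmod (topc (xi a * xi b * E)))"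
  by (intro sum_norm_le) (auto simp: norm_mult intro!: mult_right_mono b[unfolded dirs_def])
 also have "... = L * (A2 * r + 2 * A1 + A0) * basis_weight E" by (simp add: basis_weight_def sum_distrib_left)
 finally show ?thesis .
qed

text \<open>Words of index pairs expand the N-th power of a (1,1)-form: products of matrix entries
  times constant forms. Scalar coefficients with constant forms are what
  \<open>ddc_combination\<close> takes.\<close>

definition pidx :: "nat => ('n \<times> 'n) list set" where "pidx N = {l. length l = N}"

definition pcoef :: "('n => 'n => complex) => ('n \<times> 'n) list => complex" where
 "pcoef h l = prod_list (map (%(j, k). \<i> * h j k) l)"

definition pform :: "('n \<times> 'n) list => ('n::finite) ext" where
 "pform l = prod_list (map (%(j, k). dzz j k) l)"

lemma finite_pidx: "finite (pidx N :: ('n::finite \<times> 'n) list set)"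
 unfolding pidx_def using finite_lists_length_eq[of "UNIV :: ('n \<times> 'n) set" N] by simp

lemma herm_ext_power:
 fixes h :: "'n::finite => 'n => complex"
 shows "herm_ext h ^ N = (SUM l:pidx N. scal (pcoef h l) * pform l)"
proof (induction N)
 case 0
 have "pidx 0 = {[] :: ('n \<times> 'n) list}" by (auto simp: pidx_def)
 thus ?case by (simp add: pcoef_def pform_def)
next
 case (Suc N)
 let ?c = "%(p, l). p # l"
 have im: "pidx (Suc N) = ?c ` (UNIV \<times> pidx N)" by (auto simp: pidx_def length_Suc_conv image_iff)
 have inj: "inj_on ?c (UNIV \<times> pidx N)" by (auto simp: inj_on_def)
 have "(SUM l:pidx (Suc N). scal (pcoef h l) * pform l) = (SUM p:UNIV \<times> pidx N. scal (pcoef h (fst p # snd p)) * pform (fst p # snd p))"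
  unfolding im sum.reindex[OF inj] by (rule sum.cong) auto
 also have "... = (SUM p:UNIV. SUM l:pidx N. (scal (\<i> * h (fst p) (snd p)) * dzz (fst p) (snd p)) * (scal (pcoef h l) * pform l))"
  unfolding sum.cartesian_product' by (intro sum.cong refl)
  (simp only: fst_conv snd_conv pcoef_def pform_def list.map prod_list.Cons case_prod_beta scal_mult mult.assoc scal_left_commute[of "dzz _ _"])
 also have "... = (SUM p:UNIV. scal (\<i> * h (fst p) (snd p)) * dzz (fst p) (snd p)) * herm_ext h ^ N" unfolding sum_product Suc ..
 also have "(SUM p:UNIV. scal (\<i> * h (fst p) (snd p)) * dzz (fst p) (snd p)) = herm_ext h"
  unfolding herm_ext_def UNIV_Times_UNIV[symmetric] sum.cartesian_product' by simp
 finally show ?case by simp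
qed

lemma homog_pform: "l : pidx N ==> homog (2 * N) (pform l)" proof -
 assume l: "l : pidx N"
 have "homog 2 (case p of (j, k) => dzz j k)" for p :: "'a \<times> 'a" by (cases p) (simp add: homog_dzz)
 hence "homog (2 * length (map (%(j, k). dzz j k) l)) (prod_list (map (%(j, k). dzz j k) l))" by (intro homog_prod_list) auto
 thus ?thesis using l by (simp add: pform_def pidx_def)
qed

section \<open>Uniform estimates on compact sets of a chart\<close>

locale chart_form =
 fixes Om :: "(complex^'n::finite) set" and om :: "'n form_field"
 assumes open_Om: "open Om" and metric: "hermitian_metric_on Om om"
begin

definition hw where "hw z = hcoef (om z)"
definition P where "P l z = pcoef (hw z) l"
definition HH where "HH z = hprod (herm_ext (hw z))"

lemma om_pos: "z : Om ==> positive_11_form (om z)" using metric by (simp add: hermitian_metric_on_def)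

lemma Ext_om: "z : Om ==> Ext (om z) = herm_ext (hw z)"
 and hermitian_hw: "z : Om ==> hermitian (hw z)" unfolding hw_def using om_pos real_11_form_herm by (auto simp: positive_11_form_def)

lemma frozen: "w : Om ==> frozen (hw w)" by (simp add: frozen_def hermitian_hw)

lemma HH_pos: "z : Om ==> v ~= 0 ==> HH z v v > 0"
 unfolding HH_def hprod_def Ext_om[symmetric] using om_pos by (simp add: Ext_om[symmetric] positive_11_form_def)

lemma smooth_om: "smooth_on Om (%z. om z vs)" using metric by (simp add: hermitian_metric_on_def smooth_form_on_def)

lemma smooth_hw: "smooth_on Om (%z. hw z j k)" proof -
 have "(%z. hw z j k) = (%z. (1/2) * (om z [axis j 1, axis k \<i>] - \<i> * om z [axis j 1, axis k 1]))" by (simp add: hw_def hcoef_def)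
 moreover have "smooth_on Om ..." by (intro smooth_on_cmult smooth_on_diff smooth_om open_Om)
 ultimately show ?thesis by simp
qed

lemma smooth_P: "smooth_on Om (P l)"
proof (induction l)
 case Nil
 thus ?case by (simp add: P_def[abs_def] pcoef_def)
next
 case (Cons p l)
 have "P (p # l) = (%z. (\<i> * hw z (fst p) (snd p)) * P l z)" by (simp add: P_def[abs_def] pcoef_def case_prod_beta)
 moreover have "smooth_on Om ..." by (intro smooth_on_mult smooth_on_cmult smooth_hw Cons open_Om)
 ultimately show ?case by simp
qed

lemma om_power: "z : Om ==> Ext (om z) ^ N = (SUM l:pidx N. scal (P l z) * pform l)" by (simp add: Ext_om herm_ext_power P_def)

definition vol0 where "vol0 z = Re (topc (Ext (om z) ^ CARD('n)))"

lemma vol0_pos: "z : Om ==> vol0 z > 0" unfolding vol0_def by (rule positive_11_form_top) (rule om_pos)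

lemma real_om: "z : Om ==> real_ext (Ext (om z))" by (simp add: Ext_om real_ext_herm hermitian_hw)

lemma topc_vol0: "z : Om ==> topc (Ext (om z) ^ CARD('n)) = of_real (vol0 z)"
 unfolding vol0_def using topc_real[OF real_ext_power[OF real_om]] by (metis of_real_Re)

lemma vol0_continuous: "continuous_on Om vol0" proof -
 have "continuous_on Om (%z. Re (SUM l:pidx CARD('n). P l z * topc (pform l)))" by (intro continuous_intros smooth_on_continuous smooth_P)
 thus ?thesis by (rule continuous_on_eq) (simp add: vol0_def om_power topc_sum)
qed

end

text \<open>Centres \<open>w\<close> range over \<open>K\<close> and points over its closed
  \<open>d\<close>-neighbourhood. The bound \<open>d <= 1\<close> lets higher powers of the distance
  be dropped.\<close>

locale chart_compact = chart_form Om om for Om :: "(complex^'n::finite) set" and om :: "'n form_field" +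
 fixes K :: "(complex^'n) set" and d :: real
 assumes compact_K: "compact K" and d: "0 < d" "d <= 1"
  and K_d: "!!w z. w : K ==> dist w z <= d ==> z : Om"
begin

definition Kd where "Kd = {z. EX w:K. dist w z <= d}"

lemma KdI: "w : K ==> dist w z <= d ==> z : Kd" by (auto simp: Kd_def)

lemma K_sub: "K \<subseteq> Kd" "Kd \<subseteq> Om" "K \<subseteq> Om" proof -
 show "K \<subseteq> Kd" using d by (auto simp: Kd_def intro!: bexI)
 show "Kd \<subseteq> Om" using K_d by (auto simp: Kd_def)
 with \<open>K \<subseteq> Kd\<close> show "K \<subseteq> Om" by auto
qed

lemma compact_Kd: "compact Kd" proof -
 have "Kd = {x + y | x y. x : K & y : cball 0 d}"
 proof (intro equalityI subsetI)
  fix z assume "z : Kd"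
  then obtain w where "w : K" "dist w z <= d" by (auto simp: Kd_def)
  thus "z : {x + y | x y. x : K & y : cball 0 d}" by (intro CollectI exI[of _ w] exI[of _ "z - w"]) (auto simp: dist_norm norm_minus_commute)
 next
  fix z assume "z : {x + y | x y. x : K & y : cball 0 d}"
  thus "z : Kd" by (auto simp: Kd_def dist_norm intro!: bexI)
 qed
 thus ?thesis by (simp only: compact_sums[OF compact_K compact_cball])
qed

lemma bounded_on_Kd:
 fixes f :: "complex^'n => 'b::real_normed_vector"
 assumes "continuous_on Om f"
 shows "EX B>=0. ALL z:Kd. norm (f z) <= B" proof -
 have "bounded (f ` Kd)" by (rule compact_imp_bounded[OF compact_continuous_image[OF continuous_on_subset[OF assms K_sub(2)] compact_Kd]])
 then obtain B where "ALL x:f ` Kd. norm x <= B" by (auto simp: bounded_iff)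
 thus ?thesis by (intro exI[of _ "max B 0"]) auto
qed

lemma uniform_bound_finite:
 assumes "finite I" "!!i. i : I ==> EX B>=0::real. R i B" "!!i B B'. R i B ==> B <= B' ==> R i B'"
 shows "EX B>=0. ALL i:I. R i B" using assms(1,2)
proof (induction I)
 case (insert i I)
 then obtain B B' where "B >= 0" "ALL i:I. R i B" "B' >= 0" "R i B'" by (metis insertCI)
 moreover have "R j (max B B')" if "j : insert i I" for j using that calculation assms(3)[of j B "max B B'"] assms(3)[of i B' "max B B'"] by auto
 ultimately show ?case by (intro exI[of _ "max B B'"]) auto
qed auto

lemma smooth_bounds:
 fixes f :: "complex^'n => complex"
 assumes "smooth_on Om f"
 shows "EX L>=0. (ALL z:Kd. cmod (f z) <= L & (ALL b:dirs. cmod (FD f z b) <= L)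
  & (ALL a:dirs. ALL b:dirs. cmod (D2 f a b z) <= L))
  & (ALL w:K. ALL z. dist w z <= d --> cmod (f z - f w) <= L * norm (z - w))" proof -
 obtain B0 where B0: "B0 >= 0" "ALL z:Kd. cmod (f z) <= B0" using bounded_on_Kd[OF smooth_on_continuous[OF assms]] by blast
 have "EX B>=0. ALL b:dirs. ALL z:Kd. cmod (FD f z b) <= B" by (rule uniform_bound_finite[OF finite_dirs])
  (use bounded_on_Kd[OF smooth_on_continuous[OF smooth_on_frechet[OF assms]]] in \<open>auto intro: order_trans\<close>)
 then obtain B1 where B1: "B1 >= 0" "!!b z. b : dirs ==> z : Kd ==> cmod (FD f z b) <= B1" by blast
 have "EX B>=0. ALL p:dirs \<times> dirs. ALL z:Kd. cmod (D2 f (fst p) (snd p) z) <= B"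
  by (rule uniform_bound_finite[OF finite_cartesian_product[OF finite_dirs finite_dirs]])
  (use bounded_on_Kd[OF smooth_on_continuous[OF smooth_on_frechet[OF smooth_on_frechet[OF assms]]]] in
  \<open>auto simp: D2_def intro: order_trans\<close>)
 then obtain B2 where B2: "B2 >= 0" "!!a b z. a : dirs ==> b : dirs ==> z : Kd ==> cmod (D2 f a b z) <= B2" by force
 let ?N = "real (card (Basis :: (complex^'n) set))"
 have lip: "cmod (f z - f w) <= B1 * ?N * norm (z - w)" if w: "w : K" and z: "dist w z <= d" for w z
 proof (rule differentiable_bound[of "cball w d" f "%x. FD f x"])
  show "convex (cball w d)" by simp
  show "w : cball w d" "z : cball w d" using z d by auto
  fix x assume x: "x : cball w d"
  hence xK: "x : Kd" using w by (auto simp: Kd_def)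
  hence "x : Om" using K_sub by auto
  hence hd: "(f has_derivative FD f x) (at x)" using smooth_on_has_derivative[OF assms] by blast
  thus "(f has_derivative FD f x) (at x within cball w d)" by (rule has_derivative_at_withinI)
  note lin = has_derivative_linear[OF hd]
  show "onorm (FD f x) <= B1 * ?N"
  proof (rule onorm_bound)
  show "0 <= B1 * ?N" using B1 by simp
  fix v
  have "FD f x v = FD f x (SUM b:Basis. (v \<bullet> b) *\<^sub>R b)" by (simp add: euclidean_representation)
  also have "... = (SUM b:Basis. (v \<bullet> b) *\<^sub>R FD f x b)" using lin by (simp add: linear_sum linear_scale)
  also have "cmod ... <= (SUM b:(Basis :: (complex^'n) set). norm v * B1)"
  proof (intro sum_norm_le)
  fix b :: "complex^'n" assume b: "b : Basis"
  hence "cmod (FD f x b) <= B1" by (intro B1(2)[OF _ xK]) (simp add: dirs_def)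
  with Basis_le_norm[OF b, of v] show "cmod ((v \<bullet> b) *\<^sub>R FD f x b) <= norm v * B1" by (simp add: mult_mono)
  qed
  finally show "norm (FD f x v) <= B1 * ?N * norm v" by (simp add: mult_ac)
  qed
 qed
 define L where "L = B0 + B1 * ?N + B1 + B2"
 have L: "B0 <= L" "B1 <= L" "B2 <= L" "B1 * ?N <= L" "L >= 0" using B0(1) B1(1) B2(1) by (auto simp: L_def)
 show ?thesis
 proof (intro exI[of _ L] conjI ballI allI impI)
  show "cmod (f z - f w) <= L * norm (z - w)" if "w : K" "dist w z <= d" for w z using lip[OF that] L(4) by (meson mult_right_mono norm_ge_zero order_trans)
  fix z assume z: "z : Kd"
  show "cmod (f z) <= L" using B0 z L(1) by force
  show "cmod (FD f z b) <= L" if "b : dirs" for b using B1(2)[OF that z] L(2) by linarith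
  show "cmod (D2 f a b z) <= L" if "a : dirs" "b : dirs" for a b using B2(2)[OF that z] L(3) by linarith
 qed (rule L)
qed

lemma P_bounds:
 "EX L>=0. ALL l:pidx N. (ALL z:Kd. cmod (P l z) <= L & (ALL b:dirs. cmod (FD (P l) z b) <= L)
  & (ALL a:dirs. ALL b:dirs. cmod (D2 (P l) a b z) <= L))
  & (ALL w:K. ALL z. dist w z <= d --> cmod (P l z - P l w) <= L * norm (z - w))"
proof (rule uniform_bound_finite[OF finite_pidx])
 fix l B B'
 assume *: "(ALL z:Kd. cmod (P l z) <= B & (ALL b:dirs. cmod (FD (P l) z b) <= B)
  & (ALL a:dirs. ALL b:dirs. cmod (D2 (P l) a b z) <= B))
  & (ALL w:K. ALL z. dist w z <= d --> cmod (P l z - P l w) <= B * norm (z - w))" and "B <= B'"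
 hence "B * norm (z - w) <= B' * norm (z - w)" for z w :: "complex^'n" by (simp add: mult_right_mono)
 with * \<open>B <= B'\<close> show "(ALL z:Kd. cmod (P l z) <= B' & (ALL b:dirs. cmod (FD (P l) z b) <= B')
  & (ALL a:dirs. ALL b:dirs. cmod (D2 (P l) a b z) <= B'))
  & (ALL w:K. ALL z. dist w z <= d --> cmod (P l z - P l w) <= B' * norm (z - w))" by (meson order_trans)
qed (rule smooth_bounds[OF smooth_P])

lemma HH_eq: "HH z u v = Re (SUM j:UNIV. SUM k:UNIV. \<i> * hw z j k * (u $ j * cnj ((\<i> *s v) $ k) - (\<i> *s v) $ j * cnj (u $ k)))"
 by (simp add: HH_def hprod_def form_of_herm_ext)

lemma HH_diff_bound:
 assumes "!!j k. cmod (hw z j k - g j k) <= B"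
 shows "abs (HH z u v - hprod (herm_ext g) u v) <= 2 * real CARD('n) ^ 2 * B * norm u * norm v" proof -
 have c: "cmod (x $ j) <= norm x" for x :: "complex^'n" and j unfolding norm_vec_def by (rule member_le_L2_set) auto
 have B: "B >= 0" using assms order_trans[OF norm_ge_zero] by blast
 let ?X = "SUM j:UNIV. SUM k:UNIV. \<i> * (hw z j k - g j k) * (u $ j * cnj ((\<i> *s v) $ k) - (\<i> *s v) $ j * cnj (u $ k))"
 have "HH z u v - hprod (herm_ext g) u v = Re ?X" unfolding HH_eq hprod_def form_of_herm_ext minus_complex.simps(1)[symmetric] sum_subtractf[symmetric]
  by (intro arg_cong[of _ _ Re] sum.cong refl) (simp add: algebra_simps)
 hence "abs (HH z u v - hprod (herm_ext g) u v) <= cmod ?X" by (simp only: abs_Re_le_cmod)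
 also have "... <= (SUM j:(UNIV::'n set). SUM k:(UNIV::'n set). B * (2 * norm u * norm v))"
 proof (intro sum_norm_le)
  fix j k
  have "cmod (u $ j * cnj ((\<i> *s v) $ k) - (\<i> *s v) $ j * cnj (u $ k)) <= norm u * norm v + norm v * norm u" proof -
  have "cmod (u $ j) * cmod (v $ k) <= norm u * norm v" "cmod (v $ j) * cmod (u $ k) <= norm v * norm u" by (intro mult_mono c; simp)+
  thus ?thesis by (intro order_trans[OF norm_triangle_ineq4] add_mono) (simp_all add: norm_mult)
  qed
  thus "cmod (\<i> * (hw z j k - g j k) * (u $ j * cnj ((\<i> *s v) $ k) - (\<i> *s v) $ j * cnj (u $ k))) <= B * (2 * norm u * norm v)"
  unfolding norm_mult[of "\<i> * _"] using assms[of j k] B by (intro mult_mono) (auto simp: norm_mult)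
 qed
 finally show ?thesis by (simp add: power2_eq_square mult_ac)
qed

lemma HH_bound: "EX C>=1. ALL z:Kd. ALL u v. abs (HH z u v) <= C * norm u * norm v" proof -
 have "EX B>=0. ALL p:(UNIV::('n\<times>'n) set). ALL z:Kd. cmod (hw z (fst p) (snd p)) <= B"
  by (rule uniform_bound_finite) (use bounded_on_Kd[OF smooth_on_continuous[OF smooth_hw]] in \<open>auto intro: order_trans\<close>)
 then obtain B where B': "B >= 0" "ALL p:(UNIV::('n\<times>'n) set). ALL z:Kd. cmod (hw z (fst p) (snd p)) <= B" by blast
 have B: "B >= 0" "!!j k z. z : Kd ==> cmod (hw z j k) <= B" using B'(1) bspec[OF B'(2) UNIV_I, of "(_, _)"] by auto
 have "abs (HH z u v) <= (2 * real CARD('n) ^ 2 * B + 1) * norm u * norm v" if "z : Kd" for z u v proof -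
  have "abs (HH z u v) <= 2 * real CARD('n) ^ 2 * B * norm u * norm v"
  using HH_diff_bound[of z "%_ _. 0" B u v] B(2)[OF that] by (simp add: herm_ext_def hprod_def)
  also have "... <= (2 * real CARD('n) ^ 2 * B + 1) * norm u * norm v" by (intro mult_right_mono) auto
  finally show ?thesis .
 qed
 thus ?thesis using B(1) by (intro exI[of _ "2 * real CARD('n) ^ 2 * B + 1"]) auto
qed

lemma HH_lipschitz: "EX C>=0. ALL w:K. ALL z. dist w z <= d --> (ALL v. abs (HH z v v - HH w v v) <= C * norm (z - w) * (norm v)^2)" proof -
 have "EX B>=0. ALL p:(UNIV::('n\<times>'n) set). ALL w:K. ALL z. dist w z <= d --> cmod (hw z (fst p) (snd p) - hw w (fst p) (snd p)) <= B * norm (z - w)"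
 proof (rule uniform_bound_finite)
  fix p B B' assume "ALL w:K. ALL z. dist w z <= d --> cmod (hw z (fst p) (snd p) - hw w (fst p) (snd p)) <= B * norm (z - w)" "B <= B'"
  thus "ALL w:K. ALL z. dist w z <= d --> cmod (hw z (fst p) (snd p) - hw w (fst p) (snd p)) <= B' * norm (z - w)"
  by (meson mult_right_mono norm_ge_zero order_trans)
 next
  show "EX B>=0. ALL w:K. ALL z. dist w z <= d --> cmod (hw z (fst p) (snd p) - hw w (fst p) (snd p)) <= B * norm (z - w)" for p :: "'n \<times> 'n"
  using smooth_bounds[OF smooth_hw[of "fst p" "snd p"]] by blast
 qed simp
 then obtain B where B': "B >= 0" "ALL p:(UNIV::('n\<times>'n) set). ALL w:K. ALL z. dist w z <= d --> cmod (hw z (fst p) (snd p) - hw w (fst p) (snd p)) <= B * norm (z - w)"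
  by blast
 have B: "B >= 0" "!!j k w z. w : K ==> dist w z <= d ==> cmod (hw z j k - hw w j k) <= B * norm (z - w)"
  using B'(1) bspec[OF B'(2) UNIV_I, of "(_, _)"] by auto
 have "abs (HH z v v - HH w v v) <= (2 * real CARD('n) ^ 2 * B) * norm (z - w) * (norm v)^2" if "w : K" "dist w z <= d" for w z v
  using HH_diff_bound[of z "hw w" "B * norm (z - w)" v v, folded HH_def] B(2)[OF that] by (simp add: power2_eq_square mult_ac)
 thus ?thesis using B(1) by (intro exI[of _ "2 * real CARD('n) ^ 2 * B"]) auto
qed

text \<open>Minimum over the compact product of \<open>Kd\<close> with the unit sphere, then
  homogeneity.\<close>

lemma HH_coercive: "EX c>0. ALL z:Kd. ALL v. c * (norm v)^2 <= HH z v v" proof (cases "Kd = {}")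
 case True
 thus ?thesis by (intro exI[of _ 1]) auto
next
 case False
 let ?S = "Kd \<times> sphere (0::complex^'n) 1"
 have "axis undefined 1 : sphere (0::complex^'n) 1" by (simp add: norm_axis_1)
 hence ne: "?S ~= {}" using False by blast
 have cont: "continuous_on ?S (%p. HH (fst p) (snd p) (snd p))" unfolding HH_eq vector_smult_component
  by (intro continuous_intros continuous_on_compose2[OF smooth_on_continuous[OF smooth_hw]])
  (use K_sub in \<open>auto intro!: continuous_intros\<close>)
 obtain p where p: "p : ?S" "!!p'. p' : ?S ==> HH (fst p) (snd p) (snd p) <= HH (fst p') (snd p') (snd p')"
  using continuous_attains_inf[OF compact_Times[OF compact_Kd compact_sphere] ne cont] by blast
 let ?c = "HH (fst p) (snd p) (snd p)"
 have c: "?c > 0" using p(1) K_sub by (intro HH_pos) auto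
 have "?c * (norm v)^2 <= HH z v v" if z: "z : Kd" for z v proof (cases "v = 0")
  case True
  interpret f: frozen "hw z" using frozen z K_sub by blast
  have "HH z 0 0 = 0" using linear_0[OF f.H_linear_right] by (simp add: HH_def)
  thus ?thesis using True by simp
 next
  case False
  interpret f: frozen "hw z" using frozen z K_sub by blast
  let ?u = "(1 / norm v) *\<^sub>R v"
  have "?c <= HH z ?u ?u" using p(2)[of "(z, ?u)"] z False by auto
  also have "HH z ?u ?u = HH z v v / (norm v)^2"
  using linear_scale[OF f.H_linear_right, of ?u "1 / norm v" v] linear_scale[OF f.H_linear_left, of "1 / norm v" v v] by (simp add: HH_def power2_eq_square)
  finally show ?thesis using False by (simp add: field_simps)
 qed
 thus ?thesis using c by blast
qed

definition qw where "qw w z = HH w (z - w) (z - w) / 2"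
definition ecoef where "ecoef w z c e = - (HH w (z - w) c * HH w (z - w) (\<i> *s e)) / 2"

lemma frozen_q: "w : Om ==> frozen.q (hw w) w = qw w" using frozen.q_def[OF frozen] by (intro HOL.ext) (simp add: qw_def HH_def)

lemma frozen_etcoef: "w : Om ==> frozen.etcoef (hw w) w = ecoef w" using frozen.etcoef_def[OF frozen] by (intro HOL.ext) (simp add: ecoef_def HH_def)

lemma vol0_frozen: "w : Om ==> topc (herm_ext (hw w) ^ CARD('n)) = of_real (vol0 w)" using topc_vol0 Ext_om by metis

lemma smooth_qw: "w : Om ==> smooth_on UNIV (qw w)" using frozen.smooth_q[OF frozen, of w w] frozen_q by simp

lemma smooth_ecoef: "w : Om ==> smooth_on UNIV (%z. ecoef w z c e)" using frozen.smooth_etcoef[OF frozen, of w w c e] frozen_etcoef by simp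

text \<open>The coefficient of dd^c(tt omega^(n-1)), with omega^(n-1) expanded into constant forms.
  As omega is not closed, this operator also has terms of order one and zero.\<close>

definition Lop :: "(complex^'n => real) => complex^'n => complex" where
 "Lop tt z = (SUM l:pidx (CARD('n) - 1). topc (ddc_fun (%z. of_real (tt z) * P l z) z * pform l))"

text \<open>The coefficient of dd^c(beta wedge omega^(n-2)) for the two-form beta with coefficients
  \<open>py c e\<close>; it will be applied to multiples of the rank-one form.\<close>

definition Mop :: "(complex^'n => complex^'n => complex^'n => real) => complex^'n => complex" where
 "Mop py z = (SUM c:Basis. SUM e:Basis. SUM l:pidx (CARD('n) - 2).
  topc (ddc_fun (%z. of_real (py c e z) * P l z) z * (xi c * xi e * pform l)))"

lemma C2_comp_qw:
 assumes "w : Om" "smooth_on UNIV g"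
 shows "C_k_on 2 S (%z. complex_of_real (g (qw w z)))" proof -
 have "smooth_on UNIV (%z. complex_of_real (g (qw w z)))" by (intro smooth_on_of_real smooth_on_compose_real[OF _ _ _ assms(2) smooth_qw[OF assms(1)]]) auto
 hence "C_k_on 2 UNIV (%z. complex_of_real (g (qw w z)))" unfolding smooth_on_def by blast
 thus ?thesis by (rule C_k_on_subset) simp
qed

lemma C2_comp_ecoef:
 assumes "w : Om" "smooth_on UNIV g"
 shows "C_k_on 2 S (%z. complex_of_real (g (qw w z) * ecoef w z c e))" proof -
 have "smooth_on UNIV (%z. complex_of_real (g (qw w z) * ecoef w z c e))"
  by (intro smooth_on_of_real smooth_on_mult smooth_ecoef smooth_on_compose_real[OF _ _ _ assms(2) smooth_qw[OF assms(1)]] assms(1)) auto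
 hence "C_k_on 2 UNIV (%z. complex_of_real (g (qw w z) * ecoef w z c e))" unfolding smooth_on_def by blast
 thus ?thesis by (rule C_k_on_subset) simp
qed

text \<open>At frozen coefficients dd^c g(q) = 2 g' \<open>be\<close> + 2 g'' \<open>et\<close>, and
  the trace of \<open>et\<close> is q/n. The remainder has a factor \<open>norm (z - w)\<close> on
  the leading derivatives and an \<open>abs g\<close> from second derivatives of omega.
  \<open>C\<close> does not depend on \<open>g\<close>, since the test functions used later vary
  with the scale.\<close>

lemma Lop_estimate:
 "EX C>=0. ALL w:K. ALL z. dist w z <= d --> (ALL g g' g''. smooth_on UNIV g -->
  (ALL x. (g has_real_derivative g' x) (at x)) --> (ALL x. (g' has_real_derivative g'' x) (at x)) -->
  abs (Re (Lop (%z. g (qw w z)) z) - 2 * vol0 w * (g' (qw w z) + g'' (qw w z) * qw w z / CARD('n)))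
  <= C * (norm (z - w) * (abs (g' (qw w z)) + (norm (z - w))^2 * abs (g'' (qw w z))) + abs (g (qw w z))))" proof -
 obtain CH where CH: "CH >= 1" "!!z u v. z : Kd ==> abs (HH z u v) <= CH * norm u * norm v" using HH_bound by blast
 let ?I = "pidx (CARD('n) - 1) :: ('n \<times> 'n) list set"
 obtain L where L: "L >= 0" "!!l z b. l : ?I ==> z : Kd ==> b : dirs ==> cmod (FD (P l) z b) <= L"
  "!!l z a b. l : ?I ==> z : Kd ==> a : dirs ==> b : dirs ==> cmod (D2 (P l) a b z) <= L"
  "!!l w z. l : ?I ==> w : K ==> dist w z <= d ==> cmod (P l z - P l w) <= L * norm (z - w)" using P_bounds[of "CARD('n) - 1"] by blast
 let ?W = "SUM l:?I. basis_weight (pform l :: 'n ext)"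
 \<comment> \<open>The 3 counts the terms with \<open>g'\<close> and one factor of the distance: one
   from the second derivative of \<open>g\<close>(q) and two cross terms.\<close>
 define C where "C = L * (3 * CH^2) * ?W"
 have W: "?W >= 0" by (intro sum_nonneg basis_weight_nonneg)
 have "abs (Re (Lop (%z. g (qw w z)) z) - 2 * vol0 w * (g' (qw w z) + g'' (qw w z) * qw w z / CARD('n)))
  <= C * (norm (z - w) * (abs (g' (qw w z)) + (norm (z - w))^2 * abs (g'' (qw w z))) + abs (g (qw w z)))"
  if w: "w : K" and z: "dist w z <= d" and g: "smooth_on UNIV g"
  and g': "!!x. (g has_real_derivative g' x) (at x)" and g'': "!!x. (g' has_real_derivative g'' x) (at x)" for w z g g' g'' proof -
  have wOm: "w : Om" using w K_sub by auto
  interpret f: frozen "hw w" w by (rule frozen[OF wOm])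
  note fq = frozen_q[OF wOm]
  have zK: "z : Kd" using w z by (rule KdI)
  have wK: "w : Kd" using w K_sub by auto
  define Y where "Y = norm (z - w)"
  have Y: "0 <= Y" "Y <= 1" using z d by (auto simp: Y_def dist_norm norm_minus_commute)
  let ?f = "%z. complex_of_real (g (qw w z))" and ?x = "qw w z"
  have Hy: "abs (HH w (z - w) b) <= CH * Y" if "b : dirs" for b using CH(2)[OF wK, of "z - w" b] norm_dirs[OF that] by (simp add: Y_def)
  have Hab: "abs (HH w a b) <= CH" if "a : dirs" "b : dirs" for a b using CH(2)[OF wK, of a b] norm_dirs[OF that(1)] norm_dirs[OF that(2)] by simp
  have CH0: "CH >= 0" using CH(1) by simp
  have e: "cmod (topc (ddc_fun (%z. ?f z * P l z) z * pform l) - P l w * topc (ddc_fun ?f z * pform l))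
  <= L * ((abs (g'' ?x) * (CH * Y) * (CH * Y) + abs (g' ?x) * CH) * Y + 2 * (abs (g' ?x) * (CH * Y)) + abs (g ?x)) * basis_weight (pform l)"
  if l: "l : ?I" for l
  proof (rule frozen_error[OF open_Om])
  show "z : Om" using zK K_sub by auto
  show "C_k_on 2 Om ?f" by (rule C2_comp_qw[OF wOm g])
  show "C_k_on 2 Om (P l)" using smooth_P by (simp add: smooth_on_def)
  show "cmod (D2 ?f a b z) <= abs (g'' ?x) * (CH * Y) * (CH * Y) + abs (g' ?x) * CH" if "a : dirs" "b : dirs" for a b
  unfolding f.D2_comp_q(2)[of g g' g'', OF g' g'', unfolded fq, folded HH_def] norm_of_real
  by (rule order_trans[OF abs_triangle_ineq]) (auto simp: abs_mult intro!: add_mono mult_mono mult_nonneg_nonneg Hy Hab that CH0 Y)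
  show "cmod (FD ?f z b) <= abs (g' ?x) * (CH * Y)" if "b : dirs" for b
  unfolding f.D2_comp_q(1)[of g g' g'', OF g' g'', unfolded fq, folded HH_def] norm_of_real by (auto simp: abs_mult intro!: mult_mono Hy that)
  show "cmod (?f z) <= abs (g ?x)" by simp
  show "cmod (P l z - P l w) <= L * Y" using L(4)[OF l w z] by (simp add: Y_def)
  qed (use L(2,3)[OF l zK] in auto)
  have main: "(SUM l:?I. P l w * topc (ddc_fun ?f z * pform l)) = of_real (2 * vol0 w * (g' ?x + g'' ?x * ?x / CARD('n)))" proof -
  have "(SUM l:?I. P l w * topc (ddc_fun ?f z * pform l)) = topc (ddc_fun ?f z * (SUM l:?I. scal (P l w) * pform l))"
  unfolding sum_distrib_left topc_sum by (simp add: scal_left_commute[of "ddc_fun _ _"])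
  also have "... = topc (ddc_fun ?f z * herm_ext (hw w) ^ (CARD('n) - 1))" by (simp add: herm_ext_power P_def)
  also have "... = of_real (2 * g' ?x) * topc (herm_ext (hw w) * herm_ext (hw w) ^ (CARD('n) - 1)) +
  of_real (2 * g'' ?x) * topc (f.et z * herm_ext (hw w) ^ (CARD('n) - 1))"
  unfolding f.ddc_fun_comp_q[of g g' g'', OF g' g'', unfolded fq] distrib_right mult.assoc by simp
  also have "herm_ext (hw w) * herm_ext (hw w) ^ (CARD('n) - 1) = herm_ext (hw w) ^ CARD('n)" by (metis One_nat_def Suc_pred power_Suc zero_less_card_finite)
  finally show ?thesis unfolding f.topc_et vol0_frozen[OF wOm] fq by (simp add: algebra_simps)
  qed
  have "abs (Re (Lop (%z. g (qw w z)) z) - 2 * vol0 w * (g' ?x + g'' ?x * ?x / CARD('n)))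
  = abs (Re (Lop (%z. g (qw w z)) z - of_real (2 * vol0 w * (g' ?x + g'' ?x * ?x / CARD('n)))))" by simp
  also have "... <= cmod (Lop (%z. g (qw w z)) z - of_real (2 * vol0 w * (g' ?x + g'' ?x * ?x / CARD('n))))" by (rule abs_Re_le_cmod)
  also have "... = cmod (SUM l:?I. topc (ddc_fun (%z. ?f z * P l z) z * pform l) - P l w * topc (ddc_fun ?f z * pform l))"
  unfolding main[symmetric] Lop_def sum_subtractf ..
  also have "... <= (SUM l:?I. L * ((abs (g'' ?x) * (CH * Y) * (CH * Y) + abs (g' ?x) * CH) * Y + 2 * (abs (g' ?x) * (CH * Y)) + abs (g ?x)) * basis_weight (pform l :: 'n ext))"
  by (intro sum_norm_le e)
  also have "... = L * ((abs (g'' ?x) * (CH * Y) * (CH * Y) + abs (g' ?x) * CH) * Y + 2 * (abs (g' ?x) * (CH * Y)) + abs (g ?x)) * ?W"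
  by (simp add: sum_distrib_left)
  also have "... <= L * (3 * CH^2 * (Y * (abs (g' ?x) + Y^2 * abs (g'' ?x)) + abs (g ?x))) * ?W"
  proof (intro mult_right_mono[OF _ W] mult_left_mono[OF _ L(1)])
  have c1: "CH <= CH^2" "1 <= CH^2" using CH(1) by (auto simp: power2_eq_square mult_ge1_I)
  have "abs (g' ?x) * CH * Y <= CH^2 * (Y * abs (g' ?x))" using mult_right_mono[OF c1(1), of "Y * abs (g' ?x)"] Y by (simp add: mult_ac)
  moreover have "abs (g ?x) <= CH^2 * abs (g ?x)" using c1 mult_right_mono[OF c1(2), of "abs (g ?x)"] by simp
  moreover have "abs (g'' ?x) * (CH * Y) * (CH * Y) * Y = CH^2 * (Y * (Y^2 * abs (g'' ?x)))" by (simp add: power2_eq_square)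
  moreover have "CH^2 * (Y * (Y^2 * abs (g'' ?x))) >= 0" "CH^2 * abs (g ?x) >= 0" using Y by auto
  moreover have "(abs (g'' ?x) * (CH * Y) * (CH * Y) + abs (g' ?x) * CH) * Y + 2 * (abs (g' ?x) * (CH * Y)) + abs (g ?x)
  = abs (g'' ?x) * (CH * Y) * (CH * Y) * Y + 3 * (abs (g' ?x) * CH * Y) + abs (g ?x)" by (simp add: distrib_right)
  moreover have "3 * CH^2 * (Y * (abs (g' ?x) + Y^2 * abs (g'' ?x)) + abs (g ?x)) =
  3 * (CH^2 * (Y * abs (g' ?x))) + 3 * (CH^2 * (Y * (Y^2 * abs (g'' ?x)))) + 3 * (CH^2 * abs (g ?x))" by (simp only: distrib_left mult.assoc)
  ultimately show "(abs (g'' ?x) * (CH * Y) * (CH * Y) + abs (g' ?x) * CH) * Y + 2 * (abs (g' ?x) * (CH * Y)) + abs (g ?x)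
  <= 3 * CH^2 * (Y * (abs (g' ?x) + Y^2 * abs (g'' ?x)) + abs (g ?x))" by linarith
  qed
  finally show ?thesis by (simp add: C_def Y_def mult_ac)
 qed
 moreover have "C >= 0" using L(1) W by (simp add: C_def)
 ultimately show ?thesis by blast
qed

text \<open>The principal part is \<open>ddc_fun_etcoef\<close> wedged with omega^(n-2), hence the
  sign in the statement. The coefficients \<open>ecoef\<close> are quadratic in
  \<open>z - w\<close>, so each further derivative of \<open>g\<close> comes with two more powers of
  the distance.\<close>

lemma Mop_estimate:
 assumes n2: "CARD('n) >= 2"
 shows "EX C>=0. ALL w:K. ALL z. dist w z <= d --> (ALL g g' g''. smooth_on UNIV g -->
  (ALL x. (g has_real_derivative g' x) (at x)) --> (ALL x. (g' has_real_derivative g'' x) (at x)) -->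
  abs (Re (Mop (%c e z. g (qw w z) * ecoef w z c e) z) + 2 * vol0 w * (g (qw w z) + g' (qw w z) * qw w z / CARD('n)))
  <= C * (norm (z - w) * (abs (g (qw w z)) + (norm (z - w))^2 * abs (g' (qw w z)) + (norm (z - w)) ^ 4 * abs (g'' (qw w z)))))" proof -
 obtain CH where CH: "CH >= 1" "!!z u v. z : Kd ==> abs (HH z u v) <= CH * norm u * norm v" using HH_bound by blast
 let ?I = "pidx (CARD('n) - 2) :: ('n \<times> 'n) list set"
 obtain L where L: "L >= 0" "!!l z b. l : ?I ==> z : Kd ==> b : dirs ==> cmod (FD (P l) z b) <= L"
  "!!l z a b. l : ?I ==> z : Kd ==> a : dirs ==> b : dirs ==> cmod (D2 (P l) a b z) <= L"
  "!!l w z. l : ?I ==> w : K ==> dist w z <= d ==> cmod (P l z - P l w) <= L * norm (z - w)" using P_bounds[of "CARD('n) - 2"] by blast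
 let ?W = "SUM c:Basis. SUM e:Basis. SUM l:?I. basis_weight (xi c * xi e * pform l :: 'n ext)"
 \<comment> \<open>The numerical coefficients of the error terms add up to at most 7/2 for each of
   \<open>g\<close>, \<open>g'\<close> and \<open>g''\<close>.\<close>
 define C where "C = L * (4 * CH ^ 4) * ?W"
 have W: "?W >= 0" by (intro sum_nonneg basis_weight_nonneg)
 have CH0: "CH >= 0" using CH(1) by simp
 have "abs (Re (Mop (%c e z. g (qw w z) * ecoef w z c e) z) + 2 * vol0 w * (g (qw w z) + g' (qw w z) * qw w z / CARD('n)))
  <= C * (norm (z - w) * (abs (g (qw w z)) + (norm (z - w))^2 * abs (g' (qw w z)) + (norm (z - w)) ^ 4 * abs (g'' (qw w z))))"
  if w: "w : K" and z: "dist w z <= d" and g: "smooth_on UNIV g"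
  and g': "!!x. (g has_real_derivative g' x) (at x)" and g'': "!!x. (g' has_real_derivative g'' x) (at x)" for w z g g' g'' proof -
  have wOm: "w : Om" using w K_sub by auto
  interpret f: frozen "hw w" w by (rule frozen[OF wOm])
  note fq = frozen_q[OF wOm] frozen_etcoef[OF wOm]
  have zK: "z : Kd" using w z by (rule KdI)
  have wK: "w : Kd" using w K_sub by auto
  define Y where "Y = norm (z - w)"
  have Y: "0 <= Y" "Y <= 1" using z d by (auto simp: Y_def dist_norm norm_minus_commute)
  let ?f = "%c e z. complex_of_real (g (qw w z) * ecoef w z c e)" and ?x = "qw w z"
  have Hy: "abs (HH w (z - w) b) <= CH * Y" if "norm b = 1" for b using CH(2)[OF wK, of "z - w" b] that by (simp add: Y_def)
  have Hab: "abs (HH w a b) <= CH" if "norm a = 1" "norm b = 1" for a b using CH(2)[OF wK, of a b] that by simp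
  have CHY: "0 <= CH * Y" "CH * Y <= CH" using CH0 Y mult_left_mono[of Y 1 CH] by auto
  have nb: "norm b = 1" "norm (\<i> *s b) = 1" if "b : Basis" for b :: "complex^'n" using that by (auto simp: norm_i_scale)
  have t3: "abs (r * a * b * c) <= abs r * A * B * D" if "abs a <= A" "abs b <= B" "abs c <= D" for r a b c A B D :: real
  using that unfolding abs_mult by (intro mult_mono) auto
  have t8: "abs (- 1 / 2 * (x1 + x2 + x3 + x4 + x5 + x6 + x7 + x8)) <= 1 / 2 * (A + 5 * B + 2 * D)"
  if "abs x1 <= A" "abs x2 <= B" "abs x3 <= B" "abs x4 <= B" "abs x5 <= B" "abs x6 <= D" "abs x7 <= B" "abs x8 <= D"
  for x1 x2 x3 x4 x5 x6 x7 x8 A B D :: real proof -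
  have "abs (x1 + x2 + x3 + x4 + x5 + x6 + x7 + x8) <= A + B + B + B + B + D + B + D" by (intro order_trans[OF abs_triangle_ineq] add_mono that)
  also have "... = A + 5 * B + 2 * D" by simp
  finally show ?thesis unfolding abs_mult by simp
  qed
  have s3: "abs (- 1 / 2 * (x1 + x2 + x3)) <= 1 / 2 * (A + 2 * B)"
  if "abs x1 <= A" "abs x2 <= B" "abs x3 <= B" for x1 x2 x3 A B :: real proof -
  have "abs (x1 + x2 + x3) <= A + B + B" by (intro order_trans[OF abs_triangle_ineq] add_mono that)
  thus ?thesis unfolding abs_mult by simp
  qed
  let ?A2 = "1 / 2 * (abs (g'' ?x) * (CH * Y) ^ 4 + 5 * (abs (g' ?x) * CH * (CH * Y) * (CH * Y)) + 2 * (abs (g ?x) * CH * CH))"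
  let ?A1 = "1 / 2 * (abs (g' ?x) * (CH * Y) * (CH * Y) * (CH * Y) + 2 * (abs (g ?x) * CH * (CH * Y)))"
  let ?A0 = "1 / 2 * (abs (g ?x) * (CH * Y) * (CH * Y))"
  have e: "cmod (topc (ddc_fun (%z. ?f c e z * P l z) z * (xi c * xi e * pform l)) - P l w * topc (ddc_fun (?f c e) z * (xi c * xi e * pform l)))
  <= L * (?A2 * Y + 2 * ?A1 + ?A0) * basis_weight (xi c * xi e * pform l)"
  if l: "l : ?I" and c: "c : Basis" and e: "e : Basis" for l c e
  proof (rule frozen_error[OF open_Om])
  show "z : Om" using zK K_sub by auto
  show "C_k_on 2 Om (?f c e)" by (rule C2_comp_ecoef[OF wOm g])
  show "C_k_on 2 Om (P l)" using smooth_P by (simp add: smooth_on_def)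
  show "cmod (D2 (?f c e) a b z) <= ?A2" if "a : dirs" "b : dirs" for a b proof -
  note n = norm_dirs[OF that(1)] norm_dirs[OF that(2)] nb[OF c] nb[OF e]
  let ?l = "%v. HH w (z - w) v" and ?m = "HH w (z - w) (\<i> *s e)"
  have 1: "abs (g'' ?x * ?l a * ?l b * ?l c * ?m) <= abs (g'' ?x) * (CH * Y) ^ 4" proof -
  have "abs (g'' ?x * ?l a * ?l b * ?l c * ?m) <= abs (g'' ?x) * (CH * Y) * (CH * Y) * (CH * Y) * (CH * Y)"
  unfolding abs_mult by (intro mult_mono Hy n mult_nonneg_nonneg CHY abs_ge_zero order_refl)
  thus ?thesis by (simp add: power4_eq_xxxx mult_ac)
  qed
  have 2: "abs (g' ?x * (HH w a b * (?l c * ?m))) <= abs (g' ?x) * CH * (CH * Y) * (CH * Y)"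
  using t3[OF Hab[of a b] Hy[of c] Hy[of "\<i> *s e"], of "g' ?x"] n by (simp add: mult_ac)
  have 3: "abs (g' ?x * (?l b * HH w a c * ?m)) <= abs (g' ?x) * CH * (CH * Y) * (CH * Y)"
  using t3[OF Hab[of a c] Hy[of b] Hy[of "\<i> *s e"], of "g' ?x"] n by (simp add: mult_ac)
  have 4: "abs (g' ?x * (?l b * ?l c * HH w a (\<i> *s e))) <= abs (g' ?x) * CH * (CH * Y) * (CH * Y)"
  using t3[OF Hab[of a "\<i> *s e"] Hy[of b] Hy[of c], of "g' ?x"] n by (simp add: mult_ac)
  have 5: "abs (g' ?x * (?l a * HH w b c * ?m)) <= abs (g' ?x) * CH * (CH * Y) * (CH * Y)"
  using t3[OF Hab[of b c] Hy[of a] Hy[of "\<i> *s e"], of "g' ?x"] n by (simp add: mult_ac)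
  have 6: "abs (g ?x * (HH w b c * HH w a (\<i> *s e))) <= abs (g ?x) * CH * CH"
  using t3[OF Hab[of b c] Hab[of a "\<i> *s e"], of 1 1 "g ?x"] n by (simp add: mult_ac)
  have 7: "abs (g' ?x * (?l a * ?l c * HH w b (\<i> *s e))) <= abs (g' ?x) * CH * (CH * Y) * (CH * Y)"
  using t3[OF Hab[of b "\<i> *s e"] Hy[of a] Hy[of c], of "g' ?x"] n by (simp add: mult_ac)
  have 8: "abs (g ?x * (HH w a c * HH w b (\<i> *s e))) <= abs (g ?x) * CH * CH"
  using t3[OF Hab[of a c] Hab[of b "\<i> *s e"], of 1 1 "g ?x"] n by (simp add: mult_ac)
  show ?thesis unfolding f.D2_etcoef_comp[of g g' g'', OF g' g'', unfolded fq, folded HH_def] norm_of_real by (rule t8[OF 1 2 3 4 5 6 7 8])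
  qed
  show "cmod (FD (?f c e) z b) <= ?A1" if "b : dirs" for b proof -
  note n = norm_dirs[OF that] nb[OF c] nb[OF e]
  let ?l = "%v. HH w (z - w) v" and ?m = "HH w (z - w) (\<i> *s e)"
  have 1: "abs (g' ?x * ?l b * ?l c * ?m) <= abs (g' ?x) * (CH * Y) * (CH * Y) * (CH * Y)" by (rule t3) (intro Hy n)+
  have 2: "abs (g ?x * HH w b c * ?m) <= abs (g ?x) * CH * (CH * Y)" using t3[OF Hab[of b c] Hy[of "\<i> *s e"], of 1 1 "g ?x"] n by (simp add: mult_ac)
  have 3: "abs (g ?x * ?l c * HH w b (\<i> *s e)) <= abs (g ?x) * CH * (CH * Y)"
  using t3[OF Hab[of b "\<i> *s e"] Hy[of c], of 1 1 "g ?x"] n by (simp add: mult_ac)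
  show ?thesis unfolding f.D_etcoef_comp[of g g', OF g', unfolded fq, folded HH_def] norm_of_real by (rule s3[OF 1 2 3])
  qed
  show "cmod (?f c e z) <= ?A0" using t3[OF Hy[of c] Hy[of "\<i> *s e"], of 1 1 "g ?x"] nb[OF c] nb[OF e] by (simp add: ecoef_def abs_mult mult_ac norm_mult)
  show "cmod (P l z - P l w) <= L * Y" using L(4)[OF l w z] by (simp add: Y_def)
  qed (use L(2,3)[OF l zK] in auto)
  have main: "(SUM c:Basis. SUM e:Basis. SUM l:?I. P l w * topc (ddc_fun (?f c e) z * (xi c * xi e * pform l)))
  = of_real (- 2 * vol0 w * (g ?x + g' ?x * ?x / CARD('n)))" proof -
  let ?be = "herm_ext (hw w)"
  have "(SUM l:?I. P l w * topc (ddc_fun (?f c e) z * (xi c * xi e * pform l)))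
  = topc (ddc_fun (?f c e) z * (xi c * xi e) * ?be ^ (CARD('n) - 2))" for c e proof -
  have "ddc_fun (?f c e) z * (xi c * xi e) * ?be ^ (CARD('n) - 2)
  = (SUM l:?I. scal (P l w) * (ddc_fun (?f c e) z * (xi c * xi e * pform l)))"
  unfolding herm_ext_power sum_distrib_left by (simp only: scal_left_commute[of "ddc_fun _ _"] scal_left_commute[of "xi _"] mult.assoc P_def)
  thus ?thesis by (simp add: topc_sum)
  qed
  hence "(SUM c:Basis. SUM e:Basis. SUM l:?I. P l w * topc (ddc_fun (?f c e) z * (xi c * xi e * pform l)))
  = topc ((SUM c:Basis. SUM e:Basis. ddc_fun (?f c e) z * (xi c * xi e)) * ?be ^ (CARD('n) - 2))" by (simp add: sum_distrib_right topc_sum)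
  also have "... = - (of_real (2 * g' ?x) * topc (?be * f.et z * ?be ^ (CARD('n) - 2)) + of_real (2 * g ?x) * topc (?be * ?be * ?be ^ (CARD('n) - 2)))"
  unfolding f.ddc_fun_etcoef[of g g' g'', OF g' g'', unfolded fq] mult_minus_left distrib_right mult.assoc topc_simps ..
  also have "?be * f.et z * ?be ^ (CARD('n) - 2) = f.et z * ?be ^ (CARD('n) - 1)" proof -
  have "?be * ?be ^ (CARD('n) - 2) = ?be ^ (CARD('n) - 1)" using n2 by (metis Suc_1 Suc_diff_Suc diff_Suc_1 less_eq_Suc_le plus_1_eq_Suc power_Suc One_nat_def)
  moreover have "?be * f.et z = f.et z * ?be" by (rule homog2_commute[OF homog_herm_ext])
  ultimately show ?thesis by (simp only: mult.assoc)
  qed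
  also have "?be * ?be * ?be ^ (CARD('n) - 2) = ?be ^ CARD('n)"
  using n2 by (metis (no_types, opaque_lifting) add_diff_inverse_nat linorder_not_less power2_eq_square power_add)
  finally show ?thesis unfolding f.topc_et vol0_frozen[OF wOm] fq by (simp add: algebra_simps)
  qed
  let ?S = "Mop (%c e z. g (qw w z) * ecoef w z c e) z - of_real (- 2 * vol0 w * (g ?x + g' ?x * ?x / CARD('n)))"
  have "abs (Re (Mop (%c e z. g (qw w z) * ecoef w z c e) z) + 2 * vol0 w * (g ?x + g' ?x * ?x / CARD('n))) = abs (Re ?S)" by simp
  also have "... <= cmod ?S" by (rule abs_Re_le_cmod)
  also have "?S = (SUM c:Basis. SUM e:Basis. SUM l:?I. topc (ddc_fun (%z. ?f c e z * P l z) z * (xi c * xi e * pform l)) - P l w * topc (ddc_fun (?f c e) z * (xi c * xi e * pform l)))"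
  unfolding main[symmetric] Mop_def sum_subtractf ..
  also have "cmod ... <= (SUM c:Basis. SUM e:Basis. SUM l:?I. L * (?A2 * Y + 2 * ?A1 + ?A0) * basis_weight (xi c * xi e * pform l :: 'n ext))"
  by (intro sum_norm_le e)
  also have "... = L * (?A2 * Y + 2 * ?A1 + ?A0) * ?W" by (simp add: sum_distrib_left)
  also have "... <= L * (4 * CH ^ 4 * (Y * (abs (g ?x) + Y^2 * abs (g' ?x) + Y ^ 4 * abs (g'' ?x)))) * ?W"
  proof (intro mult_right_mono[OF _ W] mult_left_mono[OF _ L(1)])
  have p: "CH ^ k <= CH ^ 4" if "k <= 4" for k using CH(1) that by (rule power_increasing[rotated])
  have Yp: "Y ^ k * Y <= Y" "Y ^ Suc k <= Y" for k using Y power_le_one[of Y k] mult_right_mono[of "Y ^ k" 1 Y] by (auto simp: mult.commute)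
  have a: "abs (g ?x) * CH ^ 2 * Y <= CH ^ 4 * (Y * abs (g ?x))" using mult_right_mono[OF p[of 2], of "abs (g ?x) * Y"] Y by (simp add: mult_ac)
  have a': "abs (g ?x) * CH ^ 2 * Y^2 <= abs (g ?x) * CH ^ 2 * Y" using Yp(2)[of 1] by (intro mult_left_mono) (auto simp: numeral_2_eq_2)
  have b: "abs (g' ?x) * CH ^ 3 * Y ^ 3 <= CH ^ 4 * (Y * (Y^2 * abs (g' ?x)))"
  using mult_right_mono[OF p[of 3], of "abs (g' ?x) * Y ^ 3"] Y by (simp add: mult_ac power3_eq_cube power2_eq_square)
  have c: "abs (g'' ?x) * (CH * Y) ^ 4 * Y = CH ^ 4 * (Y * (Y ^ 4 * abs (g'' ?x)))" by (simp add: power_mult_distrib mult_ac)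
  have c0: "CH ^ 4 * (Y * (Y ^ 4 * abs (g'' ?x))) >= 0" "CH ^ 4 * (Y * (Y^2 * abs (g' ?x))) >= 0" "CH ^ 4 * (Y * abs (g ?x)) >= 0" using Y CH0 by auto
  have "?A2 * Y + 2 * ?A1 + ?A0 = 1/2 * (abs (g'' ?x) * (CH * Y) ^ 4 * Y) + 7/2 * (abs (g' ?x) * CH ^ 3 * Y ^ 3) + 3 * (abs (g ?x) * CH ^ 2 * Y) + 1/2 * (abs (g ?x) * CH ^ 2 * Y^2)"
  by (simp add: field_simps power2_eq_square power3_eq_cube)
  moreover have "4 * CH ^ 4 * (Y * (abs (g ?x) + Y^2 * abs (g' ?x) + Y ^ 4 * abs (g'' ?x))) =
  4 * (CH ^ 4 * (Y * abs (g ?x))) + 4 * (CH ^ 4 * (Y * (Y^2 * abs (g' ?x)))) + 4 * (CH ^ 4 * (Y * (Y ^ 4 * abs (g'' ?x))))"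
  by (simp only: distrib_left mult.assoc)
  ultimately show "?A2 * Y + 2 * ?A1 + ?A0 <= 4 * CH ^ 4 * (Y * (abs (g ?x) + Y^2 * abs (g' ?x) + Y ^ 4 * abs (g'' ?x)))" using a a' b c c0 by linarith
  qed
  finally show ?thesis by (simp add: C_def Y_def mult_ac)
 qed
 moreover have "C >= 0" using L(1) W by (simp add: C_def)
 ultimately show ?thesis by blast
qed

end

section \<open>Admissible metrics\<close>

context frozen
begin

definition qp where "qp z j = (of_real (H (z - w) (axis j 1)) - \<i> * of_real (H (z - w) (axis j \<i>))) / 2"

lemma et_herm: "et z = herm_ext (%j k. qp z j * cnj (qp z k))" proof -
 define lam where "lam = (SUM j:UNIV. scal (qp z j) * gen (Inl j))"
 define mm where "mm = (SUM j:UNIV. scal (cnj (qp z j)) * gen (Inr j))"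
 have "lam = covec (%v. SUM j:UNIV. qp z j * v $ j)" "mm = covec (%v. SUM j:UNIV. cnj (qp z j) * cnj (v $ j))"
  unfolding lam_def mm_def gen_def by (simp_all only: covec_sum covec_scale sum.case)
 hence sq: "lam * lam = 0" "mm * mm = 0" and ac: "mm * lam = - (lam * mm)"
  by (simp_all only: covec_square covec_anticommute[of "%v. SUM j:UNIV. cnj (qp z j) * cnj (v $ j)"])
 have ii: "\<i> *s axis j \<i> = - axis j (1 :: complex)" "\<i> *s axis j 1 = axis j (\<i> :: complex)" for j :: 'n by (simp_all add: vec_eq_iff axis_def)
 have neg: "H u (- v) = - H u v" for u v using linear_neg[OF H_linear_right] by blast
 have dq: "dq z = lam + mm" unfolding dq_def covec_real_linear[OF linear_of_real_H] lam_def mm_def sum.distrib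
  by (intro arg_cong2[of _ _ _ _ "(+)"] sum.cong refl) (simp_all add: qp_def)
 have dcq: "dcq z = scal \<i> * mm - scal \<i> * lam" proof -
  have "dcq z = (SUM j:UNIV. scal (- \<i> * qp z j) * gen (Inl j) + scal (\<i> * cnj (qp z j)) * gen (Inr j))"
  unfolding dcq_def covec_real_linear[OF linear_of_real_HJ] ii neg
  by (intro sum.cong refl arg_cong2[of _ _ _ _ "(+)"] arg_cong2[of _ _ _ _ "(*)"] arg_cong[of _ _ scal])
  (simp_all add: qp_def field_simps)
  also have "... = (SUM j:UNIV. scal (- \<i> * qp z j) * gen (Inl j)) + (SUM j:UNIV. scal (\<i> * cnj (qp z j)) * gen (Inr j))" by (rule sum.distrib)
  also have "... = scal (- \<i>) * lam + scal \<i> * mm" unfolding lam_def mm_def sum_distrib_left scal_mult mult.assoc ..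
  finally show ?thesis by (simp add: scal_minus)
 qed
 have "dq z * dcq z = scal \<i> * (lam * mm) + scal \<i> * (lam * mm)"
  unfolding dq dcq distrib_right right_diff_distrib scal_left_commute[of lam] scal_left_commute[of mm] sq ac by simp
 also have "... = scal (2 * \<i>) * (lam * mm)" unfolding distrib_right[symmetric] scal_add[symmetric] by simp
 finally have "et z = scal \<i> * (lam * mm)" by (simp add: et_def scal_mult_assoc)
 also have "... = herm_ext (%j k. qp z j * cnj (qp z k))" unfolding herm_ext_def lam_def mm_def sum_product unfolding sum_distrib_left
  by (intro sum.cong refl) (simp only: dzz_def scal_mult mult.assoc scal_left_commute[of "gen (Inl _)"])
 finally show ?thesis .
qed

lemma et_value: "form_of (et z) [v, \<i> *s v] = of_real (((H (z - w) v)^2 + (H (z - w) (\<i> *s v))^2) / 2)" proof -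
 have "\<i> *s (\<i> *s v) = - v" by (simp add: vec_eq_iff)
 hence n: "H u (\<i> *s (\<i> *s v)) = - H u v" for u by (simp only: linear_neg[OF H_linear_right])
 have two: "form_of (covec l * covec k) [a, b] = l a * k b - l b * k a" for l k and a b :: "complex^'n" by (simp add: form_of_covec_mult)
 have "form_of (et z) [v, \<i> *s v] = 1 / 2 * (of_real (H (z - w) v) * - of_real (- H (z - w) v)
  - of_real (H (z - w) (\<i> *s v)) * - of_real (H (z - w) (\<i> *s v)))" unfolding et_def dq_def dcq_def form_of_simps two n ..
 thus ?thesis by (simp add: power2_eq_square)
qed

lemma H_scale_add: "H (a *\<^sub>R u + b *\<^sub>R v) x = a * H u x + b * H v x" "H x (a *\<^sub>R u + b *\<^sub>R v) = a * H x u + b * H x v"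
 by (simp_all add: linear_add[OF H_linear_left] linear_scale[OF H_linear_left] linear_add[OF H_linear_right] linear_scale[OF H_linear_right])

lemma H_cauchy_schwarz:
 assumes "!!v. v ~= 0 ==> H v v > 0"
 shows "(H u v)^2 <= H u u * H v v" proof (cases "v = 0")
 case True
 thus ?thesis using linear_0[OF H_linear_right] by simp
next
 case False
 have nn: "H x x >= 0" for x using assms[of x] linear_0[OF H_linear_right, of x] by (cases "x = 0") auto
 let ?x = "H v v *\<^sub>R u + (- H u v) *\<^sub>R v"
 have "0 <= H ?x ?x" by (rule nn)
 also have "H ?x ?x = H v v * (H u u * H v v - (H u v)^2)" unfolding H_scale_add by (simp add: H_sym[of v u] power2_eq_square algebra_simps)
 finally show ?thesis using assms[OF False] by (simp add: zero_le_mult_iff)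
qed

text \<open>Complex Cauchy-Schwarz, obtained from the real one by testing \<open>u\<close> against
  the combination \<open>?x\<close> of \<open>v\<close> and \<i> \<open>v\<close> that is
  proportional to its projection onto the complex line of \<open>v\<close>.\<close>

lemma et_value_le:
 assumes "!!v. v ~= 0 ==> H v v > 0"
 shows "(H u v)^2 + (H u (\<i> *s v))^2 <= H u u * H v v" proof -
 let ?a = "H u v" and ?b = "H u (\<i> *s v)"
 let ?x = "?a *\<^sub>R v + ?b *\<^sub>R (\<i> *s v)" and ?s = "(H u v)^2 + (H u (\<i> *s v))^2"
 have 1: "H u ?x = ?s" unfolding H_scale_add by (simp add: power2_eq_square)
 have 2: "H ?x ?x = ?s * H v v" unfolding H_scale_add H_i_self H_i H_sym[of "\<i> *s v" v] by (simp add: power2_eq_square algebra_simps)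
 have "?s * ?s <= H u u * (?s * H v v)" using H_cauchy_schwarz[OF assms, of u ?x] unfolding 1 2 by (simp add: power2_eq_square)
 moreover have "?s >= 0" by simp
 moreover have "H x x >= 0" for x using assms[of x] linear_0[OF H_linear_right, of x] by (cases "x = 0") auto
 ultimately show ?thesis by (cases "?s = 0") (auto simp: mult.left_commute[of _ ?s] mult_le_cancel_left)
qed

end

lemma power_minus_nilpotent:
 fixes W e :: "'n::finite ext"
 assumes "homog 2 e" "e * e = 0"
 shows "(W - scal c * e) ^ Suc N = W ^ Suc N - scal (of_nat (Suc N) * c) * (e * W ^ N)" proof -
 let ?e = "scal (- c) * e"
 have "?e * W = W * ?e" using homog2_commute[OF homog_scal[OF assms(1)]] by blast
 moreover have "?e * ?e = 0" by (simp only: mult.assoc scal_left_commute[of e] assms(2)) simp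
 ultimately have "(?e + W) ^ Suc N = W ^ Suc N + of_nat (Suc N) * (?e * W ^ N)" by (rule sum_power_square_zero)
 moreover have "?e + W = W - scal c * e" by (simp add: scal_minus)
 moreover have "of_nat (Suc N) * (?e * W ^ N) = - (scal (of_nat (Suc N) * c) * (e * W ^ N))"
  unfolding scal_of_nat[symmetric] scal_mult_assoc mult.assoc by (simp add: scal_minus)
 ultimately show ?thesis by simp
qed

context chart_compact
begin

definition tw where "tw w z = frozen.et (hw w) w z"

text \<open>Common shape of the two perturbed forms: gamma for \<open>c = s / (m - 1)\<close> and
  alpha for \<open>c = s / (n - 1)\<close>. The base form varies with \<open>z\<close>, while
  \<open>tw\<close> keeps the coefficients of \<open>w\<close>.\<close>

definition almet where
 "almet w c kk z = form_of (Ext (om z) - scal (of_real (c * kk (qw w z))) * tw w z)"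

text \<open>The metric at \<open>z\<close> is nondegenerate, so every covector is represented by a
  vector; injectivity gives surjectivity in finite dimension.\<close>

lemma contr_solve:
 assumes "w : Om" "z : Om"
 shows "EX v. ALL x. HH z v x = HH w y x" proof -
 interpret fz: frozen "hw z" z by (rule frozen[OF assms(2)])
 interpret fw: frozen "hw w" w by (rule frozen[OF assms(1)])
 have rep: "hprod (herm_ext (hw u)) v x = (SUM b:Basis. hprod (herm_ext (hw u)) v b *\<^sub>R b) \<bullet> x"
  if "u : Om" for u v x proof -
  interpret fu: frozen "hw u" u by (rule frozen[OF that])
  have "fu.H v x = fu.H v (SUM b:Basis. (x \<bullet> b) *\<^sub>R b)" by (simp add: euclidean_representation)
  also have "... = (SUM b:Basis. (x \<bullet> b) * fu.H v b)" using fu.H_linear_right by (simp add: linear_sum linear_scale)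
  also have "... = (SUM b:Basis. fu.H v b *\<^sub>R b) \<bullet> x" by (simp add: inner_sum_left inner_commute[of x] mult.commute)
  finally show ?thesis .
 qed
 let ?A = "%v. SUM b:Basis. fz.H v b *\<^sub>R b"
 have lin: "linear ?A" by (rule linearI)
  (simp_all add: linear_add[OF fz.H_linear_left] linear_scale[OF fz.H_linear_left] scaleR_left_distrib sum.distrib scaleR_right.sum)
 have "inj ?A" unfolding linear_injective_0[OF lin]
 proof (intro allI impI)
  fix v assume "?A v = 0"
  hence "fz.H v v = 0" using rep[OF assms(2), of v v] by simp
  thus "v = 0" using HH_pos[OF assms(2), of v] by (auto simp: HH_def)
 qed
 hence "surj ?A" using linear_injective_imp_surjective[OF lin] by blast
 then obtain v where v': "(SUM b:Basis. fw.H y b *\<^sub>R b) = ?A v" by (rule surjE)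
 note v = v'[symmetric]
 have "fz.H v x = fw.H y x" for x proof -
  have "fz.H v x = ?A v \<bullet> x" by (rule rep[OF assms(2)])
  also have "... = (SUM b:Basis. fw.H y b *\<^sub>R b) \<bullet> x" by (simp only: v)
  also have "... = fw.H y x" by (rule rep[OF assms(1), symmetric])
  finally show ?thesis .
 qed
 thus ?thesis by (auto simp: HH_def)
qed

text \<open>The trace of the degenerate form \<open>et\<close>, frozen at \<open>w\<close>, with respect to the metric at \<open>z\<close>:
  contracting \<open>dq \<and> om\<^sup>n = 0\<close> with the vector \<open>v\<close> that solves \<open>\<iota>\<^sub>v om(z) = d\<^sup>c q\<close> avoids inverting a matrix.\<close>

lemma topc_tw:
 assumes w: "w : Om" and z: "z : Om" and E: "!!v. HH w v v <= E * HH z v v"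
 shows "EX N. topc (tw w z * Ext (om z) ^ (CARD('n) - 1)) = of_real (N * vol0 z) & 0 <= N & N <= E * qw w z / CARD('n)" proof -
 interpret fz: frozen "hw z" z by (rule frozen[OF z])
 interpret fw: frozen "hw w" w by (rule frozen[OF w])
 obtain v where v: "!!x. HH z v x = HH w (z - w) x" using contr_solve[OF w z] by blast
 have dcq: "fw.dcq z = contr v fz.be" unfolding fz.contr_be fw.dcq_def using v by (simp add: HH_def)
 define N where "N = HH z v v / (2 * CARD('n))"
 have "of_nat CARD('n) * (fw.dq z * fw.dcq z * fz.be ^ (CARD('n) - 1)) = scal (of_real (HH w (z - w) v)) * fz.be ^ CARD('n)"
  unfolding dcq fw.dq_def covec_contr_top[OF homog_herm_ext fw.linear_of_real_H] by (simp add: HH_def)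
 hence "topc (scal (of_nat CARD('n)) * (fw.dq z * fw.dcq z * fz.be ^ (CARD('n) - 1))) = of_real (HH z v v) * of_real (vol0 z)"
  by (simp add: scal_of_nat v vol0_frozen[OF z])
 hence "topc (fw.et z * fz.be ^ (CARD('n) - 1)) = of_real (N * vol0 z)" unfolding fw.et_def mult.assoc topc_simps by (simp add: N_def field_simps)
 moreover have N0: "HH z v v >= 0" using HH_pos[OF z, of v] linear_0[OF fz.H_linear_right, of v] by (cases "v = 0") (auto simp: HH_def)
 moreover have "HH z v v <= E * (2 * qw w z)" proof (cases "HH z v v = 0")
  case True
  have "E * HH w (z - w) (z - w) >= 0" proof (cases "z - w = 0")
  case True
  thus ?thesis using linear_0[OF fw.H_linear_right] by (simp add: HH_def)
  next
  case False
  have "0 < HH w (z - w) (z - w)" "0 < HH z (z - w) (z - w)" using HH_pos[OF w False] HH_pos[OF z False] by auto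
  hence "E > 0" using E[of "z - w"] zero_less_mult_pos2[of E "HH z (z - w) (z - w)"] by linarith
  thus ?thesis using \<open>0 < HH w (z - w) (z - w)\<close> by simp
  qed
  thus ?thesis using True by (simp add: qw_def)
 next
  case False
  hence pos: "HH z v v > 0" using N0 by simp
  \<comment> \<open>Cauchy-Schwarz in the metric at \<open>w\<close>, followed by the comparison
    factor \<open>E\<close>; one power of \<open>HH z v v\<close> is then cancelled.\<close>
  have "(HH z v v)^2 = (HH w (z - w) v)^2" by (simp add: v)
  also have "... <= HH w (z - w) (z - w) * HH w v v" unfolding HH_def by (rule fw.H_cauchy_schwarz) (use HH_pos[OF w] in \<open>simp add: HH_def\<close>)
  also have "... <= HH w (z - w) (z - w) * (E * HH z v v)"
  proof (rule mult_left_mono[OF E])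
  show "0 <= HH w (z - w) (z - w)" using HH_pos[OF w, of "z - w"] linear_0[OF fw.H_linear_right] by (cases "z = w") (auto simp: HH_def)
  qed
  finally have "HH z v v * HH z v v <= (E * (2 * qw w z)) * HH z v v" by (simp add: qw_def power2_eq_square mult_ac)
  thus ?thesis using pos by simp
 qed
 hence "N <= E * qw w z / CARD('n)" by (simp add: N_def field_simps)
 ultimately show ?thesis using N0 Ext_om[OF z] by (auto simp: tw_def N_def intro!: exI[of _ N])
qed

lemma tw_homog: "w : Om ==> homog 2 (tw w z)" and tw_square: "w : Om ==> tw w z * tw w z = 0"
 unfolding tw_def using frozen.homog_et[OF frozen] frozen.et_square[OF frozen] by auto

lemma tw_expand: "w : Om ==> tw w z = (SUM c:Basis. SUM e:Basis. scal (of_real (ecoef w z c e)) * (xi c * xi e))"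
 unfolding tw_def using frozen.et_expand[OF frozen, of w w z] frozen_etcoef by simp

lemma real_11_almet:
 assumes "w : Om" "z : Om"
 shows "real_11_form (almet w c kk z)" proof -
 interpret fw: frozen "hw w" w by (rule frozen[OF assms(1)])
 let ?r = "complex_of_real (c * kk (qw w z))"
 have "Ext (om z) - scal ?r * tw w z = herm_ext (%j k. hw z j k - ?r * (fw.qp z j * cnj (fw.qp z k)))"
  unfolding tw_def fw.et_herm Ext_om[OF assms(2)] herm_ext_def sum_distrib_left sum_subtractf[symmetric]
 proof (intro sum.cong refl)
  fix j k
  have "\<i> * (hw z j k - ?r * (fw.qp z j * cnj (fw.qp z k))) = \<i> * hw z j k - ?r * (\<i> * (fw.qp z j * cnj (fw.qp z k)))" by (simp add: algebra_simps)
  thus "scal (\<i> * hw z j k) * dzz j k - scal ?r * (scal (\<i> * (fw.qp z j * cnj (fw.qp z k))) * dzz j k)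
  = scal (\<i> * (hw z j k - ?r * (fw.qp z j * cnj (fw.qp z k)))) * dzz j k" by (simp only: scal_mult_assoc left_diff_distrib[symmetric] scal_diff[symmetric])
 qed
 moreover have "hermitian (%j k. hw z j k - ?r * (fw.qp z j * cnj (fw.qp z k)))" unfolding hermitian_def
 proof (intro allI)
  fix j k
  have "hw z k j = cnj (hw z j k)" using hermitian_hw[OF assms(2)] unfolding hermitian_def by blast
  thus "hw z k j - ?r * (fw.qp z k * cnj (fw.qp z j)) = cnj (hw z j k - ?r * (fw.qp z j * cnj (fw.qp z k)))" by simp
 qed
 ultimately show ?thesis unfolding almet_def by (simp only: real_11_form_herm_ext)
qed

lemma smooth_almet:
 assumes "w : Om" "smooth_on UNIV kk"
 shows "smooth_form_on Om (almet w c kk)" unfolding smooth_form_on_def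
proof
 fix vs
 have "almet w c kk z vs = om z vs - of_real c * (of_real (kk (qw w z)) *
  (SUM b:Basis. SUM e:Basis. form_of (xi b * xi e) vs * of_real (ecoef w z b e)))" for z
  unfolding almet_def by (simp add: tw_expand[OF assms(1)] mult.assoc) (simp add: mult.commute)
 moreover have "smooth_on Om (%z. om z vs - of_real c * (of_real (kk (qw w z)) *
  (SUM b:Basis. SUM e:Basis. form_of (xi b * xi e) vs * of_real (ecoef w z b e))))"
  by (intro smooth_on_diff smooth_om smooth_on_cmult smooth_on_mult smooth_on_sum smooth_on_of_real open_Om
  smooth_on_compose_real[OF _ _ _ assms(2)] smooth_on_subset[OF smooth_qw[OF assms(1)]]
  smooth_on_subset[OF smooth_ecoef[OF assms(1)]]) auto
 ultimately show "smooth_on Om (%z. almet w c kk z vs)" by presburger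
qed

lemma almet_power:
 assumes "w : Om"
 shows "Ext (almet w c kk z) ^ Suc N = Ext (om z) ^ Suc N
  - scal (of_real (real (Suc N) * c * kk (qw w z))) * (tw w z * Ext (om z) ^ N)" unfolding almet_def
 using power_minus_nilpotent[OF tw_homog[OF assms, of z] tw_square[OF assms, of z], of "Ext (om z)" "of_real (c * kk (qw w z))" N]
 by (simp add: form_of_inverse mult.assoc)

text \<open>\<open>kk x * x <= 1\<close> keeps the trace of the subtracted form bounded near the
  centre. The metrics need to be comparable only where the weight is nonzero: elsewhere the
  perturbed form is omega, so a weight of small support gives forms that are admissible on the whole
  chart.\<close>

definition weight_ok where
 "weight_ok w ep kk \<longleftrightarrow> smooth_on UNIV kk & (ALL x. 0 <= kk x) & (ALL x>=0. kk x * x <= 1) &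
  (ALL z. kk (qw w z) ~= 0 --> (ALL v. HH w v v <= (1 + ep) * HH z v v))"

lemma qw_nonneg: "w : Om ==> 0 <= qw w z" using HH_pos[of w "z - w"] linear_0[OF frozen.H_linear_right[OF frozen]] by (cases "z = w") (auto simp: qw_def HH_def)

text \<open>The rank-one form is at most q times the metric at \<open>w\<close>, so \<open>c\<close>
  times the weight removes at most the fraction \<open>c * (1 + ep)\<close> of the metric at
  \<open>z\<close>.\<close>

lemma hermitian_almet:
 assumes w: "w : Om" and ok: "weight_ok w ep kk" and c: "0 <= c" "c * (1 + ep) < 1"
 shows "hermitian_metric_on Om (almet w c kk)" unfolding hermitian_metric_on_def positive_11_form_def
proof (intro conjI ballI allI impI)
 show "smooth_form_on Om (almet w c kk)" by (rule smooth_almet[OF w]) (use ok in \<open>simp add: weight_ok_def\<close>)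
 fix z assume z: "z : Om"
 thus "real_11_form (almet w c kk z)" by (rule real_11_almet[OF w])
 fix v :: "complex^'n" assume v: "v ~= 0"
 interpret fw: frozen "hw w" w by (rule frozen[OF w])
 let ?t = "((HH w (z - w) v)^2 + (HH w (z - w) (\<i> *s v))^2) / 2" and ?k = "kk (qw w z)"
 have val: "Re (almet w c kk z [v, \<i> *s v]) = HH z v v - c * ?k * ?t"
  unfolding almet_def form_of_simps tw_def fw.et_value[of z v, folded HH_def] by (simp add: HH_def hprod_def Ext_om[OF z])
 have pos: "HH z v v > 0" by (rule HH_pos[OF z v])
 show "0 < Re (almet w c kk z [v, \<i> *s v])" proof (cases "?k = 0")
  case True
  thus ?thesis using val pos by simp
 next
  case False
  hence E: "HH w v v <= (1 + ep) * HH z v v" using ok by (simp add: weight_ok_def)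
  have k: "?k >= 0" "?k * qw w z <= 1" using ok qw_nonneg[OF w] by (auto simp: weight_ok_def)
  have "?t <= qw w z * HH w v v" using fw.et_value_le[of "z - w" v] HH_pos[OF w] by (simp add: qw_def HH_def)
  hence "?k * ?t <= ?k * (qw w z * HH w v v)" using k(1) by (rule mult_left_mono)
  also have "... <= 1 * HH w v v" using mult_right_mono[OF k(2), of "HH w v v"] HH_pos[OF w v] by (simp add: mult.assoc)
  also have "... <= (1 + ep) * HH z v v" using E by simp
  finally have "c * (?k * ?t) <= c * ((1 + ep) * HH z v v)" using c(1) by (rule mult_left_mono)
  also have "... = (c * (1 + ep)) * HH z v v" by simp
  also have "... < 1 * HH z v v" using c(2) pos by (rule mult_strict_right_mono)
  finally show ?thesis unfolding val by (simp add: mult.assoc)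
 qed
qed

lemma real_almet: "w : Om ==> z : Om ==> real_ext (Ext (almet w c kk z))" using real_11_form_herm(3)[OF real_11_almet] .

lemma homog_om: "z : Om ==> homog 2 (Ext (om z))" by (simp add: Ext_om homog_herm_ext)

lemma homog_almet: "w : Om ==> z : Om ==> homog 2 (Ext (almet w c kk z))" by (simp add: almet_def form_of_inverse homog_diff homog_scal homog_om tw_homog)

text \<open>The \<open>k\<close>-th power is affine in the rank-one form, whose trace is at most
  \<open>(1 + ep) * q / n\<close>. So a fraction of at most \<open>k * c * (1 + ep) / n\<close> of
  the volume is lost, and \<open>k = m\<close> is the worst case.\<close>

lemma Gamma_almet:
 assumes w: "w : Om" and ok: "weight_ok w ep kk" and ep: "0 <= ep" and m: "m <= CARD('n)"
  and c: "0 <= c" "real m * c * (1 + ep) < CARD('n)"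
 shows "almet w c kk : Gamma_m m Om om" unfolding Gamma_m_def
proof (intro CollectI conjI ballI)
 show "smooth_form_on Om (almet w c kk)" by (rule smooth_almet[OF w]) (use ok in \<open>simp add: weight_ok_def\<close>)
 fix z assume z: "z : Om"
 thus "real_11_form (almet w c kk z)" by (rule real_11_almet[OF w])
 fix k assume k: "k : {1..m}"
 then obtain N where N: "k = Suc N" by (cases k) auto
 let ?W = "Ext (om z)" and ?k = "kk (qw w z)"
 have E: "Ext (wedge (form_power (almet w c kk z) k) (form_power (om z) (CARD('n) - k)))
  = Ext (almet w c kk z) ^ k * ?W ^ (CARD('n) - k)" by (simp add: Ext_wedge Ext_form_power)
 also have "... = ?W ^ CARD('n) - scal (of_real (real k * c * ?k)) * (tw w z * ?W ^ (CARD('n) - 1))" proof -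
  have "?W ^ Suc N * ?W ^ (CARD('n) - Suc N) = ?W ^ CARD('n)" using k m N by (simp only: power_add[symmetric]) simp
  moreover have "?W ^ N * ?W ^ (CARD('n) - Suc N) = ?W ^ (CARD('n) - 1)" using k m N by (simp only: power_add[symmetric]) simp
  ultimately show ?thesis unfolding N almet_power[OF w] left_diff_distrib mult.assoc by presburger
 qed
 finally have eq: "Ext (wedge (form_power (almet w c kk z) k) (form_power (om z) (CARD('n) - k)))
  = ?W ^ CARD('n) - scal (of_real (real k * c * ?k)) * (tw w z * ?W ^ (CARD('n) - 1))" .
 show "positive_top_form (wedge (form_power (almet w c kk z) k) (form_power (om z) (CARD('n) - k)))"
 proof (rule positive_top_formI)
  show "real_ext (Ext (wedge (form_power (almet w c kk z) k) (form_power (om z) (CARD('n) - k))))"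
  unfolding E by (intro real_ext_mult real_ext_power real_almet w z real_om)
  show "homog (2 * CARD('n)) (Ext (wedge (form_power (almet w c kk z) k) (form_power (om z) (CARD('n) - k))))"
  unfolding E by (rule homog_mult'[OF homog_power[OF homog_almet[OF w z]] homog_power[OF homog_om[OF z]]])
  (use k m in auto)
  show "0 < Re (topc (Ext (wedge (form_power (almet w c kk z) k) (form_power (om z) (CARD('n) - k)))))" proof (cases "?k = 0")
  case True
  thus ?thesis unfolding eq using vol0_pos[OF z] by (simp add: vol0_def)
  next
  case False
  hence "!!v. HH w v v <= (1 + ep) * HH z v v" using ok by (simp add: weight_ok_def)
  from topc_tw[OF w z this] obtain N where N: "topc (tw w z * ?W ^ (CARD('n) - 1)) = of_real (N * vol0 z)"
  "0 <= N" "N <= (1 + ep) * qw w z / CARD('n)" by blast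
  have kk: "?k >= 0" "?k * qw w z <= 1" using ok qw_nonneg[OF w] by (auto simp: weight_ok_def)
  have "Re (topc (Ext (wedge (form_power (almet w c kk z) k) (form_power (om z) (CARD('n) - k))))) = vol0 z * (1 - real k * c * (?k * N))"
  unfolding eq topc_simps N by (simp add: vol0_def algebra_simps)
  moreover have "real k * c * (?k * N) < 1" proof -
  have "?k * N <= ?k * ((1 + ep) * qw w z / CARD('n))" by (rule mult_left_mono[OF N(3) kk(1)])
  also have "... = (1 + ep) * (?k * qw w z) / CARD('n)" by simp
  also have "... <= (1 + ep) * 1 / CARD('n)" using kk(2) ep by (intro divide_right_mono mult_left_mono) auto
  finally have "real k * c * (?k * N) <= real k * c * ((1 + ep) / CARD('n))" using c(1) by (intro mult_left_mono) auto
  also have "... <= real m * c * ((1 + ep) / CARD('n))" using c(1) ep k by (intro mult_right_mono) auto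
  also have "... < 1" using c(2) by (simp add: field_simps)
  finally show ?thesis .
  qed
  ultimately show ?thesis using vol0_pos[OF z] by simp
  qed
 qed
qed

text \<open>The inequality says s (1 + ep) < n - n/m. The value \<open>s = 0\<close> is kept apart:
  it is the unperturbed metric, and the only choice for \<open>m = 1\<close>.\<close>

definition sigma_ok where
 "sigma_ok m s ep \<longleftrightarrow> 0 <= ep & 1 <= m & m <= CARD('n) & 0 <= s &
  (s = 0 | 2 <= m & real m * s * (1 + ep) < real CARD('n) * (real m - 1))"

lemma almet_top_power:
 assumes w: "w : Om" and s: "s = 0 | 2 <= CARD('n)"
 shows "Ext (almet w (s / (real CARD('n) - 1)) kk z) ^ (CARD('n) - 1) =
  Ext (om z) ^ (CARD('n) - 1) - scal (of_real (s * kk (qw w z))) * (tw w z * Ext (om z) ^ (CARD('n) - 2))" proof (cases "CARD('n) >= 2")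
 case True
 then obtain N where N: "CARD('n) = Suc (Suc N)" by (auto simp: le_iff_add)
 have eq: "real (Suc N) * (s / (real (Suc (Suc N)) - 1)) * kk (qw w z) = s * kk (qw w z)" by simp
 have nat: "Suc (Suc N) - 1 = Suc N" "Suc (Suc N) - 2 = N" by simp_all
 show ?thesis unfolding N nat using almet_power[OF w, of "s / (real (Suc (Suc N)) - 1)" kk z N] unfolding eq .
next
 case False
 hence n1: "CARD('n) = 1" using zero_less_card_finite[where 'a='n] by linarith
 hence s0: "s = 0" using s by simp
 show ?thesis unfolding n1 s0 by simp
qed

text \<open>Both gamma^(m-1) wedge omega^(n-m) and alpha^(n-1) equal omega^(n-1) - s kappa eta wedge
  omega^(n-2): the power multiplies the coefficient by m - 1 in one case and by n - 1 in the other.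
  So alpha is an explicit root of the product of \<open>m - 1\<close> copies of gamma.\<close>

lemma admissible:
 assumes w: "w : Om" and ok: "weight_ok w ep kk" and s: "sigma_ok m s ep"
  and sub: "omega_m_subharmonic_on m om Om ph"
 shows "omega_subharmonic_wrt om (almet w (s / (real CARD('n) - 1)) kk) Om ph" proof -
 let ?n = "CARD('n)" and ?a = "almet w (s / (real CARD('n) - 1)) kk"
 have s': "0 <= ep" "1 <= m" "m <= ?n" "0 <= s" "s = 0 | 2 <= m & real m * s * (1 + ep) < real ?n * (real m - 1)" using s by (auto simp: sigma_ok_def)
 define g where "g = almet w (s / (real m - 1)) kk"
 define gs where "gs = replicate (m - 1) g"
 have gG: "g : Gamma_m m Om om" if "m ~= 1" unfolding g_def
 proof (rule Gamma_almet[OF w ok s'(1,3)])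
  have m2: "m >= 2" using that s' by linarith
  thus "0 <= s / (real m - 1)" using s' by simp
  show "real m * (s / (real m - 1)) * (1 + ep) < ?n" using s'(5) m2 by (auto simp: field_simps)
 qed
 have herm: "hermitian_metric_on Om ?a"
 proof (rule hermitian_almet[OF w ok])
  show "0 <= s / (real ?n - 1)" using s' zero_less_card_finite[where 'a='n] by simp
  show "s / (real ?n - 1) * (1 + ep) < 1" proof (cases "s = 0")
  case False
  hence m2: "2 <= m" and lt: "real m * s * (1 + ep) < real ?n * (real m - 1)" using s' by auto
  have "real ?n * (real m - 1) <= real m * (real ?n - 1)" using s'(3) by (simp add: algebra_simps)
  hence "real m * (s * (1 + ep)) < real m * (real ?n - 1)" using lt by (simp add: mult.assoc)
  hence "s * (1 + ep) < real ?n - 1" using m2 by simp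
  moreover have "real ?n - 1 > 0" using m2 s' by simp
  ultimately show ?thesis by (simp add: field_simps)
  qed simp
 qed
 have pow: "form_power (?a z) (?n - 1) = wedge (wedge_list (map (%ga. ga z) gs)) (form_power (om z) (?n - m))" for z proof -
  let ?W = "Ext (om z)"
  have "Ext (wedge_list (map (%ga. ga z) gs)) = Ext (g z) ^ (m - 1)" unfolding Ext_wedge_list gs_def by (simp add: map_replicate_const prod_list_replicate)
  hence 1: "Ext (wedge (wedge_list (map (%ga. ga z) gs)) (form_power (om z) (?n - m))) = Ext (g z) ^ (m - 1) * ?W ^ (?n - m)"
  by (simp add: Ext_wedge Ext_form_power)
  have "Ext (g z) ^ (m - 1) * ?W ^ (?n - m) = ?W ^ (?n - 1) - scal (of_real (s * kk (qw w z))) * (tw w z * ?W ^ (?n - 2))" proof (cases "m = 1")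
  case True
  thus ?thesis using s' by simp
  next
  case False
  then obtain N where N: "m = Suc (Suc N)" using s' by (metis One_nat_def Suc_le_D not0_implies_Suc)
  have p: "?W ^ Suc N * ?W ^ (?n - Suc (Suc N)) = ?W ^ (?n - 1)" "?W ^ N * ?W ^ (?n - Suc (Suc N)) = ?W ^ (?n - 2)" proof -
  have "Suc N + (?n - Suc (Suc N)) = ?n - 1" "N + (?n - Suc (Suc N)) = ?n - 2" using N s'(3) by linarith+
  thus "?W ^ Suc N * ?W ^ (?n - Suc (Suc N)) = ?W ^ (?n - 1)" "?W ^ N * ?W ^ (?n - Suc (Suc N)) = ?W ^ (?n - 2)" by (simp_all only: power_add[symmetric])
  qed
  have "Ext (g z) ^ Suc N = ?W ^ Suc N - scal (of_real (s * kk (qw w z))) * (tw w z * ?W ^ N)" proof -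
  have "real (Suc N) * (s / (real m - 1)) * kk (qw w z) = s * kk (qw w z)" by (simp add: N)
  thus ?thesis unfolding g_def almet_power[OF w] by (simp only:)
  qed
  moreover have "m - 1 = Suc N" "?n - m = ?n - Suc (Suc N)" using N by simp_all
  ultimately show ?thesis using p by (simp only: left_diff_distrib mult.assoc)
  qed
  also have "... = Ext (?a z) ^ (?n - 1)" by (rule almet_top_power[OF w, symmetric]) (use s' in auto)
  finally have "Ext (form_power (?a z) (?n - 1)) = Ext (wedge (wedge_list (map (%ga. ga z) gs)) (form_power (om z) (?n - m)))" by (simp add: 1 Ext_form_power)
  thus ?thesis by (metis form_of_Ext)
 qed
 have "length gs = m - 1" "set gs \<subseteq> Gamma_m m Om om" using gG by (auto simp: gs_def)
 with sub herm pow show ?thesis unfolding omega_m_subharmonic_on_def by blast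
qed

end

section \<open>Integration by parts\<close>

text \<open>By translation invariance every difference quotient has integral zero; dominated
  convergence passes to the derivative.\<close>

lemma integral_derivative_zero:
 fixes g :: "'a::euclidean_space => complex"
 assumes "smooth_on UNIV g" "compact C" "!!z. z ~: C ==> g z = 0"
 shows "integrable lborel (%z. FD g z a)"
  and "integral\<^sup>L lborel (%z. FD g z a) = 0" proof -
 let ?h = "%z. FD g z a"
 have hd: "(g has_derivative FD g z) (at z)" for z using smooth_on_has_derivative[OF assms(1)] by auto
 have hc: "continuous_on UNIV ?h" by (intro smooth_on_continuous smooth_on_frechet assms(1))
 have gc: "continuous_on UNIV g" by (intro smooth_on_continuous assms(1))
 have h0: "?h z = 0" if "z ~: C" for z proof -
  have "FD g z = FD (%_. 0) z" by (rule frechet_derivative_cong_open[of "- C"]) (use assms that compact_imp_closed in auto)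
  thus ?thesis by simp
 qed
 have int: "integrable lborel f" if "continuous_on UNIV f" "!!z. z ~: C ==> f z = 0" for f :: "'a => complex" proof -
  have "integrable lborel (%x. indicator C x *\<^sub>R f x)" by (rule borel_integrable_compact[OF assms(2) continuous_on_subset[OF that(1)]]) simp
  moreover have "(%x. indicator C x *\<^sub>R f x) = f" using that(2) by (auto simp: indicator_def)
  ultimately show ?thesis by simp
 qed
 show inth: "integrable lborel ?h" by (rule int[OF hc h0])
 have intg: "integrable lborel g" by (rule int[OF gc assms(3)])
 obtain B where B: "!!z. cmod (?h z) <= B" proof -
  have "bounded (?h ` C)" by (rule compact_imp_bounded[OF compact_continuous_image[OF continuous_on_subset[OF hc] assms(2)]]) simp
  then obtain B where "ALL x:?h ` C. norm x <= B" by (auto simp: bounded_iff)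
  hence "cmod (?h z) <= max B 0" for z using h0[of z] by (cases "z : C") auto
  thus ?thesis using that by blast
 qed
 obtain R where R: "!!z. z : C ==> norm z <= R" "R >= 0" proof -
  obtain R where "ALL z:C. norm z <= R" using compact_imp_bounded[OF assms(2)] by (auto simp: bounded_iff)
  thus ?thesis using that[of "max R 0"] by (auto intro: max.coboundedI1)
 qed
 let ?t = "%k. 1 / real (Suc k)"
 define D where "D k z = of_real (real (Suc k)) * (g (z + ?t k *\<^sub>R a) - g z)" for k z
 \<comment> \<open>The steps \<open>?t k\<close> are at most 1, so this ball contains the supports
   of all difference quotients.\<close>
 let ?S = "cball (0::'a) (R + norm a)"
 have Dz: "integral\<^sup>L lborel (D k) = 0" for k proof -
  have "integral\<^sup>L (distr lborel borel ((+) (?t k *\<^sub>R a))) g = integral\<^sup>L lborel (%z. g (?t k *\<^sub>R a + z))"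
  by (rule integral_distr) (use intg in auto)
  moreover have "integrable (distr lborel borel ((+) (?t k *\<^sub>R a))) g \<longleftrightarrow> integrable lborel (%z. g (?t k *\<^sub>R a + z))"
  by (rule integrable_distr_eq) (use intg in auto)
  ultimately have "integral\<^sup>L lborel g = integral\<^sup>L lborel (%z. g (z + ?t k *\<^sub>R a))" "integrable lborel (%z. g (z + ?t k *\<^sub>R a))"
  using intg by (simp_all add: lborel_distr_plus add.commute)
  thus ?thesis using intg by (simp add: D_def[abs_def])
 qed
 have comp: "((%t. g (z + t *\<^sub>R a)) has_derivative (%s. s *\<^sub>R ?h (z + t *\<^sub>R a))) (at t)" for z t proof -
  have "((%t. z + t *\<^sub>R a) has_derivative (%s. s *\<^sub>R a)) (at t)" by (auto intro!: derivative_eq_intros)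
  from has_derivative_compose[OF this hd]
  have "((%t. g (z + t *\<^sub>R a)) has_derivative (%s. FD g (z + t *\<^sub>R a) (s *\<^sub>R a))) (at t)" .
  thus ?thesis by (simp add: linear_scale[OF has_derivative_linear[OF hd]])
 qed
 have "(%k. integral\<^sup>L lborel (D k)) \<longlonglongrightarrow> integral\<^sup>L lborel ?h"
 proof (rule integral_dominated_convergence)
  show "?h : borel_measurable lborel" using inth by simp
  show "D k : borel_measurable lborel" for k unfolding D_def by (intro borel_measurable_continuous_onI continuous_intros continuous_on_compose2[OF gc] | simp)+
  show "integrable lborel (%z. indicator ?S z *\<^sub>R B)" by (rule borel_integrable_compact) auto
  show "AE z in lborel. (%k. D k z) \<longlonglongrightarrow> ?h z"
  proof (rule AE_I2)
  fix z
  have lim: "(%s. norm (g (z + (0 + s) *\<^sub>R a) - g (z + 0 *\<^sub>R a) - s *\<^sub>R ?h (z + 0 *\<^sub>R a)) / norm s) \<midarrow>0\<rightarrow> 0"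
  using comp[of z 0] unfolding has_derivative_at by blast
  have t0: "filterlim ?t (at 0) sequentially" by (rule filterlim_atI) (use LIMSEQ_inverse_real_of_nat in \<open>auto simp: inverse_eq_divide\<close>)
  have "(%k. norm (g (z + (0 + ?t k) *\<^sub>R a) - g (z + 0 *\<^sub>R a) - ?t k *\<^sub>R ?h (z + 0 *\<^sub>R a)) / norm (?t k)) \<longlonglongrightarrow> 0"
  by (rule filterlim_compose[OF lim t0])
  moreover have "norm (g (z + (0 + ?t k) *\<^sub>R a) - g (z + 0 *\<^sub>R a) - ?t k *\<^sub>R ?h (z + 0 *\<^sub>R a)) / norm (?t k) = norm (D k z - ?h z)" for k
  proof -
  have "D k z - ?h z = of_real (real (Suc k)) * (g (z + ?t k *\<^sub>R a) - g z - ?t k *\<^sub>R ?h z)"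
  by (simp add: D_def scaleR_conv_of_real right_diff_distrib del: of_nat_Suc)
  hence "norm (D k z - ?h z) = real (Suc k) * norm (g (z + ?t k *\<^sub>R a) - g z - ?t k *\<^sub>R ?h z)" by (simp only: norm_mult norm_of_real abs_of_nat)
  thus ?thesis by simp
  qed
  ultimately have "(%k. norm (D k z - ?h z)) \<longlonglongrightarrow> 0" by simp
  thus "(%k. D k z) \<longlonglongrightarrow> ?h z" by (simp add: tendsto_norm_zero_iff LIM_zero_iff)
  qed
  show "AE z in lborel. norm (D k z) <= indicator ?S z *\<^sub>R B" for k
  proof (rule AE_I2)
  fix z
  show "norm (D k z) <= indicator ?S z *\<^sub>R B" proof (cases "z : ?S")
  case True
  have "norm (g (z + ?t k *\<^sub>R a) - g (z + 0 *\<^sub>R a)) <= B * norm (?t k - 0)"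
  proof (rule differentiable_bound[of UNIV "%t. g (z + t *\<^sub>R a)" "%t s. s *\<^sub>R ?h (z + t *\<^sub>R a)"])
  show "onorm (%s. s *\<^sub>R ?h (z + t *\<^sub>R a)) <= B" for t
  proof (rule onorm_bound)
  show "0 <= B" using order_trans[OF norm_ge_zero B] .
  show "norm (s *\<^sub>R ?h (z + t *\<^sub>R a)) <= B * norm s" for s using mult_left_mono[OF B, of "abs s" "z + t *\<^sub>R a"] by (simp add: mult.commute)
  qed
  qed (use comp in auto)
  hence "real (Suc k) * norm (g (z + ?t k *\<^sub>R a) - g z) <= B" by (simp add: field_simps del: of_nat_Suc)
  moreover have "norm (D k z) = real (Suc k) * norm (g (z + ?t k *\<^sub>R a) - g z)" by (simp only: D_def norm_mult norm_of_real abs_of_nat)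
  ultimately show ?thesis using True by simp
  next
  case False
  have "z ~: C" using False R(1)[of z] norm_ge_zero[of a] by fastforce
  moreover have "z + ?t k *\<^sub>R a ~: C"
  proof
  assume "z + ?t k *\<^sub>R a : C"
  hence "norm (z + ?t k *\<^sub>R a) <= R" by (rule R(1))
  moreover have "norm (?t k *\<^sub>R a) <= norm a" by (simp add: divide_le_eq mult_le_cancel_left1)
  moreover have "norm z <= norm (z + ?t k *\<^sub>R a) + norm (?t k *\<^sub>R a)"
  using norm_triangle_ineq4[of "z + ?t k *\<^sub>R a" "?t k *\<^sub>R a"] by simp
  ultimately show False using False by simp
  qed
  ultimately show ?thesis using False assms(3) by (simp add: D_def)
  qed
  qed
 qed
 thus "integral\<^sup>L lborel ?h = 0" unfolding Dz by (simp add: LIMSEQ_const_iff)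
qed

section \<open>The basic inequality\<close>

context chart_compact
begin

text \<open>The coefficient of dd^c(tt alpha^(n-1)) for the perturbed metric alpha with parameter
  \<open>s\<close>, since alpha^(n-1) is omega^(n-1) minus \<open>s\<close> times the weighted
  rank-one form wedged with omega^(n-2).\<close>

definition TT where
 "TT tt s kk w z = Re (Lop tt z) - s * Re (Mop (%c e z. tt z * kk (qw w z) * ecoef w z c e) z)"

abbreviation "ddc_idx == (pidx (CARD('n) - 1) :: ('n \<times> 'n) list set) <+>
 ((Basis :: (complex^'n) set) \<times> (Basis :: (complex^'n) set) \<times> (pidx (CARD('n) - 2) :: ('n \<times> 'n) list set))"

definition ddc_coef where
 "ddc_coef tt kk w i z = (case i of Inl l => of_real (tt z) * P l z
  | Inr (c, e, l) => of_real (tt z * kk (qw w z) * ecoef w z c e) * P l z)"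

definition ddc_ext :: "real => (('n \<times> 'n) list + ((complex^'n) \<times> (complex^'n) \<times> ('n \<times> 'n) list)) => 'n ext" where
 "ddc_ext s i = (case i of Inl l => pform l | Inr (c, e, l) => scal (- of_real s) * (xi c * xi e * pform l))"

lemma finite_ddc_idx: "finite ddc_idx" by (intro finite_Plus finite_cartesian_product finite_pidx) auto

lemma sum_ddc_idx: "(SUM i:ddc_idx. G i) = (SUM l:(pidx (CARD('n) - 1) :: ('n \<times> 'n) list set). G (Inl l)) +
 (SUM c:(Basis :: (complex^'n) set). SUM e:(Basis :: (complex^'n) set). SUM l:(pidx (CARD('n) - 2) :: ('n \<times> 'n) list set). (G (Inr (c, e, l)) :: 'b::comm_monoid_add))"
proof -
 have "(SUM i:ddc_idx. G i) = sum (G o Inl) (pidx (CARD('n) - 1)) + sum (G o Inr) (Basis \<times> Basis \<times> pidx (CARD('n) - 2))"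
  by (rule sum.Plus) (auto simp: finite_pidx)
 thus ?thesis unfolding sum.cartesian_product' by simp
qed

lemma smooth_ddc_coef:
 assumes "w : Om" "smooth_on UNIV kk" "smooth_on UNIV tt"
 shows "smooth_on Om (ddc_coef tt kk w i)" proof -
 have th: "smooth_on Om tt" using assms(3) by (rule smooth_on_subset) simp
 have r: "smooth_on Om (%z. tt z * kk (qw w z) * ecoef w z c e)" for c e
  by (intro smooth_on_mult th smooth_on_compose_real[OF _ _ _ assms(2)] smooth_on_subset[OF smooth_qw[OF assms(1)]]
  smooth_on_subset[OF smooth_ecoef[OF assms(1)]] open_Om) auto
 show ?thesis proof (cases i)
  case (Inl l)
  have "smooth_on Om (%z. of_real (tt z) * P l z)" by (intro smooth_on_mult smooth_on_of_real th smooth_P open_Om)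
  thus ?thesis by (simp add: ddc_coef_def[abs_def] Inl)
 next
  case (Inr p)
  obtain c e l where p: "p = (c, e, l)" by (cases p) auto
  have "smooth_on Om (%z. of_real (tt z * kk (qw w z) * ecoef w z c e) * P l z)" by (rule smooth_on_mult[OF open_Om smooth_on_of_real[OF open_Om r] smooth_P])
  thus ?thesis by (simp add: ddc_coef_def[abs_def] Inr p)
 qed
qed

lemma field_expand:
 assumes w: "w : Om" and z: "z : Om" and s: "s = 0 | 2 <= CARD('n)"
 shows "of_real (tt z) * form_power (almet w (s / (real CARD('n) - 1)) kk z) (CARD('n) - 1) vs
  = (SUM i:ddc_idx. ddc_coef tt kk w i z * form_of (ddc_ext s i) vs)" proof -
 let ?W = "Ext (om z)"
 have "scal (of_real (tt z)) * (?W ^ (CARD('n) - 1) - scal (of_real (s * kk (qw w z))) * (tw w z * ?W ^ (CARD('n) - 2)))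
  = (SUM l:pidx (CARD('n) - 1). scal (of_real (tt z) * P l z) * pform l) +
 (SUM c:Basis. SUM e:Basis. SUM l:pidx (CARD('n) - 2). scal (of_real (tt z * kk (qw w z) * ecoef w z c e) * P l z) * (scal (- of_real s) * (xi c * xi e * pform l)))"
 proof -
  have 1: "scal (of_real (tt z)) * ?W ^ (CARD('n) - 1) = (SUM l:pidx (CARD('n) - 1). scal (of_real (tt z) * P l z) * pform l)"
  unfolding om_power[OF z] sum_distrib_left by (simp add: scal_mult_assoc)
  have 2: "tw w z * ?W ^ (CARD('n) - 2) = (SUM c:Basis. SUM e:Basis. SUM l:pidx (CARD('n) - 2). scal (of_real (ecoef w z c e) * P l z) * (xi c * xi e * pform l))"
  unfolding om_power[OF z] tw_expand[OF w] sum_distrib_right unfolding sum_distrib_left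
  by (intro sum.cong refl) (simp only: scal_mult mult.assoc scal_left_commute[of "xi _"])
  have 3: "scal (of_real (tt z)) * (scal (of_real (s * kk (qw w z))) * (tw w z * ?W ^ (CARD('n) - 2))) =
  - (SUM c:Basis. SUM e:Basis. SUM l:pidx (CARD('n) - 2). scal (of_real (tt z * kk (qw w z) * ecoef w z c e) * P l z) * (scal (- of_real s) * (xi c * xi e * pform l)))"
  unfolding 2 sum_distrib_left sum_negf[symmetric] scal_mult_assoc by (intro sum.cong refl) (simp add: scal_minus mult_ac)
  show ?thesis unfolding right_diff_distrib 1 3 by simp
 qed
 also have "... = (SUM i:ddc_idx. scal (ddc_coef tt kk w i z) * ddc_ext s i)" unfolding sum_ddc_idx by (simp add: ddc_coef_def ddc_ext_def)
 finally have eq: "scal (of_real (tt z)) * Ext (form_power (almet w (s / (real CARD('n) - 1)) kk z) (CARD('n) - 1))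
  = (SUM i:ddc_idx. scal (ddc_coef tt kk w i z) * ddc_ext s i)" by (simp only: Ext_form_power almet_top_power[OF w s])
 show ?thesis using arg_cong[OF eq, of "%a. form_of a vs"] by simp
qed

lemma ddc_top:
 assumes w: "w : Om" and z: "z : Om" and s: "s = 0 | 2 <= CARD('n)"
  and kk: "smooth_on UNIV kk" and tt: "smooth_on UNIV tt"
 shows "top_coeff (ddc (%y vs. of_real (tt y) * form_power (almet w (s / (real CARD('n) - 1)) kk y) (CARD('n) - 1) vs) z)
  = TT tt s kk w z" (is "top_coeff ?A = _")
  and "TT tt s kk w z = Re (SUM i:ddc_idx. topc (ddc_fun (ddc_coef tt kk w i) z * ddc_ext s i))" proof -
 let ?F = "%y vs. of_real (tt y) * form_power (almet w (s / (real CARD('n) - 1)) kk y) (CARD('n) - 1) vs"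
 have C2: "C_k_on 2 Om (ddc_coef tt kk w i)" for i using smooth_ddc_coef[OF w kk tt] by (simp add: smooth_on_def)
 have E: "Ext (ddc ?F z) = (SUM i:ddc_idx. ddc_fun (ddc_coef tt kk w i) z * ddc_ext s i)"
  by (rule ddc_combination[OF open_Om z field_expand[OF w _ s] C2 finite_ddc_idx])
 have real: "real_ext (Ext (ddc ?F z))"
 proof (rule ddc_real[OF open_Om z field_expand[OF w _ s] C2 finite_ddc_idx])
  fix y vs assume y: "y : Om"
  have "real_ext (Ext (almet w (s / (real CARD('n) - 1)) kk y) ^ (CARD('n) - 1))" by (intro real_ext_power real_almet w y)
  thus "?F y vs : \<real>" unfolding Ext_form_power[symmetric] by (simp add: real_ext_def)
 qed
 have hom: "homog (2 * CARD('n)) (Ext (ddc ?F z))" unfolding E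
 proof (rule homog_sum)
  fix i assume i: "i : ddc_idx"
  have n1: "CARD('n) >= 1" using zero_less_card_finite[where 'a='n] by linarith
  show "homog (2 * CARD('n)) (ddc_fun (ddc_coef tt kk w i) z * ddc_ext s i)" proof (cases i)
  case (Inl l)
  hence "l : pidx (CARD('n) - 1)" using i by auto
  note l = this
  show ?thesis unfolding Inl ddc_ext_def sum.case by (rule homog_mult'[OF homog_ddc_fun homog_pform[OF l]]) (use n1 in linarith)
  next
  case (Inr p)
  obtain c e l where p: "p = (c, e, l)" by (cases p) auto
  hence l: "l : pidx (CARD('n) - 2)" using i Inr by auto
  show ?thesis proof (cases "s = 0")
  case True
  thus ?thesis by (simp add: Inr p ddc_ext_def)
  next
  case False
  hence n2: "2 <= CARD('n)" using s by simp
  have "homog (1 + 1 + 2 * (CARD('n) - 2)) (xi c * xi e * pform l)" by (intro homog_mult homog_xi homog_pform[OF l])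
  note h = this
  show ?thesis unfolding Inr p ddc_ext_def sum.case prod.case by (rule homog_mult'[OF homog_ddc_fun homog_scal[OF h]]) (use n2 in linarith)
  qed
  qed
 qed
 show T: "TT tt s kk w z = Re (SUM i:ddc_idx. topc (ddc_fun (ddc_coef tt kk w i) z * ddc_ext s i))" proof -
  have "topc (ddc_fun (ddc_coef tt kk w (Inr (c, e, l))) z * ddc_ext s (Inr (c, e, l))) =
  - of_real s * topc (ddc_fun (%z. of_real (tt z * kk (qw w z) * ecoef w z c e) * P l z) z * (xi c * xi e * pform l))" for c e l
  unfolding ddc_ext_def sum.case prod.case scal_left_commute[of "ddc_fun _ _"] topc_simps by (simp add: ddc_coef_def[abs_def])
  moreover have "topc (ddc_fun (ddc_coef tt kk w (Inl l)) z * ddc_ext s (Inl l)) = topc (ddc_fun (%z. of_real (tt z) * P l z) z * pform l)" for l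
  by (simp add: ddc_ext_def ddc_coef_def[abs_def])
  ultimately show ?thesis unfolding sum_ddc_idx TT_def Lop_def Mop_def by (simp only: sum_distrib_left[symmetric]) simp
 qed
 show "top_coeff ?A = TT tt s kk w z" unfolding top_coeff_eq[OF hom real] T unfolding E topc_sum ..
qed

text \<open>The coefficient functions have compact support in the chart and extend by zero; each
  term is then a derivative of a smooth compactly supported function. The vanishing integral is what
  allows a constant to be subtracted from \<open>ph\<close>.\<close>

lemma TT_extend:
 assumes w: "w : Om" and s: "s = 0 | 2 <= CARD('n)" and kk: "smooth_on UNIV kk" and tt: "test_function_on Om tt"
 shows "EX T. continuous_on UNIV T & (ALL z:Om. T z = TT tt s kk w z) & (ALL z. z ~: closure {z. tt z ~= 0} --> T z = 0)
  & integrable lborel T & integral\<^sup>L lborel T = 0" proof -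
 let ?C = "closure {z. tt z ~= 0}"
 have C: "compact ?C" "?C \<subseteq> Om" and tts: "smooth_on UNIV tt" using tt by (auto simp: test_function_on_def)
 have tt0: "tt z = 0" if "z ~: ?C" for z using that closure_subset[of "{z. tt z ~= 0}"] by auto
 define F where "F i z = (if z : Om then ddc_coef tt kk w i z else 0)" for i z
 have F0: "F i z = 0" if "z ~: ?C" for i z using tt0[OF that] by (auto simp: F_def ddc_coef_def split: sum.split)
 have Fs: "smooth_on UNIV (F i)" for i
 proof (rule smooth_on_extend_zero[OF open_Om _ C(2)])
  show "smooth_on Om (F i)" by (rule smooth_on_cong[OF open_Om _ smooth_ddc_coef[OF w kk tts]]) (simp add: F_def)
 qed (use F0 in auto)
 have D0: "FD (F i) z b = 0" if "z ~: ?C" for i z b proof -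
  have "FD (F i) z = FD (%_. 0) z" by (rule frechet_derivative_cong_open[of "- ?C"]) (use F0 that in auto)
  thus ?thesis by simp
 qed
 have D2s: "continuous_on UNIV (D2 (F i) a b)" for i a b unfolding D2_def[abs_def] by (intro smooth_on_continuous smooth_on_frechet Fs)
 have D2F: "D2 (F i) a b z = D2 (ddc_coef tt kk w i) a b z" if "z : Om" for i a b z unfolding D2_def
 proof (rule fun_cong[OF frechet_derivative_cong_open[OF open_Om that]])
  fix y assume y: "y : Om"
  show "FD (F i) y b = FD (ddc_coef tt kk w i) y b" by (rule fun_cong[OF frechet_derivative_cong_open[OF open_Om y]]) (simp add: F_def)
 qed
 have D20: "D2 (F i) a b z = 0" if "z ~: ?C" for i a b z proof -
  have "FD (%y. FD (F i) y b) z = FD (%_. 0) z" by (rule frechet_derivative_cong_open[of "- ?C"]) (use D0 that in auto)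
  thus ?thesis by (simp add: D2_def)
 qed
 have D2i: "integrable lborel (D2 (F i) a b)" "integral\<^sup>L lborel (D2 (F i) a b) = 0" for i a b
  using integral_derivative_zero[OF smooth_on_frechet[OF Fs[of i], of b] C(1) D0, of a] by (auto simp: D2_def[abs_def])
 define T where "T z = Re (SUM i:ddc_idx. topc (ddc_fun (F i) z * ddc_ext s i))" for z
 have Tex: "T z = Re (SUM i:ddc_idx. SUM a:Basis. SUM b:Basis. - D2 (F i) a (\<i> *s b) z * topc (xi a * xi b * ddc_ext s i))" for z
  by (simp add: T_def topc_ddc_fun)
 have "continuous_on UNIV T" unfolding Tex by (intro continuous_intros D2s)
 moreover have "T z = TT tt s kk w z" if "z : Om" for z unfolding ddc_top(2)[OF w that s kk tts] Tex topc_ddc_fun D2F[OF that] ..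
 moreover have "T z = 0" if "z ~: ?C" for z unfolding Tex using D20[OF that] by simp
 moreover have i: "integrable lborel (%z. SUM i:ddc_idx. SUM a:Basis. SUM b:Basis. - D2 (F i) a (\<i> *s b) z * topc (xi a * xi b * ddc_ext s i))"
  by (intro Bochner_Integration.integrable_sum integrable_mult_left integrable_minus D2i)
 moreover have "integral\<^sup>L lborel (%z. SUM i:ddc_idx. SUM a:Basis. SUM b:Basis. - D2 (F i) a (\<i> *s b) z * topc (xi a * xi b * ddc_ext s i)) = 0"
  by (subst Bochner_Integration.integral_sum, (intro Bochner_Integration.integrable_sum integrable_mult_left integrable_minus D2i)[1])+
  (simp add: D2i)
 ultimately show ?thesis using integrable_Re[OF i] integral_Re[OF i] unfolding Tex[symmetric] by auto
qed

lemma real_integrable_compact: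
 assumes "loc_integrable_on Om ph" "compact C" "C \<subseteq> Om"
 shows "integrable lebesgue (%z. indicator C z * rl (ph z))" proof -
 have C: "C : sets lebesgue" using assms(2) by (simp add: compact_imp_closed)
 have "(%z. rl (ph z)) : borel_measurable (restrict_space lebesgue Om)" using assms(1) by (auto simp: loc_integrable_on_def)
 hence "(%z. rl (ph z)) : borel_measurable (restrict_space lebesgue C)" by (rule measurable_restrict_mono) (rule assms(3))
 hence m: "(%z. indicator C z *\<^sub>R rl (ph z)) : borel_measurable lebesgue"
  using borel_measurable_restrict_space_iff[of C lebesgue "%z. rl (ph z)"] C by simp
 have "(\<integral>\<^sup>+z. ennreal (norm (indicator C z *\<^sub>R rl (ph z))) \<partial>lebesgue) <= (\<integral>\<^sup>+z\<in>C. e2ennreal (abs (ph z)) \<partial>lebesgue)"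
 proof (rule nn_integral_mono)
  fix z
  have "ennreal (abs (rl (ph z))) <= e2ennreal (abs (ph z))" by (cases "ph z") auto
  thus "ennreal (norm (indicator C z *\<^sub>R rl (ph z))) <= e2ennreal (abs (ph z)) * indicator C z" by (auto simp: indicator_def)
 qed
 also have "... < \<infinity>" using assms by (auto simp: loc_integrable_on_def)
 finally have "integrable lebesgue (%z. indicator C z *\<^sub>R rl (ph z))" using m by (intro integrableI_bounded) auto
 thus ?thesis by simp
qed

text \<open>What is subtracted from omega^n is a nonnegative multiple of the trace of the rank-one
  form.\<close>

lemma top_product_le:
 assumes w: "w : Om" and z: "z : Om" and ok: "weight_ok w ep kk" and s: "0 <= s" "s = 0 | 2 <= CARD('n)"
 shows "top_coeff (wedge (om z) (form_power (almet w (s / (real CARD('n) - 1)) kk z) (CARD('n) - 1))) <= vol0 z" proof -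
 let ?W = "Ext (om z)" and ?F = "wedge (om z) (form_power (almet w (s / (real CARD('n) - 1)) kk z) (CARD('n) - 1))"
 have n1: "CARD('n) = Suc (CARD('n) - 1)" using zero_less_card_finite[where 'a='n] by linarith
 have E0: "Ext ?F = ?W * Ext (almet w (s / (real CARD('n) - 1)) kk z) ^ (CARD('n) - 1)" by (simp add: Ext_wedge Ext_form_power)
 have E: "Ext ?F = ?W ^ CARD('n) - scal (of_real (s * kk (qw w z))) * (tw w z * ?W ^ (CARD('n) - 1))" proof -
  have "?W * ?W ^ (CARD('n) - 1) = ?W ^ CARD('n)" using n1 by (metis power_Suc)
  moreover have "scal (of_real (s * kk (qw w z))) * (?W * (tw w z * ?W ^ (CARD('n) - 2))) = scal (of_real (s * kk (qw w z))) * (tw w z * ?W ^ (CARD('n) - 1))"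
  proof (cases "s = 0")
  case False
  hence "CARD('n) - 1 = Suc (CARD('n) - 2)" using s(2) by linarith
  moreover have "?W * (tw w z * ?W ^ (CARD('n) - 2)) = tw w z * (?W * ?W ^ (CARD('n) - 2))"
  by (simp only: mult.assoc[symmetric] homog2_commute[OF homog_om[OF z], of "tw w z"])
  ultimately show ?thesis by (simp only: power_Suc)
  qed simp
  ultimately show ?thesis unfolding E0 almet_top_power[OF w s(2)] right_diff_distrib scal_left_commute[of ?W] by simp
 qed
 have hom: "homog (2 * CARD('n)) (Ext ?F)" unfolding E0 by (rule homog_mult'[OF homog_om[OF z] homog_power[OF homog_almet[OF w z]]]) (use n1 in linarith)
 have real: "real_ext (Ext ?F)" unfolding E0 by (intro real_ext_mult real_ext_power real_om real_almet w z)
 have "Re (topc (Ext ?F)) <= vol0 z" proof (cases "kk (qw w z) = 0")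
  case True
  thus ?thesis unfolding E by (simp add: vol0_def)
 next
  case False
  hence "!!v. HH w v v <= (1 + ep) * HH z v v" using ok by (simp add: weight_ok_def)
  from topc_tw[OF w z this] obtain N where N: "topc (tw w z * ?W ^ (CARD('n) - 1)) = of_real (N * vol0 z)" "0 <= N" by blast
  have "kk (qw w z) >= 0" using ok by (simp add: weight_ok_def)
  hence "s * kk (qw w z) * (N * vol0 z) >= 0" using N(2) s(1) vol0_pos[OF z] by simp
  thus ?thesis unfolding E topc_simps N by (simp add: vol0_def)
 qed
 thus ?thesis unfolding top_coeff_eq[OF hom real] .
qed

text \<open>The distributional inequality in usable form: omega wedge alpha^(n-1) is enlarged to
  omega^n, and \<open>ph\<close> becomes \<open>ph - A\<close> because \<open>TT\<close> has
  integral zero. With \<open>A - ph >= 1\<close>, pointwise lower bounds for \<open>TT\<close> can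
  be multiplied by it and integrated.\<close>

lemma key_inequality:
 assumes w: "w : Om" and ok: "weight_ok w ep kk" and sg: "sigma_ok m s ep"
  and sub: "omega_m_subharmonic_on m om Om ph" and loc: "loc_integrable_on Om ph"
  and tt: "test_function_on Om tt" "!!z. 0 <= tt z"
 shows "integrable lebesgue (%z. indicator Om z * (tt z * vol0 z))"
  and "integrable lebesgue (%z. indicator Om z * ((rl (ph z) - A) * TT tt s kk w z))"
  and "0 <= (LINT z|lebesgue. indicator Om z * (tt z * vol0 z))
  + (LINT z|lebesgue. indicator Om z * ((rl (ph z) - A) * TT tt s kk w z))" proof -
 have s: "0 <= s" "s = 0 | 2 <= CARD('n)" using sg by (auto simp: sigma_ok_def)
 have kk: "smooth_on UNIV kk" using ok by (simp add: weight_ok_def)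
 let ?a = "almet w (s / (real CARD('n) - 1)) kk"
 let ?C = "closure {z. tt z ~= 0}"
 have C: "compact ?C" "?C \<subseteq> Om" and tts: "smooth_on UNIV tt" using tt by (auto simp: test_function_on_def)
 have tt0: "tt z = 0" if "z ~: ?C" for z using that closure_subset[of "{z. tt z ~= 0}"] by auto
 have comp: "integrable lebesgue (%z. indicator ?C z *\<^sub>R f z)" if "continuous_on ?C f" for f :: "_ => real"
  using borel_integrable_compact[OF C(1) that] by (simp add: integrable_completion)
 have "integrable lebesgue (%z. indicator ?C z *\<^sub>R (tt z * vol0 z))" by (intro comp continuous_intros continuous_on_subset[OF vol0_continuous C(2)]
  continuous_on_subset[OF smooth_on_continuous[OF tts]]) auto
 moreover have "(%z. indicator ?C z *\<^sub>R (tt z * vol0 z)) = (%z. indicator Om z * (tt z * vol0 z))"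
 proof (rule HOL.ext)
  fix z show "indicator ?C z *\<^sub>R (tt z * vol0 z) = indicator Om z * (tt z * vol0 z)" proof (cases "z : ?C")
  case True
  hence "z : Om" using C(2) by blast
  thus ?thesis using True by simp
  next
  case False
  thus ?thesis using tt0[OF False] by simp
  qed
 qed
 ultimately show i1: "integrable lebesgue (%z. indicator Om z * (tt z * vol0 z))" by simp
 obtain T where T: "continuous_on UNIV T" "!!z. z : Om ==> T z = TT tt s kk w z" "!!z. z ~: ?C ==> T z = 0"
  "integrable lborel T" "integral\<^sup>L lborel T = 0" using TT_extend[OF w s(2) kk tt(1)] by blast
 have eq: "indicator Om z * (r * TT tt s kk w z) = r * T z" for r z proof (cases "z : Om")
  case True
  thus ?thesis using T(2)[OF True] by simp
 next
  case False
  hence "z ~: ?C" using C(2) by blast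
  thus ?thesis using False T(3) by simp
 qed
 have eq': "indicator Om z * ((rl (ph z) - A) * TT tt s kk w z) = rl (ph z) * T z - A * T z" for z
  using eq[of z "rl (ph z) - A"] by (simp only: left_diff_distrib)
 have iT: "integrable lebesgue T" "integral\<^sup>L lebesgue T = 0" using T by (auto simp: integrable_completion integral_completion)
 have iph: "integrable lebesgue (%z. rl (ph z) * T z)" proof -
  obtain B where B: "ALL x:T ` ?C. norm x <= B"
  using compact_imp_bounded[OF compact_continuous_image[OF continuous_on_subset[OF T(1)] C(1)]] by (auto simp: bounded_iff)
  have "integrable lebesgue (%z. T z * (indicator ?C z * rl (ph z)))"
  proof (rule Bochner_Integration.integrable_bound)
  show "integrable lebesgue (%z. B * (indicator ?C z * rl (ph z)))" by (rule integrable_mult_right) (rule real_integrable_compact[OF loc C])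
  show "(%z. T z * (indicator ?C z * rl (ph z))) : borel_measurable lebesgue"
  by (rule borel_measurable_times[OF borel_measurable_integrable[OF iT(1)] borel_measurable_integrable[OF real_integrable_compact[OF loc C]]])
  show "AE z in lebesgue. norm (T z * (indicator ?C z * rl (ph z))) <= norm (B * (indicator ?C z * rl (ph z)))"
  proof (rule AE_I2)
  fix z
  show "norm (T z * (indicator ?C z * rl (ph z))) <= norm (B * (indicator ?C z * rl (ph z)))" proof (cases "z : ?C")
  case True
  hence "norm (T z) <= B" using B by blast
  hence "abs (T z) <= abs B" by simp
  thus ?thesis unfolding real_norm_def abs_mult by (rule mult_right_mono) (intro mult_nonneg_nonneg abs_ge_zero)
  qed simp
  qed
  qed
  moreover have "T z * (indicator ?C z * rl (ph z)) = rl (ph z) * T z" for z using T(3)[of z] by (cases "z : ?C") auto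
  ultimately show ?thesis by simp
 qed
 show "integrable lebesgue (%z. indicator Om z * ((rl (ph z) - A) * TT tt s kk w z))"
  unfolding eq' by (intro Bochner_Integration.integrable_diff iph integrable_mult_right iT)
 have I2: "(LINT z|lebesgue. indicator Om z * ((rl (ph z) - A) * TT tt s kk w z)) = (LINT z|lebesgue. rl (ph z) * T z)" unfolding eq' using iph iT by simp
 have "ddc_distrib_nonneg om ?a Om ph" using admissible[OF w ok sg sub] by (simp add: omega_subharmonic_wrt_def)
 hence "0 <= (LINT z:Om|lebesgue. tt z * top_coeff (wedge (om z) (form_power (?a z) (CARD('n) - 1)))) +
  (LINT z:Om|lebesgue. rl (ph z) *
  top_coeff (ddc (%y vs. of_real (tt y) * form_power (?a y) (CARD('n) - 1) vs) z))" using tt unfolding ddc_distrib_nonneg_def by blast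
 also have "(LINT z:Om|lebesgue. tt z * top_coeff (wedge (om z) (form_power (?a z) (CARD('n) - 1)))) <= (LINT z|lebesgue. indicator Om z * (tt z * vol0 z))"
  unfolding set_lebesgue_integral_def
 proof (rule integral_mono'[OF i1])
  fix z
  show "indicator Om z *\<^sub>R (tt z * top_coeff (wedge (om z) (form_power (?a z) (CARD('n) - 1)))) <= indicator Om z * (tt z * vol0 z)"
  using top_product_le[OF w _ ok s] tt(2) by (auto simp: indicator_def mult_left_mono)
  show "0 <= indicator Om z * (tt z * vol0 z)" using tt(2)[of z] vol0_pos[of z] by (auto simp: indicator_def)
 qed
 also have "(LINT z:Om|lebesgue. rl (ph z) * top_coeff (ddc (%y vs. of_real (tt y) * form_power (?a y) (CARD('n) - 1) vs) z))
  = (LINT z|lebesgue. rl (ph z) * T z)" unfolding set_lebesgue_integral_def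
 proof (rule Bochner_Integration.integral_cong[OF refl])
  fix z
  show "indicator Om z *\<^sub>R (rl (ph z) * top_coeff (ddc (%y vs. of_real (tt y) * form_power (?a y) (CARD('n) - 1) vs) z)) = rl (ph z) * T z"
  proof (cases "z : Om")
  case True
  thus ?thesis using ddc_top(1)[OF w True s(2) kk tts] T(2)[OF True] by simp
  next
  case False
  thus ?thesis using T(3)[of z] C(2) by auto
  qed
 qed
 finally show "0 <= (LINT z|lebesgue. indicator Om z * (tt z * vol0 z))
  + (LINT z|lebesgue. indicator Om z * ((rl (ph z) - A) * TT tt s kk w z))" unfolding I2 by simp
qed

end

section \<open>Decay of the mass on small balls\<close>

definition profile :: "(real => real) => (real => real) => (real => real) => bool" where
 "profile F F' F'' \<longleftrightarrow> smooth_on {0<..} F & (ALL u>0. (F has_real_derivative F' u) (at u)) &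
  (ALL u>0. (F' has_real_derivative F'' u) (at u))"

lemma smooth_on_affine: "smooth_on UNIV (%x::real. a + b * x)" by (intro smooth_on_add smooth_on_cmult smooth_on_linear[OF bounded_linear_ident]) auto

lemma smooth_on_deriv:
 fixes g :: "real => real"
 assumes "open T" "smooth_on T g"
 shows "EX g'. smooth_on T g' & (ALL x:T. (g has_real_derivative g' x) (at x))"
proof (intro exI conjI ballI)
 show "smooth_on T (%x. FD g x 1)" by (rule smooth_on_frechet[OF assms(2)])
 fix x assume x: "x : T"
 have D: "(g has_derivative FD g x) (at x)" by (rule smooth_on_has_derivative[OF assms(2) x])
 have "FD g x = (*) (FD g x 1)"
 proof
  fix h show "FD g x h = FD g x 1 * h" using linear_cmul[OF has_derivative_linear[OF D], of h 1] by (simp add: mult.commute)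
 qed
 with D show "(g has_real_derivative FD g x 1) (at x)" unfolding has_field_derivative_def by metis
qed

text \<open>Only arguments \<open>x >= 0\<close> occur, as q is nonnegative, but the operators take
  functions smooth on the whole line. The shifted profile is therefore switched off between
  \<open>- c / 4\<close> and \<open>- c / 2\<close>, where \<open>x + c\<close> is still
  positive.\<close>

lemma smooth_shift_extend:
 assumes F: "smooth_on {0<..} F" and c: "(0::real) < c"
 shows "EX G::real => real. smooth_on UNIV G & (ALL x>=- c / 4. G x = F (x + c)) & ((ALL u>0. 0 <= F u) --> (ALL x. 0 <= G x))" proof -
 obtain py :: "real => real" where py: "smooth_on UNIV py" "!!x. x <= 1 ==> py x = 1" "!!x. x >= 2 ==> py x = 0" "!!x. 0 <= py x" using smooth_cutoff by blast
 define G where "G x = (if x > - c then py (0 + (- 4 / c) * x) * F (c + 1 * x) else 0)" for x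
 have "smooth_on {-c<..} G"
 proof (rule smooth_on_cong)
  show "smooth_on {-c<..} (%x. py (0 + (- 4 / c) * x) * F (c + 1 * x))"
  by (intro smooth_on_mult smooth_on_compose_real[OF _ _ _ py(1)] smooth_on_compose_real[OF _ _ _ F]
  smooth_on_subset[OF smooth_on_affine]) auto
 qed (auto simp: G_def)
 hence "smooth_on UNIV G"
 proof (rule smooth_on_extend_zero[of "{-c<..}" "{-c/2..}", rotated 3])
  fix x assume "x ~: {- c / 2..}"
  hence "- 4 / c * x >= 2" using c by (simp add: field_simps)
  thus "G x = 0" using py(3)[of "0 + (- 4 / c) * x"] by (simp add: G_def)
 qed (use c in auto)
 moreover have "G x = F (x + c)" if "x >= - c / 4" for x proof -
  have "0 + - 4 / c * x <= 1" "x > - c" using c that by (auto simp: field_simps)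
  thus ?thesis using py(2)[of "0 + - 4 / c * x"] by (simp add: G_def add.commute)
 qed
 moreover have "0 <= G x" if "ALL u>0. 0 <= F u" for x using that py(4) by (auto simp: G_def)
 ultimately show ?thesis by blast
qed

lemma profile_shift:
 assumes pr: "profile F F' F''" and c: "0 < c"
 obtains G G' G'' where "smooth_on UNIV G" "!!x. (G has_real_derivative G' x) (at x)"
  "!!x. (G' has_real_derivative G'' x) (at x)"
  "!!x. x >= 0 ==> G x = F (x + c)" "!!x. x >= 0 ==> G' x = F' (x + c)" "!!x. x >= 0 ==> G'' x = F'' (x + c)"
  "(ALL u>0. 0 <= F u) --> (ALL x. 0 <= G x)" proof -
 obtain G where G: "smooth_on UNIV G" "!!x. x >= - c / 4 ==> G x = F (x + c)" "(ALL u>0. 0 <= F u) --> (ALL x. 0 <= G x)"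
  using smooth_shift_extend[of F c] pr c unfolding profile_def by blast
 obtain G' where G': "smooth_on UNIV G'" "!!x. (G has_real_derivative G' x) (at x)" using smooth_on_deriv[OF open_UNIV G(1)] by auto
 obtain G'' where G'': "!!x. (G' has_real_derivative G'' x) (at x)" using smooth_on_deriv[OF open_UNIV G'(1)] by auto
 have sh: "((%x. H (x + c)) has_real_derivative H' (x + c)) (at x)"
  if "!!u. u > 0 ==> (H has_real_derivative H' u) (at u)" "x > - c" for H H' x using that(1)[of "x + c"] that(2) by (intro DERIV_shift[THEN iffD1]) simp
 have 1: "G' x = F' (x + c)" if "x > - c / 4" for x
 proof (rule DERIV_unique[OF G'(2)])
  have "((%x. F (x + c)) has_real_derivative F' (x + c)) (at x)" by (rule sh) (use pr c that in \<open>auto simp: profile_def\<close>)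
  thus "(G has_real_derivative F' (x + c)) (at x)" by (rule has_field_derivative_transform_within_open[of _ _ _ "{- c / 4<..}"]) (use that G(2) in auto)
 qed
 have 2: "G'' x = F'' (x + c)" if "x > - c / 4" for x
 proof (rule DERIV_unique[OF G''])
  have "((%x. F' (x + c)) has_real_derivative F'' (x + c)) (at x)" by (rule sh) (use pr c that in \<open>auto simp: profile_def\<close>)
  thus "(G' has_real_derivative F'' (x + c)) (at x)" by (rule has_field_derivative_transform_within_open[of _ _ _ "{- c / 4<..}"]) (use that 1 in auto)
 qed
 show thesis by (rule that[OF G(1) G'(2) G'']) (use G 1 2 c in auto)
qed

context chart_compact
begin

lemma norm_le_sqrt_qw: "EX M>=1. ALL w:K. ALL z c. 0 <= c --> norm (z - w) <= M * sqrt (qw w z + c)" proof -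
 obtain c0 where c0: "c0 > 0" "!!z v. z : Kd ==> c0 * (norm v)^2 <= HH z v v" using HH_coercive by blast
 have "norm (z - w) <= max 1 (sqrt (2 / c0)) * sqrt (qw w z + c)" if "w : K" "0 <= c" for w z c proof -
  have "c0 * (norm (z - w))^2 <= 2 * qw w z" using c0(2)[of w "z - w"] that K_sub by (auto simp: qw_def)
  hence "(norm (z - w))^2 <= (2 / c0) * (qw w z + c)" using c0(1) that by (simp add: field_simps add_increasing2)
  hence "norm (z - w) <= sqrt (2 / c0) * sqrt (qw w z + c)" by (metis norm_ge_zero real_sqrt_le_mono real_sqrt_mult real_sqrt_abs abs_norm_cancel)
  also have "... <= max 1 (sqrt (2 / c0)) * sqrt (qw w z + c)" using that qw_nonneg[of w z] K_sub by (intro mult_right_mono) auto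
  finally show ?thesis .
 qed
 thus ?thesis by (intro exI[of _ "max 1 (sqrt (2 / c0))"]) auto
qed

lemma qw_le_norm: "EX M>=1. ALL w:K. ALL z. qw w z <= M * (norm (z - w))^2" proof -
 obtain CH where CH: "CH >= 1" "!!z u v. z : Kd ==> abs (HH z u v) <= CH * norm u * norm v" using HH_bound by blast
 have "qw w z <= CH * (norm (z - w))^2" if "w : K" for w z proof -
  have "abs (HH w (z - w) (z - w)) <= CH * norm (z - w) * norm (z - w)" using CH(2) that K_sub by blast
  moreover have "0 <= CH * (norm (z - w))^2" using CH(1) by simp
  ultimately show ?thesis by (simp add: qw_def power2_eq_square)
 qed
 thus ?thesis using CH(1) by blast
qed

text \<open>The estimates of both operators in terms of u = q + c, with the distance to
  \<open>w\<close> replaced by a multiple of \<open>sqrt u\<close>. The constant is uniform in the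
  centre, the shift and the profiles, because later profiles depend on the scale.\<close>

definition TT_bound where
 "TT_bound s C \<longleftrightarrow> 0 <= C & (ALL w:K. ALL z c F F' F'' B B' B'' tt kk. dist w z <= d --> 0 < c --> profile F F' F'' --> profile B B' B'' -->
  (ALL z. tt z = F (qw w z + c)) --> (ALL z. tt z * kk (qw w z) = B (qw w z + c)) -->
  (let q = qw w z; u = q + c in
  abs (TT tt s kk w z - 2 * vol0 w * (F' u + F'' u * q / CARD('n) + s * (B u + B' u * q / CARD('n))))
  <= C * (weighted1 F' F'' u + abs (F u) + s * (weighted2 B B' B'' u))))"

lemma TT_boundD:
 assumes "TT_bound s C" "w : K" "dist w z <= d" "0 < c" "profile F F' F''" "profile B B' B''"
  and "!!z. tt z = F (qw w z + c)" "!!z. tt z * kk (qw w z) = B (qw w z + c)" and "q = qw w z" "u = q + c"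
 shows "abs (TT tt s kk w z - 2 * vol0 w * (F' u + F'' u * q / CARD('n) + s * (B u + B' u * q / CARD('n))))
  <= C * (weighted1 F' F'' u + abs (F u) + s * (weighted2 B B' B'' u))"
 using assms(1)[unfolded TT_bound_def Let_def, THEN conjunct2, rule_format, OF assms(2-8)] unfolding assms(9,10) .

lemma TT_estimate:
 assumes s: "0 <= s" "s = 0 | 2 <= CARD('n)"
 shows "EX C. TT_bound s C" proof -
 obtain M where M: "M >= 1" "!!w z c. w : K ==> 0 <= c ==> norm (z - w) <= M * sqrt (qw w z + c)" using norm_le_sqrt_qw by blast
 obtain CL where CL: "CL >= 0" "!!w z g g' g''. w : K ==> dist w z <= d ==> smooth_on UNIV g ==> (!!x. (g has_real_derivative g' x) (at x)) ==>
  (!!x. (g' has_real_derivative g'' x) (at x)) ==>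
  abs (Re (Lop (%z. g (qw w z)) z) - 2 * vol0 w * (g' (qw w z) + g'' (qw w z) * qw w z / CARD('n)))
  <= CL * (norm (z - w) * (abs (g' (qw w z)) + (norm (z - w))^2 * abs (g'' (qw w z))) + abs (g (qw w z)))" using Lop_estimate by blast
 \<comment> \<open>For \<open>n = 1\<close> the second operator has no estimate, but then
   \<open>s = 0\<close> and it does not enter.\<close>
 have "EX CM>=0. s = 0 | (ALL w z g g' g''. w : K --> dist w z <= d --> smooth_on UNIV g --> (ALL x. (g has_real_derivative g' x) (at x)) -->
  (ALL x. (g' has_real_derivative g'' x) (at x)) -->
  abs (Re (Mop (%c e z. g (qw w z) * ecoef w z c e) z) + 2 * vol0 w * (g (qw w z) + g' (qw w z) * qw w z / CARD('n)))
  <= CM * (norm (z - w) * (abs (g (qw w z)) + (norm (z - w))^2 * abs (g' (qw w z)) + (norm (z - w)) ^ 4 * abs (g'' (qw w z)))))" proof (cases "s = 0")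
  case False
  hence "2 <= CARD('n)" using s by simp
  from Mop_estimate[OF this] show ?thesis by blast
 qed (auto intro: exI[of _ 0])
 then obtain CM where CM: "CM >= 0" "!!w z g g' g''. s ~= 0 ==> w : K ==> dist w z <= d ==> smooth_on UNIV g ==> (!!x. (g has_real_derivative g' x) (at x)) ==>
  (!!x. (g' has_real_derivative g'' x) (at x)) ==>
  abs (Re (Mop (%c e z. g (qw w z) * ecoef w z c e) z) + 2 * vol0 w * (g (qw w z) + g' (qw w z) * qw w z / CARD('n)))
  <= CM * (norm (z - w) * (abs (g (qw w z)) + (norm (z - w))^2 * abs (g' (qw w z)) + (norm (z - w)) ^ 4 * abs (g'' (qw w z))))" by blast
 define C where "C = CL * M ^ 3 + CM * M ^ 5"
 have C0: "C >= 0" using CL(1) CM(1) M(1) by (simp add: C_def)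
 have "abs (TT tt s kk w z - 2 * vol0 w * (F' u + F'' u * q / CARD('n) + s * (B u + B' u * q / CARD('n))))
  <= C * (weighted1 F' F'' u + abs (F u) + s * (weighted2 B B' B'' u))"
  if w: "w : K" and z: "dist w z <= d" and c: "0 < c" and F: "profile F F' F''" and B: "profile B B' B''"
  and tt: "!!z. tt z = F (qw w z + c)" and kk: "!!z. tt z * kk (qw w z) = B (qw w z + c)"
  and q: "q = qw w z" "u = q + c" for w z c F F' F'' B B' B'' tt kk q u proof -
  have wOm: "w : Om" using w K_sub by blast
  have q0: "0 <= qw w z" for z by (rule qw_nonneg[OF wOm])
  have u0: "0 < u" "0 <= q" using q0[of z] c q by auto
  define Y where "Y = norm (z - w)"
  have Y: "0 <= Y" "Y <= M * sqrt u" using M(2)[OF w, of c z] c by (auto simp: Y_def q)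
  have "Y^2 <= (M * sqrt u)^2" "Y ^ 4 <= (M * sqrt u) ^ 4" using Y by (auto intro: power_mono)
  hence Y2: "Y^2 <= M^2 * u" and Y4: "Y ^ 4 <= M ^ 4 * u^2" using u0 power_mult[of "sqrt u" 2 2] by (auto simp: power_mult_distrib)
  obtain G G' G'' where G: "smooth_on UNIV G" "!!x. (G has_real_derivative G' x) (at x)"
  "!!x. (G' has_real_derivative G'' x) (at x)"
  "!!x. x >= 0 ==> G x = F (x + c)" "!!x. x >= 0 ==> G' x = F' (x + c)" "!!x. x >= 0 ==> G'' x = F'' (x + c)" by (rule profile_shift[OF F c]) blast
  obtain E E' E'' where E: "smooth_on UNIV E" "!!x. (E has_real_derivative E' x) (at x)"
  "!!x. (E' has_real_derivative E'' x) (at x)"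
  "!!x. x >= 0 ==> E x = B (x + c)" "!!x. x >= 0 ==> E' x = B' (x + c)" "!!x. x >= 0 ==> E'' x = B'' (x + c)" by (rule profile_shift[OF B c]) blast
  have eL: "tt = (%z. G (qw w z))" using G(4) q0 tt by (intro HOL.ext) simp
  have eM: "(%c e z. tt z * kk (qw w z) * ecoef w z c e) = (%c e z. E (qw w z) * ecoef w z c e)" unfolding kk using E(4) q0 by (intro HOL.ext) simp
  let ?L = "Re (Lop tt z) - 2 * vol0 w * (F' u + F'' u * q / CARD('n))"
  let ?M = "Re (Mop (%c e z. tt z * kk (qw w z) * ecoef w z c e) z) + 2 * vol0 w * (B u + B' u * q / CARD('n))"
  have L: "abs (?L) <= CL * M ^ 3 * (weighted1 F' F'' u + abs (F u))" proof -
  have "abs (?L) <= CL * (Y * (abs (F' u) + Y^2 * abs (F'' u)) + abs (F u))" using CL(2)[OF w z G(1-3)] u0 unfolding eL Y_def by (simp add: G(4-6) q)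
  also have "... <= CL * ((M * sqrt u) * (M^2 * abs (F' u) + (M^2 * u) * abs (F'' u)) + M ^ 3 * abs (F u))"
  proof (intro mult_left_mono add_mono mult_mono Y Y2 CL(1))
  show "abs (F' u) <= M^2 * abs (F' u)" "abs (F u) <= M ^ 3 * abs (F u)" using mult_right_mono[OF one_le_power[OF M(1)] abs_ge_zero] by auto
  qed (use M(1) u0 Y(1) in auto)
  also have "... = CL * M ^ 3 * (weighted1 F' F'' u + abs (F u))" by (simp add: algebra_simps power3_eq_cube power2_eq_square)
  finally show ?thesis .
  qed
  have Mb: "abs (s * ?M) <= CM * M ^ 5 * (s * (weighted2 B B' B'' u))" proof (cases "s = 0")
  case False
  have "abs (?M) <= CM * (Y * (abs (B u) + Y^2 * abs (B' u) + Y ^ 4 * abs (B'' u)))"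
  using CM(2)[OF False w z E(1-3)] u0 unfolding eM Y_def by (simp add: E(4-6) q)
  also have "... <= CM * ((M * sqrt u) * (M ^ 4 * abs (B u) + (M ^ 4 * u) * abs (B' u) + (M ^ 4 * u^2) * abs (B'' u)))"
  proof (intro mult_left_mono add_mono mult_mono Y Y4 CM(1))
  show "abs (B u) <= M ^ 4 * abs (B u)" using mult_right_mono[OF one_le_power[OF M(1)] abs_ge_zero] by auto
  have "M^2 * u <= M ^ 4 * u" using u0 M(1) by (intro mult_right_mono power_increasing) auto
  thus "Y^2 <= M ^ 4 * u" using Y2 by linarith
  qed (use M(1) u0 Y(1) in auto)
  also have "... = CM * M ^ 5 * (weighted2 B B' B'' u)" by (simp add: algebra_simps eval_nat_numeral)
  finally have "s * abs (?M) <= s * (CM * M ^ 5 * (weighted2 B B' B'' u))" by (rule mult_left_mono) (rule s)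
  thus ?thesis using s(1) by (simp add: abs_mult mult_ac)
  qed simp
  let ?X = "weighted1 F' F'' u + abs (F u)" and ?Z = "s * (weighted2 B B' B'' u)"
  have XZ: "0 <= ?X" "0 <= ?Z" using u0 s by auto
  have "TT tt s kk w z - 2 * vol0 w * (F' u + F'' u * q / CARD('n) + s * (B u + B' u * q / CARD('n))) = ?L - s * ?M"
  unfolding TT_def by (simp add: algebra_simps)
  also have "abs (?L - s * ?M) <= CL * M ^ 3 * ?X + CM * M ^ 5 * ?Z" by (rule order_trans[OF abs_triangle_ineq4 add_mono[OF L Mb]])
  also have "... <= C * ?X + C * ?Z" unfolding C_def using XZ CL(1) CM(1) M(1) by (intro add_mono mult_right_mono) auto
  finally show ?thesis by (simp add: algebra_simps)
 qed
 hence "TT_bound s C" unfolding TT_bound_def Let_def using C0 by blast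
 thus ?thesis by blast
qed

end

section \<open>Truncated powers\<close>

definition cutoff :: "real => real" where
 "cutoff = (SOME py. smooth_on UNIV py & (ALL x<=1. py x = 1) & (ALL x>=2. py x = 0) & (ALL x. 0 <= py x & py x <= 1))"

lemma cutoff: "smooth_on UNIV cutoff" "x <= 1 ==> cutoff x = 1" "x >= 2 ==> cutoff x = 0" "0 <= cutoff x" "cutoff x <= 1"
 using someI_ex[OF smooth_cutoff] unfolding cutoff_def[symmetric] by blast+

text \<open>Beyond \<open>ta / 2\<close> only a bound is kept: that region will be charged to a
  fixed multiple of the total mass.\<close>

lemma powr_profile:
 fixes ta b :: real
 assumes ta: "0 < ta"
 defines "F == %u. cutoff (0 + (2 / ta) * u) * u powr b"
 obtains F' F'' C where "profile F F' F''"
  "!!u. 0 < u ==> u < ta / 2 ==> F u = u powr b & F' u = b * u powr (b - 1) & F'' u = b * (b - 1) * u powr (b - 2)"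
  "!!u. u > ta ==> F u = 0 & F' u = 0 & F'' u = 0" "C >= 0" "!!u. u >= ta / 2 ==> abs (F u) <= C & abs (F' u) <= C & abs (F'' u) <= C" proof -
 have F: "smooth_on {0<..} F" unfolding F_def
  by (intro smooth_on_mult smooth_on_compose_real[OF _ _ _ cutoff(1)] smooth_on_powr smooth_on_subset[OF smooth_on_affine]) auto
 obtain F' where F': "smooth_on {0<..} F'" "!!u. u > 0 ==> (F has_real_derivative F' u) (at u)" using smooth_on_deriv[OF _ F] by auto
 obtain F'' where F'': "smooth_on {0<..} F''" "!!u. u > 0 ==> (F' has_real_derivative F'' u) (at u)" using smooth_on_deriv[OF _ F'(1)] by auto
 have pr: "profile F F' F''" using F F' F'' by (simp add: profile_def)
 have uniq: "G' u = H' u" if "open S" "u : S" "!!v. v : S ==> G v = H v" "(G has_real_derivative G' u) (at u)" "(H has_real_derivative H' u) (at u)"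
  for G G' H H' S and u :: real by (rule DERIV_unique[OF that(4)], rule has_field_derivative_transform_within_open[OF that(5) that(1,2)]) (simp add: that(3))
 have s0: "F u = u powr b" if "0 < u" "u < ta / 2" for u using cutoff(2)[of "0 + (2 / ta) * u"] that ta by (simp add: F_def field_simps)
 have s1: "F' u = b * u powr (b - 1)" if "0 < u" "u < ta / 2" for u
  by (rule uniq[of "{0<..<ta/2}" _ F "%u. u powr b"]) (use that s0 F' in \<open>auto intro!: derivative_eq_intros\<close>)
 have s2: "F'' u = b * (b - 1) * u powr (b - 2)" if "0 < u" "u < ta / 2" for u
  by (rule uniq[of "{0<..<ta/2}" _ F' "%u. b * u powr (b - 1)"]) (use that s1 F'' in \<open>auto intro!: derivative_eq_intros\<close>)
 have z0: "F u = 0" if "u > ta" for u using cutoff(3)[of "0 + (2 / ta) * u"] that ta by (simp add: F_def field_simps)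
 have z1: "F' u = 0" if "u > ta" for u by (rule uniq[of "{ta<..}" _ F "%u. 0" _ "%_. 0"]) (use that z0 F' ta in auto)
 have z2: "F'' u = 0" if "u > ta" for u by (rule uniq[of "{ta<..}" _ F' "%u. 0" _ "%_. 0"]) (use that z1 F'' ta in auto)
 have bd: "EX C>=0. ALL u>=ta/2. abs (G u) <= C" if "smooth_on {0<..} G" "!!u. u > ta ==> G u = 0" for G :: "real => real" proof -
  have "bounded (G ` {ta/2..ta})"
  by (intro compact_imp_bounded compact_continuous_image continuous_on_subset[OF smooth_on_continuous[OF that(1)]]) (use ta in auto)
  then obtain C where C: "ALL u:{ta/2..ta}. abs (G u) <= C" unfolding bounded_iff by auto
  have "abs (G u) <= max C 0" if "u >= ta/2" for u using bspec[OF C, of u] \<open>!!u. u > ta ==> G u = 0\<close>[of u] that by (cases "u <= ta") auto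
  thus ?thesis by (intro exI[of _ "max C 0"]) auto
 qed
 obtain C0 C1 C2 where C: "C0 >= 0" "C1 >= 0" "C2 >= 0" "!!u. u >= ta/2 ==> abs (F u) <= C0" "!!u. u >= ta/2 ==> abs (F' u) <= C1" "!!u. u >= ta/2 ==> abs (F'' u) <= C2"
  using bd[OF F z0] bd[OF F'(1) z1] bd[OF F''(1) z2] by blast
 show thesis
 proof (rule that[OF pr, where C = "C0 + C1 + C2"])
  show "abs (F u) <= C0 + C1 + C2 & abs (F' u) <= C0 + C1 + C2 & abs (F'' u) <= C0 + C1 + C2" if "u >= ta / 2" for u using C(4-6)[OF that] C(1-3) by linarith
 qed (use s0 s1 s2 z0 z1 z2 C cutoff(4) in \<open>auto simp: F_def\<close>)
qed

text \<open>The summand 1 in the denominator allows \<open>X = 0\<close>, so constants can be chosen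
  without a case distinction.\<close>

lemma mult_small:
 fixes X y t :: real
 assumes "0 <= X" "0 < y" "0 <= t" "t <= y / (X + 1)"
 shows "X * t <= y" proof -
 have "X * t <= (X + 1) * t" using assms by (simp add: algebra_simps)
 also have "... <= y" using assms by (simp add: field_simps)
 finally show ?thesis .
qed

context chart_compact
begin

lemma vol0_bounds: "EX v>0. EX V>=v. ALL z:Kd. v <= vol0 z & vol0 z <= V" proof (cases "Kd = {}")
 case False
 have c: "continuous_on Kd vol0" by (rule continuous_on_subset[OF vol0_continuous K_sub(2)])
 obtain x where x: "x : Kd" "!!z. z : Kd ==> vol0 x <= vol0 z" using continuous_attains_inf[OF compact_Kd False c] by blast
 obtain y where y: "y : Kd" "!!z. z : Kd ==> vol0 z <= vol0 y" using continuous_attains_sup[OF compact_Kd False c] by blast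
 show ?thesis using x y vol0_pos[of x] K_sub(2) by blast
qed (auto intro: exI[of _ 1])

lemma HH_comparable:
 assumes "0 < ep"
 shows "EX r>0. r <= d & (ALL w:K. ALL z. norm (z - w) <= r --> (ALL v. HH w v v <= (1 + ep) * HH z v v))" proof -
 obtain c where c: "c > 0" "!!z v. z : Kd ==> c * (norm v)^2 <= HH z v v" using HH_coercive by blast
 obtain L where L: "L >= 0" "!!w z v. w : K ==> dist w z <= d ==> abs (HH z v v - HH w v v) <= L * norm (z - w) * (norm v)^2" using HH_lipschitz by blast
 define r where "r = min d (ep * c / (L + 1))"
 have r: "0 < r" "r <= d" "r <= ep * c / (L + 1)" using assms c(1) L(1) d by (auto simp: r_def)
 have "HH w v v <= (1 + ep) * HH z v v" if w: "w : K" and z: "norm (z - w) <= r" for w z v proof -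
  have dz: "dist w z <= d" using z r(2) by (simp add: dist_norm norm_minus_commute)
  have "L * norm (z - w) <= ep * c" by (rule mult_small[OF L(1)]) (use assms c(1) z r(3) in auto)
  hence "L * norm (z - w) * (norm v)^2 <= ep * (c * (norm v)^2)" unfolding mult.assoc[symmetric] by (rule mult_right_mono) simp
  also have "... <= ep * HH z v v" using c(2)[OF KdI[OF w dz]] assms by (intro mult_left_mono) auto
  finally show ?thesis using L(2)[OF w dz, of v] by (simp add: algebra_simps)
 qed
 thus ?thesis using r by blast
qed

lemma loc_integrable_defect:
 assumes "loc_integrable_on Om ph" "compact C" "C \<subseteq> Om"
 shows "integrable lebesgue (%z. indicator C z * (A - rl (ph z)))" proof -
 have "integrable lebesgue (%z. A * indicator C z - indicator C z * rl (ph z))"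
  using assms(2) by (intro Bochner_Integration.integrable_diff real_integrable_compact[OF assms] integrable_mult_right
  integrable_real_indicator) (use emeasure_bounded_finite[OF compact_imp_bounded[OF assms(2)]] in \<open>auto simp: compact_imp_closed\<close>)
 thus ?thesis by (simp add: algebra_simps)
qed

lemma radial_test:
 assumes w: "w : K" and tt: "smooth_on UNIV tt" and supp: "!!z. tt z ~= 0 ==> norm (z - w) <= d"
 shows "test_function_on Om tt" "closure {z. tt z ~= 0} \<subseteq> cball w d" proof -
 show sub: "closure {z. tt z ~= 0} \<subseteq> cball w d" by (rule closure_minimal) (use supp in \<open>auto simp: dist_norm norm_minus_commute\<close>)
 moreover have "compact (closure {z. tt z ~= 0})" using sub by (meson bounded_cball bounded_subset closed_closure compact_eq_bounded_closed)
 ultimately show "test_function_on Om tt" using tt K_d[OF w] unfolding test_function_on_def by auto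
qed

end

context chart_compact
begin

text \<open>With x = q/u in [0, 1] the principal part is exactly (s - a)(1 - (a + 1) x / n)
  u^(-a-1); the first factor is positive by \<open>a < s\<close>, the second by
  \<open>a + 1 < n\<close>. All error terms have the same power of u with an extra
  \<open>sqrt u\<close> or \<open>u\<close>, hence the factor \<open>t\<close>.\<close>

lemma power_profile_lower:
 fixes a s u q t :: real
 assumes a: "- 1 < a" "a < s" "a + 1 < CARD('n)" and s: "0 <= s" and u: "0 < u" "u <= t^2" and t: "0 <= t" "t <= 1" and q: "0 <= q" "q <= u"
  and F: "F u = u powr (- a)" "F' u = (- a) * u powr (- a - 1)" "F'' u = (- a) * (- a - 1) * u powr (- a - 2)"
  and B: "B u = u powr (- a - 1)" "B' u = (- a - 1) * u powr (- a - 1 - 1)" "B'' u = (- a - 1) * (- a - 1 - 1) * u powr (- a - 1 - 2)"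
 shows "(s - a) * (1 - (a + 1) / CARD('n)) * u powr (- a - 1) <= F' u + F'' u * q / CARD('n) + s * (B u + B' u * q / CARD('n))"
  and "weighted1 F' F'' u + abs (F u) + s * (weighted2 B B' B'' u)
  <= (abs a + abs a * (a + 1) + 1 + s * (1 + (a + 1) + (a + 1) * (a + 2))) * t * u powr (- a - 1)"
  and "F u <= t * u powr (- a - 1)" proof -
 let ?P = "u powr (- a - 1)" and ?n = "real CARD('n)"
 have P: "0 <= ?P" by simp
 have p1: "u * u powr (- a - 2) = ?P" "u powr (- a) = u * ?P" "u^2 * u powr (- a - 3) = ?P"
  using u by (simp_all add: powr_diff powr_minus powr_numeral field_simps eval_nat_numeral)
 define x where "x = q / u"
 have x: "0 <= x" "x <= 1" "q = x * u" using q u by (auto simp: x_def)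
 have q2: "u powr (- a - 2) * q = x * ?P" using p1(1) by (simp add: x(3) mult_ac)
 have "F' u + F'' u * q / ?n + s * (B u + B' u * q / ?n) =
  - a * ?P + a * (a + 1) * (u powr (- a - 2) * q) / ?n + s * (?P - (a + 1) * (u powr (- a - 2) * q) / ?n)"
  unfolding F B by (simp add: algebra_simps add_divide_distrib diff_divide_distrib)
 also have "... = (s - a) * (1 - (a + 1) / ?n * x) * ?P" unfolding q2 by (simp add: algebra_simps add_divide_distrib diff_divide_distrib)
 finally have m: "F' u + F'' u * q / ?n + s * (B u + B' u * q / ?n) = (s - a) * (1 - (a + 1) / ?n * x) * ?P" .
 have "(a + 1) / ?n * x <= (a + 1) / ?n * 1" using x a by (intro mult_left_mono) auto
 thus "(s - a) * (1 - (a + 1) / ?n) * ?P <= F' u + F'' u * q / ?n + s * (B u + B' u * q / ?n)"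
  unfolding m using a P by (intro mult_right_mono mult_left_mono) auto
 have su: "sqrt u <= t" using real_sqrt_le_mono[OF u(2)] t by simp
 have ut: "u <= t" using u(2) t mult_left_mono[of t 1 t] by (simp add: power2_eq_square)
 have l: "u * (y * u powr (- a - 2)) = y * ?P" "u^2 * (y * u powr (- a - 3)) = y * ?P" for y using p1 by (simp_all add: mult.left_commute)
 have aF: "abs (F' u) = abs a * ?P" "u * abs (F'' u) = abs a * (a + 1) * ?P" "abs (F u) = u * ?P"
  using l[of "abs a * (a + 1)"] p1(2) u a unfolding F by (simp_all add: abs_mult abs_minus_commute add.commute)
 have aB: "abs (B u) = ?P" "u * abs (B' u) = (a + 1) * ?P" "u^2 * abs (B'' u) = (a + 1) * (a + 2) * ?P"
  using l[of "a + 1"] l[of "(a + 1) * (a + 2)"] u a unfolding B by (simp_all add: abs_mult add.commute)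
 show "F u <= t * ?P" using mult_right_mono[OF ut P] aF(3) by linarith
 have "weighted1 F' F'' u + abs (F u) + s * (weighted2 B B' B'' u)
  = sqrt u * ((abs a + abs a * (a + 1)) * ?P) + u * ?P + s * (sqrt u * ((1 + (a + 1) + (a + 1) * (a + 2)) * ?P))" unfolding aF aB by (simp add: algebra_simps)
 also have "... <= t * ((abs a + abs a * (a + 1)) * ?P) + t * ?P + s * (t * ((1 + (a + 1) + (a + 1) * (a + 2)) * ?P))" proof -
  have "0 <= (abs a + abs a * (a + 1)) * ?P" "0 <= (1 + (a + 1) + (a + 1) * (a + 2)) * ?P" using a by (auto intro!: mult_nonneg_nonneg add_nonneg_nonneg)
  thus ?thesis by (intro add_mono mult_left_mono[OF _ s] mult_right_mono su ut P)
 qed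
 finally show "weighted1 F' F'' u + abs (F u) + s * (weighted2 B B' B'' u)
  <= (abs a + abs a * (a + 1) + 1 + s * (1 + (a + 1) + (a + 1) * (a + 2))) * t * ?P" by (simp add: algebra_simps)
qed

text \<open>At minus infinity \<open>rl\<close> takes the value 0, which is why
  \<open>1 <= A\<close> is assumed as well.\<close>

lemma defect_ge_1:
 assumes "1 <= A" "x <= ereal (A - 1)"
 shows "1 <= A - rl x" using assms by (cases x) auto

text \<open>The test function is the truncated power of q + R^2 with exponent -a. Near
  \<open>w\<close> the operator is at least a multiple of (q + R^2)^(-a-1), which is about R^(-2a-2)
  on the ball of radius \<open>R\<close>; away from \<open>w\<close> it is bounded, so the weighted
  mass of the ball is controlled by the mass of \<open>Kd\<close>.\<close>

lemma morrey:
 assumes sub: "omega_m_subharmonic_on m om Om ph" and loc: "loc_integrable_on Om ph"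
  and A: "1 <= A" "!!z. z : Kd ==> ph z <= ereal (A - 1)"
  and sg: "sigma_ok m s ep" and ep: "0 < ep" and a: "- 1 < a" "a < s" "a + 1 < CARD('n)"
 shows "EX C>=0. EX R0>0. ALL w:K. ALL R. 0 < R & R <= R0 -->
  (LINT z|lebesgue. indicator (cball w R) z * (A - rl (ph z))) <= C * R powr (2 * a + 2)" proof -
 define f where "f z = A - rl (ph z)" for z
 have f1: "1 <= f z" if "z : Kd" for z unfolding f_def by (rule defect_ge_1[OF A(1) A(2)[OF that]])
 have s: "0 <= s" "s = 0 | 2 <= CARD('n)" using sg by (auto simp: sigma_ok_def)
 obtain M1 where M1: "M1 >= 1" "!!w z c. w : K ==> 0 <= c ==> norm (z - w) <= M1 * sqrt (qw w z + c)" using norm_le_sqrt_qw by blast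
 obtain M2 where M2: "M2 >= 1" "!!w z. w : K ==> qw w z <= M2 * (norm (z - w))^2" using qw_le_norm by blast
 obtain CT where CTb: "TT_bound s CT" using TT_estimate[OF s] by blast
 hence CT: "0 <= CT" by (simp add: TT_bound_def)
 obtain v V where vV: "0 < v" "v <= V" "!!z. z : Kd ==> v <= vol0 z" "!!z. z : Kd ==> vol0 z <= V" using vol0_bounds by blast
 obtain r where r: "0 < r" "r <= d" "!!w z v. w : K ==> norm (z - w) <= r ==> HH w v v <= (1 + ep) * HH z v v" using HH_comparable[OF ep] by blast
 define D where "D = abs a + abs a * (a + 1) + 1 + s * (1 + (a + 1) + (a + 1) * (a + 2))"
 have "0 <= abs a * (a + 1)" "0 <= (a + 1) * (a + 2)" using a by (auto intro!: mult_nonneg_nonneg)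
 moreover from this have "0 <= s * (1 + (a + 1) + (a + 1) * (a + 2))" using a by (intro mult_nonneg_nonneg s) linarith
 ultimately have D0: "D >= 0" unfolding D_def by linarith
 define k1 where "k1 = (s - a) * (1 - (a + 1) / CARD('n))"
 have k1: "k1 > 0" unfolding k1_def using a by (intro mult_pos_pos) (auto simp: field_simps)
 \<comment> \<open>Two conditions: the points with nonzero weight must lie in the ball of radius
   \<open>r\<close> where the metrics are comparable, and the errors must be at most half of the
   principal term \<open>2 * (v * k1)\<close>.\<close>
 define t where "t = min 1 (min (r / (2 * M1)) (v * k1 / (CT * D + V + 1)))"
 have X0: "0 <= CT * D + V" using CT D0 vV by simp
 have t: "0 < t" "t <= 1" "t <= r / (2 * M1)" "t <= v * k1 / (CT * D + V + 1)" using r M1 vV k1 X0 by (auto simp: t_def)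
 have tr: "M1 * (2 * t) <= r" using t(3) M1 by (simp add: field_simps)
 have tk: "(CT * D + V) * t <= v * k1" using mult_small[OF X0 _ _ t(4)] t(1) vV k1 by simp
 define ta where "ta = t^2"
 have ta: "0 < ta" "ta <= 1" using t by (auto simp: ta_def power_le_one)
 have st: "sqrt ta = t" using t by (simp add: ta_def)
 define F where "F = (%u. cutoff (0 + (2 / ta) * u) * u powr (- a))"
 define B where "B = (%u. cutoff (0 + (2 / ta) * u) * u powr (- a - 1))"
 \<comment> \<open>The weight 1/u is truncated twice as far out as \<open>F\<close>, so its cutoff
   is 1 wherever \<open>F\<close> is nonzero and the product of the two is exactly the truncated
   power \<open>B\<close>.\<close>
 define k where "k = (%u. cutoff (0 + (2 / (2 * ta)) * u) * u powr (- 1))"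
 obtain F' F'' CF where F: "profile F F' F''"
  "!!u. 0 < u ==> u < ta / 2 ==> F u = u powr (-a) & F' u = (-a) * u powr (-a - 1) & F'' u = (-a) * (-a - 1) * u powr (-a - 2)"
  "!!u. u > ta ==> F u = 0 & F' u = 0 & F'' u = 0" "CF >= 0" "!!u. u >= ta / 2 ==> abs (F u) <= CF & abs (F' u) <= CF & abs (F'' u) <= CF"
  using powr_profile[OF ta(1), of "-a"] unfolding F_def by blast
 obtain B' B'' CB where B: "profile B B' B''"
  "!!u. 0 < u ==> u < ta / 2 ==> B u = u powr (-a - 1) & B' u = (-a - 1) * u powr (-a - 1 - 1) & B'' u = (-a - 1) * (-a - 1 - 1) * u powr (-a - 1 - 2)"
  "!!u. u > ta ==> B u = 0 & B' u = 0 & B'' u = 0" "CB >= 0" "!!u. u >= ta / 2 ==> abs (B u) <= CB & abs (B' u) <= CB & abs (B'' u) <= CB"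
  using powr_profile[OF ta(1), of "-a - 1"] unfolding B_def by blast
 have ta2: "0 < 2 * ta" using ta by simp
 obtain k' k'' where k: "profile k k' k''" "!!u. u > 2 * ta ==> k u = 0"
 proof (rule powr_profile[OF ta2, of "- 1"])
  fix F' F'' assume *: "profile (%u. cutoff (0 + (2 / (2 * ta)) * u) * u powr (- 1)) F' F''"
  "!!u. u > 2 * ta ==> cutoff (0 + (2 / (2 * ta)) * u) * u powr (- 1) = 0 & F' u = 0 & F'' u = 0"
  show thesis by (rule that[of F' F'']) (use * in \<open>simp_all only: k_def\<close>)
 qed
 have F0: "0 <= F u" and k0: "0 <= k u" for u using cutoff(4) by (auto simp: F_def k_def)
 have Fk: "F u * k u = B u" if "0 < u" for u proof (cases "u <= ta")
  case True
  hence "cutoff (0 + (2 / (2 * ta)) * u) = 1" using ta by (intro cutoff(2)) (simp add: field_simps)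
  thus ?thesis using that by (simp add: F_def k_def B_def powr_diff powr_minus divide_simps)
 qed (use F(3) B(3) in auto)
 define T1 where "T1 = 2 * V * (CF + CF + s * (CB + CB)) + CT * (CF + CF + CF + s * (CB + CB + CB))"
 have T1: "0 <= T1" unfolding T1_def using vV F(4) B(4) s CT by simp
 define C2 where "C2 = T1 + CF * V"
 have C2: "0 <= C2" using T1 F(4) vV by (simp add: C2_def)
 define I where "I = (LINT z|lebesgue. indicator Kd z * f z)"
 have iC: "integrable lebesgue (%z. indicator C z * f z)" if "compact C" "C \<subseteq> Om" for C unfolding f_def by (rule loc_integrable_defect[OF loc that])
 have iKd: "integrable lebesgue (%z. indicator Kd z * f z)" by (rule iC[OF compact_Kd K_sub(2)])
 have I0: "0 <= I" unfolding I_def by (rule integral_nonneg_AE, rule AE_I2) (use f1 in \<open>force simp: indicator_def\<close>)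
 \<comment> \<open>Balls of radius at most \<open>R0\<close> lie in the zone
   \<open>u < ta / 2\<close>, where the profiles are pure powers.\<close>
 define R0 where "R0 = min d (t / (2 * (M2 + 1)))"
 have R0: "0 < R0" "R0 <= d" "R0 <= t / (2 * (M2 + 1))" using d t M2 by (auto simp: R0_def)
 define C where "C = C2 * I / (v * k1) * (M2 + 1) powr (a + 1)"
 have "C >= 0" unfolding C_def using C2 I0 vV k1 by simp
 moreover have "(LINT z|lebesgue. indicator (cball w R) z * f z) <= C * R powr (2 * a + 2)"
  if w: "w : K" and R: "0 < R" "R <= R0" for w R proof -
  have wOm: "w : Om" and wKd: "w : Kd" using w K_sub by auto
  \<comment> \<open>The shift is tied to the radius: on the ball q is at most a multiple of R^2, so
    u is comparable to R^2 there.\<close>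
  define c where "c = R^2"
  have c: "0 < c" using R by (simp add: c_def)
  have q0: "0 <= qw w z" for z by (rule qw_nonneg[OF wOm])
  obtain G where G: "smooth_on UNIV G" "!!x. x >= 0 ==> G x = F (x + c)" "ALL x. 0 <= G x" by (rule profile_shift[OF F(1) c]) (use F0 in blast)
  obtain kk where kk: "smooth_on UNIV kk" "!!x. x >= 0 ==> kk x = k (x + c)" "ALL x. 0 <= kk x" by (rule profile_shift[OF k(1) c]) (use k0 in blast)
  define tt where "tt z = G (qw w z)" for z
  have ttF: "tt z = F (qw w z + c)" for z using G(2) q0 by (simp add: tt_def)
  have ttB: "tt z * kk (qw w z) = B (qw w z + c)" for z using ttF kk(2) q0[of z] Fk[of "qw w z + c"] c by simp
  have near: "norm (z - w) <= r" if "qw w z + c <= 2 * ta" for z proof -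
  have "(2 * t)^2 = 4 * t^2" by (simp add: power2_eq_square)
  hence "qw w z + c <= (2 * t)^2" using that zero_le_power2[of t] unfolding ta_def by linarith
  hence "sqrt (qw w z + c) <= 2 * t" using t(1) by (intro real_le_lsqrt) auto
  hence "M1 * sqrt (qw w z + c) <= M1 * (2 * t)" using M1 by (intro mult_left_mono) auto
  thus ?thesis using M1(2)[OF w, of c z] c tr by linarith
  qed
  have ok: "weight_ok w ep kk" unfolding weight_ok_def
  proof (intro conjI allI impI)
  fix x :: real assume x: "0 <= x"
  have "kk x * x = cutoff (0 + (2 / (2 * ta)) * (x + c)) * (x / (x + c))" proof -
  have "(x + c) powr (- 1) = inverse (x + c)" using x c by (simp add: powr_minus)
  thus ?thesis unfolding kk(2)[OF x] k_def by (simp only: divide_inverse mult_ac)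
  qed
  also have "... <= 1 * 1"
  proof (rule mult_mono)
  show "x / (x + c) <= 1" "0 <= x / (x + c)" using x c by simp_all
  qed (rule cutoff, simp)
  finally show "kk x * x <= 1" by simp
  next
  fix z v assume "kk (qw w z) ~= 0"
  hence "qw w z + c <= 2 * ta" using kk(2)[OF q0[of z]] k(2)[of "qw w z + c"] by force
  thus "HH w v v <= (1 + ep) * HH z v v" by (rule r(3)[OF w near])
  qed (use kk in auto)
  have smoothtt: "smooth_on UNIV tt" unfolding tt_def by (rule smooth_on_compose_real[OF _ _ _ G(1) smooth_qw[OF wOm]]) auto
  have suppu: "qw w z + c <= ta" if "tt z ~= 0" for z using that ttF[of z] F(3)[of "qw w z + c"] by force
  have supp: "norm (z - w) <= d" if "tt z ~= 0" for z using near[of z] suppu[OF that] ta r(2) by linarith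
  note test = radial_test[OF w smoothtt supp]
  have tt0: "0 <= tt z" for z using G(3) by (simp add: tt_def)
  obtain T where T: "!!z. z : Om ==> T z = TT tt s kk w z" "!!z. z ~: closure {z. tt z ~= 0} ==> T z = 0" using TT_extend[OF wOm s(2) kk(1) test(1)] by blast
  note key = key_inequality(1)[OF wOm ok sg sub loc test(1) tt0] key_inequality(2,3)[OF wOm ok sg sub loc test(1) tt0, of A]
  define P where "P = ((M2 + 1) * R^2) powr (- a - 1)"
  have P0: "0 < P" unfolding P_def using M2 R by simp
  have bound: "v * k1 * P * (indicator (cball w R) z * f z) - C2 * (indicator Kd z * f z)
  <= - (indicator Om z * ((rl (ph z) - A) * TT tt s kk w z)) - indicator Om z * (tt z * vol0 z)" for z proof (cases "dist w z <= d")
  case False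
  hence "z ~: closure {z. tt z ~= 0}" using test(2) by auto
  moreover from this have "tt z = 0" using closure_subset[of "{z. tt z ~= 0}"] by auto
  ultimately have e: "indicator Om z * ((rl (ph z) - A) * TT tt s kk w z) = 0" "tt z = 0" using T(1)[of z] T(2)[of z] by (auto simp: indicator_def)
  have "z ~: cball w R" using False R R0 by auto
  moreover have "0 <= C2 * (indicator Kd z * f z)" using C2 f1[of z] by (auto simp: indicator_def)
  ultimately show ?thesis unfolding e by simp
  next
  case True
  hence z: "z : Om" "z : Kd" using KdI[OF w] K_sub by auto
  have fz: "1 <= f z" by (rule f1[OF z(2)])
  define q u where "q = qw w z" and "u = q + c"
  have u: "0 < u" "0 <= q" "q <= u" using q0[of z] c by (auto simp: q_def u_def)
  define X where "X = TT tt s kk w z"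
  have est: "abs (X - 2 * vol0 w * (F' u + F'' u * q / CARD('n) + s * (B u + B' u * q / CARD('n))))
  <= CT * (weighted1 F' F'' u + abs (F u) + s * (weighted2 B B' B'' u))"
  unfolding X_def by (rule TT_boundD[where tt = tt and F = F and B = B, OF CTb w True c F(1) B(1) ttF ttB q_def u_def])
  have vz: "v <= vol0 w" "vol0 w <= V" "0 <= vol0 z" "vol0 z <= V" using vV wKd z(2) less_imp_le[OF vol0_pos[OF z(1)]] by auto
  have thu: "tt z = F u" using ttF by (simp add: u_def q_def)
  have "v * k1 * P * (indicator (cball w R) z * f z) - C2 * f z <= f z * X - F u * vol0 z" proof (cases "u < ta / 2")
  case True
  let ?Q = "u powr (- a - 1)"
  have Fu: "F u = u powr (-a)" "F' u = (-a) * u powr (-a - 1)" "F'' u = (-a) * (-a - 1) * u powr (-a - 2)"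
  and Bu: "B u = u powr (-a - 1)" "B' u = (-a - 1) * u powr (-a - 1 - 1)" "B'' u = (-a - 1) * (-a - 1 - 1) * u powr (-a - 1 - 2)"
  using F(2)[OF u(1) True] B(2)[OF u(1) True] by auto
  have ut: "u <= t^2" using True ta unfolding ta_def by linarith
  note low = power_profile_lower[OF a s(1) u(1) ut less_imp_le[OF t(1)] t(2) u(2,3), of F F' F'' B B' B'', OF Fu Bu]
  have l1: "2 * v * (k1 * ?Q) <= 2 * vol0 w * (F' u + F'' u * q / CARD('n) + s * (B u + B' u * q / CARD('n)))"
  using low(1) vz k1 vV unfolding k1_def[symmetric] by (intro mult_mono) auto
  have l2: "CT * (weighted1 F' F'' u + abs (F u) + s * (weighted2 B B' B'' u)) <= CT * (D * t * ?Q)" using low(2) unfolding D_def by (intro mult_left_mono CT)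
  have "2 * v * (k1 * ?Q) - CT * (D * t * ?Q) <= X" using est l1 l2 by linarith
  hence "f z * (2 * v * (k1 * ?Q) - CT * (D * t * ?Q)) <= f z * X" using fz by (intro mult_left_mono) auto
  moreover have "F u * vol0 z <= f z * (V * t * ?Q)" proof -
  have "F u * vol0 z <= (t * ?Q) * V" using low(3) vz F0[of u] t by (intro mult_mono) auto
  also have "... <= f z * (V * t * ?Q)" using mult_right_mono[OF fz, of "V * t * ?Q"] vV t by (simp add: mult_ac)
  finally show ?thesis .
  qed
  ultimately have "f z * ((2 * (v * k1) - (CT * D + V) * t) * ?Q) <= f z * X - F u * vol0 z" by (simp add: algebra_simps)
  moreover have "f z * (v * k1 * ?Q) <= f z * ((2 * (v * k1) - (CT * D + V) * t) * ?Q)"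
  proof (intro mult_left_mono mult_right_mono)
  show "v * k1 <= 2 * (v * k1) - (CT * D + V) * t" using tk by linarith
  qed (use fz in auto)
  ultimately have main: "f z * (v * k1 * ?Q) <= f z * X - F u * vol0 z" by linarith
  have "v * k1 * P * (indicator (cball w R) z * f z) <= f z * (v * k1 * ?Q)" proof (cases "z : cball w R")
  case True
  hence "norm (z - w) <= R" by (simp add: dist_norm norm_minus_commute)
  hence "M2 * (norm (z - w))^2 <= M2 * R^2" using M2 by (intro mult_left_mono power_mono) auto
  hence "u <= (M2 + 1) * R^2" using M2(2)[OF w, of z] unfolding u_def q_def c_def by (simp add: algebra_simps)
  hence "P <= ?Q" unfolding P_def using u a by (intro powr_mono2') auto
  hence "v * k1 * P * f z <= v * k1 * ?Q * f z" using vV k1 fz by (intro mult_right_mono mult_left_mono) auto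
  thus ?thesis using True by (simp add: mult_ac)
  qed (use fz vV k1 in auto)
  moreover have "0 <= C2 * f z" using C2 fz by simp
  ultimately show ?thesis using main by linarith
  next
  case False
  \<comment> \<open>In the transition zone the operator has no sign. It is bounded below by
    \<open>- T1\<close>, and the zone does not meet the ball, so \<open>C2 * f z\<close> covers
    it.\<close>
  hence u2: "u >= ta / 2" by simp
  have nball: "z ~: cball w R"
  proof
  have gen: "y * (t / (2 * y))^2 = ta / (4 * y)" if "0 < y" for y using that by (simp add: ta_def power2_eq_square)
  assume "z : cball w R"
  hence "norm (z - w) <= R" by (simp add: dist_norm norm_minus_commute)
  hence "M2 * (norm (z - w))^2 <= M2 * R^2" using M2 by (intro mult_left_mono power_mono) auto
  hence "u <= (M2 + 1) * R^2" using M2(2)[OF w, of z] unfolding u_def q_def c_def by (simp add: algebra_simps)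
  also have "... <= (M2 + 1) * (t / (2 * (M2 + 1)))^2" using R R0 M2 by (intro mult_left_mono power_mono) auto
  also have "(M2 + 1) * (t / (2 * (M2 + 1)))^2 = ta / (4 * (M2 + 1))" using gen[of "M2 + 1"] M2(1) by simp
  also have "... < ta / 2" using ta M2(1) by (intro divide_strict_left_mono) auto
  finally show False using u2 by simp
  qed
  have "- (C2 * f z) <= f z * X - F u * vol0 z" proof (cases "u <= ta")
  case True
  have u1: "u <= 1" "sqrt u <= 1" using True ta by auto
  have qn: "0 <= q / CARD('n)" "q / CARD('n) <= 1" proof -
  have "1 <= real CARD('n)" using zero_less_card_finite[where 'a = 'n] by linarith
  hence "q <= real CARD('n)" using u u1(1) by linarith
  thus "q / CARD('n) <= 1" by (simp add: divide_le_eq)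
  qed (use u in simp)
  have FB: "abs (F u) <= CF" "abs (F' u) <= CF" "abs (F'' u) <= CF" "abs (B u) <= CB" "abs (B' u) <= CB" "abs (B'' u) <= CB"
  using F(5)[OF u2] B(5)[OF u2] by auto
  have abs3: "abs (x + y + z) <= a + b + c" if "abs x <= a" "abs y <= b" "abs z <= c" for x y z a b c :: real using that by linarith
  have lower: "- (b + c) <= X" if "abs (X - y) <= e" "abs y <= b" "e <= c" for y e b c using that by linarith
  have sm: "abs (y * x) <= c" if "0 <= x" "x <= 1" "abs y <= c" for x y c :: real using mult_mono[of "abs y" c "abs x" 1] that by (simp add: abs_mult)
  have m1: "abs (F'' u * q / CARD('n)) <= CF" "abs (B' u * q / CARD('n)) <= CB" using sm[OF qn FB(3)] sm[OF qn FB(5)] by simp_all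
  have "abs (B u + B' u * q / CARD('n)) <= CB + CB" using m1(2) FB(4) by linarith
  hence "abs (s * (B u + B' u * q / CARD('n))) <= s * (CB + CB)" unfolding abs_mult[of s] abs_of_nonneg[OF s(1)] by (rule mult_left_mono) (rule s)
  hence "abs (F' u + F'' u * q / CARD('n) + s * (B u + B' u * q / CARD('n))) <= CF + CF + s * (CB + CB)" using m1(1) FB(2) by (intro abs3)
  hence e1: "abs (2 * vol0 w * (F' u + F'' u * q / CARD('n) + s * (B u + B' u * q / CARD('n)))) <= 2 * V * (CF + CF + s * (CB + CB))"
  unfolding abs_mult[of "2 * vol0 w"] using vz vV by (intro mult_mono) auto
  have uF: "u * abs (F'' u) <= CF" "u * abs (B' u) <= CB" "u^2 * abs (B'' u) <= CB"
  using mult_mono[OF u1(1) FB(3)] mult_mono[OF u1(1) FB(5)] mult_mono[OF power_le_one[OF less_imp_le[OF u(1)] u1(1)] FB(6), of 2] u F(4) B(4) by auto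
  have x1: "weighted1 F' F'' u <= 1 * (CF + CF)" by (rule mult_mono[OF u1(2) add_mono[OF FB(2) uF(1)]]) (use u in auto)
  have x2: "s * (weighted2 B B' B'' u) <= s * (1 * (CB + CB + CB))"
  by (rule mult_left_mono[OF mult_mono[OF u1(2) add_mono[OF add_mono[OF FB(4) uF(2)] uF(3)]] s(1)]) (use u in auto)
  have "weighted1 F' F'' u + abs (F u) + s * (weighted2 B B' B'' u) <= CF + CF + CF + s * (CB + CB + CB)" using add_mono[OF add_mono[OF x1 FB(1)] x2] by simp
  hence "CT * (weighted1 F' F'' u + abs (F u) + s * (weighted2 B B' B'' u))
  <= CT * (CF + CF + CF + s * (CB + CB + CB))" by (rule mult_left_mono) (rule CT)
  hence "- T1 <= X" unfolding T1_def by (rule lower[OF est e1])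
  hence "f z * (- T1) <= f z * X" using fz by (intro mult_left_mono) auto
  moreover have "F u * vol0 z <= f z * (CF * V)" proof -
  have "F u * vol0 z <= CF * V" using FB(1) F0[of u] vz F(4) by (intro mult_mono) auto
  also have "... <= f z * (CF * V)" using mult_right_mono[OF fz, of "CF * V"] vV F(4) by simp
  finally show ?thesis .
  qed
  ultimately show ?thesis unfolding C2_def by (simp add: algebra_simps)
  next
  case False
  hence "X = 0" "F u = 0" using est F(3)[of u] B(3)[of u] by auto
  thus ?thesis using C2 fz by simp
  qed
  thus ?thesis using nball by simp
  qed
  thus ?thesis using z unfolding X_def f_def thu by (simp add: algebra_simps)
  qed
  have ib: "integrable lebesgue (%z. indicator (cball w R) z * f z)" by (rule iC) (use K_d[OF w] R R0 in auto)
  have "(LINT z|lebesgue. v * k1 * P * (indicator (cball w R) z * f z) - C2 * (indicator Kd z * f z))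
  <= (LINT z|lebesgue. - (indicator Om z * ((rl (ph z) - A) * TT tt s kk w z)) - indicator Om z * (tt z * vol0 z))" by (rule integral_mono[OF _ _ bound])
  (intro Bochner_Integration.integrable_diff integrable_minus integrable_mult_right ib iKd key(1,2))+
  also have "... <= 0" using key by simp
  finally have "v * k1 * P * (LINT z|lebesgue. indicator (cball w R) z * f z) <= C2 * I" using ib iKd by (simp add: I_def)
  hence "(LINT z|lebesgue. indicator (cball w R) z * f z) <= C2 * I / (v * k1) * inverse P" using vV k1 P0 by (simp add: field_simps)
  also have "inverse P = ((M2 + 1) * R^2) powr (a + 1)" unfolding P_def powr_minus[symmetric] by (simp add: add.commute)
  also have "... = (M2 + 1) powr (a + 1) * R powr (2 * a + 2)" proof -
  have "R^2 = R powr 2" using R by simp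
  hence "(R^2) powr (a + 1) = R powr (2 * (a + 1))" by (simp only: powr_powr)
  moreover have "2 * (a + 1) = 2 * a + 2" by simp
  moreover have "((M2 + 1) * R^2) powr (a + 1) = (M2 + 1) powr (a + 1) * (R^2) powr (a + 1)" by (rule powr_mult)
  ultimately show ?thesis by simp
  qed
  finally show ?thesis by (simp add: C_def mult_ac)
 qed
 ultimately show ?thesis using R0(1) unfolding f_def by blast
qed

end

section \<open>Packing\<close>

lemma separated_measure:
 fixes W :: "'a::euclidean_space set"
 assumes W: "finite W" "!!x y. x : W ==> y : W ==> x ~= y ==> dl <= dist x y" and dl: "0 < dl"
  and S: "S : lmeasurable" "!!w. w : W ==> ball w (dl / 2) \<subseteq> S"
 shows "real (card W) * (unit_ball_vol DIM('a) * (dl / 2) ^ DIM('a)) <= measure lebesgue S" proof -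
 have disj: "disjoint_family_on (%w. ball w (dl / 2)) W" unfolding disjoint_family_on_def
 proof (intro ballI impI)
  fix x y assume xy: "x : W" "y : W" "x ~= y"
  show "ball x (dl / 2) \<inter> ball y (dl / 2) = {}" by (rule disjoint_ballI) (use W(2)[OF xy] in simp)
 qed
 have "real (card W) * (unit_ball_vol DIM('a) * (dl / 2) ^ DIM('a)) = (SUM w:W. measure lebesgue (ball w (dl / 2)))" using dl by (simp add: content_ball)
 also have "... = measure lebesgue (\<Union>w\<in>W. ball w (dl / 2))"
  by (rule measure_finite_Union[symmetric]) (use W(1) disj fmeasurableD2[OF lmeasurable_ball] in auto)
 also have "... <= measure lebesgue S" by (rule measure_mono_fmeasurable) (use S W(1) in \<open>auto intro!: sets.finite_UN\<close>)
 finally show ?thesis .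
qed

lemma separated_card:
 fixes W :: "'a::euclidean_space set"
 assumes W: "finite W" "!!x y. x : W ==> y : W ==> x ~= y ==> dl <= dist x y" and dl: "0 < dl" "dl <= rh"
  and sub: "W \<subseteq> cball z rh"
 shows "real (card W) * dl ^ DIM('a) <= 4 ^ DIM('a) * rh ^ DIM('a)" proof -
 have "ball w (dl / 2) \<subseteq> cball z (2 * rh)" if "w : W" for w
 proof
  fix x assume "x : ball w (dl / 2)"
  moreover have "dist z w <= rh" using sub that by auto
  ultimately show "x : cball z (2 * rh)" using dist_triangle[of z x w] dl by auto
 qed
 hence "real (card W) * (unit_ball_vol DIM('a) * (dl / 2) ^ DIM('a)) <= measure lebesgue (cball z (2 * rh))" by (intro separated_measure W dl) auto
 also have "... = unit_ball_vol DIM('a) * (2 * rh) ^ DIM('a)" using dl by (simp add: content_cball)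
 finally have "unit_ball_vol (real DIM('a)) * (real (card W) * (dl / 2) ^ DIM('a)) <= unit_ball_vol (real DIM('a)) * (2 * rh) ^ DIM('a)" by (simp only: mult_ac)
 moreover have "unit_ball_vol (real DIM('a)) > 0" by simp
 ultimately have le: "real (card W) * (dl / 2) ^ DIM('a) <= (2 * rh) ^ DIM('a)" by (meson mult_le_cancel_left_pos)
 have "real (card W) * dl ^ DIM('a) = 2 ^ DIM('a) * (real (card W) * (dl / 2) ^ DIM('a))" by (simp add: power_divide)
 also have "... <= 2 ^ DIM('a) * (2 * rh) ^ DIM('a)" by (rule mult_left_mono[OF le]) simp
 also have "... = (2 * 2 * rh) ^ DIM('a)" by (simp only: power_mult_distrib mult.assoc)
 also have "... = 4 ^ DIM('a) * rh ^ DIM('a)" by (simp add: power_mult_distrib)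
 finally show ?thesis .
qed

text \<open>The packing bound limits the cardinality of separated subsets, so one of greatest
  cardinality exists; any point at distance more than \<open>dl\<close> from it could be
  added.\<close>

lemma maximal_separated:
 fixes E :: "'a::euclidean_space set"
 assumes "bounded E" "0 < dl"
 obtains W where "finite W" "W \<subseteq> E" "!!x y. x : W ==> y : W ==> x ~= y ==> dl <= dist x y"
  "!!x. x : E ==> EX w:W. dist w x <= dl" proof -
 obtain rh where rh: "E \<subseteq> cball 0 rh" using bounded_subset_ballD[OF assms(1), of 0] ball_subset_cball by blast
 let ?P = "%W. finite W & W \<subseteq> E & (ALL x:W. ALL y:W. x ~= y --> dl <= dist x y)"
 define b where "b = nat \<lceil>4 ^ DIM('a) * (max rh dl) ^ DIM('a) / dl ^ DIM('a)\<rceil>"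
 have bound: "card W <= b" if "?P W" for W proof -
  have "real (card W) * dl ^ DIM('a) <= 4 ^ DIM('a) * (max rh dl) ^ DIM('a)"
  by (rule separated_card[of _ _ _ 0]) (use that assms rh in \<open>auto simp: subset_iff\<close>)
  hence "real (card W) <= 4 ^ DIM('a) * (max rh dl) ^ DIM('a) / dl ^ DIM('a)" using assms(2) by (simp add: field_simps)
  thus ?thesis unfolding b_def by linarith
 qed
 have "ALL W. ?P W --> card W < Suc b" by (intro allI impI le_imp_less_Suc bound)
 from ex_has_greatest_nat[of ?P "{}" card, OF _ this] obtain W where W: "?P W" "!!W'. ?P W' ==> card W' <= card W" by auto
 have "EX w:W. dist w x <= dl" if "x : E" for x
 proof (rule ccontr)
  assume "~ ?thesis"
  hence *: "!!w. w : W ==> dl < dist w x" by force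
  hence "x ~: W" using assms(2) by force
  moreover have "?P (insert x W)" using W(1) * that by (auto simp: dist_commute intro: less_imp_le)
  ultimately show False using W(2)[of "insert x W"] W(1) by auto
 qed
 with W(1) show thesis by (intro that[of W]) auto
qed

text \<open>The sum over dyadic annuli is geometric since the kernel is one power less singular than the inverse volume.\<close>

lemma separated_kernel_sum:
 fixes W :: "'a::euclidean_space set"
 assumes W: "finite W" "!!x y. x : W ==> y : W ==> x ~= y ==> dl <= dist x y" and dl: "0 < dl" and rh: "0 <= rh"
 shows "dl ^ DIM('a) * (SUM w | w : W & max dl (dist z w) <= rh. 1 / max dl (dist z w) ^ (DIM('a) - 1)) <= 8 ^ DIM('a) * rh" proof -
 let ?N = "DIM('a)" and ?t = "%w. max dl (dist z w)"
 have N: "?N >= 1" using DIM_positive[where 'a = 'a] by linarith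
 have t0: "?t w > 0" for w using dl by simp
 have "dl ^ ?N * (SUM w | w : W & ?t w <= rh. 1 / ?t w ^ (?N - 1)) <= 8 ^ ?N * rh" if "0 <= rh" "rh < 2 ^ k * dl" for k rh using that
 proof (induction k arbitrary: rh)
  case 0
  hence "{w. w : W & ?t w <= rh} = {}" by auto
  thus ?case using 0 by (simp only: sum.empty) simp
 next
  case (Suc k)
  let ?A = "{w. w : W & ?t w <= rh / 2}" and ?B = "{w. w : W & rh / 2 < ?t w & ?t w <= rh}"
  have split: "{w. w : W & ?t w <= rh} = ?A \<union> ?B" using Suc.prems by auto
  have A: "dl ^ ?N * (SUM w:?A. 1 / ?t w ^ (?N - 1)) <= 8 ^ ?N * (rh / 2)" by (rule Suc.IH) (use Suc.prems in auto)
  have B: "dl ^ ?N * (SUM w:?B. 1 / ?t w ^ (?N - 1)) <= 8 ^ ?N * (rh / 2)" proof (cases "dl <= rh")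
  case True
  hence rh: "0 < rh" using dl by linarith
  \<comment> \<open>On the annulus every kernel value is at most (2 / rh)^(N-1), and packing bounds
    the number of points by (4 rh / dl)^N; together this gives half of the claimed bound, since 8 =
    4 * 2.\<close>
  have "(SUM w:?B. 1 / ?t w ^ (?N - 1)) <= real (card ?B) * (1 / (rh / 2) ^ (?N - 1))"
  by (rule sum_bounded_above, rule divide_left_mono[OF power_mono]) (use rh t0 in auto)
  hence "dl ^ ?N * (SUM w:?B. 1 / ?t w ^ (?N - 1)) <= dl ^ ?N * (real (card ?B) * (1 / (rh / 2) ^ (?N - 1)))" using dl by (intro mult_left_mono) auto
  also have "... = (real (card ?B) * dl ^ ?N) * (1 / (rh / 2) ^ (?N - 1))" by simp
  also have "... <= (4 ^ ?N * rh ^ ?N) * (1 / (rh / 2) ^ (?N - 1))" by (intro mult_right_mono separated_card[of _ _ _ z]) (use W dl True rh in auto)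
  also have "... = 8 ^ ?N * (rh / 2)" proof -
  obtain j where j: "?N = Suc j" using N by (cases ?N) auto
  have "(8::real) ^ j = 4 ^ j * 2 ^ j" by (simp flip: power_mult_distrib)
  thus ?thesis using rh unfolding j by (simp add: power_divide)
  qed
  finally show ?thesis .
  next
  case False
  hence "?B = {}" by auto
  thus ?thesis using Suc.prems by (simp only: sum.empty) simp
  qed
  have "(SUM w | w : W & ?t w <= rh. 1 / ?t w ^ (?N - 1)) = (SUM w:?A. 1 / ?t w ^ (?N - 1)) + (SUM w:?B. 1 / ?t w ^ (?N - 1))"
  unfolding split by (rule sum.union_disjoint) (use W(1) in auto)
  hence "dl ^ ?N * (SUM w | w : W & ?t w <= rh. 1 / ?t w ^ (?N - 1)) =
  dl ^ ?N * (SUM w:?A. 1 / ?t w ^ (?N - 1)) + dl ^ ?N * (SUM w:?B. 1 / ?t w ^ (?N - 1))" by (simp only: distrib_left)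
  also have "... <= 8 ^ ?N * (rh / 2) + 8 ^ ?N * (rh / 2)" by (rule add_mono[OF A B])
  finally show ?case by (simp only: field_sum_of_halves flip: distrib_left)
 qed
 moreover obtain k where "rh / dl < 2 ^ k" using real_arch_pow[of 2 "rh / dl"] by auto
 hence "rh < 2 ^ k * dl" using dl by (simp add: pos_divide_less_eq)
 ultimately show ?thesis using rh by blast
qed

text \<open>The kernel is prescribed through its derivative and has to vanish to the right of the
  support, so it is integrated from that end.\<close>

lemma antiderivative_vanishing:
 fixes g :: "real => real"
 assumes g: "continuous_on {0<..} g" "!!v. v >= L ==> g v = 0" and L: "0 < L"
 obtains F where "!!v. 0 < v ==> (F has_real_derivative - g v) (at v)" "!!v. v >= L ==> F v = 0" proof -
 define F where "F v = integral {v..L + 1} g" for v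
 have z: "F v = 0" if "v >= L" for v proof -
  have "F v = integral {v..L + 1} (%_. 0)" unfolding F_def by (rule integral_cong) (use that g(2) in auto)
  thus ?thesis by simp
 qed
 have D: "(F has_real_derivative - g v) (at v)" if v: "0 < v" for v proof (cases "v < L + 1")
  case True
  let ?a = "v / 2"
  have int: "g integrable_on {?a..L + 1}" by (rule integrable_continuous_real, rule continuous_on_subset[OF g(1)]) (use v in auto)
  have "((%u. integral {?a..u} g) has_vector_derivative g v) (at v within {?a..L + 1})"
  by (rule integral_has_vector_derivative[OF continuous_on_subset[OF g(1)]]) (use v True in auto)
  hence "((%u. integral {?a..u} g) has_real_derivative g v) (at v within {?a<..<L + 1})"
  unfolding has_real_derivative_iff_has_vector_derivative by (rule has_vector_derivative_within_subset) auto
  hence "((%u. integral {?a..u} g) has_real_derivative g v) (at v)" using v True by (simp add: at_within_open[of v "{?a<..<L + 1}"])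
  hence "((%u. integral {?a..L + 1} g - integral {?a..u} g) has_real_derivative 0 - g v) (at v)" by (intro derivative_intros)
  hence "(F has_real_derivative 0 - g v) (at v)"
  proof (rule has_field_derivative_transform_within_open[where S = "{?a<..<L + 1}"])
  fix u assume "u : {?a<..<L + 1}"
  hence "integral {?a..u} g + integral {u..L + 1} g = integral {?a..L + 1} g" by (intro Henstock_Kurzweil_Integration.integral_combine int) auto
  thus "integral {?a..L + 1} g - integral {?a..u} g = F u" by (simp add: F_def)
  qed (use v True in auto)
  thus ?thesis by simp
 next
  case False
  hence "((%_. 0) has_real_derivative - g v) (at v)" using g(2)[of v] by simp
  thus ?thesis by (rule has_field_derivative_transform_within_open[where S = "{L<..}"]) (use False z in auto)
 qed
 show thesis by (rule that[OF D z])
qed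

section \<open>Superposition of radial kernels\<close>

lemma smooth_inverse_power: "smooth_on {0<..} (%u::real. cutoff (0 + b * u) * (u powr p + M * u powr q))"
 by (intro smooth_on_mult smooth_on_add smooth_on_cmult smooth_on_powr smooth_on_compose_real[OF _ _ _ cutoff(1)]
  smooth_on_subset[OF smooth_on_affine]) auto

lemma cutoff_derivative_bounded:
 obtains py' C where "!!x. (cutoff has_real_derivative py' x) (at x)" "0 <= C" "!!x. 1 <= x ==> x <= 2 ==> abs (py' x) <= C" "!!x. x < 1 ==> py' x = 0" proof -
 obtain py' where py': "smooth_on UNIV py'" "!!x. (cutoff has_real_derivative py' x) (at x)" using smooth_on_deriv[OF open_UNIV cutoff(1)] by auto
 have "bounded (py' ` {1..2})" by (intro compact_imp_bounded compact_continuous_image continuous_on_subset[OF smooth_on_continuous[OF py'(1)]]) auto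
 then obtain C where C: "ALL x:{1..2}. abs (py' x) <= C" unfolding bounded_iff by auto
 have "py' x = 0" if "x < 1" for x
 proof (rule DERIV_unique[OF py'(2)])
  have "((%_. 1::real) has_real_derivative 0) (at x)" by simp
  thus "(cutoff has_real_derivative 0) (at x)" by (rule has_field_derivative_transform_within_open[where S = "{..<1}"]) (use that cutoff(2) in auto)
 qed
 thus thesis using py'(2) bspec[OF C] by (intro that[of py' "max C 0"]) force+
qed

text \<open>In the pointwise bound half a power of \<open>u\<close> more than
  \<open>u powr (1 - n)\<close> is given up in exchange for a factor \<open>R\<close>. As
  \<open>u\<close> is at least of the order of the squared distance, this yields the inverse power
  2n - 1 of the distance in \<open>separated_kernel_sum\<close>.\<close>

abbreviation (input) kernel_profile_at where
 "kernel_profile_at n C R M F F' F'' ==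
  profile F F' F'' & (ALL u>0. 0 <= F u) &
  (ALL u>=2 * R^2. F u = 0 & F' u = 0) &
  (ALL u>2 * R^2. F'' u = 0) &
  (ALL u. 0 < u & u < R^2 --> F' u = - (u powr (- n) + M * u powr (1/2 - n)) & F'' u = n * u powr (- n - 1) + M * (n - 1/2) * u powr (- n - 1/2)) &
  (ALL u>0. F u <= C * R * u powr (1/2 - n)) &
  (ALL u>=R^2. u <= 2 * R^2 --> abs (F' u) <= C * R powr (- 2 * n) & u * abs (F'' u) <= C * R powr (- 2 * n))"

text \<open>The derivative is minus the kernel that makes the principal part of the operator negative, with
  the second, slightly less singular power absorbing the errors.\<close>

lemma kernel_profile:
 fixes n :: real
 assumes n: "1 <= n"
 obtains C where "0 <= C" "!!R M. 0 < R ==> R <= 1 ==> 0 <= M ==> M * R <= 1 ==> EX F F' F''. kernel_profile_at n C R M F F' F''" proof -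
 obtain py' C1 where py': "!!x. (cutoff has_real_derivative py' x) (at x)" "0 <= C1" "!!x. 1 <= x ==> x <= 2 ==> abs (py' x) <= C1" "!!x. x < 1 ==> py' x = 0"
  by (rule cutoff_derivative_bounded) blast
 \<comment> \<open>The part \<open>4 * C1 + 2 * n\<close> bounds the second derivative in the
   transition zone. The 12 serves the comparison of derivatives below, where \<open>6 * R\<close>
   has to be at most \<open>C * R * (n - 1/2)\<close> with \<open>n - 1/2\<close> possibly as small
   as 1/2.\<close>
 define C where "C = 12 + 4 * C1 + 2 * n"
 have C: "0 <= C" "2 <= C" "12 <= C" using py'(2) n by (auto simp: C_def)
 have "EX F F' F''. kernel_profile_at n C R M F F' F''"
  if R: "0 < R" "R <= 1" and M: "0 <= M" "M * R <= 1" for R M proof -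
  have R2: "0 < R^2" using R by simp
  define h where "h u = u powr (- n) + M * u powr (1/2 - n)" for u
  define h' where "h' u = - n * u powr (- n - 1) + M * ((1/2 - n) * u powr (- n - 1/2))" for u
  define g where "g u = cutoff (0 + (1 / R^2) * u) * h u" for u
  define g' where "g' u = py' (0 + (1 / R^2) * u) * (1 / R^2) * h u + h' u * cutoff (0 + (1 / R^2) * u)" for u
  have g: "smooth_on {0<..} g" unfolding g_def h_def by (rule smooth_inverse_power)
  have gz: "g u = 0" if "2 * R^2 <= u" for u using that R2 cutoff(3)[of "0 + (1 / R^2) * u"] by (simp add: g_def field_simps)
  have h0: "0 <= h u" for u unfolding h_def using M by simp
  have gn: "0 <= g u" for u unfolding g_def using cutoff(4) h0 by simp
  have gh: "g u <= h u" for u unfolding g_def using cutoff(5) h0 by (simp add: mult_left_le_one_le cutoff(4))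
  have dh: "(h has_real_derivative h' u) (at u)" if "0 < u" for u proof -
  have e: "1/2 - n - 1 = - n - 1/2" by simp
  show ?thesis unfolding h_def h'_def using that by (auto intro!: derivative_eq_intros simp: e)
  qed
  have dg: "(g has_real_derivative g' u) (at u)" if "0 < u" for u proof -
  have "((%u. cutoff (0 + (1 / R^2) * u)) has_real_derivative py' (0 + (1 / R^2) * u) * (1 / R^2)) (at u)"
  proof (rule DERIV_chain2[OF py'(1)])
  show "((%u. 0 + (1 / R^2) * u) has_real_derivative 1 / R^2) (at u)" using DERIV_add[OF DERIV_const[of 0] DERIV_cmult_Id[of "1 / R^2" u UNIV]] by simp
  qed
  from DERIV_mult[OF this dh[OF that]] show ?thesis unfolding g_def g'_def by simp
  qed
  obtain F where F: "!!v. 0 < v ==> (F has_real_derivative - g v) (at v)" "!!v. v >= 2 * R^2 ==> F v = 0"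
  by (rule antiderivative_vanishing[OF smooth_on_continuous[OF g] gz]) (use R2 in auto)
  have sF: "smooth_on {0<..} F"
  proof (rule smooth_on_realI[where g' = "%v. 0 - g v"])
  show "smooth_on {0<..} (%v. 0 - g v)" by (intro smooth_on_diff g) auto
  qed (use F(1) in auto)
  have "profile F (%v. - g v) (%v. - g' v)" unfolding profile_def using sF F(1) DERIV_minus[OF dg] by simp
  moreover have F0: "0 <= F u" if "0 < u" for u proof (cases "u <= 2 * R^2")
  case True
  have "F (2 * R^2) <= F u"
  proof (rule DERIV_nonpos_imp_nonincreasing[OF True], intro exI conjI)
  show "(F has_real_derivative - g x) (at x)" if "u <= x" for x using that \<open>0 < u\<close> by (intro F(1)) simp
  show "- g x <= 0" for x using gn[of x] by simp
  qed
  thus ?thesis using F(2)[of "2 * R^2"] by simp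
  qed (use F(2) in auto)
  moreover have "abs (- g u) <= C * R powr (- 2 * n) & u * abs (- g' u) <= C * R powr (- 2 * n)" if u: "R^2 <= u" "u <= 2 * R^2" for u proof -
  have u0: "0 < u" using u R2 by linarith
  have rp: "(R^2) powr b = R powr (2 * b)" for b using R by (simp add: powr_powr[symmetric])
  have "M * R powr (1 - 2 * n) = M * R * R powr (- 2 * n)" using R by (simp add: powr_diff powr_minus divide_simps)
  also have "... <= 1 * R powr (- 2 * n)" using M(2) by (rule mult_right_mono) simp
  finally have MR: "M * R powr (1 - 2 * n) <= R powr (- 2 * n)" by simp
  have "u powr (- n) <= (R^2) powr (- n)" "u powr (1/2 - n) <= (R^2) powr (1/2 - n)" using u R2 n by (auto intro!: powr_mono2')
  hence "u powr (- n) <= R powr (- 2 * n)" "u powr (1/2 - n) <= R powr (1 - 2 * n)" unfolding rp by (simp_all add: algebra_simps)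
  hence "h u <= R powr (- 2 * n) + M * R powr (1 - 2 * n)" unfolding h_def using M by (intro add_mono mult_left_mono) auto
  hence hb: "h u <= 2 * R powr (- 2 * n)" using MR by simp
  have "abs (- g u) <= 2 * R powr (- 2 * n)" using gn[of u] gh[of u] hb by simp
  also have "... <= C * R powr (- 2 * n)" by (rule mult_right_mono[OF C(2)]) simp
  finally have 1: "abs (- g u) <= C * R powr (- 2 * n)" .
  have uh: "u * abs (h' u) <= n * h u" proof -
  have e: "u * u powr (- n - 1) = u powr (- n)" "u * u powr (- n - 1/2) = u powr (1/2 - n)" using u0 by (auto simp: powr_mult_base)
  have "abs (h' u) = n * u powr (- n - 1) + M * ((n - 1/2) * u powr (- n - 1/2))" proof -
  have "h' u = - (n * u powr (- n - 1) + M * ((n - 1/2) * u powr (- n - 1/2)))" by (simp add: h'_def algebra_simps)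
  moreover have "0 <= n * u powr (- n - 1) + M * ((n - 1/2) * u powr (- n - 1/2))" using n M by simp
  ultimately show ?thesis by simp
  qed
  hence "u * abs (h' u) = n * (u * u powr (- n - 1)) + M * ((n - 1/2) * (u * u powr (- n - 1/2)))" by (simp only: distrib_left mult.left_commute[of u])
  also have "... = n * u powr (- n) + M * ((n - 1/2) * u powr (1/2 - n))" by (simp only: e)
  also have "... <= n * u powr (- n) + M * (n * u powr (1/2 - n))" using M by (intro add_left_mono mult_left_mono mult_right_mono) auto
  finally show ?thesis unfolding h_def by (simp add: algebra_simps)
  qed
  have pyb: "abs (py' (0 + (1 / R^2) * u)) <= C1" by (rule py'(3)) (use u R2 in \<open>auto simp: field_simps\<close>)
  have "u * abs (- g' u) <= u * (abs (py' (0 + (1 / R^2) * u)) * (1 / R^2) * h u + abs (h' u) * 1)"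
  proof (rule mult_left_mono)
  have "abs (- g' u) <= abs (py' (0 + (1 / R^2) * u) * (1 / R^2) * h u) + abs (h' u * cutoff (0 + (1 / R^2) * u))"
  unfolding g'_def by (simp only: abs_minus_cancel abs_triangle_ineq)
  also have "... <= abs (py' (0 + (1 / R^2) * u)) * (1 / R^2) * h u + abs (h' u) * 1"
  unfolding abs_mult using h0[of u] cutoff(4,5) by (intro add_mono mult_left_mono) auto
  finally show "abs (- g' u) <= abs (py' (0 + (1 / R^2) * u)) * (1 / R^2) * h u + abs (h' u) * 1" .
  qed (use u0 in simp)
  also have "... = (u / R^2) * (abs (py' (0 + (1 / R^2) * u)) * h u) + u * abs (h' u)" by (simp add: algebra_simps)
  also have "... <= 2 * (C1 * h u) + n * h u"
  by (intro add_mono[OF _ uh] mult_mono) (use u R2 pyb h0[of u] py'(2) in \<open>auto simp: pos_divide_le_eq\<close>)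
  also have "... = (2 * C1 + n) * h u" by (simp add: algebra_simps)
  also have "... <= (2 * C1 + n) * (2 * R powr (- 2 * n))" using hb py'(2) n by (intro mult_left_mono) auto
  also have "... <= C * R powr (- 2 * n)" unfolding C_def by (simp add: algebra_simps)
  finally show ?thesis using 1 by simp
  qed
  moreover have "F u <= C * R * u powr (1/2 - n)" if u: "0 < u" for u proof (cases "u <= 2 * R^2")
  case True
  \<comment> \<open>The difference decreases and is nonnegative at \<open>2 * R^2\<close>, where
    \<open>F\<close> vanishes. In the derivative, \<open>sqrt v <= 2 * R\<close> turns the half
    power lost into the factor \<open>R\<close>.\<close>
  define G where "G v = C * R * v powr (1/2 - n) - F v" for v
  have "G (2 * R^2) <= G u"
  proof (rule DERIV_nonpos_imp_nonincreasing[OF True])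
  fix v assume v: "u <= v" "v <= 2 * R^2"
  hence v0: "0 < v" using u by simp
  have e: "1/2 - n - 1 = - n - 1/2" by simp
  have "(G has_real_derivative C * R * ((1/2 - n) * v powr (- n - 1/2)) - (- g v)) (at v)"
  unfolding G_def using v0 by (intro DERIV_diff F(1) DERIV_cmult) (auto intro!: derivative_eq_intros simp: e)
  moreover have "C * R * ((1/2 - n) * v powr (- n - 1/2)) - (- g v) <= 0" proof -
  have "(2 * R)^2 = 4 * R^2" by (simp add: power2_eq_square)
  hence "v <= (2 * R)^2" using v(2) R2 by linarith
  hence sv: "sqrt v <= 2 * R" by (rule real_le_lsqrt[rotated]) (use R in simp)
  have e1: "v powr (- n) = sqrt v * v powr (- n - 1/2)" "v powr (1/2 - n) = sqrt v * sqrt v * v powr (- n - 1/2)"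
  using v0 by (simp_all add: powr_half_sqrt[symmetric] powr_add[symmetric] powr_mult_base)
  have "h v = (sqrt v * (1 + M * sqrt v)) * v powr (- n - 1/2)" unfolding h_def e1 by (simp add: algebra_simps)
  also have "... <= (2 * R * (1 + 2)) * v powr (- n - 1/2)"
  proof (intro mult_right_mono mult_mono add_mono sv)
  show "M * sqrt v <= 2" using mult_left_mono[OF sv M(1)] M(2) by simp
  qed (use M R v0 in auto)
  also have "... <= C * R * (n - 1/2) * v powr (- n - 1/2)"
  proof (rule mult_right_mono)
  have "12 * R * (1/2) <= C * R * (n - 1/2)" using C R n by (intro mult_mono) auto
  thus "2 * R * (1 + 2) <= C * R * (n - 1/2)" by simp
  qed simp
  finally show ?thesis using gh[of v] by (simp add: algebra_simps)
  qed
  ultimately show "EX y. (G has_real_derivative y) (at v) & y <= 0" by blast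
  qed
  moreover have "0 <= G (2 * R^2)" unfolding G_def using F(2)[of "2 * R^2"] C R by simp
  ultimately show ?thesis by (simp add: G_def)
  qed (use F(2) C R in auto)
  moreover have "- g u = - (u powr (- n) + M * u powr (1/2 - n)) & - g' u = n * u powr (- n - 1) + M * (n - 1/2) * u powr (- n - 1/2)"
  if "0 < u" "u < R^2" for u proof -
  have "0 + (1 / R^2) * u < 1" using that by (simp add: divide_less_eq)
  thus ?thesis using cutoff(2)[of "0 + (1 / R^2) * u"] py'(4)[of "0 + (1 / R^2) * u"] unfolding g_def g'_def h_def h'_def by (simp add: algebra_simps)
  qed
  moreover have "g' u = 0" if "2 * R^2 < u" for u
  proof (rule DERIV_unique[OF dg])
  show "0 < u" using that R2 by linarith
  have "((%_. 0) has_real_derivative 0) (at u)" by simp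
  thus "(g has_real_derivative 0) (at u)" by (rule has_field_derivative_transform_within_open[where S = "{2 * R^2<..}"]) (use that gz in auto)
  qed
  ultimately show ?thesis using F(2) gz by (intro exI[of _ F] exI[of _ "%v. - g v"] exI[of _ "%v. - g' v"]) simp
 qed
 thus thesis by (rule that[OF C(1)])
qed

section \<open>Linearity of the unperturbed operator and a plateau function\<close>

context chart_compact
begin

lemma Lop_linear:
 assumes f: "smooth_on UNIV f" and g: "smooth_on UNIV g" and z: "z : Om"
 shows "Lop (%z. c * f z + g z) z = of_real c * Lop f z + Lop g z" proof -
 have C2: "C_k_on 2 Om (%z. of_real (h z) * P l z)" if "smooth_on UNIV h" for h :: "complex^'n => real" and l
  using smooth_on_mult[OF open_Om smooth_on_of_real[OF open_Om smooth_on_subset[OF that subset_UNIV]] smooth_P] unfolding smooth_on_def by blast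
 have D: "D2 (%z. of_real (c * f z + g z) * P l z) a b z =
  of_real c * D2 (%z. of_real (f z) * P l z) a b z + D2 (%z. of_real (g z) * P l z) a b z" for l a b proof -
  let ?f = "%z. of_real (f z) * P l z" and ?g = "%z. of_real (g z) * P l z"
  have e: "(%z. of_real (c * f z + g z) * P l z) = (%z. of_real c * ?f z + ?g z)" by (simp add: algebra_simps)
  have 1: "FD (%z. of_real c * ?f z + ?g z) y b = of_real c * FD ?f y b + FD ?g y b"
  if "y : Om" for y proof -
  have "((%z. of_real c * ?f z + ?g z) has_derivative (%h. of_real c * FD ?f y h + FD ?g y h)) (at y)" using C2_D(1)[OF C2[OF f] that] C2_D(1)[OF C2[OF g] that]
  by (intro has_derivative_add has_derivative_mult_right) (simp_all add: frechet_derivative_works)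
  from fun_cong[OF frechet_derivative_at[OF this], of b] show ?thesis by simp
  qed
  have 2: "((%y. of_real c * FD ?f y b + FD ?g y b) has_derivative
  (%a. of_real c * D2 ?f a b z + D2 ?g a b z)) (at z)" unfolding D2_def using C2_D(2)[OF C2[OF f] z] C2_D(2)[OF C2[OF g] z]
  by (intro has_derivative_add has_derivative_mult_right) (simp_all add: frechet_derivative_works)
  have "D2 (%z. of_real c * ?f z + ?g z) a b z = FD (%y. of_real c * FD ?f y b + FD ?g y b) z a"
  unfolding D2_def by (rule fun_cong[OF frechet_derivative_cong_open[OF open_Om z]]) (rule 1)
  also have "... = of_real c * D2 ?f a b z + D2 ?g a b z" using fun_cong[OF frechet_derivative_at[OF 2], of a] by simp
  finally show ?thesis unfolding e .
 qed
 have "topc (ddc_fun (%z. of_real (c * f z + g z) * P l z) z * E) =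
  of_real c * topc (ddc_fun (%z. of_real (f z) * P l z) z * E) + topc (ddc_fun (%z. of_real (g z) * P l z) z * E)" for l E
  unfolding topc_ddc_fun D by (simp add: sum_distrib_left sum.distrib[symmetric] algebra_simps sum_negf sum_subtractf)
 thus ?thesis unfolding Lop_def by (simp add: sum.distrib sum_distrib_left)
qed

lemma Lop_zero: "z : Om ==> Lop (%_. 0) z = 0" using Lop_linear[OF smooth_on_const[where c = 0] smooth_on_const[where c = 0], where c = "- 1"] by simp

lemma Lop_sum:
 assumes "finite I" "!!i. i : I ==> smooth_on UNIV (g i)" and f: "smooth_on UNIV f" and z: "z : Om"
 shows "Lop (%z. c * f z + (SUM i:I. b * g i z)) z = of_real c * Lop f z + (SUM i:I. of_real b * Lop (g i) z)" using assms(1,2)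
proof (induction I)
 case empty
 show ?case using Lop_linear[OF f smooth_on_const[where c = 0] z, where c = c] Lop_zero[OF z] by simp
next
 case (insert i I)
 have s: "smooth_on UNIV (%z. c * f z + (SUM i:I. b * g i z))" using insert.prems f by (intro smooth_on_add smooth_on_sum smooth_on_cmult) auto
 have e: "(%z. c * f z + (SUM j:insert i I. b * g j z)) = (%z. b * g i z + (c * f z + (SUM j:I. b * g j z)))" using insert.hyps by (simp add: algebra_simps)
 show ?case unfolding e Lop_linear[OF insert.prems[OF insertI1] s z] using insert by simp
qed

lemma profile_zero: "profile (%_. 0) (%_. 0) (%_. 0)" by (simp add: profile_def)

lemma TT_no_weight: "TT tt 0 kk w z = Re (Lop tt z)" by (simp add: TT_def)

text \<open>The kernels will enter the test function with a minus sign; a multiple of this plateau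
  is added to make the total nonnegative. It is a sum of cutoffs of \<open>qw w\<close> over a
  finite net of \<open>K\<close>.\<close>

lemma plateau:
 obtains tt r B where "test_function_on Om tt" "!!z. 0 <= tt z" "0 < r" "r <= d"
  "!!w z. w : K ==> norm (z - w) <= r ==> 1 <= tt z" "closure {z. tt z ~= 0} \<subseteq> Kd"
  "0 <= B" "!!z. z : Om ==> abs (Re (Lop tt z)) <= B" "!!z. tt z <= B" proof -
 obtain M1 where M1: "M1 >= 1" "!!w z c. w : K ==> 0 <= c ==> norm (z - w) <= M1 * sqrt (qw w z + c)" using norm_le_sqrt_qw by blast
 obtain M2 where M2: "M2 >= 1" "!!w z. w : K ==> qw w z <= M2 * (norm (z - w))^2" using qw_le_norm by blast
 define t where "t = d / (2 * M1)"
 have t: "0 < t" "2 * t * M1 = d" using d M1 by (auto simp: t_def)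
 define r where "r = min d (t / (2 * M2))"
 have r: "0 < r" "r <= d" "r <= t / (2 * M2)" using d t M2 by (auto simp: r_def)
 have Mr: "M2 * (2 * r)^2 <= t^2" proof -
  have "2 * r <= t / M2" using r(3) M2 by (simp add: field_simps)
  hence "M2 * (2 * r)^2 <= M2 * (t / M2)^2" using r M2 by (intro mult_left_mono power_mono) auto
  also have "... = t^2 / M2" using M2(1) by (simp add: power2_eq_square)
  also have "... <= t^2 / 1" using M2(1) by (intro divide_left_mono) auto
  finally show ?thesis by simp
 qed
 obtain W where W: "finite W" "W \<subseteq> K" "!!x. x : K ==> EX w:W. dist w x <= r"
  using maximal_separated[OF compact_imp_bounded[OF compact_K] r(1)] by metis
 define g where "g w z = cutoff (0 + (1 / t^2) * qw w z)" for w z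
 define tt where "tt z = (SUM w:W. g w z)" for z
 have gs: "smooth_on UNIV (g w)" if "w : W" for w proof -
  have "w : Om" using that W K_sub by blast
  thus ?thesis unfolding g_def by (intro smooth_on_compose_real[OF _ _ _ cutoff(1)] smooth_on_compose_real[OF _ _ _ smooth_on_affine] smooth_qw) auto
 qed
 have g0: "0 <= g w z" "g w z <= 1" for w z unfolding g_def by (rule cutoff)+
 have smooth: "smooth_on UNIV tt" unfolding tt_def by (intro smooth_on_sum gs) auto
 have supp: "z : Kd" if "tt z ~= 0" for z proof -
  obtain w where w: "w : W" "g w z ~= 0" using \<open>tt z ~= 0\<close> unfolding tt_def by (meson sum.neutral)
  have "0 + (1 / t^2) * qw w z < 2" using w(2) cutoff(3)[of "0 + (1 / t^2) * qw w z"] unfolding g_def by linarith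
  hence "qw w z < 2 * t^2" using t by (simp add: pos_divide_less_eq)
  moreover have "(2 * t)^2 = 4 * t^2" "0 <= t^2" by (simp_all add: power2_eq_square)
  ultimately have "qw w z <= (2 * t)^2" by linarith
  hence "sqrt (qw w z + 0) <= 2 * t" using t by (intro real_le_lsqrt) auto
  hence "M1 * sqrt (qw w z + 0) <= M1 * (2 * t)" using M1 by (intro mult_left_mono) auto
  hence "norm (z - w) <= d" using M1(2)[of w 0 z] w W t by (auto simp: mult_ac)
  thus ?thesis using w W by (intro KdI[of w]) (auto simp: dist_norm norm_minus_commute)
 qed
 have cl: "closure {z. tt z ~= 0} \<subseteq> Kd" by (rule closure_minimal) (use supp compact_imp_closed[OF compact_Kd] in auto)
 hence "compact (closure {z. tt z ~= 0})" by (meson bounded_subset closed_closure compact_Kd compact_eq_bounded_closed)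
 hence test: "test_function_on Om tt" using smooth cl K_sub(2) by (auto simp: test_function_on_def)
 have one: "1 <= tt z" if "x : K" "norm (z - x) <= r" for x z proof -
  obtain w where w: "w : W" "dist w x <= r" using W(3)[OF \<open>x : K\<close>] by blast
  hence "norm (z - w) <= 2 * r" using that norm_triangle_ineq[of "z - x" "x - w"] by (simp add: dist_norm norm_minus_commute)
  hence "M2 * (norm (z - w))^2 <= M2 * (2 * r)^2" using M2 by (intro mult_left_mono power_mono) auto
  hence "qw w z <= t^2" using M2(2)[of w z] w W Mr by force
  hence "g w z = 1" unfolding g_def using t by (intro cutoff(2)) (simp add: field_simps)
  moreover have "g w z <= tt z" unfolding tt_def by (rule member_le_sum) (use w W g0 in auto)
  ultimately show ?thesis by simp
 qed
 have nn: "0 <= tt z" for z unfolding tt_def by (intro sum_nonneg g0)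
 have up: "tt z <= real (card W)" for z unfolding tt_def using sum_bounded_above[of W "%w. g w z" 1] g0 by simp
 show thesis proof (cases "K = {}")
  case True
  hence "W = {}" using W by simp
  hence "tt = (%_. 0)" by (auto simp: tt_def)
  thus thesis using test r d True cl Lop_zero by (intro that[of tt d 0]) auto
 next
  case False
  then obtain w where w: "w : Om" using K_sub by blast
  \<comment> \<open>Without weight \<open>TT\<close> is the real part of \<open>Lop\<close>, so its
    continuous extension by zero bounds \<open>Lop tt\<close> on the whole chart.\<close>
  obtain T where T: "continuous_on UNIV T" "!!z. z : Om ==> T z = TT tt 0 (%_. 0) w z" "!!z. z ~: closure {z. tt z ~= 0} ==> T z = 0"
  using TT_extend[OF w _ smooth_on_const test, of 0 0] by auto
  have "bounded (T ` Kd)" by (intro compact_imp_bounded compact_continuous_image continuous_on_subset[OF T(1)] compact_Kd) auto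
  then obtain B where B: "ALL z:Kd. abs (T z) <= B" unfolding bounded_iff by auto
  have "abs (Re (Lop tt z)) <= max B 0 + card W" if "z : Om" for z proof (cases "z : Kd")
  case True
  thus ?thesis using bspec[OF B, of z] T(2)[OF that] by (simp add: TT_no_weight)
  next
  case False
  hence "T z = 0" using cl T(3) by blast
  thus ?thesis using T(2)[OF that] by (simp add: TT_no_weight)
  qed
  thus thesis using test nn r one cl up by (intro that[of tt r "max B 0 + card W"]) (auto intro: order_trans[OF up])
 qed
qed

end

lemma kernel_principal_part:
 fixes n M u dl :: real
 assumes n: "1 <= n" and M: "0 <= M" and u: "0 < u"
  and F': "F' = - (u powr (- n) + M * u powr (1/2 - n))"
  and F'': "F'' = n * u powr (- n - 1) + M * (n - 1/2) * u powr (- n - 1/2)"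
 shows "F' + F'' * (u - dl^2) / n <= - (dl^2 * u powr (- n - 1)) - M / (2 * n) * u powr (1/2 - n)"
  and "sqrt u * (abs F' + u * abs F'') <= (1 + n) * (1 + M * sqrt u) * u powr (1/2 - n)" proof -
 have e: "u powr (- n) = u * u powr (- n - 1)" "u powr (1/2 - n) = u * u powr (- n - 1/2)" "u powr (1/2 - n) = sqrt u * u powr (- n)"
  using u by (simp_all add: powr_mult_base powr_half_sqrt[symmetric] powr_add[symmetric])
 have "F'' * (u - dl^2) / n = (u * u powr (- n - 1)) + M * (1 - 1 / (2 * n)) * (u * u powr (- n - 1/2))
  - dl\<^sup>2 * u powr (- n - 1) - dl^2 * (M * (1 - 1 / (2 * n)) * u powr (- n - 1/2))" unfolding F'' using n by (simp add: field_simps)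
 also have "... <= u powr (- n) + M * (1 - 1 / (2 * n)) * u powr (1/2 - n) - dl^2 * u powr (- n - 1)" proof -
  have "0 <= dl^2 * (M * (1 - 1 / (2 * n)) * u powr (- n - 1/2))" using n M by (intro mult_nonneg_nonneg) auto
  thus ?thesis unfolding e(1,2) by linarith
 qed
 finally show "F' + F'' * (u - dl^2) / n <= - (dl^2 * u powr (- n - 1)) - M / (2 * n) * u powr (1/2 - n)" unfolding F' by (simp add: algebra_simps)
 define a b where "a = u powr (- n)" and "b = M * u powr (1/2 - n)"
 have ab: "0 <= a" "0 <= b" using M by (auto simp: a_def b_def)
 have "u * abs F'' = n * a + (n - 1/2) * b" proof -
  have "0 <= F''" unfolding F'' using n M by simp
  hence "u * abs F'' = u * F''" by simp
  also have "... = n * (u * u powr (- n - 1)) + (n - 1/2) * (M * (u * u powr (- n - 1/2)))" unfolding F'' by (simp add: algebra_simps)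
  finally show ?thesis unfolding a_def b_def e(2)[symmetric] e(1)[symmetric] .
 qed
 moreover have "abs F' = a + b" using ab unfolding F' a_def b_def by linarith
 moreover have "(n - 1/2) * b <= n * b" using ab by (intro mult_right_mono) auto
 ultimately have "abs F' + u * abs F'' <= (1 + n) * (a + b)" by (simp add: algebra_simps)
 hence "sqrt u * (abs F' + u * abs F'') <= sqrt u * ((1 + n) * (a + b))" using u by (intro mult_left_mono) auto
 also have "... = (1 + n) * (1 + M * sqrt u) * u powr (1/2 - n)" unfolding a_def b_def e(3) by (simp add: algebra_simps)
 finally show "sqrt u * (abs F' + u * abs F'') <= (1 + n) * (1 + M * sqrt u) * u powr (1/2 - n)" .
qed

section \<open>Kernels with bounds uniform in centre and scale\<close>

context chart_compact
begin

abbreviation (input) kernel_at where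
 "kernel_at C c R dl w tt ==
  smooth_on UNIV tt & (ALL z. 0 <= tt z) & (ALL z. tt z ~= 0 --> dist z w <= C * R) & (ALL z. tt z <= C * R * (1 / max dl (dist z w) ^ (2 * CARD('n) - 1))) & (ALL z:Om. c / dl ^ (2 * CARD('n)) * indicator (cball w dl) z - C / R ^ (2 * CARD('n)) * indicator (cball w (C * R)) z <= - Re (Lop tt z))"

text \<open>The kernel is the profile at q + dl^2. For \<open>u < R^2\<close> the second power
  absorbs the errors, leaving a multiple of dl^2 u^(-n-1), which is of order dl^(-2n) on the ball of
  radius \<open>dl\<close>; the truncation between R^2 and 2 R^2 costs at most a multiple of
  R^(-2n).\<close>

lemma kernel_field:
 obtains C c R1 where "1 <= C" "0 < c" "0 < R1" "R1 <= 1"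
  "!!R dl w. 0 < R ==> R <= R1 ==> 0 < dl ==> C * dl <= R ==> w : K ==>
  EX tt. kernel_at C c R dl w tt" proof -
 define n where "n = real CARD('n)"
 have n: "1 <= n" using zero_less_card_finite[where 'a = 'n] unfolding n_def by linarith
 obtain M1 where M1: "M1 >= 1" "!!w z c. w : K ==> 0 <= c ==> norm (z - w) <= M1 * sqrt (qw w z + c)" using norm_le_sqrt_qw by blast
 obtain M2 where M2: "M2 >= 1" "!!w z. w : K ==> qw w z <= M2 * (norm (z - w))^2" using qw_le_norm by blast
 obtain CT where CTb: "TT_bound 0 CT" using TT_estimate[of 0] by auto
 hence CT: "0 <= CT" by (simp add: TT_bound_def)
 obtain v V where vV: "0 < v" "v <= V" "!!z. z : Kd ==> v <= vol0 z" "!!z. z : Kd ==> vol0 z <= V" using vol0_bounds by blast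
 obtain CK where CK: "0 <= CK" "!!R M. 0 < R ==> R <= 1 ==> 0 <= M ==> M * R <= 1 ==> EX F F' F''. kernel_profile_at n CK R M F F' F''"
  by (rule kernel_profile[OF n]) blast
 define D where "D = CT * (2 * (1 + n) + CK)"
 have D: "0 <= D" using CT CK(1) n by (simp add: D_def)
 \<comment> \<open>Chosen so that the gain \<open>2 * v * (M / (2 * n))\<close> equals the error
   constant \<open>D\<close>. There is no circularity: \<open>D\<close> is free of \<open>M\<close>
   because \<open>M * sqrt u <= 1\<close> will hold in the range considered.\<close>
 define M where "M = n * D / v"
 have M: "0 <= M" "2 * v * (M / (2 * n)) = D" using D n vV by (auto simp: M_def)
 define CX where "CX = 4 * V * CK + 5 * CT * CK"
 define C where "C = 1 + (M2 + 2) + 2 * M1 + CX + CK * M1 ^ (2 * CARD('n) - 1)"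
 have CX: "0 <= CX" using CT CK(1) vV by (simp add: CX_def)
 have K1: "0 <= CK * M1 ^ (2 * CARD('n) - 1)" using CK(1) M1 by simp
 have C: "1 <= C" "M2 + 2 <= C" "2 * M1 <= C" "CX <= C" "CK * M1 ^ (2 * CARD('n) - 1) <= C" using CX K1 M1(1) M2(1) unfolding C_def by linarith+
 define c where "c = 2 * v * (M2 + 1) powr (- n - 1)"
 have c: "0 < c" using vV M2(1) by (simp add: c_def)
 \<comment> \<open>The second bound gives \<open>M * R <= 1\<close>, the third keeps the support, of
   radius \<open>C * R\<close>, inside the ball of radius \<open>d\<close>.\<close>
 define R1 where "R1 = min 1 (min (1 / (M + 1)) (d / (2 * C)))"
 have R1: "0 < R1" "R1 <= 1" "R1 <= 1 / (M + 1)" "R1 <= d / (2 * C)" using M(1) d C(1) by (auto simp: R1_def)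
 have "EX tt. kernel_at C c R dl w tt"
  if R: "0 < R" "R <= R1" and dl: "0 < dl" "C * dl <= R" and w: "w : K" for R dl w proof -
  have wOm: "w : Om" "w : Kd" using w K_sub by auto
  have R': "R <= 1" using R R1 by linarith
  have MR: "M * R <= 1" by (rule mult_small[OF M(1)]) (use R R1 in auto)
  have CRd: "C * R <= d / 2" proof -
  have "C * R <= C * (d / (2 * C))" using R R1 C(1) by (intro mult_left_mono) auto
  thus ?thesis using C(1) by simp
  qed
  have dlR: "dl <= R" using dl(2) mult_right_mono[OF C(1) less_imp_le[OF dl(1)]] by linarith
  have pR: "R powr (- 2 * n) = 1 / R ^ (2 * CARD('n))" using R(1) powr_realpow[of R "2 * CARD('n)"] by (simp add: n_def powr_minus divide_inverse)
  obtain F F' F'' where H: "profile F F' F''" "ALL u>0. 0 <= F u"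
  "ALL u>=2 * R^2. F u = 0 & F' u = 0" "ALL u>2 * R^2. F'' u = 0"
  "ALL u. 0 < u & u < R^2 --> F' u = - (u powr (- n) + M * u powr (1/2 - n)) &
  F'' u = n * u powr (- n - 1) + M * (n - 1/2) * u powr (- n - 1/2)"
  "ALL u>0. F u <= CK * R * u powr (1/2 - n)"
  "ALL u>=R^2. u <= 2 * R^2 --> abs (F' u) <= CK * R powr (- 2 * n) & u * abs (F'' u) <= CK * R powr (- 2 * n)"
  using CK(2)[OF R(1) R' M(1) MR] by (elim exE conjE) (rule that; assumption)
  note F = H(1,2) H(3)[rule_format] H(4)[rule_format] H(5)[rule_format, THEN conjunct1, OF conjI] H(5)[rule_format, THEN conjunct2, OF conjI]
  H(6)[rule_format] H(7)[rule_format, THEN conjunct1] H(7)[rule_format, THEN conjunct2]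
  define e where "e = dl^2"
  have e: "0 < e" using dl by (simp add: e_def)
  obtain G where G: "smooth_on UNIV G" "!!x. x >= 0 ==> G x = F (x + e)" "ALL x. 0 <= G x" by (rule profile_shift[OF F(1) e]) (use F(2) in blast)
  have q0: "0 <= qw w z" for z by (rule qw_nonneg[OF wOm(1)])
  define tt where "tt z = G (qw w z)" for z
  have ttF: "tt z = F (qw w z + e)" for z using G(2) q0 by (simp add: tt_def)
  have smooth: "smooth_on UNIV tt" unfolding tt_def by (rule smooth_on_compose_real[OF _ _ _ G(1) smooth_qw[OF wOm(1)]]) auto
  have near: "dist z w <= C * R" if "qw w z + e <= 2 * R^2" for z proof -
  have "(2 * R)^2 = 4 * R^2" "0 <= R^2" by (simp_all add: power2_eq_square)
  hence "sqrt (qw w z + e) <= 2 * R" using that R(1) by (intro real_le_lsqrt) linarith+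
  hence "M1 * sqrt (qw w z + e) <= M1 * (2 * R)" using M1(1) by (intro mult_left_mono) auto
  also have "... <= C * R" using mult_right_mono[OF C(3), of R] R(1) by (simp add: mult_ac)
  finally show ?thesis using M1(2)[OF w, of e z] e by (simp add: dist_norm)
  qed
  have supp: "dist z w <= C * R" if "tt z ~= 0" for z using that near[of z] F(3)[of "qw w z + e"] ttF[of z] by linarith
  have bound: "tt z <= C * R * (1 / max dl (dist z w) ^ (2 * CARD('n) - 1))" for z proof -
  let ?u = "qw w z + e"
  define N where "N = 2 * CARD('n) - 1"
  have N: "real N = 2 * n - 1" using n unfolding N_def n_def by (simp add: of_nat_diff)
  have u: "0 < ?u" using e q0[of z] by linarith
  have "sqrt e <= sqrt ?u" using q0[of z] by simp
  hence "dl <= 1 * sqrt ?u" using dl(1) by (simp add: e_def)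
  also have "... <= M1 * sqrt ?u" using M1(1) u by (intro mult_right_mono) auto
  finally have t: "max dl (dist z w) <= M1 * sqrt ?u" using M1(2)[OF w, of e z] e by (simp add: dist_norm)
  have "?u powr (1/2 - n) = (?u powr (1/2)) powr (- real N)" unfolding powr_powr N by (simp add: diff_divide_distrib)
  also have "... = 1 / sqrt ?u ^ N" unfolding powr_half_sqrt[OF less_imp_le[OF u]] powr_minus_divide using powr_realpow[of "sqrt ?u" N] u by simp
  also have "... = M1 ^ N * (1 / (M1 * sqrt ?u) ^ N)" using M1(1) by (simp add: power_mult_distrib)
  also have "... <= M1 ^ N * (1 / max dl (dist z w) ^ N)"
  using M1(1) dl(1) t u by (intro mult_left_mono divide_left_mono power_mono mult_pos_pos zero_less_power) auto
  finally have "?u powr (1/2 - n) <= M1 ^ N * (1 / max dl (dist z w) ^ N)" .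
  hence "CK * R * ?u powr (1/2 - n) <= CK * R * (M1 ^ N * (1 / max dl (dist z w) ^ N))" using CK(1) R(1) by (intro mult_left_mono) auto
  also have "... = CK * M1 ^ N * R * (1 / max dl (dist z w) ^ N)" by simp
  also have "... <= C * R * (1 / max dl (dist z w) ^ N)" using C(5) R(1) dl(1) unfolding N_def by (intro mult_right_mono) auto
  finally show ?thesis using F(7)[OF u] ttF[of z] unfolding N_def by linarith
  qed
  have test: "test_function_on Om tt" "closure {z. tt z ~= 0} \<subseteq> cball w d" proof -
  have "norm (z - w) <= d" if "tt z ~= 0" for z using supp[OF that] CRd d(1) by (simp add: dist_norm)
  from radial_test[OF w smooth this] show "test_function_on Om tt" "closure {z. tt z ~= 0} \<subseteq> cball w d" by auto
  qed
  obtain T where T: "!!z. z : Om ==> T z = TT tt 0 (%_. 0) w z" "!!z. z ~: closure {z. tt z ~= 0} ==> T z = 0"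
  using TT_extend[OF wOm(1) _ smooth_on_const test(1), of 0 0] by auto
  have low: "c / dl ^ (2 * CARD('n)) * indicator (cball w dl) z - C / R ^ (2 * CARD('n)) * indicator (cball w (C * R)) z <= - Re (Lop tt z)"
  if z: "z : Om" for z proof (cases "dist w z <= d")
  case False
  hence "z ~: closure {z. tt z ~= 0}" using test(2) by auto
  hence "Re (Lop tt z) = 0" using T(1)[OF z] T(2)[of z] by (simp add: TT_no_weight)
  moreover have "dl <= d" proof -
  have "1 * R <= C * R" using C(1) R(1) by (intro mult_right_mono) auto
  thus ?thesis using dlR CRd d(1) by linarith
  qed
  ultimately show ?thesis using False C(1) R(1) by (simp add: indicator_def)
  next
  case True
  define q u where "q = qw w z" and "u = q + e"
  have u: "0 < u" "0 <= q" "q <= u" "q = u - dl^2" using q0[of z] e by (simp_all add: q_def u_def) (simp add: e_def)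
  define X where "X = Re (Lop tt z)"
  have vw: "v <= vol0 w" "vol0 w <= V" using vV wOm by auto
  have est: "abs (X - 2 * vol0 w * (F' u + F'' u * q / n)) <= CT * (weighted1 F' F'' u + abs (F u))"
  using TT_boundD[where tt = tt and F = F and kk = "%_. 0", OF CTb w True e F(1) profile_zero ttF _ q_def u_def]
  unfolding X_def n_def by (simp add: TT_no_weight)
  have Fu: "abs (F u) = F u" "F u <= CK * R * u powr (1/2 - n)" using F(2) F(7)[OF u(1)] u(1) by auto
  have pp: "0 <= u powr b" for b by simp
  have "c / dl ^ (2 * CARD('n)) * indicator (cball w dl) z - C / R ^ (2 * CARD('n)) * indicator (cball w (C * R)) z <= - X" proof (cases "u < R^2")
  case uR: True
  have su: "sqrt u <= R" using real_sqrt_le_mono[OF less_imp_le[OF uR]] R(1) by simp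
  note kp = kernel_principal_part(1)[OF n M(1) u(1) F(5,6)[OF u(1) uR], of dl, folded u(4)]
  kernel_principal_part(2)[OF n M(1) u(1) F(5,6)[OF u(1) uR]]
  have "M * sqrt u <= 1" using mult_left_mono[OF su M(1)] MR by linarith
  hence "(1 + n) * (1 + M * sqrt u) * u powr (1/2 - n) <= (1 + n) * 2 * u powr (1/2 - n)" using n by (intro mult_right_mono mult_left_mono) auto
  hence s1: "weighted1 F' F'' u <= (1 + n) * 2 * u powr (1/2 - n)" using kp(2) by linarith
  have "CK * R * u powr (1/2 - n) <= CK * u powr (1/2 - n)" using CK(1) R(1) R' mult_left_mono[of R 1 CK] by (intro mult_right_mono) auto
  hence "weighted1 F' F'' u + abs (F u) <= (1 + n) * 2 * u powr (1/2 - n) + CK * u powr (1/2 - n)" using s1 Fu by linarith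
  also have "... = (2 * (1 + n) + CK) * u powr (1/2 - n)" by (simp add: algebra_simps)
  finally have "weighted1 F' F'' u + abs (F u) <= (2 * (1 + n) + CK) * u powr (1/2 - n)" .
  from mult_left_mono[OF this CT] have er: "CT * (weighted1 F' F'' u + abs (F u)) <= D * u powr (1/2 - n)" unfolding D_def by (simp only: mult.assoc)
  have "0 <= dl^2 * u powr (- n - 1)" "0 <= M / (2 * n) * u powr (1/2 - n)" using M(1) n by simp_all
  hence neg: "F' u + F'' u * q / n <= 0" using kp(1) by linarith
  have "2 * vol0 w * (F' u + F'' u * q / n) <= 2 * v * (F' u + F'' u * q / n)" using vw neg by (intro mult_right_mono_neg) auto
  also have "... <= 2 * v * (- (dl^2 * u powr (- n - 1)) - M / (2 * n) * u powr (1/2 - n))" using kp(1) vV by (intro mult_left_mono) auto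
  also have "... = - (2 * v * (dl^2 * u powr (- n - 1))) - D * u powr (1/2 - n)" unfolding right_diff_distrib M(2)[symmetric] by simp
  finally have XX: "X <= - (2 * v * (dl^2 * u powr (- n - 1)))" using est er by linarith
  have "c / dl ^ (2 * CARD('n)) * indicator (cball w dl) z <= 2 * v * (dl^2 * u powr (- n - 1))" proof (cases "z : cball w dl")
  case True
  hence "(norm (z - w))^2 <= dl^2" by (intro power_mono) (auto simp: dist_norm norm_minus_commute)
  hence "qw w z <= M2 * dl^2" using M2(2)[OF w, of z] mult_left_mono[of "(norm (z - w))^2" "dl^2" M2] M2(1) by linarith
  hence "u <= (M2 + 1) * dl^2" unfolding u_def q_def e_def by (simp add: algebra_simps)
  hence "((M2 + 1) * dl^2) powr (- n - 1) <= u powr (- n - 1)" using u n by (intro powr_mono2') auto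
  hence "2 * v * (dl^2 * ((M2 + 1) * dl^2) powr (- n - 1)) <= 2 * v * (dl^2 * u powr (- n - 1))" using vV by (intro mult_left_mono) auto
  moreover have "dl^2 * ((M2 + 1) * dl^2) powr (- n - 1) = (M2 + 1) powr (- n - 1) / dl ^ (2 * CARD('n))" proof -
  have "dl^2 * (dl^2) powr (- n - 1) = (dl^2) powr (- n)" using e by (simp add: powr_mult_base e_def)
  also have "... = 1 / dl ^ (2 * CARD('n))" using e by (simp add: powr_minus powr_realpow n_def power_mult divide_inverse e_def)
  finally have "(M2 + 1) powr (- n - 1) * (dl^2 * (dl^2) powr (- n - 1)) = (M2 + 1) powr (- n - 1) * (1 / dl ^ (2 * CARD('n)))" by simp
  thus ?thesis unfolding powr_mult by (simp only: mult_ac) simp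
  qed
  ultimately show ?thesis using True by (simp add: c_def)
  qed (use vV in auto)
  moreover have "0 <= C / R ^ (2 * CARD('n)) * indicator (cball w (C * R)) z" using C(1) R(1) by simp
  ultimately show ?thesis using XX by linarith
  next
  case uR: False
  have nb: "z ~: cball w dl"
  proof
  assume "z : cball w dl"
  hence "(norm (z - w))^2 <= dl^2" by (intro power_mono) (auto simp: dist_norm norm_minus_commute)
  hence "qw w z <= M2 * dl^2" using M2(2)[OF w, of z] mult_left_mono[of "(norm (z - w))^2" "dl^2" M2] M2(1) by linarith
  hence "u <= (M2 + 1) * dl^2" unfolding u_def q_def e_def by (simp add: algebra_simps)
  \<comment> \<open>The hypothesis \<open>C * dl <= R\<close> with \<open>C >= M2 + 2\<close>
    separates the scales: the ball of radius \<open>dl\<close> does not reach the truncation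
    zone.\<close>
  also have "... < (C * C) * dl^2"
  proof (rule mult_strict_right_mono)
  have "C * 1 <= C * C" using C(1) by (intro mult_left_mono) auto
  thus "M2 + 1 < C * C" using C(2) by linarith
  qed (use dl in simp)
  also have "... = (C * dl)^2" by (simp add: power2_eq_square)
  also have "... <= R^2" using dl C(1) by (intro power_mono) auto
  finally show False using uR by simp
  qed
  have "X <= C / R ^ (2 * CARD('n)) * indicator (cball w (C * R)) z" proof (cases "u <= 2 * R^2")
  case True
  hence zin: "z : cball w (C * R)" using near[of z] by (simp add: u_def q_def dist_commute)
  let ?r = "R powr (- 2 * n)"
  have b: "abs (F' u) <= CK * ?r" "u * abs (F'' u) <= CK * ?r" using F(8,9)[of u] True uR by auto
  have "abs (F'' u * q / n) <= u * abs (F'' u)" proof -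
  have "abs (F'' u * q / n) = abs (F'' u) * (q / n)" using u n by (simp add: abs_mult)
  also have "... <= abs (F'' u) * u"
  proof (rule mult_left_mono)
  have "q / n <= q / 1" using u n by (intro divide_left_mono) auto
  thus "q / n <= u" using u(3) by linarith
  qed simp
  finally show ?thesis by (simp add: mult.commute)
  qed
  hence "abs (F' u + F'' u * q / n) <= 2 * CK * ?r" using b by linarith
  hence "2 * vol0 w * abs (F' u + F'' u * q / n) <= 2 * V * (2 * CK * ?r)" using vw vV by (intro mult_mono) auto
  moreover have "2 * vol0 w * (F' u + F'' u * q / n) <= 2 * vol0 w * abs (F' u + F'' u * q / n)" using vw vV by (intro mult_left_mono) auto
  moreover have "CT * (weighted1 F' F'' u + abs (F u)) <= CT * (5 * CK * ?r)"
  proof (rule mult_left_mono[OF _ CT])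
  have "(2 * R)^2 = 4 * R^2" "0 <= R^2" by (simp_all add: power2_eq_square)
  hence "sqrt u <= 2 * R" using True R(1) by (intro real_le_lsqrt) linarith+
  hence "sqrt u <= 2" using R' by linarith
  hence "weighted1 F' F'' u <= 2 * (CK * ?r + CK * ?r)" by (rule mult_mono[OF _ add_mono[OF b]]) (use u(1) in auto)
  moreover have "F u <= CK * ?r" proof -
  have "u powr (1/2 - n) <= (R^2) powr (1/2 - n)" using uR R(1) n by (intro powr_mono2') auto
  also have "(R^2) powr (1/2 - n) = R powr (2 * (1/2 - n))" using R(1) by (simp only: powr_powr flip: powr_numeral)
  also have "... = R * ?r" using R(1) by (simp add: powr_mult_base)
  finally have "CK * R * u powr (1/2 - n) <= CK * R * (R * ?r)" using CK(1) R(1) by (intro mult_left_mono) auto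
  also have "... = (CK * ?r) * (R * R)" by simp
  also have "... <= (CK * ?r) * (1 * 1)" using CK(1) R(1) R' by (intro mult_left_mono mult_mono) auto
  finally show ?thesis using Fu by simp
  qed
  ultimately have "weighted1 F' F'' u + F u <= 2 * (CK * ?r + CK * ?r) + CK * ?r" by (rule add_mono)
  thus "weighted1 F' F'' u + abs (F u) <= 5 * CK * ?r" unfolding Fu(1) by simp
  qed
  ultimately have "X <= 2 * V * (2 * CK * ?r) + CT * (5 * CK * ?r)" using est by linarith
  also have "... = CX * ?r" unfolding CX_def by (simp add: algebra_simps)
  also have "... <= C * ?r" using C(4) by (intro mult_right_mono) auto
  finally show ?thesis unfolding pR using zin by simp
  next
  case False
  hence "X = 0" using est F(3,4)[of u] by simp
  thus ?thesis using C(1) R(1) by simp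
  qed
  thus ?thesis using nb by simp
  qed
  thus ?thesis by (simp add: X_def)
  qed
  show ?thesis using smooth G(3) supp bound low unfolding tt_def[symmetric] by (intro exI[of _ tt]) (auto simp: tt_def)
 qed
 thus thesis by (rule that[OF C(1) c R1(1,2)])
qed

end

section \<open>The mass of a compact set at a fixed scale\<close>

context chart_compact
begin

text \<open>The test function is \<open>C1 * R^2\<close> times the plateau minus dl^(2n) times the
  sum of the kernels centred at a \<open>dl\<close>-net of \<open>E\<close>. The singular parts of
  the kernels cover \<open>E\<close>, their truncations are supported in balls of radius
  \<open>C * R\<close> whose mass is bounded by the hypothesis, and the plateau gives the term
  \<open>R^2\<close>. The net is counted by disjoint balls of radius \<open>dl / 2\<close>, which
  stick out of \<open>E\<close>; hence the set \<open>S\<close>.\<close>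

lemma mass_estimate_scale:
 assumes sub: "omega_m_subharmonic_on m om Om ph" and loc: "loc_integrable_on Om ph" and m: "1 <= m" "m <= CARD('n)"
  and A: "1 <= A" "!!z. z : Kd ==> ph z <= ereal (A - 1)"
  and CM: "0 <= CM" "0 < R0" "!!w R. w : K ==> 0 < R ==> R <= R0 ==>
  (LINT z|lebesgue. indicator (cball w R) z * (A - rl (ph z))) <= CM * R powr b"
 obtains C c D R1 where "1 <= C" "0 < c" "0 <= D" "0 < R1"
  "!!E R dl S. compact E ==> E \<subseteq> K ==> 0 < R ==> R <= R1 ==> 0 < dl ==> C * dl <= R ==> S : lmeasurable ==>
  (!!w. w : E ==> ball w (dl / 2) \<subseteq> S) ==>
  c * (LINT z|lebesgue. indicator E z * (A - rl (ph z))) <= D * (R^2 + R powr b / R ^ (2 * CARD('n)) * measure lebesgue S)" proof -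
 define f where "f z = A - rl (ph z)" for z
 define N where "N = 2 * CARD('n)"
 have N: "DIM(complex^'n) = N" by (simp add: N_def)
 have f1: "1 <= f z" if "z : Kd" for z unfolding f_def by (rule defect_ge_1[OF A(1) A(2)[OF that]])
 obtain C c R1 where C: "1 <= C" "0 < c" "0 < R1" "R1 <= 1" and ker:
  "!!R dl w. 0 < R ==> R <= R1 ==> 0 < dl ==> C * dl <= R ==> w : K ==>
  EX tt. kernel_at C c R dl w tt" by (rule kernel_field) blast
 obtain tt0 r B where tt0: "test_function_on Om tt0" "!!z. 0 <= tt0 z" "0 < r" "r <= d"
  "!!w z. w : K ==> norm (z - w) <= r ==> 1 <= tt0 z" "closure {z. tt0 z ~= 0} \<subseteq> Kd"
  "0 <= B" "!!z. z : Om ==> abs (Re (Lop tt0 z)) <= B" "!!z. tt0 z <= B" by (rule plateau) blast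
 obtain v V where vV: "0 < v" "v <= V" "!!z. z : Kd ==> vol0 z <= V" using vol0_bounds by blast
 define R2 where "R2 = min R1 (min (r / C) (R0 / C))"
 have R2: "0 < R2" "R2 <= R1" "R2 <= r / C" "R2 <= R0 / C" using C tt0(3) CM(2) by (auto simp: R2_def)
 \<comment> \<open>The size of the weighted kernel sum over \<open>R^2\<close>: one factor
   \<open>C * R\<close> from the bound on each kernel, the other from the radius in
   \<open>separated_kernel_sum\<close>.\<close>
 define C1 where "C1 = C * C * 8 ^ N"
 have C1: "0 <= C1" using C by (simp add: C1_def)
 define I where "I = (LINT z|lebesgue. indicator Kd z * f z)"
 have iC: "integrable lebesgue (%z. indicator C z * f z)" if "compact C" "C \<subseteq> Om" for C unfolding f_def by (rule loc_integrable_defect[OF loc that])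
 have iKd: "integrable lebesgue (%z. indicator Kd z * f z)" by (rule iC[OF compact_Kd K_sub(2)])
 have I0: "0 <= I" unfolding I_def by (rule integral_nonneg_AE, rule AE_I2) (use f1 in \<open>force simp: indicator_def\<close>)
 define C2 where "C2 = C1 * B * (1 + V)"
 have C2: "0 <= C2" using C1 tt0(7) vV by (simp add: C2_def)
 define C3 where "C3 = C * CM * C powr b * 2 ^ N / unit_ball_vol (real N)"
 have C3: "0 <= C3" using C(1) CM(1) by (simp add: C3_def)
 define D where "D = C2 * I + C3"
 have D: "0 <= D" using C2 I0 C3 by (simp add: D_def)
 have "c * (LINT z|lebesgue. indicator E z * f z) <= D * (R^2 + R powr b / R ^ N * measure lebesgue S)"
  if E: "compact E" "E \<subseteq> K" and R: "0 < R" "R <= R2" and dl: "0 < dl" "C * dl <= R"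
  and S: "S : lmeasurable" "!!w. w : E ==> ball w (dl / 2) \<subseteq> S" for E R dl S proof (cases "E = {}")
  case True
  thus ?thesis using D R(1) by simp
 next
  case False
  then obtain w0 where w0: "w0 : E" by blast
  have w0Om: "w0 : Om" using w0 E K_sub by blast
  obtain W where W: "finite W" "W \<subseteq> E" "!!x y. x : W ==> y : W ==> x ~= y ==> dl <= dist x y"
  "!!x. x : E ==> EX w:W. dist w x <= dl" by (rule maximal_separated[OF compact_imp_bounded[OF E(1)] dl(1)]) blast
  have WK: "w : K" if "w : W" for w using that W(2) E(2) by blast
  have "ALL w:W. EX tt. kernel_at C c R dl w tt" using ker[OF R(1) order_trans[OF R(2) R2(2)] dl(1,2)] WK by blast
  from bchoice[OF this] obtain Th where Th: "ALL w:W. smooth_on UNIV (Th w) & (ALL z. 0 <= Th w z) & (ALL z. Th w z ~= 0 --> dist z w <= C * R) &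
  (ALL z. Th w z <= C * R * (1 / max dl (dist z w) ^ (2 * CARD('n) - 1))) &
  (ALL z:Om. c / dl ^ (2 * CARD('n)) * indicator (cball w dl) z - C / R ^ (2 * CARD('n)) * indicator (cball w (C * R)) z
  <= - Re (Lop (Th w) z))" by blast
  have Th1: "smooth_on UNIV (Th w)" "0 <= Th w z" "Th w z ~= 0 ==> dist z w <= C * R"
  "Th w z <= C * R * (1 / max dl (dist z w) ^ (N - 1))"
  "z : Om ==> c / dl ^ N * indicator (cball w dl) z - C / R ^ N * indicator (cball w (C * R)) z <= - Re (Lop (Th w) z)"
  if "w : W" for w z using bspec[OF Th that] unfolding N_def by blast+
  have CR: "C * R <= r" "C * R <= R0" "0 < C * R" proof -
  have "R <= r / C" "R <= R0 / C" using R R2 by linarith+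
  thus "C * R <= r" "C * R <= R0" "0 < C * R" using C(1) R(1) by (simp_all add: pos_le_divide_eq mult.commute)
  qed
  have dlCR: "dl <= C * R" proof -
  have "1 * dl <= C * dl" "1 * R <= C * R" using C(1) dl(1) R(1) by (auto intro: mult_right_mono)
  thus ?thesis using dl(2) by linarith
  qed
  \<comment> \<open>Where some kernel is nonzero the plateau is at least 1, as
    \<open>C * R <= r\<close>, so the first term dominates the kernel sum and \<open>tt\<close> is
    nonnegative.\<close>
  define tt where "tt z = (C1 * R^2) * tt0 z + (SUM w:W. (- (dl ^ N)) * Th w z)" for z
  have tt': "tt z = C1 * R^2 * tt0 z - dl ^ N * (SUM w:W. Th w z)" for z by (simp add: tt_def sum_distrib_left sum_negf)
  have sTh: "0 <= dl ^ N * (SUM w:W. Th w z)" for z using dl(1) Th1(2) by (intro mult_nonneg_nonneg sum_nonneg) auto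
  have nn: "0 <= tt z" for z proof (cases "EX w:W. Th w z ~= 0")
  case False
  hence "(SUM w:W. Th w z) = 0" by (intro sum.neutral) blast
  thus ?thesis unfolding tt' using C1 tt0(2) by simp
  next
  case True
  then obtain w where w: "w : W" "Th w z ~= 0" by blast
  have "norm (z - w) <= r" using Th1(3)[OF w] CR(1) by (simp add: dist_norm)
  hence one: "1 <= tt0 z" by (rule tt0(5)[OF WK[OF w(1)]])
  let ?W = "{w. w : W & max dl (dist z w) <= C * R}"
  have "(SUM w:W. Th w z) = (SUM w:?W. Th w z)" by (rule sum.mono_neutral_right) (use W(1) Th1(3) dlCR in force)+
  also have "... <= (SUM w:?W. C * R * (1 / max dl (dist z w) ^ (N - 1)))" by (rule sum_mono) (use Th1(4) in auto)
  also have "... = C * R * (SUM w:?W. 1 / max dl (dist z w) ^ (N - 1))" by (simp only: sum_distrib_left)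
  finally have "dl ^ N * (SUM w:W. Th w z) <= dl ^ N * (C * R * (SUM w:?W. 1 / max dl (dist z w) ^ (N - 1)))" using dl(1) by (intro mult_left_mono) auto
  also have "... = C * R * (dl ^ N * (SUM w:?W. 1 / max dl (dist z w) ^ (N - 1)))" by (simp only: mult_ac)
  also have "... <= C * R * (8 ^ N * (C * R))" using separated_kernel_sum[OF W(1,3) dl(1), of "C * R" z] CR(3) unfolding N by (intro mult_left_mono) auto
  also have "... = C1 * R^2 * 1" by (simp add: C1_def power2_eq_square)
  also have "... <= C1 * R^2 * tt0 z" using one C1 by (intro mult_left_mono) auto
  finally show ?thesis unfolding tt' by simp
  qed
  have supp: "z : Kd" if "tt z ~= 0" for z proof (cases "tt0 z = 0")
  case False
  hence "z : {z. tt0 z ~= 0}" by simp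
  thus ?thesis by (rule subsetD[OF tt0(6) subsetD[OF closure_subset]])
  next
  case True
  have "EX w:W. Th w z ~= 0"
  proof (rule ccontr)
  assume "~ ?thesis"
  hence "(SUM w:W. Th w z) = 0" by (intro sum.neutral) blast
  thus False using \<open>tt z ~= 0\<close> True unfolding tt' by simp
  qed
  then obtain w where w: "w : W" "Th w z ~= 0" by blast
  thus ?thesis using Th1(3)[OF w] CR(1) tt0(4) by (intro KdI[OF WK[OF w(1)]]) (simp add: dist_commute)
  qed
  have cl: "closure {z. tt z ~= 0} \<subseteq> Kd" by (rule closure_minimal) (use supp compact_imp_closed[OF compact_Kd] in auto)
  hence "compact (closure {z. tt z ~= 0})" by (meson bounded_subset closed_closure compact_Kd compact_eq_bounded_closed)
  moreover have s0: "smooth_on UNIV tt0" using tt0(1) by (simp add: test_function_on_def)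
  moreover have "smooth_on UNIV tt" unfolding tt_def using s0 Th1(1) by (intro smooth_on_add smooth_on_sum smooth_on_cmult) auto
  ultimately have test: "test_function_on Om tt" using cl K_sub(2) by (auto simp: test_function_on_def)
  have ok: "weight_ok w0 1 (%_. 0)" by (simp add: weight_ok_def)
  have sg: "sigma_ok m 0 1" using m by (simp add: sigma_ok_def)
  note key = key_inequality(1)[OF w0Om ok sg sub loc test nn] key_inequality(2,3)[OF w0Om ok sg sub loc test nn, of A]
  obtain T where T: "!!z. z : Om ==> T z = TT tt 0 (%_. 0) w0 z" "!!z. z ~: closure {z. tt z ~= 0} ==> T z = 0"
  using TT_extend[OF w0Om _ smooth_on_const test, of 0 0] by auto
  have EKd: "E \<subseteq> Kd" using E K_sub by blast
  have WKd: "cball w (C * R) \<subseteq> Kd" if "w : W" for w using KdI[OF WK[OF that]] CR(1) tt0(4) by auto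
  have bound: "c * (indicator E z * f z) - C2 * R^2 * (indicator Kd z * f z) - C / R ^ N * dl ^ N * (SUM w:W. indicator (cball w (C * R)) z * f z)
  <= - (indicator Om z * ((rl (ph z) - A) * TT tt 0 (%_. 0) w0 z)) - indicator Om z * (tt z * vol0 z)" for z proof (cases "z : Kd")
  case False
  hence "z ~: closure {z. tt z ~= 0}" using cl by auto
  moreover have "tt z = 0" using supp False by blast
  ultimately have e: "indicator Om z * ((rl (ph z) - A) * TT tt 0 (%_. 0) w0 z) = 0" "tt z = 0" using T(1)[of z] T(2)[of z] by (auto simp: indicator_def)
  have "(SUM w:W. indicator (cball w (C * R)) z * f z) = 0" by (rule sum.neutral) (use WKd False in \<open>force simp: indicator_def\<close>)
  moreover have "z ~: E" using EKd False by blast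
  ultimately show ?thesis unfolding e using False by simp
  next
  case True
  have z: "z : Om" using True K_sub by blast
  have fz: "1 <= f z" by (rule f1[OF True])
  have L: "Re (Lop tt z) = C1 * R^2 * Re (Lop tt0 z) + dl ^ N * (SUM w:W. - Re (Lop (Th w) z))" proof -
  have "Lop tt z = of_real (C1 * R^2) * Lop tt0 z + (SUM w:W. of_real (- (dl ^ N)) * Lop (Th w) z)"
  unfolding tt_def[abs_def] by (rule Lop_sum[OF W(1) Th1(1) s0 z])
  thus ?thesis by (simp add: sum_distrib_left sum_negf del: of_real_mult of_real_power)
  qed
  have l1: "- (C1 * R^2 * B) <= C1 * R^2 * Re (Lop tt0 z)" proof -
  have "C1 * R^2 * (- B) <= C1 * R^2 * Re (Lop tt0 z)" using tt0(8)[OF z] C1 by (intro mult_left_mono) auto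
  thus ?thesis by simp
  qed
  have l2: "dl ^ N * (SUM w:W. c / dl ^ N * indicator (cball w dl) z - C / R ^ N * indicator (cball w (C * R)) z)
  <= dl ^ N * (SUM w:W. - Re (Lop (Th w) z))" using dl(1) Th1(5)[OF _ z] by (intro mult_left_mono sum_mono) auto
  have l3: "dl ^ N * (SUM w:W. c / dl ^ N * indicator (cball w dl) z - C / R ^ N * indicator (cball w (C * R)) z)
  = c * (SUM w:W. indicator (cball w dl) z) - C / R ^ N * dl ^ N * (SUM w:W. indicator (cball w (C * R)) z)"
  using dl(1) by (simp add: sum_subtractf right_diff_distrib sum_distrib_left sum_divide_distrib mult_ac)
  have l4: "c * indicator E z <= c * (SUM w:W. indicator (cball w dl) z)" proof (cases "z : E")
  case True
  then obtain w where w: "w : W" "dist w z <= dl" using W(4) by blast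
  have "indicator (cball w dl) z <= (SUM w:W. indicator (cball w dl) z :: real)" by (rule member_le_sum) (use w W(1) in auto)
  thus ?thesis using w True C(2) by simp
  qed (use C(2) in \<open>auto intro!: sum_nonneg mult_nonneg_nonneg\<close>)
  have "c * indicator E z - C / R ^ N * dl ^ N * (SUM w:W. indicator (cball w (C * R)) z) - C1 * R^2 * B <= Re (Lop tt z)"
  unfolding L using l1 l2 l3 l4 by linarith
  hence "f z * (c * indicator E z - C / R ^ N * dl ^ N * (SUM w:W. indicator (cball w (C * R)) z) - C1 * R^2 * B) <= f z * Re (Lop tt z)"
  using fz by (intro mult_left_mono) auto
  moreover have "tt z * vol0 z <= f z * (C1 * R^2 * B * V)" proof -
  have "tt z <= C1 * R^2 * tt0 z" unfolding tt' using sTh by simp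
  also have "... <= C1 * R^2 * B" using tt0(9) C1 by (intro mult_left_mono) auto
  finally have "tt z * vol0 z <= C1 * R^2 * B * V" using vV(3)[OF True] vol0_pos[OF z] nn[of z] C1 tt0(7) by (intro mult_mono) auto
  also have "... <= f z * (C1 * R^2 * B * V)" using mult_right_mono[OF fz, of "C1 * R^2 * B * V"] C1 tt0(7) vV by simp
  finally show ?thesis .
  qed
  ultimately have "f z * (c * indicator E z - C / R ^ N * dl ^ N * (SUM w:W. indicator (cball w (C * R)) z) - C1 * R^2 * B) - f z * (C1 * R^2 * B * V)
  <= f z * Re (Lop tt z) - tt z * vol0 z" by linarith
  moreover have "c * (indicator E z * f z) - C2 * R^2 * (indicator Kd z * f z) - C / R ^ N * dl ^ N * (SUM w:W. indicator (cball w (C * R)) z * f z)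
  = f z * (c * indicator E z - C / R ^ N * dl ^ N * (SUM w:W. indicator (cball w (C * R)) z) - C1 * R^2 * B) - f z * (C1 * R^2 * B * V)"
  unfolding sum_distrib_right[symmetric] C2_def using True by (simp add: algebra_simps)
  moreover have "f z * Re (Lop tt z) - tt z * vol0 z = - (indicator Om z * ((rl (ph z) - A) * TT tt 0 (%_. 0) w0 z)) - indicator Om z * (tt z * vol0 z)"
  using z by (simp add: TT_no_weight f_def algebra_simps)
  ultimately show ?thesis by linarith
  qed
  have iE: "integrable lebesgue (%z. indicator E z * f z)" by (rule iC[OF E(1)]) (use EKd K_sub in blast)
  have iw: "integrable lebesgue (%z. indicator (cball w (C * R)) z * f z)" if "w : W" for w by (rule iC) (use WKd[OF that] K_sub in auto)
  have "(LINT z|lebesgue. c * (indicator E z * f z) - C2 * R^2 * (indicator Kd z * f z) - C / R ^ N * dl ^ N * (SUM w:W. indicator (cball w (C * R)) z * f z))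
  <= (LINT z|lebesgue. - (indicator Om z * ((rl (ph z) - A) * TT tt 0 (%_. 0) w0 z)) - indicator Om z * (tt z * vol0 z))" by (rule integral_mono[OF _ _ bound])
  (intro Bochner_Integration.integrable_diff integrable_minus integrable_mult_right Bochner_Integration.integrable_sum iE iw iKd key(1,2); assumption)+
  also have "... <= 0" using key by simp
  finally have "c * (LINT z|lebesgue. indicator E z * f z) <= C2 * R^2 * I + C / R ^ N * dl ^ N * (SUM w:W. \<integral>z. indicator (cball w (C * R)) z * f z \<partial>lebesgue)"
  using iE iw iKd by (simp add: I_def Bochner_Integration.integral_sum)
  also have "... <= C2 * R^2 * I + C3 * (R powr b / R ^ N * measure lebesgue S)"
  proof (rule add_left_mono)
  let ?u = "unit_ball_vol (real N)"
  have "0 < ?u" by simp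
  hence u: "?u ~= 0" by linarith
  have "(SUM w:W. \<integral>z. indicator (cball w (C * R)) z * f z \<partial>lebesgue) <= real (card W) * (CM * (C * R) powr b)"
  by (rule sum_bounded_above) (use CM(3)[OF WK CR(3,2)] in \<open>simp add: f_def\<close>)
  hence "C / R ^ N * dl ^ N * (SUM w:W. \<integral>z. indicator (cball w (C * R)) z * f z \<partial>lebesgue) <= C / R ^ N * dl ^ N * (real (card W) * (CM * (C * R) powr b))"
  using C(1) R(1) dl(1) by (intro mult_left_mono) auto
  \<comment> \<open>The number of net points times dl^N is rewritten as the total volume of the
    balls of radius \<open>dl / 2\<close> around them.\<close>
  also have "... = (C * CM * C powr b * 2 ^ N / ?u) * (R powr b / R ^ N) * (real (card W) * (?u * (dl / 2) ^ N))" using u by (simp add: powr_mult power_divide)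
  also have "... <= (C * CM * C powr b * 2 ^ N / ?u) * (R powr b / R ^ N) * measure lebesgue S"
  proof (rule mult_left_mono)
  show "real (card W) * (?u * (dl / 2) ^ N) <= measure lebesgue S" using separated_measure[OF W(1,3) dl(1) S(1)] S(2) W(2) unfolding N by blast
  qed (use C(1) CM(1) R(1) in simp)
  finally show "C / R ^ N * dl ^ N * (SUM w:W. \<integral>z. indicator (cball w (C * R)) z * f z \<partial>lebesgue) <= C3 * (R powr b / R ^ N * measure lebesgue S)"
  by (simp add: C3_def mult.assoc)
  qed
  also have "... <= D * R^2 + D * (R powr b / R ^ N * measure lebesgue S)"
  proof (rule add_mono)
  have "(C2 * I) * R^2 <= D * R^2" unfolding D_def using C3 by (intro mult_right_mono) auto
  thus "C2 * R^2 * I <= D * R^2" by (simp only: mult_ac)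
  show "C3 * (R powr b / R ^ N * measure lebesgue S) <= D * (R powr b / R ^ N * measure lebesgue S)"
  unfolding D_def using C2 I0 R(1) by (intro mult_right_mono) auto
  qed
  finally show ?thesis by (simp add: distrib_left)
 qed
 thus thesis unfolding f_def N_def by (rule that[OF C(1,2) D R2(1)])
qed

end

section \<open>Local integrability\<close>

text \<open>Dyadic layers: above \<open>t0\<close> the integrand is at most
  \<open>t (Suc k) powr p\<close> on the layer starting at \<open>t k\<close>, and the layers sum to
  a geometric series of ratio \<open>2 powr (p - s)\<close>, which is below 1.\<close>

lemma weak_type_integrable:
 fixes f :: "'a::euclidean_space => real"
 assumes K: "K : lmeasurable" and G: "!!t. {z : K. t <= f z} : sets lebesgue"
  and weak: "!!t. t0 <= t ==> measure lebesgue {z : K. t <= f z} <= C * t powr (- s)"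
  and t0: "0 < t0" and p: "0 < p" "p < s" and f0: "!!z. z : K ==> 0 <= f z" and C: "0 <= C"
 shows "(\<integral>\<^sup>+z\<in>K. ennreal (f z powr p) \<partial>lebesgue) < \<infinity>" proof -
 define t where "t k = 2 ^ k * t0" for k
 have tp: "0 < t k" "t0 <= t k" for k using t0 by (auto simp: t_def)
 let ?G = "%k. {z : K. t k <= f z}"
 have GL: "?G k : lmeasurable" for k by (rule fmeasurableI2[OF K _ G]) auto
 let ?q = "2 powr (p - s)"
 have q: "0 < ?q" "?q < 1" using p by (auto simp: powr_less_one)
 define c where "c = t0 powr (p - s) * 2 powr p * C"
 have c: "0 <= c" using C by (simp add: c_def)
 have pt: "ennreal (f z powr p) * indicator K z <= ennreal (t0 powr p) * indicator K z + (\<Sum>k. ennreal (t (Suc k) powr p) * indicator (?G k) z)" for z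
 proof (cases "z : K & t0 <= f z")
  case True
  obtain k where k: "t k <= f z" "f z < t (Suc k)" proof -
  obtain j where "f z / t0 < 2 ^ j" using real_arch_pow[of 2 "f z / t0"] by auto
  hence j: "f z < t j" using t0 by (simp add: t_def pos_divide_less_eq)
  define j0 where "j0 = (LEAST j. f z < t j)"
  have j0: "f z < t j0" unfolding j0_def by (rule LeastI[of _ j]) (rule j)
  moreover have "j0 ~= 0"
  proof
  assume "j0 = 0"
  hence "f z < t0" using j0 by (simp add: t_def)
  thus False using True by simp
  qed
  then obtain i where i: "j0 = Suc i" by (cases j0) auto
  moreover have "~ f z < t i" using not_less_Least[of i "%j. f z < t j"] i unfolding j0_def by simp
  ultimately show thesis using that[of i] by simp
  qed
  have "ennreal (f z powr p) * indicator K z <= ennreal (t (Suc k) powr p) * indicator (?G k) z" using True k p f0 by (auto intro!: ennreal_leI powr_mono2)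
  also have "... <= (\<Sum>k. ennreal (t (Suc k) powr p) * indicator (?G k) z)" proof -
  have "g k <= suminf g" for g :: "nat => ennreal" using sum_le_suminf[of g "{k}"] by simp
  thus ?thesis .
  qed
  finally show ?thesis by (simp add: add_increasing)
 next
  case False
  hence "ennreal (f z powr p) * indicator K z <= ennreal (t0 powr p) * indicator K z" using p f0 by (auto simp: indicator_def intro!: ennreal_leI powr_mono2)
  thus ?thesis by (simp add: add_increasing2)
 qed
 have mG: "?G k : sets lebesgue" for k by (rule G)
 have "(\<integral>\<^sup>+z\<in>K. ennreal (f z powr p) \<partial>lebesgue)
  <= (\<integral>\<^sup>+z. ennreal (t0 powr p) * indicator K z + (\<Sum>k. ennreal (t (Suc k) powr p) * indicator (?G k) z) \<partial>lebesgue)"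
  by (rule nn_integral_mono) (rule pt)
 also have "... = ennreal (t0 powr p) * emeasure lebesgue K + (\<Sum>k. ennreal (t (Suc k) powr p) * emeasure lebesgue (?G k))"
  using fmeasurableD[OF K] mG by (simp add: nn_integral_add nn_integral_suminf nn_integral_cmult)
 also have "... <= ennreal (t0 powr p) * emeasure lebesgue K + (\<Sum>k. ennreal (c * ?q ^ k))"
 proof (intro add_left_mono suminf_le)
  fix k
  have "ennreal (t (Suc k) powr p) * emeasure lebesgue (?G k) = ennreal (t (Suc k) powr p * measure lebesgue (?G k))"
  using emeasure_eq_measure2[OF GL[of k]] by (simp add: ennreal_mult)
  also have "... <= ennreal (c * ?q ^ k)"
  proof (rule ennreal_leI)
  have ts: "t (Suc k) = 2 * t k" by (simp add: t_def)
  have "(2 * t k) powr p * measure lebesgue (?G k) <= (2 * t k) powr p * (C * t k powr (- s))" using weak[OF tp(2)] by (intro mult_left_mono) auto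
  also have "(2 * t k) powr p * (C * t k powr (- s)) = 2 powr p * C * t k powr (p - s)"
  using tp(1)[of k] by (simp add: powr_mult powr_diff powr_minus divide_inverse)
  also have "t k powr (p - s) = ?q ^ k * t0 powr (p - s)" proof -
  have "(2 ^ k) powr (p - s) = ?q ^ k" by (simp add: powr_powr powr_realpow[symmetric] mult.commute)
  thus ?thesis by (simp add: t_def powr_mult)
  qed
  finally show "t (Suc k) powr p * measure lebesgue (?G k) <= c * ?q ^ k" unfolding ts by (simp add: c_def mult_ac)
  qed
  finally show "ennreal (t (Suc k) powr p) * emeasure lebesgue (?G k) <= ennreal (c * ?q ^ k)" .
 qed auto
 also have "(\<Sum>k. ennreal (c * ?q ^ k)) = ennreal (\<Sum>k. c * ?q ^ k)"
  by (rule suminf_ennreal2) (use c q in \<open>auto intro!: summable_mult summable_geometric\<close>)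
 also have "ennreal (t0 powr p) * emeasure lebesgue K + ennreal (\<Sum>k. c * ?q ^ k) < \<infinity>"
  using fmeasurableD2[OF K] by (simp add: ennreal_mult_less_top less_top)
 finally show ?thesis .
qed

section \<open>Weak type bound for level sets\<close>

context chart_compact
begin

text \<open>For fixed \<open>R\<close> the net scale \<open>dl\<close> tends to 0, so
  \<open>S\<close> can be replaced by \<open>E\<close>. On \<open>E\<close> the integrand is at
  least \<open>t\<close>; the radius is then chosen so that the term with the measure of
  \<open>E\<close> takes up half of the left side.\<close>

lemma level_set_measure:
 fixes b :: real
 assumes sub: "omega_m_subharmonic_on m om Om ph" and loc: "loc_integrable_on Om ph" and m: "1 <= m" "m <= CARD('n)"
  and A: "1 <= A" "!!z. z : Kd ==> ph z <= ereal (A - 1)"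
  and CM: "0 <= CM" "0 < R0" "!!w R. w : K ==> 0 < R ==> R <= R0 ==>
  (LINT z|lebesgue. indicator (cball w R) z * (A - rl (ph z))) <= CM * R powr b"
  and b: "b < 2 * real CARD('n)"
 obtains C t0 where "0 <= C" "0 < t0" "!!t. t0 <= t ==>
  measure lebesgue {z : K. t <= A - rl (ph z)} <= C * t powr (- (1 + 2 / (2 * real CARD('n) - b)))"
  "!!t. {z : K. t <= A - rl (ph z)} : sets lebesgue" proof -
 define f where "f z = A - rl (ph z)" for z
 obtain C0 c D R1 where C0: "1 <= C0" "0 < c" "0 <= D" "0 < R1" and est:
  "!!E R dl S. compact E ==> E \<subseteq> K ==> 0 < R ==> R <= R1 ==> 0 < dl ==> C0 * dl <= R ==> S : lmeasurable ==>
  (!!w. w : E ==> ball w (dl / 2) \<subseteq> S) ==>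
  c * (LINT z|lebesgue. indicator E z * f z) <= D * (R^2 + R powr b / R ^ (2 * CARD('n)) * measure lebesgue S)"
  unfolding f_def by (rule mass_estimate_scale[OF sub loc m A CM]) blast+
 define k where "k = 2 * real CARD('n) - b"
 have k: "0 < k" using b by (simp add: k_def)
 have E1: "c * (LINT z|lebesgue. indicator E z * f z) <= D * (R^2 + R powr (- k) * measure lebesgue E)"
  if E: "compact E" "E \<subseteq> K" and R: "0 < R" "R <= R1" for E R
 proof (rule field_le_epsilon)
  fix e :: real assume e: "0 < e"
  define h where "h = e / (D * R powr (- k) + 1)"
  have Dk: "0 <= D * R powr (- k)" using C0(3) by simp
  have h: "0 < h" using e Dk by (simp add: h_def)
  \<comment> \<open>Outer regularity: an open set of almost the same measure contains the balls of
    radius \<open>dl / 2\<close> around \<open>E\<close> once \<open>dl\<close> is small.\<close>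
  obtain S where S: "open S" "E \<subseteq> S" "S - E : lmeasurable" "emeasure lebesgue (S - E) < ennreal h"
  by (rule sets_lebesgue_outer_open[OF _ h, of E]) (use E in \<open>auto simp: compact_imp_closed\<close>)
  have EL: "E : lmeasurable" using E(1) by (rule lmeasurable_compact)
  have SE: "S = E \<union> (S - E)" using S(2) by blast
  have SL: "S : lmeasurable" using fmeasurable.Un[OF EL S(3)] SE by simp
  have "measure lebesgue (S - E) < h" using S(3,4) h by (simp add: emeasure_eq_measure2 ennreal_less_iff)
  hence mS: "measure lebesgue S <= measure lebesgue E + h" using measure_Un_le[of E lebesgue "S - E"] SE fmeasurableD[OF EL] fmeasurableD[OF S(3)] by simp
  obtain r where r: "r > 0" "(\<Union>x\<in>E. ball x r) \<subseteq> S" by (rule compact_subset_open_imp_ball_epsilon_subset[OF E(1) S(1,2)])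
  define dl where "dl = min r (R / C0)"
  have dl: "0 < dl" "C0 * dl <= R" "dl <= r" proof -
  show "0 < dl" "dl <= r" using r R C0 by (auto simp: dl_def)
  have "dl <= R / C0" by (simp add: dl_def)
  thus "C0 * dl <= R" using C0(1) by (simp add: pos_le_divide_eq mult.commute)
  qed
  have "ball w (dl / 2) \<subseteq> S" if "w : E" for w proof -
  have "ball w (dl / 2) \<subseteq> ball w r" using dl by (intro subset_ball) auto
  thus ?thesis using r(2) that by blast
  qed
  from est[OF E R dl(1,2) SL this]
  have "c * (LINT z|lebesgue. indicator E z * f z) <= D * (R^2 + R powr b / R ^ (2 * CARD('n)) * measure lebesgue S)" .
  also have "R powr b / R ^ (2 * CARD('n)) = R powr (- k)" using R(1) powr_realpow[of R "2 * CARD('n)"] by (simp add: k_def powr_diff)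
  also have "D * (R^2 + R powr (- k) * measure lebesgue S) <= D * (R^2 + R powr (- k) * (measure lebesgue E + h))"
  using mS C0(3) by (intro mult_left_mono add_left_mono) auto
  also have "... = D * (R^2 + R powr (- k) * measure lebesgue E) + (D * R powr (- k)) * h" by (simp add: algebra_simps)
  also have "(D * R powr (- k)) * h <= e" by (rule mult_small[OF Dk e]) (use h in \<open>auto simp: h_def\<close>)
  finally show "c * (LINT z|lebesgue. indicator E z * f z) <= D * (R^2 + R powr (- k) * measure lebesgue E) + e" by simp
 qed
 define C1 where "C1 = D / c + 1"
 have C1: "0 < C1" using C0 by (simp add: C1_def add_nonneg_pos)
 have E2: "(LINT z|lebesgue. indicator E z * f z) <= C1 * (R^2 + R powr (- k) * measure lebesgue E)"
  if "compact E" "E \<subseteq> K" "0 < R" "R <= R1" for E R proof -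
  have "(LINT z|lebesgue. indicator E z * f z) <= (D / c) * (R^2 + R powr (- k) * measure lebesgue E)" using E1[OF that] C0(2) by (simp add: field_simps)
  also have "... <= C1 * (R^2 + R powr (- k) * measure lebesgue E)" unfolding C1_def by (intro mult_right_mono add_nonneg_nonneg mult_nonneg_nonneg) auto
  finally show ?thesis .
 qed
 define s where "s = 1 + 2 / k"
 \<comment> \<open>From this level on, the radius chosen below is at most \<open>R1\<close>.\<close>
 define t0 where "t0 = 2 * C1 * R1 powr (- k)"
 have t0: "0 < t0" using C1 C0(4) by (simp add: t0_def)
 have E3: "measure lebesgue E <= (2 * C1) powr s * t powr (- s)"
  if E: "compact E" "E \<subseteq> K" "!!z. z : E ==> t <= f z" and t: "t0 <= t" for E t proof -
  have tp: "0 < t" using t0 t by linarith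
  \<comment> \<open>Solves \<open>C1 * R powr (- k) = t / 2\<close>.\<close>
  define R where "R = (2 * C1 / t) powr (1 / k)"
  have R: "0 < R" using C1 tp by (simp add: R_def)
  have Rk: "R powr (- k) = t / (2 * C1)" unfolding R_def using C1 tp k by (simp add: powr_powr powr_minus_divide)
  have "R <= R1" proof -
  have "R powr (- k) >= R1 powr (- k)" unfolding Rk using t C1 by (simp add: t0_def field_simps)
  thus ?thesis using powr_less_mono2_neg[of "- k" R1 R] C0(4) k by (cases "R <= R1") auto
  qed
  have EL: "E : lmeasurable" using E(1) by (rule lmeasurable_compact)
  have "t * measure lebesgue E = (LINT z|lebesgue. indicator E z * t)" using fmeasurableD2[OF EL] fmeasurableD[OF EL] by (simp add: less_top)
  also have "... <= (LINT z|lebesgue. indicator E z * f z)"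
  proof (rule integral_mono)
  show "integrable lebesgue (%z. indicator E z * f z)" unfolding f_def by (rule loc_integrable_defect[OF loc E(1)]) (use E K_sub in blast)
  show "integrable lebesgue (%z. indicator E z * t)"
  by (intro integrable_mult_left integrable_real_indicator) (use fmeasurableD2[OF EL] fmeasurableD[OF EL] in \<open>auto simp: less_top\<close>)
  show "indicator E z * t <= indicator E z * f z" for z using E(3) by (auto simp: indicator_def)
  qed
  also have "... <= C1 * (R^2 + R powr (- k) * measure lebesgue E)" by (rule E2[OF E(1,2) R \<open>R <= R1\<close>])
  also have "... = C1 * R^2 + t / 2 * measure lebesgue E" unfolding Rk using C1 by (simp add: distrib_left)
  finally have "measure lebesgue E <= 2 * C1 / t * R^2" using tp by (simp add: field_simps)
  also have "R^2 = (2 * C1 / t) powr (2 / k)" using R unfolding R_def by (simp add: powr_powr powr_realpow[symmetric] power2_eq_square powr_add[symmetric])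
  also have "2 * C1 / t * (2 * C1 / t) powr (2 / k) = (2 * C1 / t) powr s" using C1 tp by (simp add: s_def powr_add)
  also have "... = (2 * C1) powr s * t powr (- s)" using C1 tp by (simp add: powr_divide powr_minus_divide)
  finally show ?thesis .
 qed
 have KL: "K : lmeasurable" by (rule lmeasurable_compact[OF compact_K])
 have GS: "{z : K. t <= f z} : sets lebesgue" for t proof -
  have "(%z. indicator K z * f z) : borel_measurable lebesgue"
  using borel_measurable_integrable[OF loc_integrable_defect[OF loc compact_K K_sub(3), of A]] unfolding f_def .
  hence "{z : space lebesgue. t <= indicator K z * f z} : sets lebesgue" by (rule borel_measurable_le[OF borel_measurable_const])
  hence "K \<inter> {z. t <= indicator K z * f z} : sets lebesgue" using fmeasurableD[OF KL] by (intro sets.Int) auto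
  moreover have "K \<inter> {z. t <= indicator K z * f z} = {z : K. t <= f z}" by auto
  ultimately show ?thesis by simp
 qed
 have "measure lebesgue {z : K. t <= f z} <= (2 * C1) powr s * t powr (- s)" if t: "t0 <= t" for t
 proof (rule field_le_epsilon)
  fix e :: real assume e: "0 < e"
  let ?G = "{z : K. t <= f z}"
  \<comment> \<open>Level sets are merely measurable, whereas the estimate is for compact sets;
    inner regularity closes the gap.\<close>
  obtain T where T: "closed T" "T \<subseteq> ?G" "?G - T : lmeasurable" "emeasure lebesgue (?G - T) < ennreal e"
  by (rule sets_lebesgue_inner_closed[OF GS e]) blast
  have "K \<inter> T = T" using T(2) by blast
  hence "compact T" using compact_Int_closed[OF compact_K T(1)] by simp
  hence "measure lebesgue T <= (2 * C1) powr s * t powr (- s)" using T(2) by (intro E3 t) auto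
  moreover have "measure lebesgue (?G - T) < e" using T(3,4) e by (simp add: emeasure_eq_measure2 ennreal_less_iff)
  moreover have "measure lebesgue (T \<union> (?G - T)) <= measure lebesgue T + measure lebesgue (?G - T)"
  by (rule measure_Un_le) (use T(1) fmeasurableD[OF T(3)] in auto)
  moreover have "T \<union> (?G - T) = ?G" using T(2) by blast
  ultimately show "measure lebesgue ?G <= (2 * C1) powr s * t powr (- s) + e" by simp
 qed
 thus thesis using t0 GS unfolding f_def s_def k_def by (intro that[of "(2 * C1) powr s" t0]) (simp_all only: s_def k_def powr_ge_zero)
qed

end

section \<open>Upper bounds and the choice of exponents\<close>

context chart_compact
begin

text \<open>With \<open>s = 0\<close> and zero weight the admissible metric is omega itself.
  Quasi-subharmonicity for this one metric gives \<open>ph\<close> locally as an upper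
  semicontinuous function plus a continuous one.\<close>

lemma sub_usc:
 assumes sub: "omega_m_subharmonic_on m om Om ph" and m: "1 <= m" "m <= CARD('n)"
 shows "open {z : Om. ph z < a}"
proof (subst open_subopen, intro ballI)
 fix z assume "z : {z : Om. ph z < a}"
 hence z: "z : Om" "ph z < a" by auto
 have "weight_ok z 1 (%_. 0)" "sigma_ok m 0 1" using m by (auto simp: weight_ok_def sigma_ok_def)
 from admissible[OF z(1) this sub] have "quasi_subharmonic_wrt (almet z (0 / (real CARD('n) - 1)) (%_. 0)) Om ph" by (simp add: omega_subharmonic_wrt_def)
 from bspec[OF this[unfolded quasi_subharmonic_wrt_def] z(1)] obtain V u and rh :: "complex^'n => real" where
  V': "open V" "z : V" "V \<subseteq> Om" "subharmonic_wrt (almet z (0 / (real CARD('n) - 1)) (%_. 0)) V u"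
  "smooth_on V rh" "ALL y:V. ph y = u y + ereal (rh y)" by (elim exE conjE) (rule that; assumption)
 have V: "open V" "z : V" "V \<subseteq> Om" "upper_semicontinuous_on V u" "smooth_on V rh" "!!y. y : V ==> ph y = u y + ereal (rh y)"
  using V' by (simp_all add: subharmonic_wrt_def)
 obtain t1 where t1: "ph z < ereal t1" "ereal t1 < a" using ereal_dense2[OF z(2)] by blast
 obtain t2 where t2: "ph z < ereal t2" "ereal t2 < ereal t1" using ereal_dense2[OF t1(1)] by blast
 have uz: "u z < ereal (t2 - rh z)" using t2(1) V(6)[OF V(2)] by (cases "u z") auto
 have at: "at z within V = at z" using V(1,2) by (rule at_within_open[rotated])
 have e1: "\<forall>\<^sub>F y in at z. u y < ereal (t2 - rh z)" using V(4) uz V(2) unfolding upper_semicontinuous_on_def at[symmetric] by blast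
 have "isCont rh z" using smooth_on_continuous[OF V(5)] V(1,2) continuous_on_eq_continuous_at by blast
 hence e2: "\<forall>\<^sub>F y in at z. rh y < rh z + (t1 - t2)" unfolding isCont_def by (rule order_tendstoD) (use t2 in auto)
 have e3: "\<forall>\<^sub>F y in at z. y : V" using V(1,2) by (rule eventually_at_in_open')
 have "\<forall>\<^sub>F y in at z. y : Om & ph y < a" using e1 e2 e3
 proof eventually_elim
  case (elim y)
  have "ph y < ereal t1" unfolding V(6)[OF elim(3)] using elim(1,2) by (cases "u y") auto
  thus ?case using t1(2) V(3) elim(3) by auto
 qed
 hence "\<forall>\<^sub>F y in nhds z. y : Om & ph y < a" using z unfolding eventually_nhds_conv_at by auto
 thus "EX T. open T & z : T & T \<subseteq> {z : Om. ph z < a}" unfolding eventually_nhds by blast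
qed

text \<open>The sublevel sets at integer levels are open and, as \<open>ph\<close> is never plus
  infinity, cover the compact set. The shift by 1 leaves room for
  \<open>A - ph >= 1\<close>.\<close>

lemma sub_bounded_above:
 assumes sub: "omega_m_subharmonic_on m om Om ph" and m: "1 <= m" "m <= CARD('n)" and C: "compact C" "C \<subseteq> Om"
 shows "EX A>=1. ALL z:C. ph z <= ereal (A - 1)" proof -
 let ?U = "%k::nat. {z : Om. ph z < ereal (real k)}"
 have "C \<subseteq> (\<Union>k\<in>UNIV. ?U k)"
 proof
  fix z assume z: "z : C"
  hence "ph z ~= \<infinity>" using sub C by (auto simp: omega_m_subharmonic_on_def)
  hence "EX k::nat. ph z < ereal (real k)" using less_PInf_Ex_of_nat by auto
  thus "z : (\<Union>k\<in>UNIV. ?U k)" using z C by auto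
 qed
 then obtain D where D: "finite D" "C \<subseteq> (\<Union>k\<in>D. ?U k)" using compactE_image[OF C(1), of UNIV ?U] sub_usc[OF sub m] by auto
 define A where "A = real (Max (insert 0 D)) + 1"
 have "ph z <= ereal (A - 1)" if "z : C" for z proof -
  obtain k where k: "k : D" "ph z < ereal (real k)" using D(2) \<open>z : C\<close> by auto
  have "k <= Max (insert 0 D)" using k(1) D(1) by (intro Max_ge) auto
  hence "ereal (real k) <= ereal (A - 1)" by (simp add: A_def)
  thus ?thesis using k(2) by (meson less_imp_le order_trans)
 qed
 thus ?thesis by (intro exI[of _ A]) (auto simp: A_def)
qed

text \<open>With \<open>y = n / m - 1\<close> the bound on \<open>p\<close> reads
  \<open>(p - 1) * y < 1\<close>, also for \<open>m = n\<close>, where \<open>y = 0\<close>. As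
  \<open>a\<close> increases to n - n/m the quantity \<open>n - a - 1\<close> decreases to
  \<open>y\<close>, so the strict inequality survives for \<open>a\<close> close enough.\<close>

lemma exponent_choice:
 assumes m: "1 <= m" "m <= CARD('n)" and p: "m < CARD('n) ==> p < real CARD('n) / real (CARD('n) - m)"
 obtains a s ep where "sigma_ok m s ep" "0 < ep" "- 1 < a" "a < s" "a + 1 < real CARD('n)"
  "(p - 1) * (real CARD('n) - a - 1) < 1" proof -
 define n where "n = real CARD('n)"
 have mn: "1 <= real m" "real m <= n" using m by (auto simp: n_def)
 define y where "y = n / real m - 1"
 have y: "0 <= y" using mn by (simp add: y_def)
 have X: "(p - 1) * y < 1" proof (cases "m < CARD('n)")
  case True
  hence nm: "0 < n - real m" by (simp add: n_def)
  have "p < n / (n - real m)" using p[OF True] m by (simp add: n_def of_nat_diff)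
  hence "p - 1 < real m / (n - real m)" using nm by (simp add: field_simps)
  hence "(p - 1) * ((n - real m) / real m) < real m / (n - real m) * ((n - real m) / real m)" using nm mn by (intro mult_strict_right_mono) auto
  also have "... = 1" using nm mn by simp
  also have "(n - real m) / real m = y" using mn by (simp add: y_def field_simps)
  finally show ?thesis .
 next
  case False
  hence "y = 0" using m by (simp add: y_def n_def)
  thus ?thesis by simp
 qed
 \<comment> \<open>Half of the gap in \<open>(p - 1) * y < 1\<close>, divided by more than
   \<open>abs (p - 1)\<close>, so that moving \<open>y\<close> by \<open>et\<close> keeps the
   inequality strict.\<close>
 define e0 where "e0 = (1 - (p - 1) * y) / 2 / (abs (p - 1) + 1)"
 have e0: "0 < e0" unfolding e0_def using X by (intro divide_pos_pos) auto
 define et where "et = min (1/2) e0"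
 have et: "0 < et" "et <= 1/2" "et <= e0" using e0 by (auto simp: et_def)
 have "abs (p - 1) * et <= (1 - (p - 1) * y) / 2" by (rule mult_small[OF _ _ _ et(3)[unfolded e0_def]]) (use et X in auto)
 moreover have "(p - 1) * et <= abs (p - 1) * et" using et by (intro mult_right_mono) auto
 ultimately have Y: "(p - 1) * (y + et) < 1" using X by (simp add: distrib_left)
 define a0 where "a0 = n - n / real m"
 define a where "a = a0 - et"
 have nm1: "n / real m <= n" "1 <= n / real m" using mn by (auto simp: field_simps)
 have a: "- 1 < a" "a + 1 < n" "n - a - 1 = y + et" using nm1 et by (auto simp: a_def a0_def y_def)
 show thesis proof (cases "m = 1")
  case True
  \<comment> \<open>For \<open>m = 1\<close> the threshold n - n/m is 0: no perturbation is
    available, and a slightly negative \<open>a\<close> lies below \<open>s = 0\<close>.\<close>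
  hence "a < 0" using et by (simp add: a_def a0_def)
  moreover have "sigma_ok m 0 1" using m by (simp add: sigma_ok_def)
  ultimately show thesis using a Y unfolding n_def by (intro that[of 0 1 a]) simp_all
 next
  case False
  hence m2: "2 <= real m" using m by auto
  have a0: "0 < a0" "real m * a0 = n * (real m - 1)" using m2 mn by (auto simp: a0_def field_simps)
  define s where "s = max 0 (a0 - et / 2)"
  have s: "0 <= s" "a < s" "s < a0" using a0 et by (auto simp: s_def a_def)
  define ep where "ep = (a0 - s) / (s + 1)"
  have ep: "0 < ep" "s * (1 + ep) < a0" proof -
  show e: "0 < ep" using s by (simp add: ep_def)
  have "(s + 1) * ep = a0 - s" using s by (simp add: ep_def)
  thus "s * (1 + ep) < a0" using e by (simp add: algebra_simps)
  qed
  have "real m * (s * (1 + ep)) < real m * a0" using ep m2 by (intro mult_strict_left_mono) auto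
  hence "real m * s * (1 + ep) < real CARD('n) * (real m - 1)" using a0(2) unfolding n_def by (simp only: mult.assoc)
  hence "sigma_ok m s ep" unfolding sigma_ok_def using ep(1) s(1) m m2 by simp
  thus thesis using ep(1) a s(2) Y unfolding n_def by (intro that[of s ep a]) simp_all
 qed
qed

end

section \<open>Local integrability of powers\<close>

context chart_form
begin

lemma sub_sublevel_open:
 assumes "omega_m_subharmonic_on m om Om ph" "1 <= m" "m <= CARD('n)"
 shows "open {z : Om. ph z < a}" proof -
 \<comment> \<open>Openness of the sublevel sets involves no compact set, so the empty one serves to
   enter the locale.\<close>
 interpret chart_compact Om om "{}" 1 by unfold_locales auto
 show ?thesis by (rule sub_usc[OF assms])
qed

theorem local_power_integrable:
 assumes sub: "omega_m_subharmonic_on m om Om ph" and loc: "loc_integrable_on Om ph"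
  and m: "1 <= m" "m <= CARD('n)" and p: "0 < p" "m < CARD('n) ==> p < real CARD('n) / real (CARD('n) - m)"
  and K: "compact K" "K \<subseteq> Om"
 shows "(\<integral>\<^sup>+z\<in>K. ext_abs_powr (ph z) p \<partial>lebesgue) < \<infinity>" proof -
 obtain d0 where d0: "d0 > 0" "(\<Union>x\<in>K. ball x d0) \<subseteq> Om" by (rule compact_subset_open_imp_ball_epsilon_subset[OF K(1) open_Om K(2)])
 define d where "d = min 1 (d0 / 2)"
 interpret cc: chart_compact Om om K d
 proof
  show "compact K" "0 < d" "d <= 1" using K d0 by (auto simp: d_def)
  show "z : Om" if "w : K" "dist w z <= d" for w z proof -
  have "z : ball w d0" using that d0(1) by (auto simp: d_def)
  thus ?thesis using d0(2) that(1) by blast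
  qed
 qed
 obtain A where A: "1 <= A" "!!z. z : cc.Kd ==> ph z <= ereal (A - 1)" using cc.sub_bounded_above[OF sub m cc.compact_Kd cc.K_sub(2)] by blast
 obtain a s ep where e: "cc.sigma_ok m s ep" "0 < ep" "- 1 < a" "a < s" "a + 1 < real CARD('n)"
  "(p - 1) * (real CARD('n) - a - 1) < 1" by (rule cc.exponent_choice[OF m p(2)])
 obtain CM R0 where CM: "0 <= CM" "0 < R0" "!!w R. w : K ==> 0 < R ==> R <= R0 ==>
  (LINT z|lebesgue. indicator (cball w R) z * (A - rl (ph z))) <= CM * R powr (2 * a + 2)" using cc.morrey[OF sub loc A e(1-5)] by blast
 have b: "2 * a + 2 < 2 * real CARD('n)" using e(5) by simp
 obtain C t0 where C: "0 <= C" "0 < t0" "!!t. t0 <= t ==>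
  measure lebesgue {z : K. t <= A - rl (ph z)} <= C * t powr (- (1 + 2 / (2 * real CARD('n) - (2 * a + 2))))"
  "!!t. {z : K. t <= A - rl (ph z)} : sets lebesgue" by (rule cc.level_set_measure[OF sub loc m A CM b]) blast+
 have f1: "1 <= A - rl (ph z)" if "z : K" for z using A(2)[of z] that cc.K_sub(1) by (intro cc.defect_ge_1[OF A(1)]) auto
 have ps: "p < 1 + 2 / (2 * real CARD('n) - (2 * a + 2))" proof -
  have k: "0 < real CARD('n) - a - 1" using e(5) by simp
  have h: "2 / (2 * x) = 1 / x" for x :: real by simp
  have e': "2 * real CARD('n) - (2 * a + 2) = 2 * (real CARD('n) - a - 1)" by simp
  have "2 / (2 * real CARD('n) - (2 * a + 2)) = 1 / (real CARD('n) - a - 1)" unfolding e' h ..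
  also have "... > p - 1" using e(6) k by (simp add: pos_less_divide_eq)
  finally show ?thesis by simp
 qed
 have fin: "(\<integral>\<^sup>+z\<in>K. ennreal ((A - rl (ph z)) powr p) \<partial>lebesgue) < \<infinity>"
  using f1 by (intro weak_type_integrable[OF lmeasurable_compact[OF K(1)] C(4,3,2) p(1) ps _ C(1)]) force+
 have mK: "(%z. e2ennreal (abs (ph z)) * indicator K z) : borel_measurable lebesgue" proof -
  have "(%z. e2ennreal (abs (ph z))) : borel_measurable (restrict_space lebesgue Om)" using loc by (auto simp: loc_integrable_on_def)
  hence "(%z. e2ennreal (abs (ph z))) : borel_measurable (restrict_space lebesgue K)" by (rule measurable_restrict_mono) (rule K(2))
  thus ?thesis by (subst (asm) borel_measurable_restrict_space_iff_ennreal) (use K(1) in \<open>auto simp: compact_imp_closed\<close>)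
 qed
 have "(\<integral>\<^sup>+z\<in>K. e2ennreal (abs (ph z)) \<partial>lebesgue) ~= \<infinity>" using loc K by (auto simp: loc_integrable_on_def less_top)
 \<comment> \<open>\<open>ext_abs_powr\<close> is infinite at minus infinity while
   \<open>A - rl (ph z)\<close> is finite there, so the comparison below holds only almost
   everywhere.\<close>
 from nn_integral_PInf_AE[OF mK this] have ae: "AE z in lebesgue. e2ennreal (abs (ph z)) * indicator K z ~= \<infinity>" .
 have "(\<integral>\<^sup>+z\<in>K. ext_abs_powr (ph z) p \<partial>lebesgue) <= (\<integral>\<^sup>+z. ennreal ((1 + A) powr p) * (ennreal ((A - rl (ph z)) powr p) * indicator K z) \<partial>lebesgue)"
 proof (rule nn_integral_mono_AE, use ae in eventually_elim)
  fix z assume z: "e2ennreal (abs (ph z)) * indicator K z ~= \<infinity>"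
  show "ext_abs_powr (ph z) p * indicator K z <= ennreal ((1 + A) powr p) * (ennreal ((A - rl (ph z)) powr p) * indicator K z)" proof (cases "z : K")
  case True
  hence ni: "abs (ph z) ~= \<infinity>" using z by (cases "ph z") auto
  let ?f = "A - rl (ph z)"
  have f: "1 <= ?f" by (rule f1[OF True])
  \<comment> \<open>As \<open>?f >= 1\<close>, the modulus of \<open>ph\<close> is at most
    \<open>A + ?f <= (1 + A) * ?f\<close>.\<close>
  have "A * 1 <= A * ?f" using f A(1) by (intro mult_left_mono) auto
  moreover have "(1 + A) * ?f = ?f + A * ?f" by (simp only: distrib_right mult_1)
  ultimately have "abs (rl (ph z)) <= (1 + A) * ?f" using f A(1) by linarith
  hence "abs (rl (ph z)) powr p <= ((1 + A) * ?f) powr p" by (rule powr_mono2[OF less_imp_le[OF p(1)] abs_ge_zero])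
  also have "... = (1 + A) powr p * ?f powr p" by (rule powr_mult)
  finally show ?thesis using True ni by (simp add: ext_abs_powr_def ennreal_mult[symmetric] ennreal_leI)
  qed simp
 qed
 also have "... = ennreal ((1 + A) powr p) * (\<integral>\<^sup>+z\<in>K. ennreal ((A - rl (ph z)) powr p) \<partial>lebesgue)"
 proof (rule nn_integral_cmult)
  have [measurable]: "(%z. indicator K z * (A - rl (ph z))) : borel_measurable lebesgue"
  by (rule borel_measurable_integrable[OF cc.loc_integrable_defect[OF loc K]])
  have [measurable]: "K : sets lebesgue" using K(1) by (simp add: compact_imp_closed)
  have "(%z. ennreal ((indicator K z * (A - rl (ph z))) powr p) * indicator K z) : borel_measurable lebesgue" by measurable
  moreover have "ennreal ((indicator K z * (A - rl (ph z))) powr p) * indicator K z = ennreal ((A - rl (ph z)) powr p) * indicator K z" for z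
  by (auto simp: indicator_def)
  ultimately show "(%z. ennreal ((A - rl (ph z)) powr p) * indicator K z) : borel_measurable lebesgue" by simp
 qed
 also have "... < \<infinity>" using fin by (simp add: ennreal_mult_less_top)
 finally show ?thesis .
qed

end

section \<open>Pullback of top degree forms\<close>

text \<open>Every linear map is composed of elementary ones. On an involution both \<open>D\<close>
  and the determinant have modulus 1 by multiplicativity, which settles transpositions and, through
  a reflection, shears; degenerate and diagonal maps are covered by the hypotheses.\<close>

lemma abs_det_unique:
 fixes D :: "(real^'m => real^'m::finite) => complex"
 assumes mult: "!!f g. linear f ==> linear g ==> D (f o g) = D f * D g"
  and zero: "!!f i. linear f ==> (!!x. f x $ i = 0) ==> D f = 0"
  and diag: "!!c. D (%x. \<chi> i. c i * x $ i) = of_real (PROD i:UNIV. c i)"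
  and f: "linear f"
 shows "cmod (D f) = abs (det (matrix f))" proof -
 have lin: "linear (%x :: real^'m. \<chi> i. c i * x $ i)" for c by (rule linearI) (auto simp: vec_eq_iff algebra_simps)
 have dc: "cmod (D (%x. \<chi> i. c i * x $ i)) = abs (det (matrix (%x :: real^'m. \<chi> i. c i * x $ i)))" for c
  unfolding diag by (subst det_diagonal) (auto simp: matrix_def axis_def simp flip: of_real_prod)
 have det: "det (matrix (f o g)) = det (matrix f) * det (matrix g)" if "linear f" "linear g" for f g :: "real^'m => real^'m"
  using that by (simp add: matrix_compose det_mul)
 have invol: "cmod (D k) = 1 & abs (det (matrix k)) = 1" if k: "linear k" "k o k = id" for k proof -
  have "D id = 1" using diag[of "%_. 1"] by (simp add: id_def)
  hence "cmod (D k) ^ 2 = 1" using mult[OF k(1) k(1)] k(2) by (simp add: power2_eq_square flip: norm_mult)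
  moreover have "(det (matrix k))^2 = 1" using det[OF k(1) k(1)] k(2) by (simp add: power2_eq_square matrix_id_mat_1)
  ultimately show ?thesis using norm_ge_zero[of "D k"] by (auto simp: power2_eq_1_iff simp del: norm_ge_zero)
 qed
 show ?thesis using f
 proof (rule induct_linear_elementary)
  fix f g :: "real^'m => real^'m"
  assume "linear f" "linear g" "cmod (D f) = abs (det (matrix f))" "cmod (D g) = abs (det (matrix g))"
  thus "cmod (D (f o g)) = abs (det (matrix (f o g)))" by (simp add: mult det norm_mult abs_mult)
 next
  fix f :: "real^'m => real^'m" and i assume fi: "linear f" "!!x. f x $ i = 0"
  hence "row i (matrix f) = 0" by (simp add: row_def matrix_def vec_eq_iff)
  thus "cmod (D f) = abs (det (matrix f))" using zero[OF fi] by (simp add: det_zero_row)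
 next
  fix a b :: 'm assume ab: "a ~= b"
  have "linear (%x :: real^'m. \<chi> i. x $ Transposition.transpose a b i)" by (rule linearI) (auto simp: vec_eq_iff)
  moreover have "(%x :: real^'m. \<chi> i. x $ Transposition.transpose a b i) o (%x. \<chi> i. x $ Transposition.transpose a b i) = id"
  by (auto simp: fun_eq_iff vec_eq_iff)
  ultimately show "cmod (D (%x. \<chi> i. x $ Transposition.transpose a b i)) = abs (det (matrix (%x :: real^'m. \<chi> i. x $ Transposition.transpose a b i)))"
  using invol by simp
  \<comment> \<open>The shear composed with the reflection in coordinate \<open>b\<close> is an
    involution, and so is the reflection.\<close>
  let ?f = "%x :: real^'m. \<chi> i. if i = a then x $ a + x $ b else x $ i" and ?r = "%x :: real^'m. \<chi> i. (if i = b then - 1 else 1) * x $ i"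
  have lf: "linear ?f" by (rule linearI) (auto simp: vec_eq_iff algebra_simps)
  have lr: "linear ?r" by (rule lin)
  have i: "(?f o ?r) o (?f o ?r) = id" using ab by (auto simp: fun_eq_iff vec_eq_iff)
  have i2: "?r o ?r = id" by (auto simp: fun_eq_iff vec_eq_iff)
  show "cmod (D ?f) = abs (det (matrix ?f))"
  using invol[OF linear_compose[OF lr lf] i] invol[OF lr i2] by (simp add: mult[OF lf lr] det[OF lf lr] norm_mult abs_mult)
 qed (rule dc)
qed

definition pb :: "(complex^'n => complex^'n) => ('n::finite) ext => 'n ext" where
 "pb L a = Ext (%vs. form_of a (map L vs))"

lemma form_of_pb: "form_of (pb L a) vs = form_of a (map L vs)" by (simp add: pb_def)

lemma pb_mult: "pb L (a * b) = pb L a * pb L b" by (rule form_of_eqI) (simp add: form_of_pb form_of_mult wedge_def nths_map)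

lemma pb_scal: "pb L (scal c) = scal c" by (rule form_of_eqI) (simp add: form_of_pb scal.rep_eq const_form_def)

lemma pb_covec: "pb L (covec l) = covec (l o L)" by (rule form_of_eqI) (auto simp: form_of_pb covec.rep_eq hd_map length_Suc_conv)

lemma pb_prod_list: "pb L (prod_list as) = prod_list (map (pb L) as)" by (induction as) (simp_all add: pb_mult pb_scal[where c = 1, simplified])

lemma pb_power: "pb L (a ^ k) = pb L a ^ k" by (induction k) (simp_all add: pb_mult pb_scal[where c = 1, simplified])

lemma pb_real_vol: "pb L real_vol = prod_list (map (%b. covec (coord b o L)) basis_list)" by (simp add: real_vol_def pb_prod_list pb_covec comp_def)

text \<open>The factor by which the pullback scales top degree. Only its modulus is computed, so no
  orientation has to be tracked.\<close>

definition pdet :: "(complex^'n => complex^'n) => ('n::finite) itself => complex" where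
 "pdet L _ = topc (pb L (real_vol :: 'n ext)) / topc (real_vol :: 'n ext)"

lemma topc_real_vol: "topc (real_vol :: ('n::finite) ext) ~= 0" using real_vol_nonzero topc_eq[OF homog_real_vol] by (metis scal_0 mult_zero_left)

lemma pb_top:
 fixes a :: "('n::finite) ext"
 assumes L: "linear L" and a: "homog (2 * CARD('n)) a"
 shows "pb L a = scal (pdet L TYPE('n)) * a" and "topc (pb L a) = pdet L TYPE('n) * topc a" proof -
 have "homog (1 * length (map (%b. covec (coord b o L)) (basis_list :: (complex^'n) list))) (prod_list (map (%b. covec (coord b o L)) (basis_list :: (complex^'n) list)))"
  by (rule homog_prod_list) (auto intro!: homog_covec[unfolded One_nat_def] linear_compose[OF L linear_coord])
 hence h: "homog (2 * CARD('n)) (pb L (real_vol :: 'n ext))" by (simp add: pb_real_vol basis_list(3))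
 let ?r = "real_vol :: 'n ext"
 have "scal (1 / topc ?r) * (scal (topc ?r) * vol_ext) = (vol_ext :: 'n ext)" unfolding scal_mult_assoc using topc_real_vol[where 'n = 'n] by simp
 hence r: "vol_ext = scal (1 / topc ?r) * ?r" by (simp only: topc_eq[OF homog_real_vol, symmetric])
 have p: "pb L ?r = scal (pdet L TYPE('n)) * ?r" using topc_eq[OF h] unfolding r scal_mult_assoc pdet_def by simp
 obtain z where z: "a = scal z * ?r" using topc_eq[OF a] unfolding r scal_mult_assoc by blast
 have "pb L a = scal z * (scal (pdet L TYPE('n)) * ?r)" by (simp only: z pb_mult pb_scal p)
 thus 1: "pb L a = scal (pdet L TYPE('n)) * a" unfolding z scal_mult_assoc by (simp only: mult.commute)
 show "topc (pb L a) = pdet L TYPE('n) * topc a" unfolding 1 by simp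
qed

lemma pdet_compose:
 assumes "linear L" "linear M"
 shows "pdet (L o M) TYPE('n::finite) = pdet L TYPE('n) * pdet M TYPE('n)" proof -
 have "pb (L o M) (real_vol :: 'n ext) = pb M (pb L real_vol)" by (rule form_of_eqI) (simp add: form_of_pb)
 also have "... = scal (pdet L TYPE('n)) * (scal (pdet M TYPE('n)) * real_vol)"
  by (simp add: pb_top(1)[OF assms(1) homog_real_vol] pb_mult pb_scal pb_top(1)[OF assms(2) homog_real_vol])
 finally show ?thesis using topc_real_vol[where 'n = 'n] by (simp add: pdet_def[of "L o M"])
qed

lemma pdet_diagonal:
 assumes "!!b. b : Basis ==> coord b o L = (%v. of_real (c b) * coord b v)"
 shows "pdet L TYPE('n::finite) = of_real (PROD b:Basis. c b)" proof -
 have "set bs \<subseteq> Basis ==> prod_list (map (%b. covec (coord b o L)) bs) = scal (of_real (prod_list (map c bs))) * prod_list (map (%b. covec (coord b)) bs)"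
  for bs :: "(complex^'n) list"
 proof (induction bs)
  case (Cons b bs)
  hence "covec (coord b o L) = scal (of_real (c b)) * xi b" using assms[of b] by (simp add: covec_scale del: o_apply)
  thus ?case using Cons by (simp add: comp_def scal_mult mult.assoc scal_left_commute[of "xi b"])
 qed simp
 from this[of basis_list] have "pb L (real_vol :: 'n ext) = scal (of_real (prod_list (map c basis_list))) * real_vol"
  unfolding pb_real_vol by (simp add: basis_list real_vol_def)
 hence "pdet L TYPE('n) = of_real (prod_list (map c basis_list))" using topc_real_vol[where 'n = 'n] by (simp add: pdet_def)
 also have "prod_list (map c (basis_list :: (complex^'n) list)) = (PROD b:Basis. c b)"
  using prod.distinct_set_conv_list[OF basis_list(2), of c] by (simp add: basis_list(1))
 finally show ?thesis .
qed

lemma pdet_zero: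
 assumes "b : Basis" "!!v. coord b (L v) = 0"
 shows "pdet L TYPE('n::finite) = 0" proof -
 have "covec (coord b o L) = (0 :: 'n ext)" by (rule form_of_eqI) (simp add: assms(2) covec.rep_eq)
 hence "(0 :: 'n ext) : set (map (%b. covec (coord b o L)) basis_list)" using assms(1) basis_list(1) by force
 moreover have "(0 :: 'n ext) : set xs ==> prod_list xs = 0" for xs by (induction xs) auto
 ultimately have "prod_list (map (%b. covec (coord b o L)) basis_list) = (0 :: 'n ext)" by blast
 thus ?thesis by (simp add: pdet_def pb_real_vol topc_def)
qed

section \<open>Change of variables on \<open>\<complex>\<^sup>n\<close>\<close>

text \<open>An enumeration of the 2n real basis vectors by a type with 2n elements. It identifies
  the space with a real Cartesian power, where determinants and the change of variables formula are
  stated.\<close>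

definition basis_ix :: "'n::finite bit0 => complex^'n" where
 "basis_ix = (SOME p. bij_betw p UNIV Basis)"

lemma bij_basis_ix: "bij_betw (basis_ix :: 'n::finite bit0 => complex^'n) UNIV Basis" proof -
 have "card (UNIV :: 'n bit0 set) = card (Basis :: (complex^'n) set)" by simp
 hence "EX p :: 'n bit0 => complex^'n. bij_betw p UNIV Basis" by (intro finite_same_card_bij) auto
 thus ?thesis unfolding basis_ix_def by (rule someI_ex)
qed

definition ri :: "real^('n::finite bit0) => complex^'n" where "ri x = (SUM i:UNIV. x $ i *\<^sub>R basis_ix i)"
definition ir :: "complex^'n => real^('n::finite bit0)" where "ir v = (\<chi> i. v \<bullet> basis_ix i)"

lemma basis_ix: "basis_ix i : Basis" "inj basis_ix" using bij_basis_ix by (auto simp: bij_betw_def)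

lemma linear_ri: "linear ri" by (rule linearI) (simp_all add: ri_def algebra_simps sum.distrib scaleR_sum_right)

lemma linear_ir: "linear ir" by (rule linearI) (simp_all add: ir_def vec_eq_iff algebra_simps)

lemma ri_inner: "ri x \<bullet> basis_ix i = x $ i" proof -
 have "ri x \<bullet> basis_ix i = (SUM j:UNIV. if j = i then x $ j else 0)" unfolding ri_def inner_sum_left
  by (rule sum.cong) (simp_all add: inner_Basis basis_ix(1) inj_eq[OF basis_ix(2)])
 thus ?thesis by simp
qed

lemma ir_ri [simp]: "ir (ri x) = x" by (simp add: ir_def ri_inner vec_eq_iff)

lemma ri_ir [simp]: "ri (ir v) = v"
proof (rule euclidean_eqI)
 fix b :: "complex^'a" assume "b : Basis"
 then obtain i where "b = basis_ix i" using bij_basis_ix by (metis bij_betw_imp_surj_on rangeE)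
 thus "ri (ir v) \<bullet> b = v \<bullet> b" by (simp add: ri_inner ir_def)
qed

lemma distr_ri: "distr lborel borel ri = (lborel :: (complex^'n::finite) measure)"
proof (rule lborel_eqI[symmetric])
 have m: "ri : borel_measurable (borel :: (real^'n bit0) measure)"
  by (rule borel_measurable_continuous_onI[OF linear_continuous_on[OF linear_conv_bounded_linear[THEN iffD1, OF linear_ri]]])
 fix l u :: "complex^'n" assume lu: "!!b. b : Basis ==> l \<bullet> b <= u \<bullet> b"
 have "ri x : box l u \<longleftrightarrow> x : box (ir l) (ir u)" for x proof -
  have "ri x : box l u \<longleftrightarrow> (ALL b:range basis_ix. l \<bullet> b < ri x \<bullet> b & ri x \<bullet> b < u \<bullet> b)"
  unfolding mem_box bij_betw_imp_surj_on[OF bij_basis_ix] ..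
  thus ?thesis by (auto simp: ri_inner mem_box_cart ir_def)
 qed
 hence "ri -` box l u = box (ir l) (ir u)" by auto
 hence "emeasure (distr lborel borel ri) (box l u) = emeasure lborel (box (ir l) (ir u))" using m by (simp add: emeasure_distr)
 also have "... = (PROD b:(Basis :: (real^'n bit0) set). (ir u - ir l) \<bullet> b)"
  using lu[OF basis_ix(1)] by (intro emeasure_lborel_box) (auto simp: Basis_vec_def inner_axis ir_def)
 also have "(Basis :: (real^'n bit0) set) = (%i. axis i 1) ` UNIV" by (auto simp: Basis_vec_def)
 also have "(PROD b:(%i. axis i 1) ` UNIV. (ir u - ir l) \<bullet> b) = (PROD i:UNIV. (u - l) \<bullet> basis_ix i)"
  by (subst prod.reindex) (auto simp: inj_on_def axis_eq_axis inner_axis ir_def inner_diff_left)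
 also have "... = (PROD b:Basis. (u - l) \<bullet> b)" by (rule prod.reindex_bij_betw[OF bij_basis_ix])
 finally show "emeasure (distr lborel borel ri) (box l u) = (PROD b:Basis. (u - l) \<bullet> b)" .
qed simp

definition jac :: "(complex^'n => complex^'n::finite) => real" where
 "jac L = abs (det (matrix (ir o L o ri)))"

lemma jac_eq_pdet:
 assumes L: "linear L"
 shows "cmod (pdet L TYPE('n::finite)) = jac L" proof -
 let ?D = "%h :: real^'n bit0 => real^'n bit0. pdet (ri o h o ir) TYPE('n)"
 have lin: "linear (ri o h o ir)" if "linear h" for h by (intro linear_compose linear_ir linear_ri that)
 have "cmod (?D (ir o L o ri)) = abs (det (matrix (ir o L o ri)))"
 proof (rule abs_det_unique[where D = ?D])
  fix f g :: "real^'n bit0 => real^'n bit0" assume "linear f" "linear g"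
  moreover have "ri o (f o g) o ir = (ri o f o ir) o (ri o g o ir)" by (simp add: fun_eq_iff)
  ultimately show "?D (f o g) = ?D f * ?D g" by (simp only: pdet_compose lin)
 next
  fix f :: "real^'n bit0 => real^'n bit0" and i assume "!!x. f x $ i = 0"
  thus "?D f = 0" by (intro pdet_zero[OF basis_ix(1)[of i]]) (simp add: coord_def ri_inner)
 next
  fix c
  let ?i = "inv_into UNIV basis_ix"
  have "?D (%x. \<chi> i. c i * x $ i) = of_real (PROD b:Basis. c (?i b))"
  proof (rule pdet_diagonal)
  fix b :: "complex^'n" assume "b : Basis"
  then obtain i where "b = basis_ix i" using bij_basis_ix by (metis bij_betw_imp_surj_on rangeE)
  thus "coord b o (ri o (%x. \<chi> i. c i * x $ i) o ir) = (%v. of_real (c (?i b)) * coord b v)"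
  by (simp add: fun_eq_iff coord_def ri_inner ir_def inv_f_f[OF basis_ix(2)])
  qed
  also have "(PROD b:Basis. c (?i b)) = (PROD i:UNIV. c i)"
  using prod.reindex_bij_betw[OF bij_basis_ix, of "%b. c (?i b)"] by (simp add: inv_f_f[OF basis_ix(2)])
  finally show "?D (%x. \<chi> i. c i * x $ i) = of_real (PROD i:UNIV. c i)" .
 qed (intro linear_compose linear_ir linear_ri L)
 moreover have "ri o (ir o L o ri) o ir = L" by (simp add: fun_eq_iff)
 ultimately show ?thesis by (simp only: jac_def)
qed

lemma nn_integral_eq_HK:
 fixes F :: "'a::euclidean_space => real"
 assumes "A : sets borel" "F : borel_measurable borel" "!!x. x : A ==> 0 <= F x" "F absolutely_integrable_on A"
 shows "(\<integral>\<^sup>+x\<in>A. ennreal (F x) \<partial>lborel) = ennreal (integral A F)" proof -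
 have "(\<integral>\<^sup>+x\<in>A. ennreal (F x) \<partial>lborel) = (\<integral>\<^sup>+x. ennreal (indicator A x *\<^sub>R F x) \<partial>lebesgue)"
  using assms(1,2) by (subst nn_integral_completion) (auto intro!: nn_integral_cong simp: indicator_def)
 also have "... = ennreal (LINT x|lebesgue. indicator A x *\<^sub>R F x)"
  using assms by (intro nn_integral_eq_integral) (auto simp: set_integrable_def indicator_def)
 also have "(LINT x|lebesgue. indicator A x *\<^sub>R F x) = integral A F"
  using set_lebesgue_integral_eq_integral(2)[OF assms(4)] by (simp add: set_lebesgue_integral_def)
 finally show ?thesis .
qed

text \<open>Transported to real coordinates by the measure preserving map \<open>ri\<close>. The
  assumption \<open>fin\<close> provides the absolute integrability under which the formula applies;
  the result is then read back for nonnegative integrals.\<close>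

lemma nn_integral_change_of_variables:
 fixes T :: "complex^'n => complex^'n::finite"
 assumes S: "S : sets borel" "T ` S : sets borel" and f: "f : borel_measurable borel" "!!x. x : T ` S ==> 0 <= f x"
  and h: "h : borel_measurable borel" "!!z. z : S ==> h z = jac (D z) * f (T z)"
  and T: "!!z. z : S ==> (T has_derivative D z) (at z)" "inj_on T S"
  and fin: "(\<integral>\<^sup>+z\<in>T ` S. ennreal (f z) \<partial>lborel) < \<infinity>"
 shows "(\<integral>\<^sup>+z\<in>S. ennreal (h z) \<partial>lborel) = (\<integral>\<^sup>+z\<in>T ` S. ennreal (f z) \<partial>lborel)" proof -
 have [measurable]: "(ri :: real^'n bit0 => complex^'n) : borel_measurable borel"
  by (rule borel_measurable_continuous_onI[OF linear_continuous_on[OF linear_conv_bounded_linear[THEN iffD1, OF linear_ri]]])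
 note [measurable] = S f(1) h(1)
 have tr: "(\<integral>\<^sup>+z\<in>A. ennreal (k z) \<partial>lborel) = (\<integral>\<^sup>+x\<in>ri -` A. ennreal (k (ri x)) \<partial>lborel)"
  if "A : sets borel" "k : borel_measurable borel" for A and k :: "complex^'n => real"
  using that by (subst distr_ri[symmetric], subst nn_integral_distr) (auto intro!: nn_integral_cong simp: indicator_def)
 define S' where "S' = (ri -` S :: (real^'n bit0) set)"
 define g where "g = ir o T o ri"
 have S'b: "S' : sets borel" using measurable_sets[of ri borel borel S] S(1) by (simp add: S'_def)
 have gS: "g ` S' = ri -` (T ` S)"
 proof (intro set_eqI iffI)
  fix x assume "x : ri -` (T ` S)"
  then obtain y where y: "y : S" "ri x = T y" by auto
  thus "x : g ` S'" unfolding S'_def g_def by (intro image_eqI[of _ _ "ir y"]) (auto simp flip: y(2))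
 qed (auto simp: g_def S'_def)
 have gSb: "g ` S' : sets borel" unfolding gS using measurable_sets[of ri borel borel "T ` S"] S(2) by simp
 let ?F = "%x. f (ri x)"
 \<comment> \<open>Values are embedded in a one-dimensional Cartesian space, to match the
   vector-valued form of the theorem.\<close>
 let ?v = "%r. r *\<^sub>R (1 :: real^1)"
 have Fm: "?F : borel_measurable borel" and Hm: "(%x. h (ri x)) : borel_measurable borel" by measurable
 have F0: "0 <= ?F x" if "x : g ` S'" for x using that f(2) unfolding gS by auto
 have Fa: "?F absolutely_integrable_on (g ` S')" unfolding set_integrable_def
 proof (rule integrableI_bounded)
  show "(%x. indicator (g ` S') x *\<^sub>R ?F x) : borel_measurable lebesgue" using gSb Fm by (intro measurable_completion) simp
  have "(\<integral>\<^sup>+x. ennreal (norm (indicator (g ` S') x *\<^sub>R ?F x)) \<partial>lebesgue) = (\<integral>\<^sup>+x\<in>g ` S'. ennreal (?F x) \<partial>lborel)"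
  using gSb Fm F0 by (subst nn_integral_completion) (auto intro!: nn_integral_cong simp: indicator_def)
  also have "... < \<infinity>" using fin unfolding gS tr[OF S(2) f(1)] .
  finally show "(\<integral>\<^sup>+x. ennreal (norm (indicator (g ` S') x *\<^sub>R ?F x)) \<partial>lebesgue) < \<infinity>" .
 qed
 have bl: "bounded_linear ?v" by (rule bounded_linear_scaleR_left)
 have "(?v o ?F) absolutely_integrable_on (g ` S')" by (rule absolutely_integrable_linear[OF Fa bl])
 moreover have "integral (g ` S') (?v o ?F) = ?v (integral (g ` S') ?F)" by (rule integral_linear[OF set_lebesgue_integral_eq_integral(1)[OF Fa] bl])
 moreover have der: "(g has_derivative (ir o D (ri x) o ri)) (at x within S')" if "x : S'" for x proof -
  have "(ri has_derivative ri) (at x)" "(ir has_derivative ir) (at (T (ri x)))"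
  using linear_ri linear_ir by (auto simp: linear_conv_bounded_linear intro: bounded_linear_imp_has_derivative)
  moreover have "(T has_derivative D (ri x)) (at (ri x))" using T(1) that by (simp add: S'_def)
  ultimately have "(g has_derivative (ir o D (ri x) o ri)) (at x)" unfolding g_def by (intro diff_chain_at) (auto simp: comp_def)
  thus ?thesis by (rule has_derivative_at_withinI)
 qed
 moreover have inj: "inj_on g S'"
 proof (rule inj_onI)
  fix x y assume xy: "x : S'" "y : S'" "g x = g y"
  hence "T (ri x) = T (ri y)" unfolding g_def by (metis comp_apply ri_ir)
  hence "ri x = ri y" using T(2) xy by (auto simp: S'_def dest: inj_onD)
  thus "x = y" by (metis ir_ri)
 qed
 ultimately have cv: "(%x. abs (det (matrix (ir o D (ri x) o ri))) *\<^sub>R (?v o ?F) (g x)) absolutely_integrable_on S'"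
  "integral S' (%x. abs (det (matrix (ir o D (ri x) o ri))) *\<^sub>R (?v o ?F) (g x)) = ?v (integral (g ` S') ?F)"
  using has_absolute_integral_change_of_variables[of S' g "%x. ir o D (ri x) o ri" "?v o ?F" "?v (integral (g ` S') ?F)"] S'b by auto
 let ?c = "%v :: real^1. v $ 1"
 have bc: "bounded_linear ?c" by (rule bounded_linear_vec_nth)
 let ?G = "?c o (%x. abs (det (matrix (ir o D (ri x) o ri))) *\<^sub>R (?v o ?F) (g x))"
 have G: "?G x = h (ri x)" if "x : S'" for x using that h(2)[of "ri x"] by (simp add: S'_def jac_def g_def)
 have Ga: "?G absolutely_integrable_on S'" by (rule absolutely_integrable_linear[OF cv(1) bc])
 have "integral S' ?G = integral (g ` S') ?F" using integral_linear[OF set_lebesgue_integral_eq_integral(1)[OF cv(1)] bc] cv(2) by simp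
 hence i: "integral S' (%x. h (ri x)) = integral (g ` S') ?F" by (subst integral_cong[OF G, symmetric]) auto
 have Ha: "(%x. h (ri x)) absolutely_integrable_on S'" by (rule iffD1[OF set_integrable_cong[OF refl refl G] Ga])
 have H0: "0 <= h (ri x)" if "x : S'" for x using that h(2)[of "ri x"] f(2)[of "T (ri x)"] by (simp add: S'_def jac_def)
 have "(\<integral>\<^sup>+z\<in>S. ennreal (h z) \<partial>lborel) = (\<integral>\<^sup>+x\<in>S'. ennreal (h (ri x)) \<partial>lborel)" unfolding S'_def by (rule tr[OF S(1) h(1)])
 also have "... = (\<integral>\<^sup>+x\<in>g ` S'. ennreal (?F x) \<partial>lborel)"
  using nn_integral_eq_HK[OF S'b Hm H0 Ha] nn_integral_eq_HK[OF gSb Fm F0 Fa] i by simp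
 also have "... = (\<integral>\<^sup>+z\<in>T ` S. ennreal (f z) \<partial>lborel)" unfolding gS by (rule tr[OF S(2) f(1), symmetric])
 finally show ?thesis .
qed

section \<open>The volume measure\<close>

text \<open>The inverse chart made total with a constant value outside the image, so that it is
  Borel measurable on the whole space.\<close>

definition chart_point :: "('a, 'n) chart => complex^'n => 'a" where
 "chart_point c z = (if z : chart_image c then chart_inv c z else undefined)"

lemma is_chartD:
 assumes "is_chart c"
 shows "open (fst c)" "open (chart_image c)" "continuous_on (fst c) (snd c)" "continuous_on (chart_image c) (chart_inv c)"
  "x : fst c ==> chart_inv c (snd c x) = x" "z : chart_image c ==> snd c (chart_inv c z) = z"
  "z : chart_image c ==> chart_inv c z : fst c" "x : fst c ==> snd c x : chart_image c" proof -
 show "open (fst c)" "open (chart_image c)" using assms by (simp_all add: is_chart_def)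
 have h: "homeomorphism (fst c) (chart_image c) (snd c) (chart_inv c)" using assms by (simp add: is_chart_def)
 show "continuous_on (fst c) (snd c)" "continuous_on (chart_image c) (chart_inv c)" using homeomorphism_cont1[OF h] homeomorphism_cont2[OF h] .
 show "x : fst c ==> chart_inv c (snd c x) = x" by (rule homeomorphism_apply1[OF h])
 show "z : chart_image c ==> snd c (chart_inv c z) = z" by (rule homeomorphism_apply2[OF h])
 show "z : chart_image c ==> chart_inv c z : fst c" "x : fst c ==> snd c x : chart_image c" using homeomorphism_image2[OF h] by (auto simp: chart_image_def)
qed

lemma chart_point_measurable:
 assumes "is_chart c"
 shows "chart_point c : borel_measurable borel" unfolding chart_point_def[abs_def] by (rule borel_measurable_continuous_on_if) (use is_chartD[OF assms] in auto)

lemma chart_image_set: "is_chart c ==> snd c ` (B \<inter> fst c) = chart_point c -` B \<inter> chart_image c"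
 by (auto simp: chart_point_def is_chartD intro!: image_eqI[of _ _ "chart_inv c _"])

lemma chart_image_borel:
 assumes "is_chart c" "B : sets borel"
 shows "snd c ` (B \<inter> fst c) : sets borel" unfolding chart_image_set[OF assms(1)]
 using measurable_sets[OF chart_point_measurable[OF assms(1)] assms(2)] is_chartD(2)[OF assms(1)] by auto

locale hermitian_manifold =
 fixes A :: "('a::t2_space, 'n::finite) chart set" and om :: "('a, 'n) chart => 'n form_field"
 assumes manifold: "compact_complex_manifold A" and form: "hermitian_form A om"
begin

lemma A_local: "c : A ==> c : local_charts A" using manifold by (auto simp: compact_complex_manifold_def complex_atlas_def local_charts_def)

lemma local_is_chart: "c : local_charts A ==> is_chart c" by (simp add: local_charts_def)

lemma chart_form: "c : local_charts A ==> chart_form (chart_image c) (om c)"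
 using form is_chartD(2)[OF local_is_chart] by (auto simp: chart_form_def hermitian_form_def)

definition vdens where "vdens c z = top_coeff (form_power (om c z) CARD('n))"

lemma vdens:
 assumes "c : local_charts A" "z : chart_image c"
 shows "0 < vdens c z" "topc (Ext (om c z) ^ CARD('n)) = of_real (vdens c z)" "homog (2 * CARD('n)) (Ext (om c z) ^ CARD('n))"
  "vdens c z = chart_form.vol0 (om c) z" proof -
 interpret chart_form "chart_image c" "om c" by (rule chart_form[OF assms(1)])
 interpret chart_compact "chart_image c" "om c" "{}" 1 by unfold_locales auto
 show h: "homog (2 * CARD('n)) (Ext (om c z) ^ CARD('n))" by (rule homog_power[OF homog_om[OF assms(2)]])
 show v: "vdens c z = vol0 z"
  unfolding vdens_def vol0_def using h real_ext_power[OF real_om[OF assms(2)]] by (subst top_coeff_eq) (simp_all add: Ext_form_power)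
 show "0 < vdens c z" "topc (Ext (om c z) ^ CARD('n)) = of_real (vdens c z)" using vol0_pos[OF assms(2)] topc_vol0[OF assms(2)] by (simp_all add: v)
qed

lemma vdens_continuous: "c : local_charts A ==> continuous_on (chart_image c) (vdens c)"
 using chart_form.vol0_continuous[OF chart_form] by (simp add: vdens(4) cong: continuous_on_cong)

definition wdens where "wdens c z = indicator (chart_image c) z *\<^sub>R vdens c z"

lemma wdens_measurable: "c : local_charts A ==> wdens c : borel_measurable borel" unfolding wdens_def[abs_def]
 by (rule borel_measurable_continuous_on_indicator[OF _ vdens_continuous]) (use is_chartD(2)[OF local_is_chart] in auto)

lemma wdens_nonneg: "c : local_charts A ==> 0 <= wdens c z" using vdens(1)[of c z] by (auto simp: wdens_def indicator_def)

definition chart_measure where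
 "chart_measure c = distr (density lborel (%z. ennreal (wdens c z))) borel (chart_point c)"

lemma sets_chart_measure [simp]: "sets (chart_measure c) = sets borel" by (simp add: chart_measure_def)

lemma nn_integral_chart_measure:
 assumes c: "c : local_charts A" and g: "g : borel_measurable borel"
 shows "(\<integral>\<^sup>+x. g x \<partial>chart_measure c) = (\<integral>\<^sup>+z. ennreal (wdens c z) * g (chart_point c z) \<partial>lborel)" proof -
 note [measurable] = g chart_point_measurable[OF local_is_chart[OF c]] wdens_measurable[OF c]
 have "(\<integral>\<^sup>+x. g x \<partial>chart_measure c) = (\<integral>\<^sup>+z. g (chart_point c z) \<partial>density lborel (%z. ennreal (wdens c z)))"
  unfolding chart_measure_def by (rule nn_integral_distr) measurable
 also have "... = (\<integral>\<^sup>+z. ennreal (wdens c z) * g (chart_point c z) \<partial>lborel)" by (rule nn_integral_density) measurable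
 finally show ?thesis .
qed

lemma emeasure_chart_measure:
 assumes c: "c : local_charts A" and B: "B : sets borel"
 shows "emeasure (chart_measure c) B = (\<integral>\<^sup>+z\<in>snd c ` (B \<inter> fst c). ennreal (wdens c z) \<partial>lborel)" proof -
 have "emeasure (chart_measure c) B = (\<integral>\<^sup>+z. ennreal (wdens c z) * indicator B (chart_point c z) \<partial>lborel)"
  using B by (subst nn_integral_chart_measure[OF c, symmetric]) auto
 also have "... = (\<integral>\<^sup>+z\<in>snd c ` (B \<inter> fst c). ennreal (wdens c z) \<partial>lborel)"
  unfolding chart_image_set[OF local_is_chart[OF c]] by (intro nn_integral_cong) (auto simp: wdens_def indicator_def)
 finally show ?thesis .
qed

lemma chart_measure_formula:
 assumes c: "c : local_charts A" and B: "B : sets borel" "B \<subseteq> fst c"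
 shows "emeasure (chart_measure c) B = (\<integral>\<^sup>+z\<in>snd c ` B. ennreal (top_coeff (form_power (om c z) CARD('n))) \<partial>lebesgue)" proof -
 have BB: "B \<inter> fst c = B" using B(2) by blast
 have S: "snd c ` B : sets borel" using chart_image_borel[OF local_is_chart[OF c] B(1)] by (simp add: BB)
 have "(\<integral>\<^sup>+z\<in>snd c ` B. ennreal (wdens c z) \<partial>lborel) = (\<integral>\<^sup>+z\<in>snd c ` B. ennreal (wdens c z) \<partial>lebesgue)"
  by (rule nn_integral_completion[symmetric])
 also have "... = (\<integral>\<^sup>+z\<in>snd c ` B. ennreal (vdens c z) \<partial>lebesgue)"
  by (intro nn_integral_cong) (use B(2) in \<open>auto simp: wdens_def indicator_def chart_image_def\<close>)
 finally show ?thesis using emeasure_chart_measure[OF c B(1)] by (simp add: BB vdens_def)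
qed

text \<open>Top forms pull back by the determinant. Taking moduli suffices, as both densities are
  positive.\<close>

lemma vdens_transform:
 assumes c: "c : local_charts A" and a: "a : local_charts A" and z: "z : overlap c a"
  and D: "(transition c a has_derivative D) (at z)"
 shows "vdens c z = jac D * vdens a (transition c a z)" proof -
 let ?w = "transition c a z"
 have lin: "linear D" using has_derivative_linear[OF D] .
 have fd: "FD (transition c a) z = D" using frechet_derivative_at[OF D] by simp
 obtain x where x: "x : fst c" "x : fst a" "z = snd c x" using z by (auto simp: overlap_def)
 have zc: "z : chart_image c" "?w : chart_image a"
  using is_chartD(5,8)[OF local_is_chart[OF c]] is_chartD(8)[OF local_is_chart[OF a]] x by (simp_all add: transition_def)
 have "om c z = pullback (transition c a) (om a) z" using form c a z by (auto simp: hermitian_form_def)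
 hence "Ext (om c z) = pb D (Ext (om a ?w))" by (simp add: pullback_def fd pb_def)
 hence "of_real (vdens c z) = topc (pb D (Ext (om a ?w) ^ CARD('n)))" using vdens(2)[OF c zc(1)] by (simp add: pb_power)
 also have "... = pdet D TYPE('n) * of_real (vdens a ?w)" unfolding pb_top(2)[OF lin vdens(3)[OF a zc(2)]] vdens(2)[OF a zc(2)] ..
 finally have "cmod (of_real (vdens c z)) = cmod (pdet D TYPE('n) * of_real (vdens a ?w))" by simp
 thus ?thesis using vdens(1)[OF c zc(1)] vdens(1)[OF a zc(2)] by (simp add: norm_mult jac_eq_pdet[OF lin])
qed

text \<open>One of the two charts is taken from \<open>A\<close> because a local chart is known to
  be compatible with the charts of \<open>A\<close>. The transition formula is applied on compact
  pieces of the overlap, and monotone limits give the general set.\<close>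

lemma chart_measure_compatible:
 assumes c: "c : local_charts A" and a: "a : A" and B: "B : sets borel" "B \<subseteq> fst c \<inter> fst a"
 shows "emeasure (chart_measure c) B = emeasure (chart_measure a) B" proof -
 note al = A_local[OF a] and cc = is_chartD[OF local_is_chart[OF c]] and ca = is_chartD[OF local_is_chart[OF A_local[OF a]]]
 let ?O = "overlap c a" and ?T = "transition c a"
 have O: "?O = chart_image c \<inter> chart_inv c -` fst a" unfolding overlap_def chart_image_def using cc(5) by auto
 have "open ?O" unfolding O by (rule continuous_open_preimage[OF cc(4,2) ca(1)])
 \<comment> \<open>Compact exhaustion of the overlap: on each piece the continuous density has
   finite integral, as the change of variables requires.\<close>
 then obtain C where C: "!!k. compact (C k)" "!!k. C k \<subseteq> ?O" "!!k. C k \<subseteq> interior (C (Suc k))" "\<Union>(range C) = ?O"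
  by (rule open_Union_compact_subsets) blast
 have "holomorphic_map_on ?O ?T" using c a by (auto simp: local_charts_def compatible_charts_def)
 hence "ALL z:?O. EX D. (?T has_derivative D) (at z)" by (auto simp: holomorphic_map_on_def)
 then obtain D where D: "!!z. z : ?O ==> (?T has_derivative D z) (at z)" by (auto dest!: bchoice)
 define K where "K k = chart_inv c ` C k" for k
 have CO: "C k \<subseteq> chart_image c" for k using C(2) O by blast
 have K: "compact (K k)" for k unfolding K_def by (rule compact_continuous_image[OF continuous_on_subset[OF cc(4) CO] C(1)])
 have KI: "x : K k \<longleftrightarrow> snd c x : C k" if "x : fst c" for x k
 proof
  assume "x : K k"
  then obtain z where z: "z : C k" "x = chart_inv c z" by (auto simp: K_def)
  thus "snd c x : C k" using cc(6)[OF subsetD[OF CO z(1)]] by simp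
 next
  assume "snd c x : C k"
  thus "x : K k" unfolding K_def using cc(5)[OF that] by (intro image_eqI[of _ _ "snd c x"]) simp_all
 qed
 have Bk: "B \<inter> K k : sets borel" for k using B(1) compact_imp_closed[OF K] by auto
 have TO: "?T z : chart_image a" if "z : ?O" for z using that ca(8) unfolding O transition_def by auto
 have eq: "emeasure (chart_measure c) (B \<inter> K k) = emeasure (chart_measure a) (B \<inter> K k)" for k proof -
  let ?S = "snd c ` (B \<inter> K k)"
  have sub: "B \<inter> K k \<inter> fst c = B \<inter> K k" "B \<inter> K k \<inter> fst a = B \<inter> K k" using B(2) by auto
  have SC: "?S \<subseteq> C k" using KI B(2) by blast
  have TS: "?T ` ?S = snd a ` (B \<inter> K k)" unfolding image_image transition_def by (rule image_cong) (use B(2) cc(5) in auto)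
  have Sb: "?S : sets borel" "?T ` ?S : sets borel"
  using chart_image_borel[OF local_is_chart[OF c] Bk[of k]] chart_image_borel[OF local_is_chart[OF al] Bk[of k]] unfolding sub TS .
  have "(\<integral>\<^sup>+z\<in>?S. ennreal (wdens c z) \<partial>lborel) = (\<integral>\<^sup>+z\<in>?T ` ?S. ennreal (wdens a z) \<partial>lborel)"
  proof (rule nn_integral_change_of_variables[OF Sb wdens_measurable[OF al] wdens_nonneg[OF al] wdens_measurable[OF c], where D = D])
  fix z assume "z : ?S"
  hence z: "z : ?O" using SC C(2) by blast
  show "(?T has_derivative D z) (at z)" by (rule D[OF z])
  show "wdens c z = jac (D z) * wdens a (?T z)" using vdens_transform[OF c al z D[OF z]] TO[OF z] z unfolding O wdens_def by simp
  next
  show "inj_on ?T ?S"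
  proof (rule inj_onI)
  fix y z assume yz: "y : ?S" "z : ?S" "?T y = ?T z"
  hence "y : ?O" "z : ?O" using SC C(2) by auto
  hence "chart_inv c y = chart_inv c z" using ca(5) yz(3) unfolding O transition_def by (metis IntD2 comp_apply vimageD)
  thus "y = z" using cc(6) \<open>y : ?O\<close> \<open>z : ?O\<close> unfolding O by (metis IntD1)
  qed
  have TC: "compact (?T ` C k)" "?T ` C k \<subseteq> chart_image a" proof -
  have "continuous_on (C k) ?T" by (intro continuous_at_imp_continuous_on ballI has_derivative_continuous[OF D]) (use C(2) in blast)
  thus "compact (?T ` C k)" by (rule compact_continuous_image[OF _ C(1)])
  show "?T ` C k \<subseteq> chart_image a" using TO C(2) by blast
  qed
  have "integrable lborel (%z. indicator (?T ` C k) z *\<^sub>R vdens a z)"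
  by (rule borel_integrable_compact[OF TC(1) continuous_on_subset[OF vdens_continuous[OF al] TC(2)]])
  hence "(\<integral>\<^sup>+z. ennreal (norm (indicator (?T ` C k) z *\<^sub>R vdens a z)) \<partial>lborel) < \<infinity>" by (simp add: integrable_iff_bounded)
  moreover have "(\<integral>\<^sup>+z\<in>?T ` ?S. ennreal (wdens a z) \<partial>lborel) <= (\<integral>\<^sup>+z. ennreal (norm (indicator (?T ` C k) z *\<^sub>R vdens a z)) \<partial>lborel)"
  using SC by (intro nn_integral_mono) (auto simp: indicator_def wdens_def intro!: ennreal_leI)
  ultimately show "(\<integral>\<^sup>+z\<in>?T ` ?S. ennreal (wdens a z) \<partial>lborel) < \<infinity>" by (rule le_less_trans[rotated])
  qed
  thus ?thesis using emeasure_chart_measure[OF c Bk[of k]] emeasure_chart_measure[OF al Bk[of k]] unfolding sub TS by simp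
 qed
 have "C k \<subseteq> C (Suc k)" for k using C(3) interior_subset by blast
 hence inc: "incseq (%k. B \<inter> K k)" unfolding K_def by (intro incseq_SucI) blast
 have un: "(\<Union>k. B \<inter> K k) = B" proof -
  have "EX k. x : K k" if "x : B" for x proof -
  have "snd c x : ?O" using B(2) that by (auto simp: overlap_def)
  then obtain k where "snd c x : C k" using C(4) by blast
  thus ?thesis using KI B(2) that by blast
  qed
  thus ?thesis by blast
 qed
 have lim: "(SUP k. emeasure (chart_measure b) (B \<inter> K k)) = emeasure (chart_measure b) B" for b
  using SUP_emeasure_incseq[of "%k. B \<inter> K k" "chart_measure b"] Bk inc un by auto
 show ?thesis using lim[of c] lim[of a] eq by simp
qed

text \<open>A finite subcover is numbered, and from each chart domain those with smaller number are
  removed.\<close>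

lemma finite_partition:
 obtains I :: "('a, 'n) chart set" and P where "finite I" "I \<subseteq> A" "disjoint_family_on P I" "(\<Union>i\<in>I. P i) = UNIV"
  "!!i. i : I ==> P i : sets borel" "!!i. i : I ==> P i \<subseteq> fst i" proof -
 have op: "open (fst c)" if "c : A" for c using that is_chartD(1)[OF local_is_chart[OF A_local]] by blast
 have "UNIV \<subseteq> (\<Union>c\<in>A. fst c)" using manifold by (auto simp: compact_complex_manifold_def complex_atlas_def)
 then obtain I where I: "I \<subseteq> A" "finite I" "UNIV \<subseteq> (\<Union>c\<in>I. fst c)"
  using compactE_image[of "UNIV :: 'a set" A fst] manifold op by (auto simp: compact_complex_manifold_def)
 obtain f :: "('a, 'n) chart => nat" where f: "inj_on f I" using finite_imp_inj_to_nat_seg[OF I(2)] by blast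
 define P where "P i = fst i - (\<Union>j\<in>{j : I. f j < f i}. fst j)" for i
 have "x : (\<Union>i\<in>I. P i)" for x proof -
  obtain i0 where "i0 : I & x : fst i0" using I(3) by blast
  from ex_has_least_nat[where P = "%i. i : I & x : fst i" and m = f, OF this]
  obtain i where i: "i : I" "x : fst i" "!!j. j : I ==> x : fst j ==> f i <= f j" by blast
  hence "x : P i" unfolding P_def by (auto simp: not_less[symmetric])
  thus ?thesis using i(1) by blast
 qed
 moreover have "disjoint_family_on P I" unfolding disjoint_family_on_def
 proof (intro ballI impI)
  fix i j assume ij: "i : I" "j : I" "i ~= j"
  hence "f i < f j | f j < f i" using f by (meson inj_onD nat_neq_iff)
  thus "P i \<inter> P j = {}" using ij by (auto simp: P_def)
 qed
 moreover have "P i : sets borel" if "i : I" for i proof -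
  have "open (fst j)" if "j : I" for j using op I(1) that by blast
  thus ?thesis unfolding P_def using I(2) that by (intro sets.Diff sets.finite_UN borel_open) simp_all
 qed
 ultimately show thesis using I by (intro that[of I P]) (auto simp: P_def)
qed

text \<open>The definite description denotes: gluing the chart measures over the finite partition
  gives such a measure, and any other one agrees with it on each piece.\<close>

lemma volume_measure: "is_volume_measure A om (volume_measure A om)" proof -
 obtain I P where P: "finite I" "I \<subseteq> A" "disjoint_family_on P I" "(\<Union>i\<in>I. P i) = UNIV"
  "!!i. i : I ==> P i : sets borel" "!!i. i : I ==> P i \<subseteq> fst i" by (rule finite_partition) blast
 have split: "emeasure M B = (SUM i:I. emeasure M (B \<inter> P i))" if "sets M = sets borel" "B : sets borel" for M :: "'a measure" and B proof -
  have "(SUM i:I. emeasure M (B \<inter> P i)) = emeasure M (\<Union>i\<in>I. B \<inter> P i)"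
  proof (rule sum_emeasure[OF _ _ P(1)])
  show "(%i. B \<inter> P i) ` I \<subseteq> sets M" by (intro image_subsetI) (simp add: that sets.Int P(5))
  show "disjoint_family_on (%i. B \<inter> P i) I" using P(3) unfolding disjoint_family_on_def by blast
  qed
  also have "(\<Union>i\<in>I. B \<inter> P i) = B" using P(4) by blast
  finally show ?thesis by simp
 qed
 have BP: "B \<inter> P i : sets borel" "B \<inter> P i \<subseteq> fst i" "i : A" if "i : I" "B : sets borel" for i B
  using sets.Int[OF that(2) P(5)[OF that(1)]] P(6)[OF that(1)] P(2) that(1) by blast+
 define mm where "mm B = (SUM i:I. emeasure (chart_measure i) (B \<inter> P i))" for B
 define V where "V = measure_of UNIV (sets borel) mm"
 have sV: "sets V = sets borel" unfolding V_def using sets.sigma_sets_eq[of borel] by simp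
 have eV: "emeasure V B = mm B" if "B : sets borel" for B
 proof (rule emeasure_measure_of[OF V_def])
  show "positive (sets V) mm" by (simp add: positive_def mm_def)
  show "countably_additive (sets V) mm"
  proof (rule countably_additiveI)
  fix F :: "nat => 'a set" assume F: "range F \<subseteq> sets V" "disjoint_family F"
  have "(\<Sum>k. mm (F k)) = (SUM i:I. \<Sum>k. emeasure (chart_measure i) (F k \<inter> P i))" unfolding mm_def by (rule suminf_sum) auto
  also have "... = (SUM i:I. emeasure (chart_measure i) (\<Union>k. F k \<inter> P i))"
  proof (intro sum.cong refl suminf_emeasure)
  fix i assume i: "i : I"
  have "F k : sets borel" for k using F(1) sV by blast
  thus "range (%k. F k \<inter> P i) \<subseteq> sets (chart_measure i)" by (intro image_subsetI) (simp add: sets.Int P(5)[OF i])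
  show "disjoint_family (%k. F k \<inter> P i)" using F(2) unfolding disjoint_family_on_def by blast
  qed
  finally show "(\<Sum>k. mm (F k)) = mm (\<Union>k. F k)" by (simp add: mm_def)
  qed
 qed (use that sV in auto)
 have "is_volume_measure A om V" unfolding is_volume_measure_def
 proof (intro conjI ballI impI sV)
  fix c B assume c: "c : local_charts A" and B: "B : sets borel" "B \<subseteq> fst c"
  have "mm B = (SUM i:I. emeasure (chart_measure c) (B \<inter> P i))" unfolding mm_def
  proof (rule sum.cong[OF refl])
  fix i assume i: "i : I"
  show "emeasure (chart_measure i) (B \<inter> P i) = emeasure (chart_measure c) (B \<inter> P i)"
  by (rule chart_measure_compatible[OF c, symmetric]) (use BP[OF i B(1)] B(2) in blast)+
  qed
  also have "... = emeasure (chart_measure c) B" using split[OF sets_chart_measure B(1)] by simp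
  finally show "emeasure V B = (\<integral>\<^sup>+z\<in>snd c ` B. ennreal (top_coeff (form_power (om c z) CARD('n))) \<partial>lebesgue)"
  using eV[OF B(1)] chart_measure_formula[OF c B] by simp
 qed
 moreover have "V' = V" if V': "is_volume_measure A om V'" for V'
 proof (rule measure_eqI)
  have s: "sets V' = sets borel" using V' by (simp add: is_volume_measure_def)
  thus "sets V' = sets V" by (simp add: sV)
  fix B assume "B : sets V'"
  hence B: "B : sets borel" by (simp add: s)
  have "emeasure V' B = mm B" unfolding split[OF s B] mm_def
  proof (rule sum.cong[OF refl])
  fix i assume i: "i : I"
  have "emeasure V' (B \<inter> P i) = (\<integral>\<^sup>+z\<in>snd i ` (B \<inter> P i). ennreal (top_coeff (form_power (om i z) CARD('n))) \<partial>lebesgue)"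
  using V' A_local[OF BP(3)[OF i B]] BP[OF i B] unfolding is_volume_measure_def by blast
  also have "... = emeasure (chart_measure i) (B \<inter> P i)" by (rule chart_measure_formula[symmetric, OF A_local[OF BP(3)[OF i B]] BP(1,2)[OF i B]])
  finally show "emeasure V' (B \<inter> P i) = emeasure (chart_measure i) (B \<inter> P i)" .
  qed
  thus "emeasure V' B = emeasure V B" by (simp add: eV B)
 qed
 ultimately show ?thesis unfolding volume_measure_def by (rule theI)
qed

lemma nn_integral_volume:
 assumes c: "c : local_charts A" and g: "g : borel_measurable borel" and supp: "!!x. x ~: fst c ==> g x = 0"
 shows "(\<integral>\<^sup>+x. g x \<partial>volume_measure A om) = (\<integral>\<^sup>+z. ennreal (wdens c z) * g (chart_point c z) \<partial>lborel)" proof -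
 let ?V = "volume_measure A om"
 have sV: "sets ?V = sets borel" using volume_measure by (simp add: is_volume_measure_def)
 have U: "fst c : sets borel" using is_chartD(1)[OF local_is_chart[OF c]] by simp
 have m: "g : borel_measurable ?V" "indicator (fst c) : borel_measurable ?V" using g U by (auto simp: sV cong: measurable_cong_sets)
 have "density ?V (indicator (fst c)) = chart_measure c"
 proof (rule measure_eqI)
  fix B assume "B : sets (density ?V (indicator (fst c)))"
  hence B: "B : sets borel" by (simp add: sV)
  have "emeasure (density ?V (indicator (fst c))) B = (\<integral>\<^sup>+x. indicator (fst c) x * indicator B x \<partial>?V)"
  by (rule emeasure_density[OF m(2)]) (simp add: sV B)
  also have "... = emeasure ?V (fst c \<inter> B)"
  unfolding indicator_inter_arith[symmetric] by (rule nn_integral_indicator) (use B U in \<open>simp add: sV\<close>)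
  also have "... = emeasure (chart_measure c) (fst c \<inter> B)"
  using volume_measure c B U chart_measure_formula[OF c, of "fst c \<inter> B"] by (auto simp: is_volume_measure_def)
  also have "... = emeasure (chart_measure c) B" using B U by (simp add: emeasure_chart_measure[OF c] Int_ac)
  finally show "emeasure (density ?V (indicator (fst c))) B = emeasure (chart_measure c) B" .
 qed (simp add: sV)
 hence "(\<integral>\<^sup>+x. g x \<partial>chart_measure c) = (\<integral>\<^sup>+x. indicator (fst c) x * g x \<partial>?V)"
  using nn_integral_density[OF m(2,1)] by simp
 also have "... = (\<integral>\<^sup>+x. g x \<partial>?V)" using supp by (intro nn_integral_cong) (auto simp: indicator_def)
 finally show ?thesis using nn_integral_chart_measure[OF c g] by simp
qed

end

lemma ext_abs_powr_measurable: "(%x. ext_abs_powr x p) : borel_measurable borel" unfolding ext_abs_powr_def by measurable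

context hermitian_manifold
begin

lemma chart_at:
 obtains c where "c : A" "x : fst c" proof -
 have "(\<Union>c\<in>A. fst c) = UNIV" using manifold by (simp only: compact_complex_manifold_def complex_atlas_def)
 hence "x : (\<Union>c\<in>A. fst c)" by (simp only: UNIV_I)
 thus thesis by (rule UN_E) (rule that)
qed

lemma SH_mD:
 assumes "ph : SH_m m A om" "c : local_charts A"
 shows "loc_integrable_on (chart_image c) (ph o chart_inv c)" "omega_m_subharmonic_on m (om c) (chart_image c) (ph o chart_inv c)"
 using assms unfolding SH_m_def by blast+

lemma SH_m_sublevel_open:
 assumes ph: "ph : SH_m m A om" and m: "1 <= m" "m <= CARD('n)"
 shows "open {x. ph x < y}"
proof (subst open_subopen, intro ballI)
 fix x assume x: "x : {x. ph x < y}"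
 obtain c where c: "c : A" "x : fst c" by (rule chart_at)
 note cl = A_local[OF c(1)]
 note cc = is_chartD[OF local_is_chart[OF cl]]
 interpret chart_form "chart_image c" "om c" by (rule chart_form[OF cl])
 let ?L = "{z : chart_image c. (ph o chart_inv c) z < y}"
 have "open ?L" by (rule sub_sublevel_open[OF SH_mD(2)[OF ph cl] m])
 hence "open (fst c \<inter> snd c -` ?L)" by (rule continuous_open_preimage[OF cc(3,1)])
 moreover have "fst c \<inter> snd c -` ?L \<subseteq> {x. ph x < y}" using cc(5) by auto
 moreover have "x : fst c \<inter> snd c -` ?L" using c(2) x cc(5,8) by simp
 ultimately show "EX T. open T & x : T & T \<subseteq> {x. ph x < y}" by blast
qed

text \<open>In a chart the volume has a density that is bounded on a small closed ball, so the claim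
  reduces to the local estimate for Lebesgue measure there.\<close>

lemma SH_m_integrable_near:
 assumes ph: "ph : SH_m m A om" and m: "1 <= m" "m <= CARD('n)"
  and p: "0 < p" "m < CARD('n) ==> p < real CARD('n) / real (CARD('n) - m)"
 shows "EX N. open N & x : N & (\<integral>\<^sup>+y\<in>N. ext_abs_powr (ph y) p \<partial>volume_measure A om) < \<infinity>" proof -
 obtain c where c: "c : A" "x : fst c" by (rule chart_at)
 note cl = A_local[OF c(1)]
 note cc = is_chartD[OF local_is_chart[OF cl]]
 interpret chart_form "chart_image c" "om c" by (rule chart_form[OF cl])
 obtain r where r: "r > 0" "cball (snd c x) r \<subseteq> chart_image c" using cc(2,8) c(2) open_contains_cball by blast
 let ?K = "cball (snd c x) r"
 define N where "N = fst c \<inter> snd c -` ball (snd c x) r"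
 have N: "open N" "x : N" unfolding N_def using continuous_open_preimage[OF cc(3,1) open_ball] c(2) r(1) by auto
 have g: "(%y. ext_abs_powr (ph y) p) : borel_measurable borel"
  by (rule measurable_compose[OF borel_measurableI_less ext_abs_powr_measurable]) (use SH_m_sublevel_open[OF ph m] in auto)
 have gN: "(%y. ext_abs_powr (ph y) p * indicator N y) : borel_measurable borel"
  using g N(1) by (intro borel_measurable_times_ennreal borel_measurable_indicator) simp_all
 have "bounded (vdens c ` ?K)" by (intro compact_imp_bounded compact_continuous_image continuous_on_subset[OF vdens_continuous[OF cl] r(2)]) simp
 then obtain B where B: "ALL z:?K. abs (vdens c z) <= B" unfolding bounded_iff by auto
 let ?h = "%z. ext_abs_powr (ph (chart_point c z)) p * indicator ?K z"
 have h: "?h : borel_measurable borel" using measurable_compose[OF chart_point_measurable[OF local_is_chart[OF cl]] g]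
  by (intro borel_measurable_times_ennreal borel_measurable_indicator) simp_all
 have "(\<integral>\<^sup>+y\<in>N. ext_abs_powr (ph y) p \<partial>volume_measure A om) =
  (\<integral>\<^sup>+z. ennreal (wdens c z) * (ext_abs_powr (ph (chart_point c z)) p * indicator N (chart_point c z)) \<partial>lborel)"
  by (rule nn_integral_volume[OF cl gN]) (simp add: N_def)
 also have "... <= (\<integral>\<^sup>+z. ennreal B * ?h z \<partial>lborel)"
 proof (rule nn_integral_mono)
  fix z
  show "ennreal (wdens c z) * (ext_abs_powr (ph (chart_point c z)) p * indicator N (chart_point c z)) <= ennreal B * ?h z"
  proof (cases "z : chart_image c & chart_point c z : N")
  case True
  hence "z : ?K" using cc(6)[of z] by (auto simp: chart_point_def N_def)
  moreover from this have "wdens c z <= B" using bspec[OF B, of z] r(2) by (auto simp: wdens_def)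
  ultimately show ?thesis by (auto simp: indicator_def intro!: mult_right_mono ennreal_leI)
  qed (auto simp: wdens_def indicator_def)
 qed
 also have "... = ennreal B * (\<integral>\<^sup>+z. ?h z \<partial>lborel)" by (rule nn_integral_cmult) (use h in simp)
 also have "(\<integral>\<^sup>+z. ?h z \<partial>lborel) = (\<integral>\<^sup>+z. ?h z \<partial>lebesgue)" by (rule nn_integral_completion[symmetric])
 also have "... = (\<integral>\<^sup>+z\<in>?K. ext_abs_powr ((ph o chart_inv c) z) p \<partial>lebesgue)"
  by (intro nn_integral_cong) (use r(2) in \<open>auto simp: chart_point_def indicator_def\<close>)
 also have "ennreal B * ... < \<infinity>" proof -
  have "(\<integral>\<^sup>+z\<in>?K. ext_abs_powr ((ph o chart_inv c) z) p \<partial>lebesgue) < \<infinity>"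
  by (rule local_power_integrable[OF SH_mD(2,1)[OF ph cl] m p _ r(2)]) simp_all
  thus ?thesis by (simp add: ennreal_mult_less_top)
 qed
 finally show ?thesis using N by blast
qed

end

theorem mainTheorem1:
  fixes A :: "('a::t2_space, 'n::finite) chart set"
    and \<omega> :: "('a, 'n) chart \<Rightarrow> 'n form_field"
    and m :: nat and p :: real
  assumes "compact_complex_manifold A"
    and "hermitian_form A \<omega>"
    and "1 \<le> m" and "m \<le> CARD('n)"
    and "0 < p"
    and "m < CARD('n) \<Longrightarrow> p < real CARD('n) / real (CARD('n) - m)"
  shows "SH_m m A \<omega> \<subseteq> L_p p (volume_measure A \<omega>)"
proof
 fix ph assume ph: "ph : SH_m m A \<omega>"
 interpret hermitian_manifold A \<omega> by unfold_locales (use assms in auto)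
 let ?V = "volume_measure A \<omega>" and ?g = "%x. ext_abs_powr (ph x) p"
 have sV: "sets ?V = sets borel" using volume_measure by (simp add: is_volume_measure_def)
 have phb: "ph : borel_measurable borel" by (rule borel_measurableI_less) (use SH_m_sublevel_open[OF ph assms(3,4)] in auto)
 have g: "?g : borel_measurable ?V" using measurable_compose[OF phb ext_abs_powr_measurable] sV by (simp cong: measurable_cong_sets)
 have "ALL x. EX N. open N & x : N & (\<integral>\<^sup>+y\<in>N. ?g y \<partial>?V) < \<infinity>"
  using SH_m_integrable_near[OF ph assms(3-6)] by blast
 then obtain N where N: "!!x. open (N x)" "!!x. x : N x" "!!x. (\<integral>\<^sup>+y\<in>N x. ?g y \<partial>?V) < \<infinity>" by metis
 have cov: "UNIV \<subseteq> (\<Union>x\<in>UNIV. N x)" using N(2) by blast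
 have cmp: "compact (UNIV :: 'a set)" using assms(1) by (simp add: compact_complex_manifold_def)
 obtain D where D: "finite D" "UNIV \<subseteq> (\<Union>x\<in>D. N x)"
 proof (rule compactE_image[OF cmp N(1) cov])
  fix C' assume "finite C'" "UNIV \<subseteq> (\<Union>x\<in>C'. N x)"
  thus thesis by (rule that)
 qed
 have "(\<integral>\<^sup>+y. ?g y \<partial>?V) <= (\<integral>\<^sup>+y. (SUM x:D. ?g y * indicator (N x) y) \<partial>?V)"
 proof (rule nn_integral_mono)
  fix y
  obtain x where x: "x : D" "y : N x" using D(2) by blast
  have "?g y * indicator (N x) y <= (SUM x:D. ?g y * indicator (N x) y)" by (rule member_le_sum) (use x D(1) in auto)
  thus "?g y <= (SUM x:D. ?g y * indicator (N x) y)" using x(2) by simp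
 qed
 also have "... = (SUM x:D. \<integral>\<^sup>+y\<in>N x. ?g y \<partial>?V)"
 proof (rule nn_integral_sum)
  have "indicator (N x) : borel_measurable ?V" for x by (rule borel_measurable_indicator) (simp add: sV N(1))
  thus "(%y. ?g y * indicator (N x) y) : borel_measurable ?V" for x using g by (intro borel_measurable_times_ennreal)
 qed
 also have "... < \<infinity>" using D(1) N(3) by (simp add: less_top)
 finally show "ph : L_p p ?V" using phb sV by (simp add: L_p_def cong: measurable_cong_sets)
qed

end
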